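(* Let $\gamma>0$, let $$X=\Big\{u:\mathbb{R}^2\to\mathbb{C}:\ \int_{\mathbb{R}^2}\big(|\nabla u|^2+|u|^2+\ln(1+|x|)\,|u|^2\big)\,dx<\infty\Big\},$$ $$E(u)=\int_{\mathbb{R}^2}|\nabla u|^2\,dx+\frac{\gamma}{4\pi}\int_{\mathbb{R}^2}\int_{\mathbb{R}^2}\ln(|x-y|)\,|u(x)|^2|u(y)|^2\,dx\,dy,\qquad N(u)=\int_{\mathbb{R}^2}|u|^2\,dx,$$ and $e_0(\lambda)=\inf\{E(u):u\in X,\ N(u)=\lambda\}$. Let $\lambda>0$ and let $u^*\in X$ be a spherically symmetric decreasing function with $N(u^* )=\lambda$ and $E(u^* )=e_0(\lambda)$. If $v\in X$ satisfies $N(v)=\lambda$ and $E(v)=e_0(\lambda)$, then there exist $\theta\in\mathbb{R}$ and $x_0\in\mathbb{R}^2$ such that $v(x)=e^{i\theta}u^*(x-x_0)$ for all $x\in\mathbb{R}^2$.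
   Context: $\gamma>0$ is a fixed coupling constant.
   Formalization: The identity v(x)=e^{iθ}u*(x−x₀) is proved for almost every x instead of for all x, since elements of X are determined only up to null sets (changing v at one point keeps N(v) and E(v) but breaks the pointwise identity). *)

theory Defs
  imports "HOL-Analysis.Analysis"
begin

definition partial :: "2 \<Rightarrow> (real^2 \<Rightarrow> real) \<Rightarrow> real^2 \<Rightarrow> real" where
  "partial i \<phi> x = frechet_derivative \<phi> (at x) (axis i 1)"

definition test_fn :: "(real^2 \<Rightarrow> real) \<Rightarrow> bool" where
  "test_fn \<phi> \<longleftrightarrow> \<phi> differentiable_on UNIV
     \<and> (\<forall>i. continuous_on UNIV (partial i \<phi>))
     \<and> bounded {x. \<phi> x \<noteq> 0}"

definition weak_gradient :: "(real^2 \<Rightarrow> complex) \<Rightarrow> (real^2 \<Rightarrow> complex^2) \<Rightarrow> bool" where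
  "weak_gradient u G \<longleftrightarrow>
     (\<forall>K. compact K \<longrightarrow> set_integrable lborel K u \<and> (\<forall>i. set_integrable lborel K (\<lambda>x. G x $ i)))
     \<and> (\<forall>\<phi> i. test_fn \<phi> \<longrightarrow>
          (\<integral>x. complex_of_real (partial i \<phi> x) * u x \<partial>lborel)
            = - (\<integral>x. complex_of_real (\<phi> x) * (G x $ i) \<partial>lborel))"

definition grad :: "(real^2 \<Rightarrow> complex) \<Rightarrow> real^2 \<Rightarrow> complex^2" where
  "grad u = (SOME G. weak_gradient u G)"

definition Xspace :: "(real^2 \<Rightarrow> complex) set" where
  "Xspace = {u. u \<in> borel_measurable lborel
     \<and> (\<exists>G. weak_gradient u G \<and> integrable lborel (\<lambda>x. \<Sum>i\<in>UNIV. (cmod (G x $ i))\<^sup>2))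
     \<and> integrable lborel (\<lambda>x. (cmod (u x))\<^sup>2)
     \<and> integrable lborel (\<lambda>x. ln (1 + norm x) * (cmod (u x))\<^sup>2)}"

definition Nmass :: "(real^2 \<Rightarrow> complex) \<Rightarrow> real" where
  "Nmass u = (\<integral>x. (cmod (u x))\<^sup>2 \<partial>lborel)"

definition Energy :: "real \<Rightarrow> (real^2 \<Rightarrow> complex) \<Rightarrow> real" where
  "Energy \<gamma> u = (\<integral>x. (\<Sum>i\<in>UNIV. (cmod (grad u x $ i))\<^sup>2) \<partial>lborel)
     + \<gamma> / (4 * pi) * (\<integral>x. (\<integral>y. ln (norm (x - y)) * (cmod (u x))\<^sup>2 * (cmod (u y))\<^sup>2 \<partial>lborel) \<partial>lborel)"

definition e0 :: "real \<Rightarrow> real \<Rightarrow> real" where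
  "e0 \<gamma> lam = Inf {Energy \<gamma> u | u. u \<in> Xspace \<and> Nmass u = lam}"

definition sym_decreasing :: "(real^2 \<Rightarrow> complex) \<Rightarrow> bool" where
  "sym_decreasing u \<longleftrightarrow> (\<exists>f :: real \<Rightarrow> real. antimono_on {0..} f
      \<and> (\<forall>x. u x = complex_of_real (f (norm x))))"

end

theory Submission
  imports Defs "HOL-Complex_Analysis.Complex_Analysis"
begin

text \<open>The logarithm is conditionally negative definite, so the energy of a state of the same mass lies below
 its linearisation at a minimiser. Hence a minimiser is a ground state of its own linearised operator; uniqueness of
 the modulus of such a ground state shows that it is a constant phase times a nonnegative function \<open>w\<close>.
 Polarising \<open>w\<close> across a line that halves its mass does not increase the energy, and equality forces
 \<open>w\<close> to be symmetric in that line; two orthogonal such lines give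
 a centre of symmetry, every line through it halves the mass, and \<open>w\<close> is radial about it.
 In the area variable \<open>a = pi |x|^2\<close> Newton's theorem turns the Euler--Lagrange equation into
 \<open>(a F')' = V F / (4 pi)\<close>, \<open>(a V')' = c F^2\<close>. The scaling \<open>F \<mapsto> s F (s a)\<close>,
 \<open>V \<mapsto> s V (s a)\<close> normalises \<open>V 0\<close>. Following Lieb, if two nonnegative profiles have the same
 \<open>V 0\<close> but different \<open>F 0\<close>, then they and their potentials are strictly ordered, which contradicts
 that both linearised operators have ground state energy zero. So the profiles agree, and the mass fixes \<open>s\<close>.\<close>

text \<open>The kernel has no sign and is unbounded at 0 and at infinity. The bound
  \<open>\<bar>ln r\<bar> \<le> 1/r + ln (1 + r)\<close> separates the two defects: the singular
  part is controlled by the mass and the Dirichlet integral through a Hardy-type estimate of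
  \<open>u^2 / \<bar>x - y\<bar>\<close>, uniform in \<open>y\<close>, the growing part by the
  weight in \<open>X\<close>. The same estimate bounds the energy from below. The other obstacle is
  regularity: a minimiser comes with a weak gradient and with identities up to null sets. The radial
  equation is therefore tested with functions whose gradients are again test functions, so that no
  derivative of the minimiser remains, and the profile is recovered, up to a constant, as an
  explicit double integral from which continuity and derivatives are read off. The area variable
  carries the Lebesgue measure of the plane to that of the half-line, and the Laplacian of a radial
  function becomes \<open>4 pi (a F')'\<close>, which is the origin of \<open>1 / (4 pi)\<close>.
  The point \<open>a = 0\<close> stays singular; the equations are treated there as an integrated
  first-order system.\<close>

abbreviation tendsto_seq :: "(nat \<Rightarrow> 'a::topological_space) \<Rightarrow> 'a \<Rightarrow> bool" (infix "~~>" 60) where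
 "X ~~> l \<equiv> X \<longlonglongrightarrow> l"

abbreviation integ :: "('a::euclidean_space \<Rightarrow> 'b::{banach, second_countable_topology}) \<Rightarrow> bool" where
 "integ \<equiv> integrable lborel"

abbreviation Bor :: "('a::topological_space \<Rightarrow> 'b::topological_space) set" where
 "Bor \<equiv> borel_measurable borel"

abbreviation lborel2 :: "('a::euclidean_space \<times> 'b::euclidean_space) measure" where
 "lborel2 \<equiv> lborel \<Otimes>\<^sub>M lborel"

abbreviation area :: "real^2 \<Rightarrow> real" where
 "area x \<equiv> pi * (norm x)\<^sup>2"

lemmas Lintegrable_add = Bochner_Integration.integrable_add
 and Lintegrable_bound = Bochner_Integration.integrable_bound
 and Lintegrable_diff = Bochner_Integration.integrable_diff
 and Lintegrable_sum = Bochner_Integration.integrable_sum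
 and Lintegral_add = Bochner_Integration.integral_add
 and Lintegral_cong = Bochner_Integration.integral_cong
 and Lintegral_diff = Bochner_Integration.integral_diff
 and Lintegral_nonneg = Bochner_Integration.integral_nonneg
 and Lintegral_sum = Bochner_Integration.integral_sum
 and Lintegral_zero = Bochner_Integration.integral_zero

section \<open>Test functions and local integrability\<close>

text \<open>The gradient is carried along as an explicit field \<open>p\<close>, so that products
  and compositions produce formulas; \<open>partial\<close> itself is only accessible through
  \<open>frechet_derivative\<close>.\<close>

definition c1 :: "(real^2 \<Rightarrow> real) \<Rightarrow> (real^2 \<Rightarrow> real^2) \<Rightarrow> bool" where
 "c1 phi p \<longleftrightarrow> (\<forall>x. (phi has_derivative (\<lambda>h. p x \<bullet> h)) (at x)) \<and> continuous_on UNIV p"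

lemma c1_derivative: "c1 phi p \<Longrightarrow> (phi has_derivative (\<lambda>h. p x \<bullet> h)) (at x)"
 by (simp add: c1_def)

lemma c1_continuous: "c1 phi p \<Longrightarrow> continuous_on UNIV phi"
 by (meson c1_def continuous_at_imp_continuous_on has_derivative_continuous)

lemma c1_continuous_gradient: "c1 phi p \<Longrightarrow> continuous_on UNIV p"
 by (simp add: c1_def)

lemma c1_borel: "c1 phi p \<Longrightarrow> phi \<in> Bor"
 using c1_continuous borel_measurable_continuous_onI by blast

lemma c1_partial:
 assumes "c1 phi p"
 shows "partial i phi x = p x $ i"
proof -
 have "frechet_derivative phi (at x) = (\<lambda>h. p x \<bullet> h)"
  using frechet_derivative_at[OF c1_derivative[OF assms, of x]] by simp
 then show ?thesis
  by (simp add: partial_def cart_eq_inner_axis)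
qed

lemma c1_imp_test_fn:
 assumes "c1 phi p" "bounded {x. phi x \<noteq> 0}"
 shows "test_fn phi"
proof -
 have "partial i phi = (\<lambda>x. p x $ i)" for i
  using c1_partial[OF assms(1)] by blast
 moreover have "continuous_on UNIV (\<lambda>x. p x $ i)" for i
  by (intro continuous_on_component c1_continuous_gradient[OF assms(1)])
 moreover have "phi differentiable_on UNIV"
  using c1_derivative[OF assms(1)]
  by (auto simp: differentiable_on_def differentiable_def)
 ultimately show ?thesis
  using assms(2) unfolding test_fn_def by simp
qed

lemma test_fn_imp_c1:
 assumes "test_fn phi"
 shows "c1 phi (\<lambda>x. \<chi> i. partial i phi x)"
 unfolding c1_def
proof (intro conjI allI)
 fix x
 have D: "(phi has_derivative frechet_derivative phi (at x)) (at x)"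
  using assms unfolding test_fn_def differentiable_on_def
  by (simp add: frechet_derivative_works)
 then have L: "linear (frechet_derivative phi (at x))"
  using has_derivative_linear by blast
 have "frechet_derivative phi (at x) h = (\<chi> i. partial i phi x) \<bullet> h" for h
 proof -
  have "frechet_derivative phi (at x) h = frechet_derivative phi (at x) (\<Sum>i\<in>UNIV. h $ i *\<^sub>R axis i 1)"
   using basis_expansion[of h] by (simp add: scalar_mult_eq_scaleR)
  also have "\<dots> = (\<Sum>i\<in>UNIV. h $ i * partial i phi x)"
   by (simp add: linear_sum[OF L] linear_cmul[OF L] partial_def)
  finally show ?thesis
   by (simp add: inner_vec_def mult.commute)
 qed
 then have "frechet_derivative phi (at x) = (\<lambda>h. (\<chi> i. partial i phi x) \<bullet> h)" by blast
 with D show "(phi has_derivative (\<lambda>h. (\<chi> i. partial i phi x) \<bullet> h)) (at x)" by simp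
next
 show "continuous_on UNIV (\<lambda>x. \<chi> i. partial i phi x)"
  using assms unfolding test_fn_def by (intro continuous_on_vec_lambda) auto
qed

lemma c1_const: "c1 (\<lambda>x. c) (\<lambda>x. 0)"
 by (auto simp: c1_def)

lemma c1_inner: "c1 (\<lambda>x. x \<bullet> e) (\<lambda>x. e)"
 by (auto simp: c1_def inner_commute intro!: derivative_eq_intros)

lemma c1_component: "c1 (\<lambda>x. x $ i) (\<lambda>x. axis i 1)"
 using c1_inner[of "axis i 1"] by (simp add: cart_eq_inner_axis)

lemma c1_add: "c1 f p \<Longrightarrow> c1 g q \<Longrightarrow> c1 (\<lambda>x. f x + g x) (\<lambda>x. p x + q x)"
 unfolding c1_def by (auto simp: inner_add_left intro!: derivative_eq_intros continuous_intros)

lemma c1_cmult: "c1 f p \<Longrightarrow> c1 (\<lambda>x. c * f x) (\<lambda>x. c *\<^sub>R p x)"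
 unfolding c1_def by (auto intro!: derivative_eq_intros continuous_intros)

lemma c1_mult:
 assumes "c1 f p" "c1 g q"
 shows "c1 (\<lambda>x. f x * g x) (\<lambda>x. f x *\<^sub>R q x + g x *\<^sub>R p x)"
 using assms c1_continuous[OF assms(1)] c1_continuous[OF assms(2)] unfolding c1_def
 by (auto simp: inner_add_left algebra_simps intro!: derivative_eq_intros continuous_intros)

lemma c1_compose:
 assumes "c1 f p" and F: "\<And>t. (F has_real_derivative F' t) (at t)" "continuous_on UNIV F'"
 shows "c1 (\<lambda>x. F (f x)) (\<lambda>x. F' (f x) *\<^sub>R p x)"
 unfolding c1_def
proof (intro conjI allI)
 fix x
 show "((\<lambda>x. F (f x)) has_derivative (\<lambda>h. (F' (f x) *\<^sub>R p x) \<bullet> h)) (at x)"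
  using has_derivative_compose[OF c1_derivative[OF assms(1), of x] F(1)[of "f x", unfolded has_field_derivative_def]]
  by simp
 show "continuous_on UNIV (\<lambda>x. F' (f x) *\<^sub>R p x)"
  by (intro continuous_intros continuous_on_compose2[OF F(2)] c1_continuous[OF assms(1)]
    c1_continuous_gradient[OF assms(1)]) auto
qed

lemma c1_norm_square: "c1 (\<lambda>x. x \<bullet> x) (\<lambda>x. 2 *\<^sub>R x)"
 unfolding c1_def by (auto simp: inner_commute intro!: derivative_eq_intros continuous_intros)

lemma c1_linear_compose:
 assumes "c1 f p" and "bounded_linear A" "\<And>x y. A x \<bullet> y = x \<bullet> B y" "bounded_linear B"
 shows "c1 (\<lambda>x. f (A x + b)) (\<lambda>x. B (p (A x + b)))"
 unfolding c1_def
proof (intro conjI allI)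
 fix x
 have *: "B y \<bullet> h = y \<bullet> A h" for y h
  using assms(3) by (metis inner_commute)
 have "((\<lambda>x. A x + b) has_derivative A) (at x)"
  by (auto intro!: derivative_eq_intros bounded_linear.has_derivative[OF assms(2)])
 from has_derivative_compose[OF this c1_derivative[OF assms(1), of "A x + b"]]
 show "((\<lambda>x. f (A x + b)) has_derivative (\<lambda>h. B (p (A x + b)) \<bullet> h)) (at x)"
  by (simp add: *)
 show "continuous_on UNIV (\<lambda>x. B (p (A x + b)))"
  by (intro bounded_linear.continuous_on[OF assms(4)] continuous_on_compose2[OF c1_continuous_gradient[OF assms(1)]]
    bounded_linear.continuous_on[OF assms(2)] continuous_intros) auto
qed

lemma test_fn_translate:
 assumes "test_fn phi"
 shows "test_fn (\<lambda>x. phi (x + b))" (is ?t1) "partial i (\<lambda>x. phi (x + b)) x = partial i phi (x + b)" (is ?t2)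
proof -
 have c: "c1 (\<lambda>x. phi (x + b)) (\<lambda>x. \<chi> i. partial i phi (x + b))"
  using c1_linear_compose[OF test_fn_imp_c1[OF assms], of "\<lambda>x. x" "\<lambda>x. x" b] by simp
 have "{x. phi (x + b) \<noteq> 0} = (\<lambda>x. x - b) ` {x. phi x \<noteq> 0}"
  by (force simp: image_iff intro: exI[of _ "_ + b"])
 moreover have "bounded {x. phi x \<noteq> 0}"
  using assms by (simp add: test_fn_def)
 ultimately have "bounded {x. phi (x + b) \<noteq> 0}"
  using bounded_translation_minus by metis
 with c show ?t1
  by (rule c1_imp_test_fn)
 show ?t2
  using c1_partial[OF c] by simp
qed

lemma test_fn_mult_c1:
 assumes "test_fn phi" "c1 f p"
 shows "test_fn (\<lambda>x. phi x * f x)" (is ?t1)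
  "partial i (\<lambda>x. phi x * f x) x = phi x * p x $ i + f x * partial i phi x" (is ?t2)
proof -
 note c = c1_mult[OF test_fn_imp_c1[OF assms(1)] assms(2)]
 have "bounded {x. phi x * f x \<noteq> 0}"
  by (rule bounded_subset[of "{x. phi x \<noteq> 0}"]) (use assms(1) in \<open>auto simp: test_fn_def\<close>)
 with c show ?t1
  by (rule c1_imp_test_fn)
 show ?t2
  using c1_partial[OF c] by simp
qed

lemma bounded_continuous_bounded_support:
 fixes f :: "'a::euclidean_space \<Rightarrow> real"
 assumes "continuous_on UNIV f" "bounded S" "\<And>x. x \<notin> S \<Longrightarrow> f x = 0"
 obtains C where "C \<ge> 0" "\<And>x. \<bar>f x\<bar> \<le> C"
proof -
 have "compact (f ` closure S)"
  using assms by (intro compact_continuous_image) (auto intro: continuous_on_subset)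
 then obtain B where B: "\<And>y. y \<in> f ` closure S \<Longrightarrow> norm y \<le> B"
  using compact_imp_bounded bounded_iff by metis
 have "\<bar>f x\<bar> \<le> max 0 B" for x
 proof (cases "x \<in> S")
  case True
  then have "norm (f x) \<le> B" using B closure_subset by blast
  then show ?thesis by simp
 qed (simp add: assms(3))
 then show thesis using that[of "max 0 B"] by simp
qed

text \<open>One constant and one radius serve the function and all its partial derivatives: outside
  the ball the function vanishes on an open set, hence so do its derivatives.\<close>

lemma test_fn_bounds:
 assumes "test_fn phi"
 obtains C R where "C \<ge> 0" "R > 0" "\<And>x. \<bar>phi x\<bar> \<le> C" "\<And>i x. \<bar>partial i phi x\<bar> \<le> C"
  "\<And>x. norm x > R \<Longrightarrow> phi x = 0" "\<And>i x. norm x > R \<Longrightarrow> partial i phi x = 0"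
proof -
 have "bounded {x. phi x \<noteq> 0}" using assms by (simp add: test_fn_def)
 then obtain R where R: "R > 0" "\<And>x. phi x \<noteq> 0 \<Longrightarrow> norm x \<le> R"
  using bounded_pos[of "{x. phi x \<noteq> 0}"] by auto
 have z: "phi x = 0" if "norm x > R" for x
  using R(2)[of x] that by linarith
 have pz: "partial i phi x = 0" if "norm x > R" for i x
 proof -
  have "open {y::real^2. norm y > R}"
   by (intro open_Collect_less continuous_intros)
  moreover have "((\<lambda>x. 0) has_derivative (\<lambda>h. (\<chi> i. partial i phi x) \<bullet> h)) (at x)"
   by (rule has_derivative_transform_within_open[OF c1_derivative[OF test_fn_imp_c1[OF assms]] calculation])
     (use that z in auto)
  then have "(\<lambda>h. (\<chi> i. partial i phi x) \<bullet> h) = (\<lambda>h. 0)"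
   using has_derivative_unique[OF _ has_derivative_const] by blast
  then have "(\<chi> i. partial i phi x) \<bullet> axis i 1 = 0"
   by metis
  then show ?thesis by (simp add: inner_axis)
 qed
 obtain C0 where C0: "C0 \<ge> 0" "\<And>x. \<bar>phi x\<bar> \<le> C0"
  by (rule bounded_continuous_bounded_support[of phi "cball 0 R"])
    (use z c1_continuous[OF test_fn_imp_c1[OF assms]] in auto)
 have "\<exists>C\<ge>0. \<forall>x. \<bar>partial i phi x\<bar> \<le> C" for i
 proof -
  obtain C where "C \<ge> 0" "\<And>x. \<bar>partial i phi x\<bar> \<le> C"
   by (rule bounded_continuous_bounded_support[of "partial i phi" "cball 0 R"])
     (use pz assms in \<open>auto simp: test_fn_def\<close>)
  then show ?thesis by blast
 qed
 then obtain C1 where C1: "\<And>i. C1 i \<ge> 0" "\<And>i x. \<bar>partial i phi x\<bar> \<le> C1 i" by metis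
 define C where "C = C0 + (\<Sum>i\<in>UNIV. C1 i)"
 have 1: "C1 i \<le> (\<Sum>i\<in>UNIV. C1 i)" for i
  by (rule member_le_sum) (use C1 in auto)
 have 2: "0 \<le> (\<Sum>i\<in>UNIV. C1 i)" using C1 by (simp add: sum_nonneg)
 show thesis
 proof (rule that[of C R])
  show "\<bar>phi x\<bar> \<le> C" for x using C0(2)[of x] 2 by (simp add: C_def)
  show "\<bar>partial i phi x\<bar> \<le> C" for i x using C1(2)[of i x] 1[of i] C0(1) by (simp add: C_def)
 qed (use C0 2 R z pz in \<open>auto simp: C_def\<close>)
qed

lemma test_fn_continuous: "test_fn phi \<Longrightarrow> continuous_on UNIV phi"
 using c1_continuous test_fn_imp_c1 by blast

lemma test_fn_borel [measurable_dest]: "test_fn phi \<Longrightarrow> phi \<in> Bor"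
 using borel_measurable_continuous_onI test_fn_continuous by blast

lemma partial_borel: "test_fn phi \<Longrightarrow> partial i phi \<in> Bor"
 by (simp add: borel_measurable_continuous_onI test_fn_def)

definition loc_int :: "(real^2 \<Rightarrow> real) \<Rightarrow> bool" where
 "loc_int u \<longleftrightarrow> (\<forall>K. compact K \<longrightarrow> set_integrable lborel K u)"

lemma loc_int_borel:
 assumes "loc_int u"
 shows "u \<in> Bor"
proof -
 have m: "(\<lambda>x. indicator (cball 0 (real n)) x *\<^sub>R u x) \<in> borel_measurable lborel" for n
  using assms unfolding loc_int_def set_integrable_def
  using borel_measurable_integrable compact_cball by blast
 have "(\<lambda>n. indicator (cball 0 (real n)) x *\<^sub>R u x) ~~> u x" for x
 proof -
  obtain N where "norm x \<le> real N" using real_arch_simple by blast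
  then have "eventually (\<lambda>n. indicator (cball 0 (real n)) x *\<^sub>R u x = u x) sequentially"
   by (auto simp: eventually_sequentially indicator_def intro!: exI[of _ N])
  then show ?thesis by (rule tendsto_eventually)
 qed
 then have "u \<in> borel_measurable lborel"
  by (intro borel_measurable_LIMSEQ_real[OF _ m])
 then show ?thesis by simp
qed

lemma loc_int_mult_integrable:
 assumes u: "loc_int u" and m: "psi \<in> Bor"
  and b: "\<And>x. \<bar>psi x\<bar> \<le> C" "\<And>x. norm x > R \<Longrightarrow> psi x = 0"
 shows "integ (\<lambda>x. psi x * u x)"
proof -
 have i: "integ (\<lambda>x. indicator (cball 0 R) x *\<^sub>R u x)"
  using u unfolding loc_int_def set_integrable_def using compact_cball by blast
 show ?thesis
 proof (rule Lintegrable_bound[OF integrable_mult_right[OF i, of C]])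
  show "(\<lambda>x. psi x * u x) \<in> borel_measurable lborel"
   using m loc_int_borel[OF u] by measurable
  show "AE x in lborel. norm (psi x * u x) \<le> norm (C * indicator (cball 0 R) x *\<^sub>R u x)" (is "AE x in _. ?Q1 x")
  proof (intro AE_I2)
   fix x
   have "C \<ge> 0" using b(1)[of 0] by linarith
   then show "?Q1 x"
    using b(1)[of x] b(2)[of x] by (cases "norm x > R") (auto simp: abs_mult mult_right_mono)
  qed
 qed
qed

lemma loc_intI:
 assumes "u \<in> Bor"
  and "\<And>R. \<exists>w. integ w \<and> (\<forall>x. norm x \<le> R \<longrightarrow> \<bar>u x\<bar> \<le> w x)"
 shows "loc_int u"
 unfolding loc_int_def
proof (intro allI impI)
 fix K :: "(real^2) set" assume K: "compact K"
 then obtain R where R: "\<And>x. x \<in> K \<Longrightarrow> norm x \<le> R"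
  using compact_imp_bounded bounded_iff by metis
 from assms(2)[of R] obtain w where w: "integ w" "\<And>x. norm x \<le> R \<Longrightarrow> \<bar>u x\<bar> \<le> w x" by blast
 have [measurable]: "K \<in> sets borel" using K compact_imp_closed by (metis borel_closed)
 show "set_integrable lborel K u"
  unfolding set_integrable_def
 proof (rule Lintegrable_bound[OF w(1)])
  show "(\<lambda>x. indicat_real K x *\<^sub>R u x) \<in> borel_measurable lborel"
   using assms(1) by measurable
  show "AE x in lborel. norm (indicat_real K x *\<^sub>R u x) \<le> norm (w x)"
   using R w(2) by (intro AE_I2) (auto simp: indicator_def order.trans[OF _ abs_ge_self])
 qed
qed

lemma loc_int_bound:
 assumes "loc_int w" "u \<in> Bor" "\<And>x. \<bar>u x\<bar> \<le> w x"
 shows "loc_int u"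
proof (rule loc_intI[OF assms(2)])
 fix R
 have "integ (\<lambda>x. indicator (cball 0 R) x * w x)"
  using assms(1) by (intro loc_int_mult_integrable[where C=1 and R=R]) (auto simp: indicator_def)
 then show "\<exists>w. integ w \<and> (\<forall>x. norm x \<le> R \<longrightarrow> \<bar>u x\<bar> \<le> w x)"
  using assms(3) by (intro exI[of _ "\<lambda>x. indicator (cball 0 R) x * w x"]) auto
qed

lemma integrable_imp_loc_int: "integ u \<Longrightarrow> loc_int u"
 by (rule loc_intI) (auto intro!: exI[of _ "\<lambda>x. \<bar>u x\<bar>"])

lemma loc_int_add: "loc_int u \<Longrightarrow> loc_int v \<Longrightarrow> loc_int (\<lambda>x. u x + v x)"
 unfolding loc_int_def by (auto simp: set_integral_add)

lemma loc_int_cmult: "loc_int u \<Longrightarrow> loc_int (\<lambda>x. c * u x)"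
 unfolding loc_int_def by auto

lemma loc_int_abs: "loc_int u \<Longrightarrow> loc_int (\<lambda>x. \<bar>u x\<bar>)"
 unfolding loc_int_def by (auto simp: set_integrable_abs)

lemma loc_int_const: "loc_int (\<lambda>x. c)"
proof (rule loc_intI)
 fix R
 show "\<exists>w. integ w \<and> (\<forall>x::real^2. norm x \<le> R \<longrightarrow> \<bar>c\<bar> \<le> w x)"
  by (intro exI[of _ "\<lambda>x. indicator (cball 0 R) x * \<bar>c\<bar>"] conjI integrable_mult_left integrable_real_indicator)
    (auto simp: emeasure_lborel_cball_finite[unfolded infinity_ennreal_def])
qed simp

lemma test_fn_mult_integrable:
 assumes "test_fn phi" "loc_int u"
 shows "integ (\<lambda>x. phi x * u x)" (is ?t1) "integ (\<lambda>x. partial i phi x * u x)" (is ?t2)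
proof -
 obtain C R where "C \<ge> 0" "R > 0" "\<And>x. \<bar>phi x\<bar> \<le> C" "\<And>i x. \<bar>partial i phi x\<bar> \<le> C"
  "\<And>x. norm x > R \<Longrightarrow> phi x = 0" "\<And>i x. norm x > R \<Longrightarrow> partial i phi x = 0"
  using test_fn_bounds[OF assms(1)] by metis
 then show ?t1 ?t2
  using loc_int_mult_integrable[OF assms(2)] test_fn_borel[OF assms(1)] partial_borel[OF assms(1)] by blast+
qed

subsection \<open>The fundamental lemma\<close>

text \<open>Open boxes form an intersection-stable generator of the Borel sets, so the vanishing of
  the integrals extends to all of them by the Dynkin argument.\<close>

lemma integral_box_zero_imp_AE_zero:
 fixes f :: "'a::euclidean_space \<Rightarrow> real"
 assumes f: "integ f" and box: "\<And>a b. (LBINT x. indicator (box a b) x * f x) = 0"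
 shows "AE x in lborel. f x = 0"
proof (rule sigma_finite_measure.density_zero[OF sigma_finite_lborel f])
 fix A :: "'a set" assume "A \<in> sets lborel"
 then have A: "A \<in> sigma_sets UNIV (range (\<lambda>(a, b). box a b))"
  by (simp add: borel_eq_box)
 have "Int_stable (range (\<lambda>(a, b). box a b :: 'a set))"
  by (auto simp: Int_stable_def box_Int_box)
 moreover have "range (\<lambda>(a, b). box a b) \<subseteq> Pow (UNIV :: 'a set)" by simp
 ultimately have "A \<in> sets borel \<and> (LBINT x. indicator A x * f x) = 0"
  using A
 proof (induction rule: sigma_sets_induct_disjoint)
  case (basic A) then show ?case using box by auto
 next
  case empty then show ?case by simp
 next
  case (compl A)
  \<comment> \<open>Complements require the integral over the whole space, which is the limit of the
    integrals over growing boxes.\<close>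
  have UN: "(LBINT x. f x) = 0"
  proof -
   have "(\<lambda>n. LBINT x. indicator (box (- real n *\<^sub>R One) (real n *\<^sub>R One)) x * f x) ~~> (LBINT x. f x)"
   proof (rule integral_dominated_convergence[where w="\<lambda>x. norm (f x)"])
    show "AE x in lborel. (\<lambda>n. indicat_real (box (- real n *\<^sub>R One) (real n *\<^sub>R One)) x * f x) ~~> f x"
    proof (intro AE_I2 tendsto_eventually)
     fix x :: 'a
     obtain N where N: "norm x < real N" using reals_Archimedean2 by blast
     have "x \<in> box (- real n *\<^sub>R One) (real n *\<^sub>R One)" if "n \<ge> N" for n
     proof -
      have "\<bar>x \<bullet> b\<bar> < real n" if "b \<in> Basis" for b
       using Basis_le_norm[OF that, of x] N \<open>n \<ge> N\<close> by linarith
      then show ?thesis by (force simp: mem_box abs_less_iff)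
     qed
     then show "\<forall>\<^sub>F n in sequentially. indicat_real (box (- real n *\<^sub>R One) (real n *\<^sub>R One)) x * f x = f x"
      by (auto simp: eventually_sequentially intro!: exI[of _ N])
    qed
   qed (use f in \<open>auto simp: indicator_def\<close>)
   then show ?thesis using box by (simp add: LIMSEQ_const_iff)
  qed
  have "integ (\<lambda>x. indicator A x * f x)"
   using integrable_mult_indicator[OF _ f, of A] compl by simp
  then have "(LBINT x. f x - indicator A x * f x) = 0"
   using f UN compl by simp
  moreover have "(\<lambda>x. f x - indicator A x * f x) = (\<lambda>x. indicator (UNIV - A) x * f x)"
   by (auto simp: indicator_def)
  ultimately show ?case using compl by auto
 next
  case (union A)
  then have A: "\<And>i. A i \<in> sets lborel" by auto
  have U: "(\<Union>i. A i) \<in> sets lborel" using A by (intro sets.countable_UN) auto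
  have "integ (\<lambda>x. indicat_real (\<Union>i. A i) x *\<^sub>R f x)"
   by (rule integrable_mult_indicator[OF U f])
  then have "set_lebesgue_integral lborel (\<Union>i. A i) f = (\<Sum>i. set_lebesgue_integral lborel (A i) f)"
   by (intro lebesgue_integral_countable_add[OF A])
     (use union in \<open>auto simp: disjoint_family_on_def set_integrable_def\<close>)
  then show ?case using union U by (simp add: set_lebesgue_integral_def)
 qed
 then show "set_lebesgue_integral lborel A f = 0" by (simp add: set_lebesgue_integral_def)
qed

text \<open>A rational step suffices because test functions are only \<open>C^1\<close>: value and
  slope both vanish at 0, and \<open>smooth_step (n * t)\<close> tends to the indicator of the open
  half-line.\<close>

definition smooth_step :: "real \<Rightarrow> real" where
 "smooth_step t = (if t \<le> 0 then 0 else t\<^sup>2 / (1 + t\<^sup>2))"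

definition smooth_step' :: "real \<Rightarrow> real" where
 "smooth_step' t = (if t \<le> 0 then 0 else 2 * t / (1 + t\<^sup>2)^2)"

lemma one_plus_square_pos: "0 < 1 + (t::real)^2" "1 + t\<^sup>2 \<noteq> 0"
 by (metis add_pos_nonneg zero_less_one zero_le_power2)
   (metis add_pos_nonneg zero_less_one zero_le_power2 less_irrefl)

lemma smooth_step_DERIV: "(smooth_step has_real_derivative smooth_step' t) (at t)"
proof -
 have pos: "((\<lambda>t. t\<^sup>2 / (1 + t\<^sup>2)) has_real_derivative 2 * t / (1 + t\<^sup>2)^2) (at t)" for t :: real
  using one_plus_square_pos[of t]
  by (auto intro!: derivative_eq_intros simp: power2_eq_square field_simps)
 consider "t < 0" | "t = 0" | "t > 0" by linarith
 then show ?thesis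
 proof cases
  case 1
  have "((\<lambda>t. 0) has_real_derivative 0) (at t)" by simp
  then have "(smooth_step has_real_derivative 0) (at t)"
   by (rule has_field_derivative_transform_within[where d="- t"]) (use 1 in \<open>auto simp: smooth_step_def dist_real_def\<close>)
  then show ?thesis using 1 by (simp add: smooth_step'_def)
 next
  case 2
  have "((\<lambda>h. smooth_step h / h) \<longlongrightarrow> 0) (at 0)"
  proof (rule Lim_null_comparison)
   show "\<forall>\<^sub>F x in at 0. norm (smooth_step x / x) \<le> \<bar>x\<bar>"
   proof (rule always_eventually, rule allI)
    fix x :: real
    have "\<bar>smooth_step x\<bar> \<le> x\<^sup>2"
     using one_plus_square_pos[of x] by (auto simp: smooth_step_def divide_le_eq mult_le_cancel_left1)
    then show "norm (smooth_step x / x) \<le> \<bar>x\<bar>"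
     by (cases "x = 0") (auto simp: divide_le_eq power2_eq_square abs_mult_self_eq)
   qed
   show "((\<lambda>x::real. \<bar>x\<bar>) \<longlongrightarrow> 0) (at 0)" by (auto intro!: tendsto_eq_intros)
  qed
  then show ?thesis using 2 by (simp add: has_field_derivative_iff smooth_step'_def smooth_step_def)
 next
  case 3
  then have "(smooth_step has_real_derivative 2 * t / (1 + t\<^sup>2)^2) (at t)"
   by (intro has_field_derivative_transform_within[OF pos, where d=t]) (auto simp: smooth_step_def dist_real_def)
  then show ?thesis using 3 by (simp add: smooth_step'_def)
 qed
qed

lemma smooth_step'_continuous: "continuous_on UNIV smooth_step'"
proof -
 have "smooth_step' = (\<lambda>t. 2 * max t 0 / (1 + (max t 0)^2)^2)"
  by (auto simp: smooth_step'_def max_def fun_eq_iff)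
 moreover have "continuous_on UNIV (\<lambda>t::real. 2 * max t 0 / (1 + (max t 0)^2)^2)"
  by (intro continuous_intros) (use one_plus_square_pos in auto)
 ultimately show ?thesis by (simp only:)
qed

lemma smooth_step_nonneg: "0 \<le> smooth_step t"
 by (simp add: smooth_step_def)

lemma smooth_step_le_1: "smooth_step t \<le> 1"
 using one_plus_square_pos[of t] by (auto simp: smooth_step_def divide_le_eq)

lemma smooth_step_tendsto: "(\<lambda>n. smooth_step (real n * t)) ~~> (if t > 0 then 1 else 0)"
proof (cases "t > 0")
 case True
 have "(\<lambda>n. (real n * t)^2 / (1 + (real n * t)^2)) ~~> 1" using True by real_asymp
 moreover have "\<forall>\<^sub>F n in sequentially. (real n * t)^2 / (1 + (real n * t)^2) = smooth_step (real n * t)"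
  using True by (auto simp: eventually_sequentially smooth_step_def mult_le_0_iff intro!: exI[of _ 1])
 ultimately show ?thesis using True by (simp add: tendsto_cong)
next
 case False
 then have "smooth_step (real n * t) = 0" for n
  by (simp add: smooth_step_def mult_nonneg_nonpos)
 then show ?thesis using False by simp
qed

text \<open>Products of rescaled steps are test functions that converge, boundedly, to the indicator
  of an open box; all box integrals of \<open>k\<close> therefore vanish.\<close>

lemma fundamental_lemma:
 assumes k: "loc_int k" and z: "\<And>phi. test_fn phi \<Longrightarrow> (LBINT x. phi x * k x) = 0"
 shows "AE x in lborel. k x = 0"
proof -
 have km[measurable]: "k \<in> Bor" by (rule loc_int_borel[OF k])
 have bz: "(LBINT x. indicator (box a b) x * k x) = 0" for a b
 proof -
  define phi where "phi n x = (\<Prod>i\<in>UNIV. smooth_step (real n * (x $ i - a $ i)) * smooth_step (real n * (b $ i - x $ i)))" for n x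
  have sup: "phi n x = 0" if nb: "x \<notin> cbox a b" for n x
  proof -
   obtain i where "x $ i < a $ i \<or> x $ i > b $ i"
    using nb unfolding mem_box_cart by (meson not_le)
   then have "smooth_step (real n * (x $ i - a $ i)) * smooth_step (real n * (b $ i - x $ i)) = 0"
    by (auto simp: smooth_step_def mult_le_0_iff)
   then show ?thesis unfolding phi_def by (metis (no_types, lifting) finite_class.finite_UNIV iso_tuple_UNIV_I prod_zero)
  qed
  have c: "\<exists>p. c1 (phi n) p" for n
  proof -
   have lin: "c1 (\<lambda>x. real n * (x $ i - a $ i)) (\<lambda>x. real n *\<^sub>R axis i 1)"
    "c1 (\<lambda>x. real n * (b $ i - x $ i)) (\<lambda>x. - real n *\<^sub>R axis i 1)" for i
    using c1_cmult[OF c1_add[OF c1_component[of i] c1_const[of "- a $ i"]], of "real n"]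
     c1_cmult[OF c1_add[OF c1_component[of i] c1_const[of "- b $ i"]], of "- real n"]
    by (simp_all add: algebra_simps)
   have 1: "\<exists>p. c1 (\<lambda>x. smooth_step (real n * (x $ i - a $ i)) * smooth_step (real n * (b $ i - x $ i))) p" for i
    using c1_mult[OF c1_compose[OF lin(1)[of i] smooth_step_DERIV smooth_step'_continuous]
      c1_compose[OF lin(2)[of i] smooth_step_DERIV smooth_step'_continuous]] by blast
   have "\<exists>p. c1 (\<lambda>x. \<Prod>i\<in>J. smooth_step (real n * (x $ i - a $ i)) * smooth_step (real n * (b $ i - x $ i))) p" if "finite J" for J :: "2 set"
    using that
   proof (induction J)
    case empty then show ?case using c1_const[of 1] by auto
   next
    case (insert i J)
    then show ?case using c1_mult 1[of i] by fastforce
   qed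
   then show ?thesis unfolding phi_def by simp
  qed
  have t: "test_fn (phi n)" for n
  proof -
   have "{x. phi n x \<noteq> 0} \<subseteq> cbox a b" using sup by blast
   then show ?thesis using c[of n] c1_imp_test_fn bounded_subset bounded_cbox by metis
  qed
  have b01: "0 \<le> phi n x \<and> phi n x \<le> 1" for n x
   unfolding phi_def
   by (intro conjI prod_nonneg prod_le_1 ballI mult_nonneg_nonneg mult_le_one smooth_step_nonneg smooth_step_le_1)
  have lim: "(\<lambda>n. phi n x) ~~> indicator (box a b) x" for x
  proof -
   have "(\<lambda>n. phi n x) ~~> (\<Prod>i\<in>UNIV. (if x $ i - a $ i > 0 then 1 else 0) * (if b $ i - x $ i > 0 then 1 else 0))"
    unfolding phi_def by (intro tendsto_prod tendsto_mult smooth_step_tendsto)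
   moreover have "(\<Prod>i\<in>UNIV. (if x $ i - a $ i > 0 then 1 else 0) * (if b $ i - x $ i > 0 then 1 else 0)) = indicat_real (box a b) x"
   proof (cases "x \<in> box a b")
    case True then show ?thesis by (simp add: mem_box_cart)
   next
    case False
    then obtain i where "\<not> (a $ i < x $ i \<and> x $ i < b $ i)" by (auto simp: mem_box_cart)
    then have "(if x $ i - a $ i > 0 then 1 else 0) * (if b $ i - x $ i > 0 then 1 else 0) = (0::real)" by auto
    then have "(\<Prod>i\<in>UNIV. (if x $ i - a $ i > 0 then 1 else 0) * (if b $ i - x $ i > 0 then 1 else 0)) = (0::real)"
     by (metis (no_types, lifting) finite_class.finite_UNIV iso_tuple_UNIV_I prod_zero)
    then show ?thesis using False by simp
   qed
   ultimately show ?thesis by simp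
  qed
  have "(\<lambda>n. LBINT x. phi n x * k x) ~~> (LBINT x. indicator (box a b) x * k x)"
  proof (rule integral_dominated_convergence[where w="\<lambda>x. indicator (cbox a b) x * \<bar>k x\<bar>"])
   show "integ (\<lambda>x. indicator (cbox a b) x * \<bar>k x\<bar>)"
    using loc_int_abs[OF k] unfolding loc_int_def set_integrable_def by (auto simp: compact_cbox)
   show "AE x in lborel. norm (phi n x * k x) \<le> indicator (cbox a b) x * \<bar>k x\<bar>" (is "AE x in _. ?Q1 x") for n
   proof (intro AE_I2)
    fix x show "?Q1 x"
     using b01[of n x] sup[of x n] by (auto simp: indicator_def abs_mult mult_left_le_one_le)
   qed
  qed (use lim t in \<open>auto intro!: tendsto_mult\<close>)
  moreover have "(LBINT x. phi n x * k x) = 0" for n using z t by blast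
  ultimately show ?thesis by (simp add: LIMSEQ_const_iff)
 qed
 \<comment> \<open>\<open>k\<close> is only locally integrable, so the box criterion is applied to
   its restrictions to growing boxes.\<close>
 have "AE x in lborel. indicator (box (- real n *\<^sub>R One) (real n *\<^sub>R One)) x * k x = 0" for n :: nat
 proof (rule integral_box_zero_imp_AE_zero)
  have "set_integrable lborel (cbox (- real n *\<^sub>R One) (real n *\<^sub>R One)) k"
   using k by (simp add: loc_int_def compact_cbox)
  then have "set_integrable lborel (box (- real n *\<^sub>R One) (real n *\<^sub>R One)) k"
   by (rule set_integrable_subset) (auto simp: box_subset_cbox)
  then show "integ (\<lambda>x. indicator (box (- real n *\<^sub>R One) (real n *\<^sub>R One)) x * k x)"
   by (simp add: set_integrable_def)
  fix a b :: "real^2"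
  obtain c d where "box a b \<inter> box (- real n *\<^sub>R One) (real n *\<^sub>R One) = box c d"
   using box_Int_box by blast
  then have "indicator (box a b) x * (indicator (box (- real n *\<^sub>R One) (real n *\<^sub>R One)) x * k x) = indicator (box c d) x * k x" for x
   by (metis indicator_inter_arith mult.assoc)
  then show "(LBINT x. indicator (box a b) x * (indicator (box (- real n *\<^sub>R One) (real n *\<^sub>R One)) x * k x)) = 0"
   by (simp only: bz)
 qed
 then have "AE x in lborel. \<forall>n. indicator (box (- real n *\<^sub>R One) (real n *\<^sub>R One)) x * k x = 0"
  by (simp only: AE_all_countable simp_thms)
 then show ?thesis
 proof eventually_elim
  case (elim x)
  obtain N where N: "norm x < real N" using reals_Archimedean2 by blast
  have "\<bar>x \<bullet> b\<bar> < real N" if "b \<in> Basis" for b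
   using Basis_le_norm[OF that, of x] N by linarith
  then have "x \<in> box (- real N *\<^sub>R One) (real N *\<^sub>R One)"
   by (force simp: mem_box abs_less_iff)
  then show ?case using elim[rule_format, of N] by simp
 qed
qed

subsection \<open>Change of variables\<close>

lemma lborel_translate:
 fixes b :: "'a::euclidean_space"
 shows "distr lborel borel (\<lambda>x. x + b) = lborel"
proof -
 have "(\<lambda>x. x + b) = (+) b" by (auto simp: add.commute)
 then show ?thesis using lborel_distr_plus[of b] by simp
qed

lemma integral_translate:
 fixes f :: "'a::euclidean_space \<Rightarrow> real"
 assumes "f \<in> Bor"
 shows "(LBINT x. f (x + b)) = (LBINT x. f x)"
 using integral_distr[of "\<lambda>x. x + b" lborel borel f] assms by (simp add: lborel_translate)

lemma integrable_translate:
 fixes f :: "'a::euclidean_space \<Rightarrow> real"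
 assumes "integ f"
 shows "integ (\<lambda>x. f (x + b))"
 using integrable_distr[of "\<lambda>x. x + b" lborel borel f] assms by (simp add: lborel_translate)

lemma loc_int_translate:
 assumes "loc_int u"
 shows "loc_int (\<lambda>x. u (x + b))"
proof (rule loc_intI)
 note [measurable] = loc_int_borel[OF assms]
 show "(\<lambda>x. u (x + b)) \<in> Bor" by measurable
 fix R :: real
 have "integ (\<lambda>x. indicator (cball 0 (R + norm b)) x * \<bar>u x\<bar>)"
  using loc_int_abs[OF assms] unfolding loc_int_def set_integrable_def by (auto simp: compact_cball)
 from integrable_translate[OF this, of b]
 show "\<exists>w. integ w \<and> (\<forall>x. norm x \<le> R \<longrightarrow> \<bar>u (x + b)\<bar> \<le> w x)"
  by (intro exI[of _ "\<lambda>x. indicator (cball 0 (R + norm b)) (x + b) * \<bar>u (x + b)\<bar>"] conjI)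
    (auto simp: indicator_def intro: order.trans[OF norm_triangle_ineq])
qed

subsection \<open>Continuity of translations in the mean\<close>

text \<open>Induction over integrable functions; the substance is the indicator of a set, first of
  an open one, then of a Borel one.\<close>

lemma L1_translation_continuous:
 fixes f :: "'a::euclidean_space \<Rightarrow> real"
 assumes "integ f" "X ~~> 0"
 shows "(\<lambda>n. LBINT x. \<bar>f (x + X n) - f x\<bar>) ~~> 0"
 using assms(1)
proof (induction rule: integrable_induct)
 case (base A c)
 have fin: "A \<in> sets borel" "emeasure lborel A < \<infinity>" using base by auto
 have open_case: "(\<lambda>n. LBINT x. \<bar>indicat_real U (x + X n) - indicat_real U x\<bar>) ~~> 0"
  if U: "open U" "emeasure lborel U < \<infinity>" for U :: "'a set"
 proof -
  have [measurable]: "U \<in> sets borel" using U by simp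
  have iU: "integ (indicat_real U)" using U by (intro integrable_real_indicator) auto
  note iT = integrable_translate[OF iU]
  \<comment> \<open>Openness gives only one half of the estimate: a point of \<open>U\<close> stays
    in \<open>U\<close> under small shifts.\<close>
  have "(\<lambda>n. LBINT x. max 0 (indicat_real U x - indicat_real U (x + X n))) ~~> (\<integral>x. 0 \<partial>(lborel::'a measure))"
  proof (rule integral_dominated_convergence[where w="indicat_real U"])
   show "AE x in lborel. (\<lambda>n. max 0 (indicat_real U x - indicat_real U (x + X n))) ~~> 0"
   proof (intro AE_I2 tendsto_eventually)
    fix x
    show "\<forall>\<^sub>F n in sequentially. max 0 (indicat_real U x - indicat_real U (x + X n)) = 0"
    proof (cases "x \<in> U")
     case True
     have "(\<lambda>n. x + X n) ~~> x + 0" using assms(2) by (intro tendsto_intros)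
     then have "\<forall>\<^sub>F n in sequentially. x + X n \<in> U"
      by (rule topological_tendstoD[OF _ U(1)]) (use True in simp)
     then show ?thesis by eventually_elim simp
    qed (auto simp: indicator_def)
   qed
  qed (use iU in \<open>auto simp: indicator_def\<close>)
  \<comment> \<open>The other half follows from translation invariance:
    \<open>\<bar>p - q\<bar> = 2 * max 0 (q - p) - (q - p)\<close>, and the last difference
    integrates to zero.\<close>
  moreover have "(LBINT x. \<bar>indicat_real U (x + X n) - indicat_real U x\<bar>)
    = 2 * (LBINT x. max 0 (indicat_real U x - indicat_real U (x + X n)))" for n
  proof -
   have "(LBINT x. \<bar>indicat_real U (x + X n) - indicat_real U x\<bar>)
     = (LBINT x. 2 * max 0 (indicat_real U x - indicat_real U (x + X n)) - (indicat_real U x - indicat_real U (x + X n)))"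
    by (intro Lintegral_cong) (auto simp: max_def)
   also have "\<dots> = 2 * (LBINT x. max 0 (indicat_real U x - indicat_real U (x + X n)))
     - ((LBINT x. indicat_real U x) - (LBINT x. indicat_real U (x + X n)))"
    using iU iT by (subst Lintegral_diff) (auto intro!: Lintegrable_diff integrable_max)
   also have "(LBINT x. indicat_real U (x + X n)) = (LBINT x. indicat_real U x)"
    by (intro integral_translate) auto
   finally show ?thesis by simp
  qed
  ultimately show ?thesis by (auto intro: tendsto_eq_intros)
 qed
 \<comment> \<open>Outer regularity: \<open>A\<close> differs from an open \<open>U\<close> by
   measure less than \<open>r/4\<close>, which enters twice; the open case supplies the remaining
   \<open>r/2\<close>.\<close>
 have ind: "(\<lambda>n. LBINT x. \<bar>indicat_real A (x + X n) - indicat_real A x\<bar>) ~~> 0"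
 proof (rule LIMSEQ_I)
  fix r :: real assume "r > 0"
  then obtain U where U: "open U" "A \<subseteq> U" "emeasure lborel (U - A) < ennreal (r/4)"
   using outer_regular_lborel[OF fin(1), of "r/4"] by auto
  have [measurable]: "U \<in> sets borel" "A \<in> sets borel" using U fin by simp_all
  have "emeasure lborel U = emeasure lborel A + emeasure lborel (U - A)"
   using U by (subst plus_emeasure) (auto simp: Un_absorb1)
  then have Uf: "emeasure lborel U < \<infinity>"
   using U(3) fin by (metis ennreal_less_top ennreal_add_less_top infinity_ennreal_def less_trans)
  have iU: "integ (indicat_real U)" using Uf by (intro integrable_real_indicator) auto
  have iA: "integ (indicat_real A)" using fin by (intro integrable_real_indicator) auto
  have iD: "integ (indicat_real (U - A))"
   using U(3) by (intro integrable_real_indicator) (auto intro: less_trans[OF _ ennreal_less_top])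
  have dif: "(LBINT x. indicat_real (U - A) x) < r/4"
  proof -
   have "emeasure lborel (U - A) = ennreal (measure lborel (U - A))"
    using U(3) by (intro emeasure_eq_ennreal_measure) auto
   then show ?thesis using U(3) by (simp add: ennreal_less_iff)
  qed
  obtain N where N: "\<And>n. n \<ge> N \<Longrightarrow> norm ((LBINT x. \<bar>indicat_real U (x + X n) - indicat_real U x\<bar>) - 0) < r/2"
   using LIMSEQ_D[OF open_case[OF U(1) Uf], of "r/2"] \<open>r > 0\<close> by (metis half_gt_zero)
  have "(LBINT x. \<bar>indicat_real A (x + X n) - indicat_real A x\<bar>) < r" if "n \<ge> N" for n
  proof -
   have "(LBINT x. \<bar>indicat_real A (x + X n) - indicat_real A x\<bar>)
    \<le> (LBINT x. \<bar>indicat_real U (x + X n) - indicat_real U x\<bar> + indicat_real (U - A) (x + X n) + indicat_real (U - A) x)"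
    by (intro integral_mono Lintegrable_add integrable_abs Lintegrable_diff integrable_translate iU iA iD)
      (use U(2) in \<open>auto simp: indicator_def\<close>)
   also have "\<dots> = (LBINT x. \<bar>indicat_real U (x + X n) - indicat_real U x\<bar>) + (LBINT x. indicat_real (U - A) (x + X n)) + (LBINT x. indicat_real (U - A) x)"
    by (simp only: Lintegral_add Lintegrable_add
      integrable_abs Lintegrable_diff integrable_translate iU iD)
   also have "(LBINT x. indicat_real (U - A) (x + X n)) = (LBINT x. indicat_real (U - A) x)"
    by (intro integral_translate) auto
   finally show ?thesis using N[OF that] dif unfolding real_norm_def by linarith
  qed
  then show "\<exists>no. \<forall>n\<ge>no. norm ((LBINT x. \<bar>indicat_real A (x + X n) - indicat_real A x\<bar>) - 0) < r"
   by auto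
 qed
 have "(\<lambda>n. \<bar>c\<bar> * (LBINT x. \<bar>indicat_real A (x + X n) - indicat_real A x\<bar>)) ~~> \<bar>c\<bar> * 0"
  by (intro tendsto_intros ind)
 moreover have "\<bar>c\<bar> * (LBINT x. \<bar>indicat_real A (x + X n) - indicat_real A x\<bar>)
   = (LBINT x. \<bar>indicat_real A (x + X n) *\<^sub>R c - indicat_real A x *\<^sub>R c\<bar>)" for n
  by (subst integral_mult_right_zero[symmetric])
    (auto intro!: Lintegral_cong simp: abs_mult[symmetric] algebra_simps)
 ultimately show ?case by simp
next
 case (add f g)
 show ?case
 proof (rule Lim_null_comparison[OF always_eventually])
  show "(\<lambda>n. (LBINT x. \<bar>f (x + X n) - f x\<bar>) + (LBINT x. \<bar>g (x + X n) - g x\<bar>)) ~~> 0"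
   using tendsto_add[OF add.IH] by simp
  show "\<forall>n. norm (LBINT x. \<bar>f (x + X n) + g (x + X n) - (f x + g x)\<bar>)
    \<le> (LBINT x. \<bar>f (x + X n) - f x\<bar>) + (LBINT x. \<bar>g (x + X n) - g x\<bar>)"
  proof
   fix n
   have i: "integ (\<lambda>x. \<bar>f (x + X n) - f x\<bar>)" "integ (\<lambda>x. \<bar>g (x + X n) - g x\<bar>)"
    using add by (auto intro!: integrable_translate)
   have "(LBINT x. \<bar>f (x + X n) + g (x + X n) - (f x + g x)\<bar>) \<le> (LBINT x. \<bar>f (x + X n) - f x\<bar> + \<bar>g (x + X n) - g x\<bar>)"
    using add i by (intro integral_mono) (auto intro!: integrable_translate integrable_abs Lintegrable_diff Lintegrable_add)
   then show "norm (LBINT x. \<bar>f (x + X n) + g (x + X n) - (f x + g x)\<bar>)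
    \<le> (LBINT x. \<bar>f (x + X n) - f x\<bar>) + (LBINT x. \<bar>g (x + X n) - g x\<bar>)"
    using i by simp
  qed
 qed
next
 case (lim f s)
 have sm[measurable]: "s i \<in> Bor" "f \<in> Bor" for i using lim.hyps(1)[of i] lim.hyps(4) by auto
 have L: "(\<lambda>i. LBINT x. \<bar>s i x - f x\<bar>) ~~> (\<integral>x. 0 \<partial>(lborel::'a measure))"
 proof (rule integral_dominated_convergence[where w="\<lambda>x. 3 * \<bar>f x\<bar>"])
  show "AE x in lborel. (\<lambda>i. \<bar>s i x - f x\<bar>) ~~> 0"
   using lim.hyps(2) by (intro AE_I2 tendsto_rabs_zero) (auto intro: LIM_zero)
  show "AE x in lborel. norm \<bar>s i x - f x\<bar> \<le> 3 * \<bar>f x\<bar>" for i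
   using lim.hyps(3)[of _ i] by (intro AE_I2) (smt (verit) real_norm_def space_lborel UNIV_I)
 qed (use lim.hyps(4) in auto)
 show ?case
 proof (rule LIMSEQ_I)
  fix r :: real assume r: "r > 0"
  from LIMSEQ_D[OF L, of "r/3"] r obtain i where "norm ((LBINT x. \<bar>s i x - f x\<bar>) - (\<integral>x. 0 \<partial>(lborel::'a measure))) < r/3" by auto
  then have i: "(LBINT x. \<bar>s i x - f x\<bar>) < r/3" by simp
  from LIMSEQ_D[OF lim.IH[of i], of "r/3"] r obtain N where N: "\<And>n. n \<ge> N \<Longrightarrow> (LBINT x. \<bar>s i (x + X n) - s i x\<bar>) < r/3" by auto
  have "(LBINT x. \<bar>f (x + X n) - f x\<bar>) < r" if "n \<ge> N" for n
  proof -
   have i1: "integ (\<lambda>x. \<bar>s i x - f x\<bar>)" using lim.hyps by auto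
   have i2: "integ (\<lambda>x. \<bar>s i (x + X n) - f (x + X n)\<bar>)" using integrable_translate[OF i1] .
   have i3: "integ (\<lambda>x. \<bar>s i (x + X n) - s i x\<bar>)" by (intro integrable_abs Lintegrable_diff integrable_translate lim.hyps)
   have "(LBINT x. \<bar>f (x + X n) - f x\<bar>) \<le> (LBINT x. \<bar>s i (x + X n) - f (x + X n)\<bar> + \<bar>s i (x + X n) - s i x\<bar> + \<bar>s i x - f x\<bar>)"
    by (intro integral_mono Lintegrable_add integrable_abs Lintegrable_diff i1 i2 i3 integrable_translate lim.hyps) auto
   also have "\<dots> = (LBINT x. \<bar>s i (x + X n) - f (x + X n)\<bar>) + (LBINT x. \<bar>s i (x + X n) - s i x\<bar>) + (LBINT x. \<bar>s i x - f x\<bar>)"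
    using i1 i2 i3 by simp
   also have "(LBINT x. \<bar>s i (x + X n) - f (x + X n)\<bar>) = (LBINT x. \<bar>s i x - f x\<bar>)"
    by (intro integral_translate[of "\<lambda>x. \<bar>s i x - f x\<bar>"]) measurable
   finally show ?thesis using i N[OF that] by linarith
  qed
  then show "\<exists>no. \<forall>n\<ge>no. norm ((LBINT x. \<bar>f (x + X n) - f x\<bar>) - 0) < r" by auto
 qed
qed

section \<open>Weak derivatives\<close>

text \<open>One real component of \<open>weak_gradient\<close>; the complex notion is split into
  these in \<open>weak_gradient_iff\<close>.\<close>

definition wderiv :: "2 \<Rightarrow> (real^2 \<Rightarrow> real) \<Rightarrow> (real^2 \<Rightarrow> real) \<Rightarrow> bool" where
 "wderiv i u g \<longleftrightarrow> loc_int u \<and> loc_int g \<and>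
   (\<forall>phi. test_fn phi \<longrightarrow> (LBINT x. partial i phi x * u x) = - (LBINT x. phi x * g x))"

lemma wderivD:
 assumes "wderiv i u g"
 shows "loc_int u" "loc_int g"
  "test_fn phi \<Longrightarrow> (LBINT x. partial i phi x * u x) = - (LBINT x. phi x * g x)"
 using assms by (auto simp: wderiv_def)

lemma wderiv_borel:
 assumes "wderiv i u g"
 shows "u \<in> Bor" "g \<in> Bor"
 using assms loc_int_borel by (auto simp: wderiv_def)

lemma wderiv_add:
 assumes "wderiv i u g" "wderiv i v h"
 shows "wderiv i (\<lambda>x. u x + v x) (\<lambda>x. g x + h x)"
 unfolding wderiv_def
proof (intro conjI allI impI)
 fix phi assume t: "test_fn phi"
 show "(LBINT x. partial i phi x * (u x + v x)) = - (LBINT x. phi x * (g x + h x))"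
  using test_fn_mult_integrable(2)[OF t wderivD(1)[OF assms(1)], of i] test_fn_mult_integrable(2)[OF t wderivD(1)[OF assms(2)], of i]
   test_fn_mult_integrable(1)[OF t wderivD(2)[OF assms(1)]] test_fn_mult_integrable(1)[OF t wderivD(2)[OF assms(2)]]
   wderivD(3)[OF assms(1) t] wderivD(3)[OF assms(2) t]
  by (simp add: distrib_left)
qed (use assms loc_int_add in \<open>auto simp: wderiv_def\<close>)

lemma wderiv_cmult:
 assumes "wderiv i u g"
 shows "wderiv i (\<lambda>x. c * u x) (\<lambda>x. c * g x)"
 using assms unfolding wderiv_def
 by (auto simp: loc_int_cmult mult.left_commute[of _ c])

lemma wderiv_diff:
 assumes "wderiv i u g" "wderiv i v h"
 shows "wderiv i (\<lambda>x. u x - v x) (\<lambda>x. g x - h x)"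
 using wderiv_add[OF assms(1) wderiv_cmult[OF assms(2), of "-1"]] by simp

lemma wderiv_unique:
 assumes "wderiv i u g" "wderiv i v h" "AE x in lborel. u x = v x"
 shows "AE x in lborel. g x = h x"
proof -
 note [measurable] = wderiv_borel[OF assms(1)] wderiv_borel[OF assms(2)]
 have "AE x in lborel. g x - h x = 0"
 proof (rule fundamental_lemma)
  show "loc_int (\<lambda>x. g x - h x)"
   using wderivD(2)[OF wderiv_diff[OF assms(1,2)]] .
  fix phi assume t: "test_fn phi"
  have "(LBINT x. partial i phi x * (u x - v x)) = (\<integral>x. 0 \<partial>(lborel :: (real^2) measure))"
   supply [measurable] = partial_borel[OF t, of i] by (intro integral_cong_AE) (measurable, measurable, use assms(3) in \<open>eventually_elim, simp\<close>)
  then show "(LBINT x. phi x * (g x - h x)) = 0"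
   using wderivD(3)[OF wderiv_diff[OF assms(1,2)] t] by simp
 qed
 then show ?thesis by eventually_elim simp
qed

lemma wderiv_cong_AE:
 assumes "wderiv i u g" "AE x in lborel. u x = v x" "AE x in lborel. g x = h x"
  "v \<in> Bor" "h \<in> Bor"
 shows "wderiv i v h"
proof -
 note [measurable] = wderiv_borel[OF assms(1)] assms(4,5)
 have li: "loc_int b" if "loc_int a" "AE x in lborel. a x = b x" "a \<in> Bor" "b \<in> Bor" for a b :: "real^2 \<Rightarrow> real"
  unfolding loc_int_def
 proof (intro allI impI)
  fix K :: "(real^2) set" assume K: "compact K"
  note [measurable] = that(3,4)
  have [measurable]: "K \<in> sets borel" using K compact_imp_closed by (metis borel_closed)
  have ia: "integ (\<lambda>x. indicat_real K x *\<^sub>R a x)"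
   using that(1) K by (simp add: loc_int_def set_integrable_def)
  show "set_integrable lborel K b"
   unfolding set_integrable_def
   by (rule integrable_cong_AE_imp[OF ia]) (measurable, use that(2) in \<open>eventually_elim, simp\<close>)
 qed
 show ?thesis
  unfolding wderiv_def
 proof (intro conjI allI impI)
  fix phi assume t: "test_fn phi"
  have "(LBINT x. partial i phi x * v x) = (LBINT x. partial i phi x * u x)"
   supply [measurable] = partial_borel[OF t, of i] by (intro integral_cong_AE) (measurable, measurable, use assms(2) in \<open>eventually_elim, simp\<close>)
  moreover have "(LBINT x. phi x * h x) = (LBINT x. phi x * g x)"
   supply [measurable] = test_fn_borel[OF t] by (intro integral_cong_AE) (measurable, measurable, use assms(3) in \<open>eventually_elim, simp\<close>)
  ultimately show "(LBINT x. partial i phi x * v x) = - (LBINT x. phi x * h x)"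
   using wderivD(3)[OF assms(1) t] by simp
 qed (use li wderivD[OF assms(1)] assms in auto)
qed

text \<open>Dominated convergence on both sides of the test identity. It carries the chain rule from
  functions of bounded slope over to the modulus and the square.\<close>

lemma wderiv_limit:
 assumes n: "\<And>n. wderiv i (u n) (g n)"
  and lim: "AE x in lborel. (\<lambda>n. u n x) ~~> U x" "AE x in lborel. (\<lambda>n. g n x) ~~> G x"
  and bd: "\<And>n x. \<bar>u n x\<bar> \<le> w x" "\<And>n x. \<bar>g n x\<bar> \<le> w' x" "loc_int w" "loc_int w'"
  and U: "loc_int U" "loc_int G"
 shows "wderiv i U G"
 unfolding wderiv_def
proof (intro conjI allI impI U)
 fix phi assume t: "test_fn phi"
 note [measurable] = partial_borel[OF t] test_fn_borel[OF t] loc_int_borel[OF U(1)] loc_int_borel[OF U(2)]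
  loc_int_borel[OF bd(3)] loc_int_borel[OF bd(4)]
 have [measurable]: "u n \<in> Bor" "g n \<in> Bor" for n using wderiv_borel[OF n] by auto
 have 1: "(\<lambda>n. LBINT x. partial i phi x * u n x) ~~> (LBINT x. partial i phi x * U x)"
 proof (rule integral_dominated_convergence[where w="\<lambda>x. \<bar>partial i phi x * w x\<bar>"])
  show "integ (\<lambda>x. \<bar>partial i phi x * w x\<bar>)"
   by (intro integrable_abs test_fn_mult_integrable[OF t bd(3)])
  show "AE x in lborel. (\<lambda>n. partial i phi x * u n x) ~~> partial i phi x * U x"
   using lim(1) by eventually_elim (intro tendsto_intros)
  show "AE x in lborel. norm (partial i phi x * u n x) \<le> \<bar>partial i phi x * w x\<bar>" for n
   by (intro AE_I2) (simp add: abs_mult mult_left_mono order.trans[OF bd(1) abs_ge_self])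
 qed measurable
 have 2: "(\<lambda>n. LBINT x. phi x * g n x) ~~> (LBINT x. phi x * G x)"
 proof (rule integral_dominated_convergence[where w="\<lambda>x. \<bar>phi x * w' x\<bar>"])
  show "integ (\<lambda>x. \<bar>phi x * w' x\<bar>)"
   by (intro integrable_abs test_fn_mult_integrable[OF t bd(4)])
  show "AE x in lborel. (\<lambda>n. phi x * g n x) ~~> phi x * G x"
   using lim(2) by eventually_elim (intro tendsto_intros)
  show "AE x in lborel. norm (phi x * g n x) \<le> \<bar>phi x * w' x\<bar>" for n
   by (intro AE_I2) (simp add: abs_mult mult_left_mono order.trans[OF bd(2) abs_ge_self])
 qed measurable
 have "(\<lambda>n. LBINT x. partial i phi x * u n x) ~~> - (LBINT x. phi x * G x)"
  using tendsto_minus[OF 2] wderivD(3)[OF n t] by simp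
 with 1 show "(LBINT x. partial i phi x * U x) = - (LBINT x. phi x * G x)"
  by (rule LIMSEQ_unique)
qed

text \<open>Licenses Fubini for averages over segments. The case \<open>h = 0\<close> is used as
  well: it supplies majorants that do not move with \<open>tau\<close>.\<close>

lemma avg_integrable:
 fixes f :: "real^2 \<Rightarrow> real"
 assumes "integ f"
 shows "integrable (lborel \<Otimes>\<^sub>M lborel) (\<lambda>(tau::real, x). indicator {0..1} tau * f (x + (h * tau) *\<^sub>R e))"
proof (rule lborel_pair.Fubini_integrable)
 have [measurable]: "f \<in> Bor" using assms by auto
 show "(\<lambda>(tau::real, x). indicator {0..1} tau * f (x + (h * tau) *\<^sub>R e)) \<in> borel_measurable (lborel \<Otimes>\<^sub>M lborel)"
  by measurable
 have "(LBINT x. norm (case (tau, x) of (tau, x) \<Rightarrow> indicator {0..1} tau * f (x + (h * tau) *\<^sub>R e)))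
   = indicator {0..1} tau * (LBINT x. \<bar>f x\<bar>)" for tau :: real
  using integral_translate[of "\<lambda>x. \<bar>f x\<bar>" "(h * tau) *\<^sub>R e"] by (simp add: abs_mult indicator_def)
 then show "integ (\<lambda>tau. LBINT x. norm (case (tau, x) of (tau::real, x) \<Rightarrow> indicator {0..1} tau * f (x + (h * tau) *\<^sub>R e)))"
  by simp
 show "AE tau in lborel. integ (\<lambda>x. case (tau, x) of (tau::real, x) \<Rightarrow> indicator {0..1} tau * f (x + (h * tau) *\<^sub>R e))"
  by (intro AE_I2) (auto intro!: integrable_mult_right integrable_translate assms)
qed

lemma loc_int_cutoff:
 assumes "loc_int u"
 shows "integ (\<lambda>x. indicator (cball 0 R) x * u x)"
 using assms unfolding loc_int_def set_integrable_def by (auto simp: compact_cball)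

lemma test_fn_line_integral:
 assumes "test_fn phi"
 shows "h * (LBINT tau. indicator {0..1} tau * partial i phi (x - (h * tau) *\<^sub>R axis i 1))
   = phi x - phi (x - h *\<^sub>R axis i 1)"
proof -
 have d: "((\<lambda>t. - phi (x - (h * t) *\<^sub>R axis i 1)) has_real_derivative h * partial i phi (x - (h * t) *\<^sub>R axis i 1)) (at t)" for t
 proof -
  have 1: "((\<lambda>t. x - (h * t) *\<^sub>R axis i (1::real)) has_derivative (\<lambda>s. - ((h * s) *\<^sub>R axis i 1))) (at t)"
   by (auto intro!: derivative_eq_intros)
  have "((\<lambda>t. phi (x - (h * t) *\<^sub>R axis i 1)) has_derivative
    (\<lambda>s. (\<chi> j. partial j phi (x - (h * t) *\<^sub>R axis i 1)) \<bullet> - ((h * s) *\<^sub>R axis i 1))) (at t)"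
   by (rule has_derivative_compose[OF 1 c1_derivative[OF test_fn_imp_c1[OF assms]]])
  from has_derivative_minus[OF this]
  have "((\<lambda>t. - phi (x - (h * t) *\<^sub>R axis i 1)) has_derivative
    (\<lambda>s. - ((\<chi> j. partial j phi (x - (h * t) *\<^sub>R axis i 1)) \<bullet> - ((h * s) *\<^sub>R axis i 1)))) (at t)" .
  moreover have "(\<lambda>s. - ((\<chi> j. partial j phi (x - (h * t) *\<^sub>R axis i 1)) \<bullet> - ((h * s) *\<^sub>R axis i 1)))
    = (*) (h * partial i phi (x - (h * t) *\<^sub>R axis i 1))"
   by (auto simp: inner_axis)
  ultimately show ?thesis
   unfolding has_field_derivative_def by simp
 qed
 have c: "continuous_on UNIV (\<lambda>t. h * partial i phi (x - (h * t) *\<^sub>R axis i 1))"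
 proof -
  have "continuous_on UNIV (partial i phi)" using assms by (simp add: test_fn_def)
  then have "continuous_on UNIV (\<lambda>t. partial i phi (x - (h * t) *\<^sub>R axis i 1))"
   by (rule continuous_on_compose2) (auto intro!: continuous_intros)
  then show ?thesis by (rule continuous_on_mult_left)
 qed
 have "(LBINT t. h * partial i phi (x - (h * t) *\<^sub>R axis i 1) * indicator {0..1} t)
   = - phi (x - (h * 1) *\<^sub>R axis i 1) - (- phi (x - (h * 0) *\<^sub>R axis i 1))"
  by (rule integral_FTC_Icc_real[OF _ d]) (use c in \<open>auto simp: continuous_on_eq_continuous_at\<close>)
 then show ?thesis
  by (subst integral_mult_right_zero[symmetric]) (simp add: mult_ac)
qed

text \<open>The fundamental theorem of calculus along a coordinate direction. Against a test
  function the increment of \<open>u\<close> becomes an increment of \<open>phi\<close>, to which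
  the classical theorem applies; the test identity then moves the derivative back to
  \<open>u\<close>, translate by translate.\<close>

lemma wderiv_difference:
 assumes w: "wderiv i u g"
 shows "AE x in lborel. u (x + h *\<^sub>R axis i 1) - u x
   = h * (LBINT tau. indicator {0..1} tau * g (x + (h * tau) *\<^sub>R axis i 1))"
proof -
 note [measurable] = wderiv_borel[OF w]
 let ?e = "axis i 1 :: real^2"
 define J where "J x = (LBINT tau. indicator {0..1} tau * g (x + (h * tau) *\<^sub>R ?e))" for x
 have Jm[measurable]: "J \<in> Bor"
  unfolding J_def by measurable
 \<comment> \<open>For \<open>tau\<close> in \<open>[0,1]\<close> the segment from a point of the
   ball of radius \<open>R\<close> stays within radius \<open>R + \<bar>h\<bar>\<close>, so only a
   local piece of \<open>G\<close> matters.\<close>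
 have cut: "indicator {0..1} tau * G (x + (h * tau) *\<^sub>R ?e) = indicator {0..1} tau * (indicator (cball 0 (R + \<bar>h\<bar>)) (x + (h * tau) *\<^sub>R ?e) * G (x + (h * tau) *\<^sub>R ?e))"
  if "norm x \<le> R" for x tau R and G :: "real^2 \<Rightarrow> real"
 proof (cases "tau \<in> {0..1}")
  case True
  have "norm (x + (h * tau) *\<^sub>R ?e) \<le> norm x + \<bar>h * tau\<bar>"
   using norm_triangle_ineq[of x "(h * tau) *\<^sub>R ?e"] by simp
  also have "\<bar>h * tau\<bar> \<le> \<bar>h\<bar>"
   using True by (simp add: abs_mult mult_left_le)
  finally show ?thesis using that by simp
 qed simp
 have Jl: "loc_int J"
 proof (rule loc_intI)
  fix R :: real
  let ?G = "\<lambda>x. indicator (cball 0 (R + \<bar>h\<bar>)) x * \<bar>g x\<bar>"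
  have "integ ?G" by (rule loc_int_cutoff[OF loc_int_abs[OF wderivD(2)[OF w]]])
  from lborel_pair.integrable_snd[OF avg_integrable[OF this, of h ?e]]
  have "integ (\<lambda>x. LBINT tau. indicator {0..1} tau * ?G (x + (h * tau) *\<^sub>R ?e))" .
  moreover have "\<bar>J x\<bar> \<le> (LBINT tau. indicator {0..1} tau * ?G (x + (h * tau) *\<^sub>R ?e))" if "norm x \<le> R" for x
  proof -
   have "\<bar>J x\<bar> \<le> (LBINT tau. \<bar>indicator {0..1} tau * g (x + (h * tau) *\<^sub>R ?e)\<bar>)"
    unfolding J_def by (rule integral_abs_bound)
   also have "\<dots> = (LBINT tau. indicator {0..1} tau * \<bar>g (x + (h * tau) *\<^sub>R ?e)\<bar>)"
    by (simp add: abs_mult indicator_def)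
   finally show ?thesis using cut[OF that, where G="\<lambda>x. \<bar>g x\<bar>"] by simp
  qed
  ultimately show "\<exists>w. integ w \<and> (\<forall>x. norm x \<le> R \<longrightarrow> \<bar>J x\<bar> \<le> w x)" by blast
 qed simp
 have "AE x in lborel. u (x + h *\<^sub>R ?e) - u x - h * J x = 0"
 proof (rule fundamental_lemma)
  show "loc_int (\<lambda>x. u (x + h *\<^sub>R ?e) - u x - h * J x)"
   using loc_int_add[OF loc_int_add[OF loc_int_translate[OF wderivD(1)[OF w], of "h *\<^sub>R ?e"] loc_int_cmult[OF wderivD(1)[OF w], of "-1"]]
     loc_int_cmult[OF Jl, of "-h"]] by simp
  fix phi assume t: "test_fn phi"
  note [measurable] = partial_borel[OF t] test_fn_borel[OF t]
  obtain C R where CR: "C \<ge> 0" "R > 0" "\<And>x. \<bar>phi x\<bar> \<le> C" "\<And>i x. \<bar>partial i phi x\<bar> \<le> C"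
   "\<And>x. norm x > R \<Longrightarrow> phi x = 0" "\<And>i x. norm x > R \<Longrightarrow> partial i phi x = 0"
   using test_fn_bounds[OF t] by metis
  have t': "test_fn (\<lambda>x. phi (x - b))" "partial i (\<lambda>x. phi (x - b)) x = partial i phi (x - b)" for b x
   using test_fn_translate[OF t, where b="-b"] by simp_all
  have i1: "integ (\<lambda>x. phi x * u (x + h *\<^sub>R ?e))" "integ (\<lambda>x. phi x * u x)"
   "integ (\<lambda>x. phi (x - h *\<^sub>R ?e) * u x)" "integ (\<lambda>x. phi x * J x)"
   by (rule test_fn_mult_integrable[OF t loc_int_translate[OF wderivD(1)[OF w]]]
     test_fn_mult_integrable[OF t wderivD(1)[OF w]] test_fn_mult_integrable[OF t'(1) wderivD(1)[OF w]]
     test_fn_mult_integrable[OF t Jl])+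
  have "(LBINT x. phi x * u (x + h *\<^sub>R ?e)) = (LBINT x. phi (x - h *\<^sub>R ?e) * u x)"
   using integral_translate[of "\<lambda>x. phi (x - h *\<^sub>R ?e) * u x" "h *\<^sub>R ?e"] by simp
  then have "(LBINT x. phi x * (u (x + h *\<^sub>R ?e) - u x)) = (LBINT x. phi (x - h *\<^sub>R ?e) * u x - phi x * u x)"
   using i1 by (simp add: right_diff_distrib)
  also have "\<dots> = (LBINT x. - h * (LBINT tau. indicator {0..1} tau * (partial i phi (x - (h * tau) *\<^sub>R ?e) * u x)))"
  proof (rule Lintegral_cong[OF refl])
   fix x
   have "(LBINT tau. indicator {0..1} tau * (partial i phi (x - (h * tau) *\<^sub>R ?e) * u x))
     = (LBINT tau. indicator {0..1} tau * partial i phi (x - (h * tau) *\<^sub>R ?e)) * u x"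
    by (subst integral_mult_left_zero[symmetric]) (simp add: mult_ac)
   then have "- h * (LBINT tau. indicator {0..1} tau * (partial i phi (x - (h * tau) *\<^sub>R ?e) * u x))
     = - (h * (LBINT tau. indicator {0..1} tau * partial i phi (x - (h * tau) *\<^sub>R ?e))) * u x" by simp
   then show "phi (x - h *\<^sub>R ?e) * u x - phi x * u x
     = - h * (LBINT tau. indicator {0..1} tau * (partial i phi (x - (h * tau) *\<^sub>R ?e) * u x))"
    unfolding test_fn_line_integral[OF t] by (simp add: algebra_simps)
  qed
  also have "\<dots> = - h * (LBINT x. (LBINT tau. indicator {0..1} tau * (partial i phi (x - (h * tau) *\<^sub>R ?e) * u x)))"
   by simp
  also have "(LBINT x. (LBINT tau. indicator {0..1} tau * (partial i phi (x - (h * tau) *\<^sub>R ?e) * u x)))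
    = (LBINT tau. (LBINT x. indicator {0..1} tau * (partial i phi (x - (h * tau) *\<^sub>R ?e) * u x)))"
  proof (rule lborel_pair.Fubini_integral)
   let ?U = "\<lambda>x. indicator (cball 0 (R + \<bar>h\<bar>)) x * \<bar>u x\<bar>"
   have iU: "integ ?U" by (rule loc_int_cutoff[OF loc_int_abs[OF wderivD(1)[OF w]]])
   show "integrable (lborel \<Otimes>\<^sub>M lborel) (\<lambda>(tau, x). indicator {0..1} tau * (partial i phi (x - (h * tau) *\<^sub>R ?e) * u x))"
   proof (rule Lintegrable_bound)
    show "integrable (lborel \<Otimes>\<^sub>M lborel) (\<lambda>z. C * (case z of (tau::real, x) \<Rightarrow> indicator {0..1} tau * ?U (x + (0 * tau) *\<^sub>R ?e)))"
     by (intro integrable_mult_right avg_integrable iU)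
    show "AE z in lborel \<Otimes>\<^sub>M lborel. norm (case z of (tau, x) \<Rightarrow> indicator {0..1} tau * (partial i phi (x - (h * tau) *\<^sub>R ?e) * u x))
     \<le> norm (C * (case z of (tau::real, x) \<Rightarrow> indicator {0..1} tau * ?U (x + (0 * tau) *\<^sub>R ?e)))" (is "AE z in _. ?Q1 z")
    proof (intro AE_I2)
     fix z :: "real \<times> (real^2)"
     obtain tau x where z: "z = (tau, x)" by force
     show "?Q1 z"
     proof (cases "tau \<in> {0..1}")
      case True
      have "partial i phi (x - (h * tau) *\<^sub>R ?e) = 0" if "norm x > R + \<bar>h\<bar>"
      proof -
       have "\<bar>h * tau\<bar> \<le> \<bar>h\<bar>" using True by (simp add: abs_mult mult_left_le)
       moreover have "norm x - \<bar>h * tau\<bar> \<le> norm (x - (h * tau) *\<^sub>R ?e)"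
        using norm_triangle_ineq2[of x "(h * tau) *\<^sub>R ?e"] by simp
       ultimately show ?thesis using CR(6) that by auto
      qed
      then show ?thesis using True CR(4)[of i "x - (h * tau) *\<^sub>R ?e"] CR(1)
       by (cases "norm x > R + \<bar>h\<bar>") (auto simp: z abs_mult mult_right_mono)
     qed (simp add: z)
    qed
   qed measurable
  qed
  also have "- h * \<dots> = - h * (LBINT tau. - (LBINT x. indicator {0..1} tau * (phi x * g (x + (h * tau) *\<^sub>R ?e))))"
  proof -
   have "(LBINT x. indicator {0..1} tau * (partial i phi (x - (h * tau) *\<^sub>R ?e) * u x))
     = - (LBINT x. indicator {0..1} tau * (phi x * g (x + (h * tau) *\<^sub>R ?e)))" for tau :: real
    using wderivD(3)[OF w t'(1)[of "(h * tau) *\<^sub>R ?e"]]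
     integral_translate[of "\<lambda>x. phi (x - (h * tau) *\<^sub>R ?e) * g x" "(h * tau) *\<^sub>R ?e"]
    by (simp add: t'(2))
   then show ?thesis by simp
  qed
  also have "\<dots> = h * (LBINT tau. (LBINT x. indicator {0..1} tau * (phi x * g (x + (h * tau) *\<^sub>R ?e))))"
   by simp
  also have "(LBINT tau. (LBINT x. indicator {0..1} tau * (phi x * g (x + (h * tau) *\<^sub>R ?e))))
   = (LBINT x. (LBINT tau. indicator {0..1} tau * (phi x * g (x + (h * tau) *\<^sub>R ?e))))"
  proof (rule lborel_pair.Fubini_integral[symmetric])
   let ?G = "\<lambda>x. indicator (cball 0 (R + \<bar>h\<bar>)) x * \<bar>g x\<bar>"
   have iG: "integ ?G" by (rule loc_int_cutoff[OF loc_int_abs[OF wderivD(2)[OF w]]])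
   show "integrable (lborel \<Otimes>\<^sub>M lborel) (\<lambda>(tau, x). indicator {0..1} tau * (phi x * g (x + (h * tau) *\<^sub>R ?e)))"
   proof (rule Lintegrable_bound)
    show "integrable (lborel \<Otimes>\<^sub>M lborel) (\<lambda>z. C * (case z of (tau::real, x) \<Rightarrow> indicator {0..1} tau * ?G (x + (h * tau) *\<^sub>R ?e)))"
     by (intro integrable_mult_right avg_integrable iG)
    show "AE z in lborel \<Otimes>\<^sub>M lborel. norm (case z of (tau, x) \<Rightarrow> indicator {0..1} tau * (phi x * g (x + (h * tau) *\<^sub>R ?e)))
     \<le> norm (C * (case z of (tau::real, x) \<Rightarrow> indicator {0..1} tau * ?G (x + (h * tau) *\<^sub>R ?e)))" (is "AE z in _. ?Q2 z")
    proof (intro AE_I2)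
     fix z :: "real \<times> (real^2)"
     obtain tau x where z: "z = (tau, x)" by force
     show "?Q2 z"
     proof (cases "norm x \<le> R")
      case True
      show ?thesis
       using cut[OF True, where G="\<lambda>x. \<bar>g x\<bar>" and tau=tau, symmetric] CR(1) CR(3)[of x]
        mult_right_mono[OF CR(3)[of x], of "indicator {0..1} tau * \<bar>g (x + (h * tau) *\<^sub>R ?e)\<bar>"]
       by (auto simp: z abs_mult mult_ac)
     next
      case False
      then have "phi x = 0" using CR(5) by simp
      then show ?thesis by (simp add: z)
     qed
    qed
   qed measurable
  qed
  also have "\<dots> = (LBINT x. phi x * J x)"
   unfolding J_def by (subst integral_mult_right_zero[symmetric]) (simp add: mult_ac)
  finally have "(LBINT x. phi x * (u (x + h *\<^sub>R ?e) - u x)) = h * (LBINT x. phi x * J x)" .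
  moreover have "(LBINT x. phi x * (u (x + h *\<^sub>R ?e) - u x - h * J x))
   = (LBINT x. (phi x * u (x + h *\<^sub>R ?e) - phi x * u x) - h * (phi x * J x))"
   by (intro Lintegral_cong) (auto simp: algebra_simps)
  ultimately show "(LBINT x. phi x * (u (x + h *\<^sub>R ?e) - u x - h * J x)) = 0"
   using i1 by (simp add: right_diff_distrib)
 qed
 then show ?thesis
  unfolding J_def by eventually_elim simp
qed

text \<open>The difference quotient of \<open>F (u x)\<close> factors as a secant slope
  \<open>m\<close> times the quotient \<open>d\<close> of \<open>u\<close>. On the support of the
  test function \<open>d\<close> tends to \<open>g\<close> in the mean, while \<open>m\<close> is
  bounded and tends to \<open>F' (u x)\<close> almost everywhere along a subsequence.\<close>

lemma wderiv_chain:
 assumes w: "wderiv i u g"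
  and F: "\<And>t. (F has_real_derivative F' t) (at t)" "continuous_on UNIV F'" "\<And>t. \<bar>F' t\<bar> \<le> L"
 shows "wderiv i (\<lambda>x. F (u x)) (\<lambda>x. F' (u x) * g x)"
proof -
 note [measurable] = wderiv_borel[OF w]
 have Fc: "continuous_on UNIV F"
  using F(1) by (meson DERIV_isCont continuous_at_imp_continuous_on)
 have [measurable]: "F \<in> Bor" "F' \<in> Bor"
  using Fc F(2) by (auto intro: borel_measurable_continuous_onI)
 have L0: "L \<ge> 0" using F(3)[of 0] by linarith
 have lip: "\<bar>F a - F b\<bar> \<le> L * \<bar>a - b\<bar>" for a b
  using field_differentiable_bound[of UNIV F F' L a b] F by (auto simp: has_field_derivative_at_within)
 have lu: "loc_int (\<lambda>x. F (u x))"
 proof (rule loc_int_bound)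
  show "loc_int (\<lambda>x. \<bar>F 0\<bar> + L * \<bar>u x\<bar>)"
   by (intro loc_int_add loc_int_const loc_int_cmult loc_int_abs wderivD(1)[OF w])
  show "\<bar>F (u x)\<bar> \<le> \<bar>F 0\<bar> + L * \<bar>u x\<bar>" for x using lip[of "u x" 0] by auto
 qed measurable
 have lg: "loc_int (\<lambda>x. F' (u x) * g x)"
 proof (rule loc_int_bound)
  show "loc_int (\<lambda>x. L * \<bar>g x\<bar>)"
   by (intro loc_int_cmult loc_int_abs wderivD(2)[OF w])
  show "\<bar>F' (u x) * g x\<bar> \<le> L * \<bar>g x\<bar>" for x using F(3) by (simp add: abs_mult mult_right_mono)
 qed measurable
 show ?thesis
  unfolding wderiv_def
 proof (intro conjI allI impI lu lg)
  fix phi assume t: "test_fn phi"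
  note [measurable] = partial_borel[OF t] test_fn_borel[OF t]
  let ?e = "axis i 1 :: real^2"
  obtain C R where CR: "C \<ge> 0" "R > 0" "\<And>x. \<bar>phi x\<bar> \<le> C" "\<And>i x. \<bar>partial i phi x\<bar> \<le> C"
   "\<And>x. norm x > R \<Longrightarrow> phi x = 0" "\<And>i x. norm x > R \<Longrightarrow> partial i phi x = 0"
   using test_fn_bounds[OF t] by metis
  have t': "test_fn (\<lambda>x. phi (x - b))" for b
   using test_fn_translate(1)[OF t, where b="-b"] by simp
  define h where "h n = 1 / real (Suc n)" for n
  have h: "h n > 0" "h n \<le> 1" for n by (auto simp: h_def)
  have h0: "h ~~> 0" unfolding h_def by (rule LIMSEQ_Suc[OF lim_1_over_n])
  \<comment> \<open>Cut off one unit beyond the support: all shifts have length at most 1, and the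
    cut functions are globally integrable.\<close>
  define gR where "gR x = indicator (cball 0 (R + 1)) x * g x" for x
  define uR where "uR x = indicator (cball 0 (R + 1)) x * u x" for x
  have igR: "integ gR" unfolding gR_def by (rule loc_int_cutoff[OF wderivD(2)[OF w]])
  have iuR: "integ uR" unfolding uR_def by (rule loc_int_cutoff[OF wderivD(1)[OF w]])
  have [measurable]: "gR \<in> Bor" "uR \<in> Bor" using igR iuR by auto
  have near: "norm (x + (s * tau) *\<^sub>R ?e) \<le> R + 1" if "norm x \<le> R" "0 \<le> s" "s \<le> 1" "0 \<le> tau" "tau \<le> 1" for x s tau
  proof -
   have "norm (x + (s * tau) *\<^sub>R ?e) \<le> norm x + \<bar>s * tau\<bar>"
    using norm_triangle_ineq[of x "(s * tau) *\<^sub>R ?e"] by simp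
   moreover have "\<bar>s * tau\<bar> \<le> 1" using that by (simp add: mult_le_one)
   ultimately show ?thesis using that by linarith
  qed
  define d where "d n x = (u (x + h n *\<^sub>R ?e) - u x) / h n" for n x
  have dm[measurable]: "d n \<in> Bor" for n unfolding d_def by measurable
  \<comment> \<open>\<open>q n\<close> dominates \<open>\<bar>d n - g\<bar>\<close> on the support,
    and its integral tends to 0 by continuity of translations in the mean.\<close>
  define q where "q n x = (LBINT tau. indicator {0..1} tau * \<bar>gR (x + (h n * tau) *\<^sub>R ?e) - gR x\<bar>)" for n x
  have iq: "integrable (lborel \<Otimes>\<^sub>M lborel) (\<lambda>(tau::real, x). indicator {0..1} tau * \<bar>gR (x + (h n * tau) *\<^sub>R ?e) - gR x\<bar>)" for n
  proof -
   have "integrable (lborel \<Otimes>\<^sub>M lborel) (\<lambda>z. \<bar>(case z of (tau::real, x) \<Rightarrow> indicator {0..1} tau * gR (x + (h n * tau) *\<^sub>R ?e)) -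
     (case z of (tau::real, x) \<Rightarrow> indicator {0..1} tau * gR (x + (0 * tau) *\<^sub>R ?e))\<bar>)"
    by (intro integrable_abs Lintegrable_diff avg_integrable igR)
   also have "(\<lambda>z. \<bar>(case z of (tau::real, x) \<Rightarrow> indicator {0..1} tau * gR (x + (h n * tau) *\<^sub>R ?e)) -
     (case z of (tau::real, x) \<Rightarrow> indicator {0..1} tau * gR (x + (0 * tau) *\<^sub>R ?e))\<bar>)
    = (\<lambda>(tau::real, x). indicator {0..1} tau * \<bar>gR (x + (h n * tau) *\<^sub>R ?e) - gR x\<bar>)"
    by (auto simp: fun_eq_iff abs_mult right_diff_distrib[symmetric])
   finally show ?thesis .
  qed
  have q0: "(\<lambda>n. LBINT x. q n x) ~~> 0"
  proof -
   have "(LBINT x. q n x) = (LBINT tau. indicator {0..1} tau * (LBINT x. \<bar>gR (x + (h n * tau) *\<^sub>R ?e) - gR x\<bar>))" for n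
    unfolding q_def using lborel_pair.Fubini_integral[OF iq[of n]] by simp
   moreover have "(\<lambda>n. LBINT tau. indicator {0..1} tau * (LBINT x. \<bar>gR (x + (h n * tau) *\<^sub>R ?e) - gR x\<bar>))
     ~~> (\<integral>tau. 0 \<partial>(lborel :: real measure))"
   proof (rule integral_dominated_convergence[where w="\<lambda>tau. indicator {0..1} tau * (2 * (LBINT x. \<bar>gR x\<bar>))"])
    show "AE tau in lborel. (\<lambda>n. indicator {0..1} tau * (LBINT x. \<bar>gR (x + (h n * tau) *\<^sub>R ?e) - gR x\<bar>)) ~~> 0"
    proof (intro AE_I2 tendsto_mult_right_zero)
     fix tau :: real
     have "(\<lambda>n. (h n * tau) *\<^sub>R ?e) ~~> (0 * tau) *\<^sub>R ?e" by (intro tendsto_intros h0)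
     then show "(\<lambda>n. LBINT x. \<bar>gR (x + (h n * tau) *\<^sub>R ?e) - gR x\<bar>) ~~> 0"
      using L1_translation_continuous[OF igR] by simp
    qed
    show "AE tau in lborel. norm (indicator {0..1} tau * (LBINT x. \<bar>gR (x + (h n * tau) *\<^sub>R ?e) - gR x\<bar>))
     \<le> indicator {0..1} tau * (2 * (LBINT x. \<bar>gR x\<bar>))" for n
    proof (intro AE_I2)
     fix tau :: real
     have ia: "integ (\<lambda>x. \<bar>gR x\<bar>)" "integ (\<lambda>x. \<bar>gR (x + (h n * tau) *\<^sub>R ?e)\<bar>)"
      using igR by (auto intro!: integrable_translate)
     have "(LBINT x. \<bar>gR (x + (h n * tau) *\<^sub>R ?e) - gR x\<bar>) \<le> (LBINT x. \<bar>gR (x + (h n * tau) *\<^sub>R ?e)\<bar> + \<bar>gR x\<bar>)"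
      by (intro integral_mono integrable_abs Lintegrable_diff Lintegrable_add integrable_translate igR ia) auto
     also have "\<dots> = 2 * (LBINT x. \<bar>gR x\<bar>)"
      using ia integral_translate[of "\<lambda>x. \<bar>gR x\<bar>" "(h n * tau) *\<^sub>R ?e"] by simp
     finally show "norm (indicator {0..1} tau * (LBINT x. \<bar>gR (x + (h n * tau) *\<^sub>R ?e) - gR x\<bar>))
      \<le> indicator {0..1} tau * (2 * (LBINT x. \<bar>gR x\<bar>))"
      by (simp add: abs_mult indicator_def)
    qed
   qed auto
   ultimately show ?thesis by simp
  qed
  have dq: "AE x in lborel. norm x \<le> R \<longrightarrow> \<bar>d n x - g x\<bar> \<le> q n x" for n
  proof -
   have "AE x in lborel. integ (\<lambda>tau::real. indicator {0..1} tau * gR (x + (h n * tau) *\<^sub>R ?e))"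
    using lborel_pair.AE_integrable_snd[OF avg_integrable[OF igR, of "h n" ?e]] .
   then show ?thesis using wderiv_difference[OF w, of "h n"]
   proof eventually_elim
    case (elim x)
    show ?case
    proof
     assume x: "norm x \<le> R"
     have gg: "indicator {0..1} tau * g (x + (h n * tau) *\<^sub>R ?e) = indicator {0..1} tau * gR (x + (h n * tau) *\<^sub>R ?e)" for tau :: real
      using near[OF x, of "h n" tau] h(1)[of n] h(2)[of n] by (auto simp: gR_def indicator_def)
     have g0: "gR x = g x" using x by (simp add: gR_def)
     have i2: "integ (\<lambda>tau::real. indicator {0..1} tau * gR x)" by auto
     have "d n x - g x = (LBINT tau. indicator {0..1} tau * gR (x + (h n * tau) *\<^sub>R ?e)) - (\<integral>tau. indicator {0..1} tau * gR x \<partial>(lborel :: real measure))"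
      using elim(2) h(1)[of n] by (simp add: d_def gg g0)
     also have "\<dots> = (LBINT tau. indicator {0..1} tau * gR (x + (h n * tau) *\<^sub>R ?e) - indicator {0..1} tau * gR x)"
      using elim(1) i2 by (rule Lintegral_diff[symmetric])
     finally have "\<bar>d n x - g x\<bar> \<le> (LBINT tau. \<bar>indicator {0..1} tau * gR (x + (h n * tau) *\<^sub>R ?e) - indicator {0..1} tau * gR x\<bar>)"
      by simp
     also have "\<dots> = q n x" unfolding q_def
      by (intro Lintegral_cong) (auto simp: abs_mult right_diff_distrib[symmetric])
     finally show "\<bar>d n x - g x\<bar> \<le> q n x" .
    qed
   qed
  qed
  have "(\<lambda>n. h n *\<^sub>R ?e) ~~> 0 *\<^sub>R ?e" by (intro tendsto_intros h0)
  then have "(\<lambda>n. LBINT x. norm (uR (x + h n *\<^sub>R ?e) - uR x)) ~~> 0"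
   using L1_translation_continuous[OF iuR, of "\<lambda>n. h n *\<^sub>R ?e"] by simp
  \<comment> \<open>Mean convergence gives almost everywhere convergence only along a subsequence;
    the limit of the integrals is the same along it.\<close>
  then obtain r where r: "strict_mono r" "AE x in lborel. (\<lambda>n. uR (x + h (r n) *\<^sub>R ?e) - uR x) ~~> 0"
   using tendsto_L1_AE_subseq[of lborel "\<lambda>n x. uR (x + h n *\<^sub>R ?e) - uR x",
     OF Lintegrable_diff[OF integrable_translate[OF iuR] iuR]] by blast
  \<comment> \<open>Where the increment of \<open>u\<close> vanishes the slope takes the value
    \<open>F' (u x)\<close>. Then \<open>Fm\<close> holds at every point, and the slope, as a
    function of the shifted value, is continuous at \<open>u x\<close>.\<close>
  define m where "m n x = (if u (x + h n *\<^sub>R ?e) = u x then F' (u x) else (F (u (x + h n *\<^sub>R ?e)) - F (u x)) / (u (x + h n *\<^sub>R ?e) - u x))" for n x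
  have mm[measurable]: "m n \<in> Bor" for n unfolding m_def by measurable
  have mL: "\<bar>m n x\<bar> \<le> L" for n x
   using lip[of "u (x + h n *\<^sub>R ?e)" "u x"] F(3) by (auto simp: m_def divide_le_eq)
  have Fm: "(F (u (x + h n *\<^sub>R ?e)) - F (u x)) / h n = m n x * d n x" for n x
   by (auto simp: m_def d_def)
  have i0: "integ (\<lambda>x. phi x * psi x)" if "loc_int psi" for psi
   by (rule test_fn_mult_integrable[OF t that])
  have l1: "loc_int (\<lambda>x. m n x * d n x)" for n
  proof -
   have "loc_int (\<lambda>x. (1 / h n) * F (u (x + h n *\<^sub>R ?e)) + (- 1 / h n) * F (u x))"
    by (intro loc_int_add loc_int_cmult loc_int_translate[OF lu] lu)
   then show ?thesis unfolding Fm[symmetric] by (simp add: diff_divide_distrib)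
  qed
  \<comment> \<open>Discrete integration by parts: translation moves the difference quotient onto
    \<open>phi\<close>, with a sign.\<close>
  have lim1: "(\<lambda>n. LBINT x. phi x * (m n x * d n x)) ~~> (LBINT x. - (partial i phi x) * F (u x))"
  proof -
   have "(LBINT x. phi x * (m n x * d n x)) = (LBINT x. ((phi (x - h n *\<^sub>R ?e) - phi x) / h n) * F (u x))" for n
   proof -
    have a: "integ (\<lambda>x. phi x * F (u (x + h n *\<^sub>R ?e)))" "integ (\<lambda>x. phi x * F (u x))"
     "integ (\<lambda>x. phi (x - h n *\<^sub>R ?e) * F (u x))"
     by (rule i0[OF loc_int_translate[OF lu]] i0[OF lu] test_fn_mult_integrable[OF t' lu])+
    have "(LBINT x. phi x * (m n x * d n x)) = (LBINT x. (phi x * F (u (x + h n *\<^sub>R ?e)) - phi x * F (u x)) / h n)"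
     unfolding Fm[symmetric] by (intro Lintegral_cong) (auto simp: algebra_simps)
    also have "\<dots> = ((LBINT x. phi x * F (u (x + h n *\<^sub>R ?e))) - (LBINT x. phi x * F (u x))) / h n"
     using a by simp
    also have "(LBINT x. phi x * F (u (x + h n *\<^sub>R ?e))) = (LBINT x. phi (x - h n *\<^sub>R ?e) * F (u x))"
     using integral_translate[of "\<lambda>x. phi (x - h n *\<^sub>R ?e) * F (u x)" "h n *\<^sub>R ?e"] by simp
    also have "(\<dots> - (LBINT x. phi x * F (u x))) / h n = (LBINT x. (phi (x - h n *\<^sub>R ?e) * F (u x) - phi x * F (u x)) / h n)"
     using a by simp
    finally show ?thesis by (simp add: algebra_simps)
   qed
   moreover have "(\<lambda>n. LBINT x. ((phi (x - h n *\<^sub>R ?e) - phi x) / h n) * F (u x)) ~~> (LBINT x. - (partial i phi x) * F (u x))"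
   proof (rule integral_dominated_convergence[where w="\<lambda>x. C * (indicator (cball 0 (R + 1)) x * \<bar>F (u x)\<bar>)"])
    show "integ (\<lambda>x. C * (indicator (cball 0 (R + 1)) x * \<bar>F (u x)\<bar>))"
     by (intro integrable_mult_right loc_int_cutoff loc_int_abs lu)
    show "AE x in lborel. (\<lambda>n. ((phi (x - h n *\<^sub>R ?e) - phi x) / h n) * F (u x)) ~~> - (partial i phi x) * F (u x)"
    proof (intro AE_I2 tendsto_mult tendsto_const)
     fix x
     have "((\<lambda>s. phi (x + s *\<^sub>R ?e)) has_real_derivative partial i phi x) (at 0)"
     proof -
      have 1: "((\<lambda>s. x + s *\<^sub>R ?e) has_derivative (\<lambda>s. s *\<^sub>R ?e)) (at 0)"
       by (auto intro!: derivative_eq_intros)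
      have "((\<lambda>s. phi (x + s *\<^sub>R ?e)) has_derivative (\<lambda>s. (\<chi> j. partial j phi (x + 0 *\<^sub>R ?e)) \<bullet> s *\<^sub>R ?e)) (at 0)"
       by (rule has_derivative_compose[OF 1 c1_derivative[OF test_fn_imp_c1[OF t]]])
      moreover have "(\<lambda>s. (\<chi> j. partial j phi (x + 0 *\<^sub>R ?e)) \<bullet> s *\<^sub>R ?e) = (*) (partial i phi x)"
       by (auto simp: inner_axis)
      ultimately show ?thesis by (simp add: has_field_derivative_def)
     qed
     then have D: "((\<lambda>s. (phi (x + s *\<^sub>R ?e) - phi x) / s) \<longlongrightarrow> partial i phi x) (at 0)"
      by (simp add: has_field_derivative_iff)
     have "filterlim (\<lambda>n. - h n) (at 0) sequentially"
      unfolding filterlim_at using tendsto_minus[OF h0] h(1) by (auto simp: less_le)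
     then have "((\<lambda>n. (phi (x + (- h n) *\<^sub>R ?e) - phi x) / (- h n)) \<longlongrightarrow> partial i phi x) sequentially"
      by (rule filterlim_compose[OF D])
     from tendsto_minus[OF this]
     show "(\<lambda>n. (phi (x - h n *\<^sub>R ?e) - phi x) / h n) ~~> - partial i phi x" by simp
    qed
    show "AE x in lborel. norm (((phi (x - h n *\<^sub>R ?e) - phi x) / h n) * F (u x)) \<le> C * (indicator (cball 0 (R + 1)) x * \<bar>F (u x)\<bar>)" (is "AE x in _. ?Q1 x") for n
    proof (intro AE_I2)
     fix x
     have "\<bar>(phi (x - h n *\<^sub>R ?e) - phi x) / h n\<bar> \<le> C"
     proof -
      have "(phi (x - h n *\<^sub>R ?e) - phi x) / h n = - (LBINT tau. indicator {0..1} tau * partial i phi (x - (h n * tau) *\<^sub>R ?e))"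
       using test_fn_line_integral[OF t, of "h n" i x] h(1)[of n] by (simp add: field_simps)
      also have "\<bar>\<dots>\<bar> \<le> (\<integral>tau. indicator {0..1} tau * C \<partial>(lborel :: real measure))"
       unfolding abs_minus_cancel
      proof (rule integral_abs_bound_integral)
       show "integ (\<lambda>tau::real. indicator {0..1} tau * C)" by auto
       then show "integ (\<lambda>tau. indicator {0..1} tau * partial i phi (x - (h n * tau) *\<^sub>R ?e))"
        by (rule Lintegrable_bound) (auto simp: indicator_def CR(4) order.trans[OF CR(4) abs_ge_self])
       show "\<bar>indicator {0..1} tau * partial i phi (x - (h n * tau) *\<^sub>R ?e)\<bar> \<le> indicator {0..1} tau * C" for tau :: real
        using CR(4) by (auto simp: indicator_def)
      qed
      also have "\<dots> = C" by simp
      finally show ?thesis .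
     qed
     moreover have "(phi (x - h n *\<^sub>R ?e) - phi x) / h n = 0" if "norm x > R + 1"
     proof -
      have "norm x - h n \<le> norm (x - h n *\<^sub>R ?e)"
       using norm_triangle_ineq2[of x "h n *\<^sub>R ?e"] h(1)[of n] by simp
      then show ?thesis using CR(5) that h(2)[of n] by auto
     qed
     ultimately show "?Q1 x"
      by (cases "norm x > R + 1") (auto simp: abs_mult mult_right_mono simp del: abs_divide times_divide_eq_left)
    qed
   qed measurable
   ultimately show ?thesis by simp
  qed
  have lim2: "(\<lambda>n. LBINT x. phi x * (m (r n) x * d (r n) x)) ~~> (LBINT x. phi x * (F' (u x) * g x))"
  proof -
   have lmg: "loc_int (\<lambda>x. m n x * g x)" for n
   proof (rule loc_int_bound)
    show "loc_int (\<lambda>x. L * \<bar>g x\<bar>)" by (intro loc_int_cmult loc_int_abs wderivD(2)[OF w])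
    show "\<bar>m n x * g x\<bar> \<le> L * \<bar>g x\<bar>" for x using mL by (simp add: abs_mult mult_right_mono)
   qed measurable
   have A: "(\<lambda>n. LBINT x. phi x * (m (r n) x * g x)) ~~> (LBINT x. phi x * (F' (u x) * g x))"
   proof (rule integral_dominated_convergence[where w="\<lambda>x. \<bar>phi x * (L * \<bar>g x\<bar>)\<bar>"])
    show "integ (\<lambda>x. \<bar>phi x * (L * \<bar>g x\<bar>)\<bar>)"
     by (intro integrable_abs i0 loc_int_cmult loc_int_abs wderivD(2)[OF w])
    show "AE x in lborel. norm (phi x * (m (r n) x * g x)) \<le> \<bar>phi x * (L * \<bar>g x\<bar>)\<bar>" for n
     using mL L0 by (intro AE_I2) (auto simp: abs_mult intro!: mult_left_mono mult_right_mono)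
    show "AE x in lborel. (\<lambda>n. phi x * (m (r n) x * g x)) ~~> phi x * (F' (u x) * g x)"
     using r(2)
    proof eventually_elim
     case (elim x)
     show ?case
     proof (cases "norm x \<le> R")
      case True
      have "uR (x + h n *\<^sub>R ?e) - uR x = u (x + h n *\<^sub>R ?e) - u x" for n
       using near[OF True, of "h n" 1] h(1)[of n] h(2)[of n] True by (simp add: uR_def)
      then have "(\<lambda>n. u (x + h (r n) *\<^sub>R ?e) - u x) ~~> 0" using elim by simp
      then have u0: "(\<lambda>n. u (x + h (r n) *\<^sub>R ?e)) ~~> u x" by (simp add: LIM_zero_iff)
      have "(\<lambda>n. m (r n) x) ~~> F' (u x)"
      proof -
       define S where "S b = (if b = u x then F' (u x) else (F b - F (u x)) / (b - u x))" for b
       have "((\<lambda>b. (F b - F (u x)) / (b - u x)) \<longlongrightarrow> F' (u x)) (at (u x))"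
        using F(1)[of "u x"] by (simp add: has_field_derivative_iff)
       then have "(S \<longlongrightarrow> S (u x)) (at (u x))"
        by (rule filterlim_cong[THEN iffD1, rotated 3]) (auto simp: S_def eventually_at_filter)
       then have "isCont S (u x)" by (simp add: isCont_def)
       from isCont_tendsto_compose[OF this u0] have "(\<lambda>n. S (u (x + h (r n) *\<^sub>R ?e))) ~~> S (u x)" .
       moreover have "S (u (x + h (r n) *\<^sub>R ?e)) = m (r n) x" for n by (simp add: S_def m_def)
       ultimately show ?thesis by (simp add: S_def)
      qed
      then show ?thesis by (intro tendsto_intros)
     next
      case False
      then have "phi x = 0" using CR(5) by simp
      then show ?thesis by simp
     qed
    qed
   qed measurable
   have B: "(\<lambda>n. LBINT x. phi x * (m (r n) x * d (r n) x) - phi x * (m (r n) x * g x)) ~~> 0"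
   proof (rule Lim_null_comparison[OF always_eventually])
    have "(\<lambda>n. LBINT x. q (r n) x) ~~> 0" using LIMSEQ_subseq_LIMSEQ[OF q0 r(1)] by (simp add: o_def)
    then show "(\<lambda>n. (C * L) * (LBINT x. q (r n) x)) ~~> 0" by (rule tendsto_mult_right_zero)
    show "\<forall>n. norm (LBINT x. phi x * (m (r n) x * d (r n) x) - phi x * (m (r n) x * g x)) \<le> (C * L) * (LBINT x. q (r n) x)"
    proof
     fix n
     have iqq: "integ (\<lambda>x. (C * L) * q (r n) x)"
      unfolding q_def by (intro integrable_mult_right lborel_pair.integrable_snd[OF iq])
     have idd: "integ (\<lambda>x. phi x * (m (r n) x * d (r n) x) - phi x * (m (r n) x * g x))"
      by (intro Lintegrable_diff i0 l1 lmg)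
     have "\<bar>LBINT x. phi x * (m (r n) x * d (r n) x) - phi x * (m (r n) x * g x)\<bar> \<le> (LBINT x. \<bar>phi x * (m (r n) x * d (r n) x) - phi x * (m (r n) x * g x)\<bar>)"
      by (rule integral_abs_bound)
     also have "\<dots> \<le> (LBINT x. (C * L) * q (r n) x)"
     proof (rule integral_mono_AE[OF integrable_abs[OF idd] iqq])
      show "AE x in lborel. \<bar>phi x * (m (r n) x * d (r n) x) - phi x * (m (r n) x * g x)\<bar> \<le> (C * L) * q (r n) x"
       using dq[of "r n"]
      proof eventually_elim
       case (elim x)
       have qn: "q (r n) x \<ge> 0" unfolding q_def by (intro Lintegral_nonneg) auto
       have "phi x * (m (r n) x * d (r n) x) - phi x * (m (r n) x * g x) = phi x * m (r n) x * (d (r n) x - g x)"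
        by (simp add: algebra_simps)
       then have e: "\<bar>phi x * (m (r n) x * d (r n) x) - phi x * (m (r n) x * g x)\<bar> = \<bar>phi x\<bar> * \<bar>m (r n) x\<bar> * \<bar>d (r n) x - g x\<bar>"
        by (simp add: abs_mult)
       show ?case
       proof (cases "norm x \<le> R")
        case True
        show ?thesis unfolding e
         using elim True CR(1) CR(3)[of x] mL[of "r n" x] qn L0 by (intro mult_mono) auto
       next
        case False
        then have "phi x = 0" using CR(5) by simp
        then show ?thesis using qn CR(1) L0 by simp
       qed
      qed
     qed
     also have "\<dots> = (C * L) * (LBINT x. q (r n) x)" by simp
     finally show "norm (LBINT x. phi x * (m (r n) x * d (r n) x) - phi x * (m (r n) x * g x)) \<le> (C * L) * (LBINT x. q (r n) x)" by simp
    qed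
   qed
   have "(\<lambda>n. (LBINT x. phi x * (m (r n) x * d (r n) x) - phi x * (m (r n) x * g x)) + (LBINT x. phi x * (m (r n) x * g x))) ~~> 0 + (LBINT x. phi x * (F' (u x) * g x))"
    by (intro tendsto_add A B)
   moreover have "(LBINT x. phi x * (m (r n) x * d (r n) x) - phi x * (m (r n) x * g x)) + (LBINT x. phi x * (m (r n) x * g x)) = (LBINT x. phi x * (m (r n) x * d (r n) x))" for n
    using Lintegral_diff[OF i0[OF l1[of "r n"]] i0[OF lmg[of "r n"]]] by simp
   ultimately show ?thesis by simp
  qed
  have "(LBINT x. phi x * (F' (u x) * g x)) = (LBINT x. - (partial i phi x) * F (u x))"
   using LIMSEQ_unique[OF lim2 LIMSEQ_subseq_LIMSEQ[OF lim1 r(1), unfolded o_def]] .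
  then show "(LBINT x. partial i phi x * F (u x)) = - (LBINT x. phi x * (F' (u x) * g x))" by simp
 qed
qed

text \<open>Approximation by \<open>sqrt (t^2 + eps)\<close>, whose slope
  \<open>t / sqrt (t^2 + eps)\<close> is bounded by 1 and tends to \<open>sgn t\<close>, including
  the value 0 at \<open>t = 0\<close>.\<close>

lemma wderiv_abs:
 assumes w: "wderiv i u g"
 shows "wderiv i (\<lambda>x. \<bar>u x\<bar>) (\<lambda>x. sgn (u x) * g x)"
proof -
 note [measurable] = wderiv_borel[OF w]
 define eps where "eps n = 1 / real (Suc n)" for n
 have e: "eps n > 0" "eps n \<le> 1" for n by (auto simp: eps_def)
 have e0: "eps ~~> 0" unfolding eps_def by (rule LIMSEQ_Suc[OF lim_1_over_n])
 have pos: "t\<^sup>2 + eps n > 0" for t n using e(1)[of n] by (simp add: add_nonneg_pos)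
 have le: "\<bar>t\<bar> \<le> sqrt (t\<^sup>2 + eps n)" for t n
  using e(1)[of n] by (intro real_le_rsqrt) simp
 have bd: "\<bar>t / sqrt (t\<^sup>2 + eps n)\<bar> \<le> 1" for t n
  using le[of t n] pos[of t n] by (auto simp: divide_le_eq)
 have D: "((\<lambda>t. sqrt (t\<^sup>2 + eps n)) has_real_derivative t / sqrt (t\<^sup>2 + eps n)) (at t)" for t n
  using pos[of t n] by (auto intro!: derivative_eq_intros simp: field_simps)
 have c: "continuous_on UNIV (\<lambda>t. t / sqrt (t\<^sup>2 + eps n))" for n
  using pos[of _ n] by (intro continuous_intros) (auto simp: less_le)
 show ?thesis
 proof (rule wderiv_limit[where u="\<lambda>n x. sqrt ((u x)^2 + eps n)" and g="\<lambda>n x. u x / sqrt ((u x)^2 + eps n) * g x"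
    and w="\<lambda>x. \<bar>u x\<bar> + 1" and w'="\<lambda>x. \<bar>g x\<bar>"])
  show "wderiv i (\<lambda>x. sqrt ((u x)^2 + eps n)) (\<lambda>x. u x / sqrt ((u x)^2 + eps n) * g x)" for n
   by (rule wderiv_chain[OF w D c bd])
  show "AE x in lborel. (\<lambda>n. sqrt ((u x)^2 + eps n)) ~~> \<bar>u x\<bar>" (is "AE x in _. ?Q1 x")
  proof (rule AE_I2)
   fix x
   have "(\<lambda>n. sqrt ((u x)^2 + eps n)) ~~> sqrt ((u x)^2 + 0)" by (intro tendsto_intros e0)
   then show "?Q1 x" by simp
  qed
  show "AE x in lborel. (\<lambda>n. u x / sqrt ((u x)^2 + eps n) * g x) ~~> sgn (u x) * g x" (is "AE x in _. ?Q2 x")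
  proof (rule AE_I2)
   fix x
   show "?Q2 x"
   proof (cases "u x = 0")
    case False
    have "(\<lambda>n. u x / sqrt ((u x)^2 + eps n) * g x) ~~> u x / sqrt ((u x)^2 + 0) * g x"
     using False by (intro tendsto_intros e0) auto
    moreover have "u x / sqrt ((u x)^2 + 0) = sgn (u x)" using False by (simp add: sgn_real_def)
    ultimately show ?thesis by (simp only:)
   qed simp
  qed
  show "\<bar>sqrt ((u x)^2 + eps n)\<bar> \<le> \<bar>u x\<bar> + 1" for n x
  proof -
   have "(u x)^2 + eps n \<le> (\<bar>u x\<bar> + 1)^2" using e(2)[of n] by (simp add: power2_sum)
   then have "sqrt ((u x)^2 + eps n) \<le> \<bar>u x\<bar> + 1" by (intro real_le_lsqrt) auto
   then show ?thesis using pos[of "u x" n] by simp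
  qed
  show "\<bar>u x / sqrt ((u x)^2 + eps n) * g x\<bar> \<le> \<bar>g x\<bar>" for n x
   using mult_right_mono[OF bd[of "u x" n] abs_ge_zero[of "g x"]] by (simp add: abs_mult)
  show "loc_int (\<lambda>x. \<bar>u x\<bar> + 1)" "loc_int (\<lambda>x. \<bar>g x\<bar>)" "loc_int (\<lambda>x. \<bar>u x\<bar>)"
   by (intro loc_int_add loc_int_abs loc_int_const wderivD[OF w])+
  show "loc_int (\<lambda>x. sgn (u x) * g x)"
   by (rule loc_int_bound[OF loc_int_abs[OF wderivD(2)[OF w]]]) (auto simp: abs_mult sgn_real_def)
 qed
qed

text \<open>The chain rule demands a bounded slope, which the square lacks;
  \<open>m t^2 / (m + t^2)\<close> has slope at most \<open>m\<close>, and both it and its slope are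
  dominated by those of the square.\<close>

lemma wderiv_square:
 assumes w: "wderiv i u g" and l: "loc_int (\<lambda>x. (u x)^2)" "loc_int (\<lambda>x. u x * g x)"
 shows "wderiv i (\<lambda>x. (u x)^2) (\<lambda>x. 2 * (u x * g x))"
proof -
 note [measurable] = wderiv_borel[OF w]
 define m where "m n = real (Suc n)" for n
 have m: "m n \<ge> 1" for n by (simp add: m_def)
 have pos: "m n + t\<^sup>2 > 0" for t n using m[of n] by (intro add_pos_nonneg) auto
 define F where "F n t = m n * t\<^sup>2 / (m n + t\<^sup>2)" for n t
 define F' where "F' n t = 2 * t * (m n / (m n + t\<^sup>2))^2" for n t
 have r: "0 \<le> m n / (m n + t\<^sup>2)" "m n / (m n + t\<^sup>2) \<le> 1" for n t
  using pos[of n t] m[of n] by (auto simp: divide_le_eq intro!: divide_nonneg_pos)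
 have D: "(F n has_real_derivative F' n t) (at t)" for n t
  unfolding F_def F'_def using pos[of n t]
  by (auto intro!: derivative_eq_intros simp: power2_eq_square field_simps)
 have c: "continuous_on UNIV (F' n)" for n
  unfolding F'_def using pos[of n] by (intro continuous_intros) (auto simp: less_le)
 have F1: "\<bar>F n t\<bar> \<le> t\<^sup>2" for n t
  unfolding F_def using mult_right_mono[OF r(2)[of n t], of "t\<^sup>2"] pos[of n t] m[of n] by (simp add: abs_mult)
 have F2: "\<bar>F' n t\<bar> \<le> 2 * \<bar>t\<bar>" for n t
 proof -
  have "(m n / (m n + t\<^sup>2))^2 \<le> 1" using r[of n t] by (simp add: power_le_one)
  then have "\<bar>2 * t\<bar> * (m n / (m n + t\<^sup>2))^2 \<le> \<bar>2 * t\<bar> * 1" by (rule mult_left_mono) simp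
  then show ?thesis unfolding F'_def by (simp add: abs_mult)
 qed
 have F3: "\<bar>F' n t\<bar> \<le> m n" for n t
 proof -
  have a: "2 * \<bar>t\<bar> \<le> m n + t\<^sup>2"
  proof -
   have "0 \<le> (\<bar>t\<bar> - 1)^2" by simp
   then show ?thesis using m[of n] by (simp add: power2_eq_square algebra_simps)
  qed
  have "2 * \<bar>t\<bar> * (m n / (m n + t\<^sup>2)) \<le> m n"
   using mult_right_mono[OF a, of "m n / (m n + t\<^sup>2)"] r(1)[of n t] pos[of n t] by simp
  then have "2 * \<bar>t\<bar> * (m n / (m n + t\<^sup>2)) * (m n / (m n + t\<^sup>2)) \<le> m n * 1"
   by (rule mult_mono) (use r[of n t] m[of n] in auto)
  then show ?thesis unfolding F'_def by (simp add: abs_mult power2_eq_square mult_ac)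
 qed
 have lr: "(\<lambda>n. m n / (m n + t\<^sup>2)) ~~> 1" for t
  unfolding m_def by real_asymp
 show ?thesis
 proof (rule wderiv_limit[where u="\<lambda>n x. F n (u x)" and g="\<lambda>n x. F' n (u x) * g x"
    and w="\<lambda>x. (u x)^2" and w'="\<lambda>x. 2 * \<bar>u x * g x\<bar>"])
  show "wderiv i (\<lambda>x. F n (u x)) (\<lambda>x. F' n (u x) * g x)" for n
   by (rule wderiv_chain[OF w D c F3])
  show "AE x in lborel. (\<lambda>n. F n (u x)) ~~> (u x)\<^sup>2" (is "AE x in _. ?Q1 x")
  proof (rule AE_I2)
   fix x
   have "(\<lambda>n. (m n / (m n + (u x)^2)) * (u x)^2) ~~> 1 * (u x)^2" by (intro tendsto_intros lr)
   then show "?Q1 x" by (simp add: F_def)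
  qed
  show "AE x in lborel. (\<lambda>n. F' n (u x) * g x) ~~> 2 * (u x * g x)" (is "AE x in _. ?Q2 x")
  proof (rule AE_I2)
   fix x
   have "(\<lambda>n. F' n (u x) * g x) ~~> 2 * u x * 1\<^sup>2 * g x" unfolding F'_def by (intro tendsto_intros lr)
   then show "?Q2 x" by (simp add: mult_ac)
  qed
  show "\<bar>F n (u x)\<bar> \<le> (u x)^2" for n x by (rule F1)
  show "\<bar>F' n (u x) * g x\<bar> \<le> 2 * \<bar>u x * g x\<bar>" for n x
   using mult_right_mono[OF F2[of n "u x"] abs_ge_zero[of "g x"]] by (simp add: abs_mult)
  show "loc_int (\<lambda>x. 2 * \<bar>u x * g x\<bar>)" "loc_int (\<lambda>x. 2 * (u x * g x))"
   by (intro loc_int_cmult loc_int_abs l)+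
 qed (use l in auto)
qed

lemma continuous_imp_loc_int:
 assumes "continuous_on UNIV f"
 shows "loc_int f"
 unfolding loc_int_def set_integrable_def
 using borel_integrable_compact[OF _ continuous_on_subset[OF assms]] by blast

text \<open>The integral of \<open>phi x - phi (x - e)\<close> vanishes by translation invariance,
  and it is also the average over \<open>tau\<close> of translated copies of the integral in
  question.\<close>

lemma test_fn_integral_partial:
 assumes t: "test_fn phi"
 shows "(LBINT x. partial i phi x) = 0"
proof -
 let ?e = "axis i 1 :: real^2"
 note [measurable] = test_fn_borel[OF t] partial_borel[OF t]
 have ii: "integ (partial i phi)" "integ phi"
  using test_fn_mult_integrable[OF t loc_int_const[of 1]] by simp_all
 have "(LBINT x. phi x - phi (x - ?e)) = 0"
 proof -
  have "integ (\<lambda>x. phi (x + - ?e))" by (rule integrable_translate[OF ii(2)])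
  moreover have "(LBINT x. phi (x + - ?e)) = (LBINT x. phi x)" by (rule integral_translate) simp
  ultimately show ?thesis using ii(2) by simp
 qed
 moreover have "phi x - phi (x - ?e) = (LBINT tau. indicator {0..1} tau * partial i phi (x + (-1 * tau) *\<^sub>R ?e))" for x
  using test_fn_line_integral[OF t, of 1 i x] by simp
 ultimately have "(LBINT x. (LBINT tau. indicator {0..1} tau * partial i phi (x + (-1 * tau) *\<^sub>R ?e))) = 0"
  by simp
 then have "(LBINT tau. (LBINT x. indicator {0..1} tau * partial i phi (x + (-1 * tau) *\<^sub>R ?e))) = 0"
  using lborel_pair.Fubini_integral[OF avg_integrable[OF ii(1), of "-1" ?e]] by simp
 moreover have "(LBINT x. indicator {0..1} tau * partial i phi (x + (-1 * tau) *\<^sub>R ?e))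
   = indicator {0..1} tau * (LBINT x. partial i phi x)" for tau :: real
  using integral_translate[of "partial i phi" "(-1 * tau) *\<^sub>R ?e"] by simp
 ultimately have "(\<integral>tau. indicator {0..1} tau * (LBINT x. partial i phi x) \<partial>(lborel :: real measure)) = 0"
  by (simp only:)
 then show ?thesis by simp
qed

lemma c1_wderiv:
 assumes "c1 f p"
 shows "wderiv i f (\<lambda>x. p x $ i)"
 unfolding wderiv_def
proof (intro conjI allI impI)
 show l: "loc_int f" "loc_int (\<lambda>x. p x $ i)"
  by (intro continuous_imp_loc_int c1_continuous[OF assms] continuous_on_component c1_continuous_gradient[OF assms])+
 fix phi assume t: "test_fn phi"
 have "0 = (LBINT x. phi x * p x $ i + f x * partial i phi x)"
  using test_fn_integral_partial[OF test_fn_mult_c1(1)[OF t assms], of i] test_fn_mult_c1(2)[OF t assms, of i] by simp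
 also have "\<dots> = (LBINT x. phi x * p x $ i) + (LBINT x. partial i phi x * f x)"
  using test_fn_mult_integrable(1)[OF t l(2)] test_fn_mult_integrable(2)[OF t l(1), of i] by (simp add: mult.commute)
 finally show "(LBINT x. partial i phi x * f x) = - (LBINT x. phi x * p x $ i)" by simp
qed

subsection \<open>Similarities\<close>

lemma lborel_orthogonal:
 fixes f :: "real^2 \<Rightarrow> real^2"
 assumes f: "orthogonal_transformation f"
 shows "distr lborel borel f = lborel"
proof -
 obtain f' where f': "orthogonal_transformation f'" "\<And>x. f' (f x) = x" "\<And>x. f (f' x) = x"
  using orthogonal_transformation_bij[OF f] orthogonal_transformation_inv[OF f]
  by (metis bij_inv_eq_iff)
 have [measurable]: "f \<in> Bor"
  using orthogonal_transformation_linear[OF f] by (intro borel_measurable_continuous_onI linear_continuous_on) (simp add: linear_conv_bounded_linear)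
 have "lborel = distr lborel borel f"
 proof (rule lborel_eqI)
  fix l u :: "real^2" assume le: "\<And>b. b \<in> Basis \<Longrightarrow> l \<bullet> b \<le> u \<bullet> b"
  have "f -` box l u = f' ` box l u"
   using f'(2,3) by (auto simp: image_iff) metis
  then have 1: "emeasure (distr lborel borel f) (box l u) = emeasure lborel (f' ` box l u)"
   by (subst emeasure_distr) auto
  have m: "f' ` box l u \<in> sets borel"
   unfolding \<open>f -` box l u = f' ` box l u\<close>[symmetric] using measurable_sets[of f borel borel "box l u"] by simp
  have 2: "f' ` box l u \<in> lmeasurable" "measure lebesgue (f' ` box l u) = measure lebesgue (box l u)"
   using measurable_orthogonal_image[OF f'(1), of "box l u"] measure_orthogonal_image[OF f'(1), of "box l u"] by auto
  have "emeasure lborel (f' ` box l u) = emeasure lebesgue (f' ` box l u)"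
   using m by simp
  also have "\<dots> = ennreal (measure lebesgue (f' ` box l u))"
   using 2(1) by (intro emeasure_eq_measure2)
  also have "\<dots> = ennreal (measure lebesgue (box l u))" using 2 by simp
  also have "\<dots> = (\<Prod>b\<in>Basis. (u - l) \<bullet> b)" using le by (simp add: inner_diff_left)
  finally show "emeasure (distr lborel borel f) (box l u) = (\<Prod>b\<in>Basis. (u - l) \<bullet> b)"
   using 1 by simp
 qed simp
 then show ?thesis by simp
qed

lemma orthogonal_borel:
 fixes f :: "real^2 \<Rightarrow> real^2"
 assumes "orthogonal_transformation f"
 shows "f \<in> Bor"
 using orthogonal_transformation_linear[OF assms]
 by (intro borel_measurable_continuous_onI linear_continuous_on) (simp add: linear_conv_bounded_linear)

lemma integral_orthogonal:
 fixes F :: "real^2 \<Rightarrow> real" and f :: "real^2 \<Rightarrow> real^2"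
 assumes "orthogonal_transformation f" "F \<in> Bor"
 shows "(LBINT x. F (f x)) = (LBINT x. F x)"
 using integral_distr[of f lborel borel F] assms orthogonal_borel[OF assms(1)] by (simp add: lborel_orthogonal[OF assms(1)])

lemma integrable_orthogonal:
 fixes F :: "real^2 \<Rightarrow> real" and f :: "real^2 \<Rightarrow> real^2"
 assumes "orthogonal_transformation f" "integ F"
 shows "integ (\<lambda>x. F (f x))"
 using integrable_distr[of f lborel borel F] assms orthogonal_borel[OF assms(1)] by (simp add: lborel_orthogonal[OF assms(1)])

lemma AE_orthogonal:
 fixes f :: "real^2 \<Rightarrow> real^2"
 assumes "orthogonal_transformation f" "AE x in lborel. P x"
 shows "AE x in lborel. P (f x)"
proof (rule AE_distrD[of f lborel borel P])
 show "AE x in distr lborel borel f. P x" unfolding lborel_orthogonal[OF assms(1)] by (rule assms(2))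
qed (use orthogonal_borel[OF assms(1)] in simp)

lemma AE_translate:
 fixes b :: "'a::euclidean_space"
 assumes "AE x in lborel. P x"
 shows "AE x in lborel. P (x + b)"
proof (rule AE_distrD[of "\<lambda>x. x + b" lborel borel P])
 show "AE x in distr lborel borel (\<lambda>x. x + b). P x" unfolding lborel_translate by (rule assms)
qed simp

lemma lborel_scale:
 fixes c :: real
 assumes "c > 0"
 shows "distr lborel borel (\<lambda>x::real^2. c *\<^sub>R x) = density lborel (\<lambda>_. ennreal (1 / c\<^sup>2))"
proof -
 have "lborel = density (distr lborel borel (\<lambda>x::real^2. c *\<^sub>R x)) (\<lambda>_. ennreal (c\<^sup>2))"
  using lborel_affine[of c "0::real^2"] assms by simp
 then have "density lborel (\<lambda>_. ennreal (1 / c\<^sup>2)) = density (density (distr lborel borel (\<lambda>x::real^2. c *\<^sub>R x)) (\<lambda>_. ennreal (c\<^sup>2))) (\<lambda>_. ennreal (1 / c\<^sup>2))"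
  by simp
 also have "\<dots> = density (distr lborel borel (\<lambda>x::real^2. c *\<^sub>R x)) (\<lambda>_. ennreal (c\<^sup>2) * ennreal (1 / c\<^sup>2))"
  by (subst density_density_eq) auto
 also have "(\<lambda>_::real^2. ennreal (c\<^sup>2) * ennreal (1 / c\<^sup>2)) = (\<lambda>_. 1)"
  using assms by (simp add: ennreal_mult[symmetric])
 finally show ?thesis by (simp add: density_1)
qed

lemma integral_scale:
 fixes F :: "real^2 \<Rightarrow> real"
 assumes "c > 0" "F \<in> Bor"
 shows "(LBINT x. F (c *\<^sub>R x)) = (LBINT x. F x) / c\<^sup>2"
proof -
 have "(LBINT x. F (c *\<^sub>R x)) = (\<integral>x. F x \<partial>density lborel (\<lambda>_. ennreal (1 / c\<^sup>2)))"
  using integral_distr[of "\<lambda>x. c *\<^sub>R x" lborel borel F] assms by (simp add: lborel_scale)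
 also have "\<dots> = (LBINT x. (1 / c\<^sup>2) *\<^sub>R F x)"
  using assms by (intro integral_density) auto
 finally show ?thesis by simp
qed

lemma integrable_scale:
 fixes F :: "real^2 \<Rightarrow> real"
 assumes "c > 0" "integ F"
 shows "integ (\<lambda>x. F (c *\<^sub>R x))"
proof -
 have "integrable (density lborel (\<lambda>_. ennreal (1 / c\<^sup>2))) F"
  using assms by (subst integrable_density) auto
 then show ?thesis
  using integrable_distr[of "\<lambda>x. c *\<^sub>R x" lborel borel F] assms by (simp add: lborel_scale)
qed

definition wgrad :: "(real^2 \<Rightarrow> real) \<Rightarrow> (real^2 \<Rightarrow> real^2) \<Rightarrow> bool" where
 "wgrad u G \<longleftrightarrow> (\<forall>i. wderiv i u (\<lambda>x. G x $ i))"

lemma wgradD: "wgrad u G \<Longrightarrow> wderiv i u (\<lambda>x. G x $ i)"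
 by (simp add: wgrad_def)

lemma wgrad_add: "wgrad u G \<Longrightarrow> wgrad v H \<Longrightarrow> wgrad (\<lambda>x. u x + v x) (\<lambda>x. G x + H x)"
 unfolding wgrad_def by (auto intro: wderiv_add)

lemma wgrad_cmult: "wgrad u G \<Longrightarrow> wgrad (\<lambda>x. c * u x) (\<lambda>x. c *\<^sub>R G x)"
 unfolding wgrad_def by (auto intro: wderiv_cmult)

lemma wgrad_diff: "wgrad u G \<Longrightarrow> wgrad v H \<Longrightarrow> wgrad (\<lambda>x. u x - v x) (\<lambda>x. G x - H x)"
 unfolding wgrad_def by (auto intro: wderiv_diff)

lemma wgrad_abs: "wgrad u G \<Longrightarrow> wgrad (\<lambda>x. \<bar>u x\<bar>) (\<lambda>x. sgn (u x) *\<^sub>R G x)"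
 unfolding wgrad_def by (auto intro: wderiv_abs)

lemma wgrad_borel:
 assumes "wgrad u G"
 shows "u \<in> Bor" (is ?t1) "G \<in> Bor" (is ?t2)
proof -
 show ?t1 using wderiv_borel(1)[OF wgradD[OF assms]] .
 show ?t2
  using wderiv_borel(2)[OF wgradD[OF assms]]
  by (subst borel_measurable_euclidean_space) (auto simp: Basis_vec_def inner_axis)
qed

lemma wgrad_unique:
 assumes "wgrad u G" "wgrad v H" "AE x in lborel. u x = v x"
 shows "AE x in lborel. G x = H x"
proof -
 have "AE x in lborel. \<forall>i. G x $ i = H x $ i"
  using wderiv_unique[OF wgradD[OF assms(1)] wgradD[OF assms(2)] assms(3)] by (simp add: AE_all_countable)
 then show ?thesis by eventually_elim (simp add: vec_eq_iff)
qed

lemma wgrad_cong_AE: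
 assumes "wgrad u G" "AE x in lborel. u x = v x" "v \<in> Bor"
 shows "wgrad v G"
 unfolding wgrad_def
 using wderiv_cong_AE[OF wgradD[OF assms(1)] assms(2) _ assms(3) wderiv_borel(2)[OF wgradD[OF assms(1)]]] by auto

lemma wgrad_translate:
 assumes "wgrad u G"
 shows "wgrad (\<lambda>x. u (x + b)) (\<lambda>x. G (x + b))"
 unfolding wgrad_def wderiv_def
proof (intro allI conjI impI)
 fix i
 note w = wgradD[OF assms, of i]
 note [measurable] = wderiv_borel[OF w]
 show "loc_int (\<lambda>x. u (x + b))" "loc_int (\<lambda>x. G (x + b) $ i)"
  using loc_int_translate[OF wderivD(1)[OF w]] loc_int_translate[OF wderivD(2)[OF w]] by auto
 fix phi assume t: "test_fn phi"
 note [measurable] = test_fn_borel[OF t] partial_borel[OF t]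
 have "(LBINT x. partial i phi x * u (x + b)) = (LBINT x. partial i (\<lambda>x. phi (x + - b)) x * u x)"
  unfolding test_fn_translate(2)[OF t]
  using integral_translate[of "\<lambda>x. partial i phi (x + - b) * u x" b] by simp
 also have "\<dots> = - (LBINT x. phi (x + - b) * G x $ i)"
  by (rule wderivD(3)[OF w test_fn_translate(1)[OF t]])
 also have "(LBINT x. phi (x + - b) * G x $ i) = (LBINT x. phi x * G (x + b) $ i)"
  using integral_translate[of "\<lambda>x. phi (x + - b) * G x $ i" b] by simp
 finally show "(LBINT x. partial i phi x * u (x + b)) = - (LBINT x. phi x * G (x + b) $ i)" .
qed

lemma loc_int_scale:
 assumes "loc_int u" "c > 0"
 shows "loc_int (\<lambda>x. u (c *\<^sub>R x))"
proof (rule loc_intI)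
 note [measurable] = loc_int_borel[OF assms(1)]
 show "(\<lambda>x. u (c *\<^sub>R x)) \<in> Bor" by measurable
 fix R :: real
 have "integ (\<lambda>x. indicator (cball 0 (c * R)) x * \<bar>u x\<bar>)"
  by (rule loc_int_cutoff[OF loc_int_abs[OF assms(1)]])
 from integrable_scale[OF assms(2) this]
 show "\<exists>w. integ w \<and> (\<forall>x. norm x \<le> R \<longrightarrow> \<bar>u (c *\<^sub>R x)\<bar> \<le> w x)"
  using assms(2)
  by (intro exI[of _ "\<lambda>x. indicator (cball 0 (c * R)) (c *\<^sub>R x) * \<bar>u (c *\<^sub>R x)\<bar>"] conjI)
    (auto simp: indicator_def)
qed

lemma wgrad_scale:
 assumes "wgrad u G" and c: "c > 0"
 shows "wgrad (\<lambda>x. u (c *\<^sub>R x)) (\<lambda>x. c *\<^sub>R G (c *\<^sub>R x))"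
 unfolding wgrad_def wderiv_def
proof (intro allI conjI impI)
 fix i
 note w = wgradD[OF assms(1), of i]
 note [measurable] = wderiv_borel[OF w]
 show "loc_int (\<lambda>x. u (c *\<^sub>R x))" "loc_int (\<lambda>x. (c *\<^sub>R G (c *\<^sub>R x)) $ i)"
  using loc_int_scale[OF wderivD(1)[OF w] c] loc_int_cmult[OF loc_int_scale[OF wderivD(2)[OF w] c]] by auto
 fix phi assume t: "test_fn phi"
 note [measurable] = test_fn_borel[OF t] partial_borel[OF t]
 define psi where "psi x = phi ((1/c) *\<^sub>R x)" for x
 have cc: "c1 psi (\<lambda>x. (1/c) *\<^sub>R (\<chi> i. partial i phi ((1/c) *\<^sub>R x)))"
  using c1_linear_compose[OF test_fn_imp_c1[OF t], of "\<lambda>x. (1/c) *\<^sub>R x" "\<lambda>x. (1/c) *\<^sub>R x" 0]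
  by (simp add: psi_def[abs_def] bounded_linear_scaleR_right)
 have "{x. psi x \<noteq> 0} \<subseteq> (\<lambda>x. c *\<^sub>R x) ` {x. phi x \<noteq> 0}"
  using c by (auto simp: psi_def image_iff intro!: exI[of _ "(1/c) *\<^sub>R _"])
 moreover have "bounded ((\<lambda>x. c *\<^sub>R x) ` {x. phi x \<noteq> 0})"
  using t by (intro bounded_scaling) (simp add: test_fn_def)
 ultimately have t': "test_fn psi"
  using c1_imp_test_fn[OF cc] bounded_subset by blast
 have p: "partial i psi x = (1/c) * partial i phi ((1/c) *\<^sub>R x)" for x
  using c1_partial[OF cc] by simp
 note [measurable] = test_fn_borel[OF t']
 have "(LBINT x. partial i phi x * u (c *\<^sub>R x)) = (LBINT x. partial i phi ((1/c) *\<^sub>R x) * u x) / c\<^sup>2"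
  using integral_scale[OF c, of "\<lambda>x. partial i phi ((1/c) *\<^sub>R x) * u x"] c by simp
 also have "(LBINT x. partial i phi ((1/c) *\<^sub>R x) * u x) = c * (LBINT x. partial i psi x * u x)"
  using c by (simp add: p)
 also have "(LBINT x. partial i psi x * u x) = - (LBINT x. psi x * G x $ i)"
  by (rule wderivD(3)[OF w t'])
 also have "(LBINT x. psi x * G x $ i) = c\<^sup>2 * (LBINT x. phi x * G (c *\<^sub>R x) $ i)"
  using integral_scale[OF c, of "\<lambda>x. psi x * G x $ i"] c by (simp add: psi_def)
 finally show "(LBINT x. partial i phi x * u (c *\<^sub>R x)) = - (LBINT x. phi x * (c *\<^sub>R G (c *\<^sub>R x)) $ i)"
  using c by (simp add: power2_eq_square mult.left_commute[of _ c])
qed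

section \<open>Reflections in lines through the origin\<close>

definition mirror :: "real^2 \<Rightarrow> real^2 \<Rightarrow> real^2" where
 "mirror e x = x - (2 * (x \<bullet> e)) *\<^sub>R e"

lemma mirror_linear: "linear (mirror e)"
 by (rule linearI) (auto simp: mirror_def algebra_simps)

lemma mirror_selfadjoint: "mirror e x \<bullet> y = x \<bullet> mirror e y"
 by (simp add: mirror_def inner_diff_left inner_diff_right inner_commute)

lemma mirror_mirror: "norm e = 1 \<Longrightarrow> mirror e (mirror e x) = x"
 by (simp add: mirror_def inner_diff_left dot_square_norm)

lemma mirror_inner: "norm e = 1 \<Longrightarrow> mirror e x \<bullet> e = - (x \<bullet> e)"
 by (simp add: mirror_def inner_diff_left dot_square_norm)

lemma mirror_orthogonal: "norm e = 1 \<Longrightarrow> orthogonal_transformation (mirror e)"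
 unfolding orthogonal_transformation_def using mirror_linear mirror_selfadjoint mirror_mirror by metis

lemma mirror_norm: "norm e = 1 \<Longrightarrow> norm (mirror e x) = norm x"
 using orthogonal_transformation_norm[OF mirror_orthogonal] by blast

lemma loc_int_orthogonal:
 assumes "loc_int u" "orthogonal_transformation f"
 shows "loc_int (\<lambda>x. u (f x))"
proof (rule loc_intI)
 note [measurable] = loc_int_borel[OF assms(1)] orthogonal_borel[OF assms(2)]
 show "(\<lambda>x. u (f x)) \<in> Bor" by measurable
 fix R :: real
 have "integ (\<lambda>x. indicator (cball 0 R) x * \<bar>u x\<bar>)"
  by (rule loc_int_cutoff[OF loc_int_abs[OF assms(1)]])
 from integrable_orthogonal[OF assms(2) this]
 show "\<exists>w. integ w \<and> (\<forall>x. norm x \<le> R \<longrightarrow> \<bar>u (f x)\<bar> \<le> w x)"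
  by (intro exI[of _ "\<lambda>x. indicator (cball 0 R) (f x) * \<bar>u (f x)\<bar>"] conjI)
    (auto simp: indicator_def orthogonal_transformation_norm[OF assms(2)])
qed

lemma mirror_component: "mirror e y $ i = (\<Sum>j\<in>UNIV. (mirror e (axis i 1) $ j) * y $ j)"
proof -
 have "mirror e y $ i = mirror e y \<bullet> axis i 1" by (simp add: inner_axis)
 also have "\<dots> = mirror e (axis i 1) \<bullet> y" by (metis mirror_selfadjoint inner_commute)
 finally show ?thesis by (simp add: inner_vec_def)
qed

text \<open>The reflection is its own transpose, so the coefficients \<open>a\<close> that express a
  partial derivative of \<open>phi\<close> through those of the reflected test function are the ones
  that form the new gradient.\<close>

lemma wgrad_mirror:
 assumes "wgrad u G" and e: "norm e = 1"
 shows "wgrad (\<lambda>x. u (mirror e x)) (\<lambda>x. mirror e (G (mirror e x)))"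
 unfolding wgrad_def wderiv_def
proof (intro allI conjI impI)
 fix i
 note w = wgradD[OF assms(1)]
 note [measurable] = wderiv_borel[OF w] orthogonal_borel[OF mirror_orthogonal[OF e]]
 note o = mirror_orthogonal[OF e]
 define a where "a = mirror e (axis i 1)"
 show "loc_int (\<lambda>x. u (mirror e x))" by (rule loc_int_orthogonal[OF wderivD(1)[OF w] o])
 have la: "loc_int (\<lambda>x. \<Sum>j\<in>J. a $ j * G x $ j)" if "finite J" for J
  using that
 proof (induction J)
  case empty show ?case by (simp add: loc_int_const)
 next
  case (insert j J) then show ?case using loc_int_add[OF loc_int_cmult[OF wderivD(2)[OF w], of "a $ j" j]] by simp
 qed
 have RG: "mirror e y $ i = (\<Sum>j\<in>UNIV. a $ j * y $ j)" for y unfolding a_def by (rule mirror_component)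
 show "loc_int (\<lambda>x. mirror e (G (mirror e x)) $ i)"
  unfolding RG using loc_int_orthogonal[OF la[of UNIV] o] by simp
 fix phi assume t: "test_fn phi"
 note [measurable] = test_fn_borel[OF t] partial_borel[OF t]
 define psi where "psi x = phi (mirror e x)" for x
 have bl: "bounded_linear (mirror e)" using mirror_linear linear_conv_bounded_linear by blast
 have cc: "c1 psi (\<lambda>x. mirror e (\<chi> i. partial i phi (mirror e x)))"
  using c1_linear_compose[OF test_fn_imp_c1[OF t] bl mirror_selfadjoint bl, of 0]
  by (simp add: psi_def[abs_def])
 obtain R where R: "\<And>x. norm x > R \<Longrightarrow> phi x = 0" using test_fn_bounds[OF t] by metis
 have "{x. psi x \<noteq> 0} \<subseteq> cball 0 R"
 proof
  fix x assume "x \<in> {x. psi x \<noteq> 0}"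
  then have "\<not> norm (mirror e x) > R" using R unfolding psi_def by blast
  then show "x \<in> cball 0 R" by (simp add: mirror_norm[OF e])
 qed
 then have t': "test_fn psi"
  using c1_imp_test_fn[OF cc] bounded_subset[OF bounded_cball] by blast
 note [measurable] = test_fn_borel[OF t']
 have "partial j psi x = mirror e (\<chi> i. partial i phi (mirror e x)) $ j" for j x using c1_partial[OF cc] by simp
 then have "(\<chi> j. partial j psi x) = mirror e (\<chi> i. partial i phi (mirror e x))" for x by (simp add: vec_eq_iff)
 then have "mirror e (\<chi> j. partial j psi x) = (\<chi> i. partial i phi (mirror e x))" for x by (simp add: mirror_mirror[OF e])
 then have p: "partial i phi (mirror e x) = (\<Sum>j\<in>UNIV. a $ j * partial j psi x)" for x
  using RG[of "\<chi> j. partial j psi x"] by (metis (no_types, lifting) sum.cong vec_lambda_beta)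
 have "(LBINT x. partial i phi x * u (mirror e x)) = (LBINT x. partial i phi (mirror e x) * u x)"
  using integral_orthogonal[OF o, of "\<lambda>x. partial i phi (mirror e x) * u x"] by (simp add: mirror_mirror[OF e])
 also have "\<dots> = (LBINT x. (\<Sum>j\<in>UNIV. a $ j * (partial j psi x * u x)))"
  unfolding p sum_distrib_right by (simp add: mult.assoc)
 also have "\<dots> = (\<Sum>j\<in>UNIV. (LBINT x. a $ j * (partial j psi x * u x)))"
  by (intro Lintegral_sum integrable_mult_right test_fn_mult_integrable[OF t' wderivD(1)[OF w]])
 also have "\<dots> = (\<Sum>j\<in>UNIV. - (LBINT x. a $ j * (psi x * G x $ j)))"
  using wderivD(3)[OF w t'] by simp
 also have "\<dots> = - (LBINT x. (\<Sum>j\<in>UNIV. a $ j * (psi x * G x $ j)))"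
  unfolding sum_negf
  by (intro arg_cong[where f=uminus] Lintegral_sum[symmetric] integrable_mult_right test_fn_mult_integrable(1)[OF t' wderivD(2)[OF w]])
 also have "(LBINT x. (\<Sum>j\<in>UNIV. a $ j * (psi x * G x $ j))) = (LBINT x. psi x * mirror e (G x) $ i)"
  unfolding RG sum_distrib_left by (simp add: mult_ac)
 also have "\<dots> = (LBINT x. phi x * mirror e (G (mirror e x)) $ i)"
 proof -
  have [measurable]: "(\<lambda>x. mirror e (G x) $ i) \<in> Bor" unfolding RG by measurable
  show ?thesis
   using integral_orthogonal[OF o, of "\<lambda>x. psi x * mirror e (G x) $ i"] by (simp add: psi_def mirror_mirror[OF e])
 qed
 finally show "(LBINT x. partial i phi x * u (mirror e x)) = - (LBINT x. phi x * mirror e (G (mirror e x)) $ i)" .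
qed

lemma test_fn_lipschitz:
 assumes "test_fn phi"
 obtains K where "K \<ge> 0" "\<And>x y. \<bar>phi x - phi y\<bar> \<le> K * norm (x - y)"
proof -
 obtain C R where CR: "C \<ge> 0" "\<And>i x. \<bar>partial i phi x\<bar> \<le> C"
  using test_fn_bounds[OF assms] by metis
 have n: "norm (\<chi> i. partial i phi x) \<le> 2 * C" for x
 proof -
  have "norm (\<chi> i. partial i phi x) \<le> (\<Sum>i\<in>UNIV. \<bar>(\<chi> i. partial i phi x) $ i\<bar>)" by (rule norm_le_l1_cart)
  also have "\<dots> \<le> (\<Sum>i\<in>(UNIV::2 set). C)" using CR(2) by (intro sum_mono) simp
  finally show ?thesis by simp
 qed
 have "norm (phi x - phi y) \<le> (2 * C) * norm (x - y)" for x y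
 proof (rule differentiable_bound[of UNIV phi "\<lambda>x h. (\<chi> i. partial i phi x) \<bullet> h"])
  show "(phi has_derivative (\<bullet>) (\<chi> i. partial i phi x)) (at x within UNIV)" for x
   using c1_derivative[OF test_fn_imp_c1[OF assms], of x] by simp
  show "onorm ((\<bullet>) (\<chi> i. partial i phi x)) \<le> 2 * C" for x
  proof (rule onorm_le)
   fix h :: "real^2"
   have "norm ((\<chi> i. partial i phi x) \<bullet> h) \<le> norm (\<chi> i. partial i phi x) * norm h" by (rule Cauchy_Schwarz_ineq2[unfolded real_norm_def[symmetric]])
   also have "\<dots> \<le> 2 * C * norm h" by (intro mult_right_mono n) simp
   finally show "norm ((\<chi> i. partial i phi x) \<bullet> h) \<le> 2 * C * norm h" .
  qed
 qed auto
 then show thesis using that[of "2 * C"] CR(1) by simp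
qed

text \<open>An odd function has no jump across its mirror line: in the test identity the singular term
 \<open>phi * X' n * g\<close> may be antisymmetrised, which gains a factor \<open>\<bar>x \<bullet> e\<bar>\<close>.\<close>

lemma wgrad_odd_sgn:
 assumes w: "wgrad g G" and odd: "\<And>x. g (mirror e x) = - g x" and e: "norm e = 1"
 shows "wgrad (\<lambda>x. sgn (x \<bullet> e) * g x) (\<lambda>x. sgn (x \<bullet> e) *\<^sub>R G x)"
 unfolding wgrad_def wderiv_def
proof (intro allI conjI impI)
 fix i
 note wi = wgradD[OF w, of i]
 note [measurable] = wderiv_borel[OF wi]
 have lb: "loc_int (\<lambda>x. f x * k x)" if "loc_int k" "\<And>x. \<bar>f x\<bar> \<le> 1" "f \<in> Bor" for f k :: "real^2 \<Rightarrow> real"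
  by (rule loc_int_bound[OF loc_int_abs[OF that(1)]]) (use that loc_int_borel in \<open>auto simp: abs_mult mult_left_le_one_le\<close>)
 have s1: "\<bar>sgn (x \<bullet> e)\<bar> \<le> 1" for x :: "real^2" by (simp add: sgn_real_def)
 have sm[measurable]: "(\<lambda>x::real^2. sgn (x \<bullet> e)) \<in> Bor" by measurable
 show "loc_int (\<lambda>x. sgn (x \<bullet> e) * g x)" by (rule lb[OF wderivD(1)[OF wi] s1 sm])
 show "loc_int (\<lambda>x. (sgn (x \<bullet> e) *\<^sub>R G x) $ i)" using lb[OF wderivD(2)[OF wi] s1 sm] by simp
 fix phi assume t: "test_fn phi"
 note [measurable] = test_fn_borel[OF t] partial_borel[OF t] orthogonal_borel[OF mirror_orthogonal[OF e]]
 obtain C R where CR: "C \<ge> 0" "\<And>x. \<bar>phi x\<bar> \<le> C" "\<And>x. norm x > R \<Longrightarrow> phi x = 0" "\<And>i x. \<bar>partial i phi x\<bar> \<le> C"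
  using test_fn_bounds[OF t] by metis
 obtain K where K: "K \<ge> 0" "\<And>x y. \<bar>phi x - phi y\<bar> \<le> K * norm (x - y)"
  using test_fn_lipschitz[OF t] by metis
 define eps where "eps n = 1 / real (Suc n)" for n
 have ep: "eps n > 0" for n by (auto simp: eps_def)
 have e0: "eps ~~> 0" unfolding eps_def by (rule LIMSEQ_Suc[OF lim_1_over_n])
 have pos: "t\<^sup>2 + eps n > 0" for t n using ep[of n] by (simp add: add_nonneg_pos)
 \<comment> \<open>A smooth sign. Its slope \<open>X' n\<close> is a bump of height
   \<open>1 / sqrt (eps n)\<close> at the mirror line, so the term containing it does not disappear
   by boundedness alone.\<close>
 define X where "X n t = t / sqrt (t\<^sup>2 + eps n)" for n t
 define X' where "X' n t = eps n / ((t\<^sup>2 + eps n) * sqrt (t\<^sup>2 + eps n))" for n t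
 have D: "(X n has_real_derivative X' n t) (at t)" for n t
 proof -
  have p: "sqrt (t\<^sup>2 + eps n) > 0" "sqrt (t\<^sup>2 + eps n) * sqrt (t\<^sup>2 + eps n) = t\<^sup>2 + eps n" using pos[of t n] by simp_all
  have "(X n has_real_derivative (sqrt (t\<^sup>2 + eps n) - t * (t / sqrt (t\<^sup>2 + eps n))) / (sqrt (t\<^sup>2 + eps n) * sqrt (t\<^sup>2 + eps n))) (at t)"
   unfolding X_def using pos[of t n] p(1)
   by (auto intro!: derivative_eq_intros simp: field_simps)
  moreover have "(sqrt (t\<^sup>2 + eps n) - t * (t / sqrt (t\<^sup>2 + eps n))) = eps n / sqrt (t\<^sup>2 + eps n)"
   using p by (simp add: field_simps power2_eq_square)
  ultimately show ?thesis unfolding X'_def p(2) by (simp add: mult.commute)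
 qed
 have Xc: "continuous_on UNIV (X' n)" for n
  unfolding X'_def using pos[of _ n] by (intro continuous_intros) (auto simp: less_le)
 have X1: "\<bar>X n t\<bar> \<le> 1" for n t
 proof -
  have "\<bar>t\<bar> \<le> sqrt (t\<^sup>2 + eps n)" using ep[of n] by (intro real_le_rsqrt) simp
  then show ?thesis unfolding X_def using pos[of t n] by (simp add: divide_le_eq)
 qed
 have X'n: "X' n t \<ge> 0" for n t unfolding X'_def using pos[of t n] ep[of n] by simp
 \<comment> \<open>Multiplied by the distance \<open>\<bar>t\<bar>\<close> to the line, the bump is
   bounded uniformly in \<open>n\<close>.\<close>
 have tX: "\<bar>t\<bar> * X' n t \<le> 1" for n t
 proof -
  have "\<bar>t\<bar> * X' n t = \<bar>X n t\<bar> * (eps n / (t\<^sup>2 + eps n))" unfolding X_def X'_def using pos[of t n] by (simp add: abs_mult)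
  also have "\<dots> \<le> 1 * 1" using X1[of n t] pos[of t n] ep[of n] by (intro mult_mono) (auto simp: divide_le_eq)
  finally show ?thesis by simp
 qed
 have Xlim: "(\<lambda>n. X n t) ~~> sgn t" for t
 proof (cases "t = 0")
  case False
  have "(\<lambda>n. t / sqrt (t\<^sup>2 + eps n)) ~~> t / sqrt (t\<^sup>2 + 0)" using False by (intro tendsto_intros e0) auto
  moreover have "t / sqrt (t\<^sup>2 + 0) = sgn t" using False by (simp add: sgn_real_def)
  ultimately show ?thesis unfolding X_def by (simp only:)
 qed (simp add: X_def)
 have X'lim: "(\<lambda>n. X' n t) ~~> 0" if "t \<noteq> 0" for t
 proof -
  have "(\<lambda>n. X' n t) ~~> 0 / ((t\<^sup>2 + 0) * sqrt (t\<^sup>2 + 0))" unfolding X'_def using that by (intro tendsto_intros e0) auto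
  then show ?thesis by simp
 qed
 have cX: "c1 (\<lambda>x. X n (x \<bullet> e)) (\<lambda>x. X' n (x \<bullet> e) *\<^sub>R e)" for n
  by (rule c1_compose[OF c1_inner D Xc])
 have [measurable]: "X n \<in> Bor" "X' n \<in> Bor" for n
  by (intro borel_measurable_continuous_onI continuous_at_imp_continuous_on ballI DERIV_isCont[OF D])
    (intro borel_measurable_continuous_onI Xc)
 have Xm: "(\<lambda>x::real^2. X n (x \<bullet> e)) \<in> Bor" for n by measurable
 note l1 = lb[OF wderivD(1)[OF wi] X1 Xm] and l2 = lb[OF wderivD(2)[OF wi] X1 Xm]
 have li: "integ (\<lambda>x. phi x * (X' n (x \<bullet> e) * g x))" for n
 proof -
  have "continuous_on UNIV (\<lambda>x. X' n (x \<bullet> e))"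
   by (rule continuous_on_compose2[OF Xc]) (auto intro!: continuous_intros)
  then have "continuous_on UNIV (\<lambda>x. phi x * X' n (x \<bullet> e))"
   by (intro continuous_on_mult test_fn_continuous[OF t])
  then obtain B where B: "\<And>x. \<bar>phi x * X' n (x \<bullet> e)\<bar> \<le> B"
   by (rule bounded_continuous_bounded_support[where S="cball 0 R"]) (use CR(3) in auto)
  have "integ (\<lambda>x. (phi x * X' n (x \<bullet> e)) * g x)"
   by (rule loc_int_mult_integrable[OF wderivD(1)[OF wi] _ B, where R=R]) (use CR(3) in auto)
  then show ?thesis by (simp add: mult_ac)
 qed
 have id: "(LBINT x. partial i phi x * (X n (x \<bullet> e) * g x)) = - (LBINT x. phi x * (X n (x \<bullet> e) * G x $ i)) - e $ i * (LBINT x. phi x * (X' n (x \<bullet> e) * g x))" for n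
 proof -
  have "(LBINT x. partial i (\<lambda>x. phi x * X n (x \<bullet> e)) x * g x) = - (LBINT x. phi x * X n (x \<bullet> e) * G x $ i)"
   by (rule wderivD(3)[OF wi test_fn_mult_c1(1)[OF t cX]])
  moreover have "(\<lambda>x. partial i (\<lambda>x. phi x * X n (x \<bullet> e)) x * g x) = (\<lambda>x. e $ i * (phi x * (X' n (x \<bullet> e) * g x)) + partial i phi x * (X n (x \<bullet> e) * g x))"
   unfolding test_fn_mult_c1(2)[OF t cX] by (auto simp: algebra_simps)
  moreover have "(LBINT x. e $ i * (phi x * (X' n (x \<bullet> e) * g x)) + partial i phi x * (X n (x \<bullet> e) * g x))
    = e $ i * (LBINT x. phi x * (X' n (x \<bullet> e) * g x)) + (LBINT x. partial i phi x * (X n (x \<bullet> e) * g x))"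
   using li[of n] test_fn_mult_integrable(2)[OF t l1[of n], of i] by simp
  ultimately show ?thesis by (simp add: mult.assoc)
 qed
 have lim1: "(\<lambda>n. LBINT x. partial i phi x * (X n (x \<bullet> e) * g x)) ~~> (LBINT x. partial i phi x * (sgn (x \<bullet> e) * g x))"
 proof (rule integral_dominated_convergence[where w="\<lambda>x. \<bar>partial i phi x * g x\<bar>"])
  show "integ (\<lambda>x. \<bar>partial i phi x * g x\<bar>)" by (intro integrable_abs test_fn_mult_integrable[OF t wderivD(1)[OF wi]])
  show "AE x in lborel. (\<lambda>n. partial i phi x * (X n (x \<bullet> e) * g x)) ~~> partial i phi x * (sgn (x \<bullet> e) * g x)"
   by (intro AE_I2 tendsto_intros Xlim)
  show "AE x in lborel. norm (partial i phi x * (X n (x \<bullet> e) * g x)) \<le> \<bar>partial i phi x * g x\<bar>" for n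
   using X1 by (intro AE_I2) (simp add: abs_mult mult_left_mono mult_left_le_one_le)
 qed measurable
 have lim2: "(\<lambda>n. LBINT x. phi x * (X n (x \<bullet> e) * G x $ i)) ~~> (LBINT x. phi x * (sgn (x \<bullet> e) * G x $ i))"
 proof (rule integral_dominated_convergence[where w="\<lambda>x. \<bar>phi x * G x $ i\<bar>"])
  show "integ (\<lambda>x. \<bar>phi x * G x $ i\<bar>)" by (intro integrable_abs test_fn_mult_integrable[OF t wderivD(2)[OF wi]])
  show "AE x in lborel. (\<lambda>n. phi x * (X n (x \<bullet> e) * G x $ i)) ~~> phi x * (sgn (x \<bullet> e) * G x $ i)"
   by (intro AE_I2 tendsto_intros Xlim)
  show "AE x in lborel. norm (phi x * (X n (x \<bullet> e) * G x $ i)) \<le> \<bar>phi x * G x $ i\<bar>" for n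
   using X1 by (intro AE_I2) (simp add: abs_mult mult_left_mono mult_left_le_one_le)
 qed measurable
 have lim3: "(\<lambda>n. LBINT x. phi x * (X' n (x \<bullet> e) * g x)) ~~> 0"
 proof -
  have fold: "(LBINT x. phi x * (X' n (x \<bullet> e) * g x)) = (LBINT x. 1/2 * ((phi x - phi (mirror e x)) * X' n (x \<bullet> e) * g x))" for n
  proof -
   have ev: "X' n (- t) = X' n t" for t by (simp add: X'_def)
   have eq: "(\<lambda>x. phi (mirror e x) * (X' n (mirror e x \<bullet> e) * g (mirror e x))) = (\<lambda>x. - (phi (mirror e x) * (X' n (x \<bullet> e) * g x)))"
    by (simp add: mirror_inner[OF e] odd ev)
   have a: "(LBINT x. - (phi (mirror e x) * (X' n (x \<bullet> e) * g x))) = (LBINT x. phi x * (X' n (x \<bullet> e) * g x))"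
    using integral_orthogonal[OF mirror_orthogonal[OF e], of "\<lambda>x. phi x * (X' n (x \<bullet> e) * g x)"] unfolding eq by simp
   have b: "integ (\<lambda>x. - (phi (mirror e x) * (X' n (x \<bullet> e) * g x)))"
    using integrable_orthogonal[OF mirror_orthogonal[OF e] li[of n]] unfolding eq .
   have "(LBINT x. 1/2 * ((phi x - phi (mirror e x)) * X' n (x \<bullet> e) * g x))
    = (LBINT x. 1/2 * (phi x * (X' n (x \<bullet> e) * g x) + - (phi (mirror e x) * (X' n (x \<bullet> e) * g x))))"
    by (intro Lintegral_cong) (auto simp: algebra_simps)
   also have "\<dots> = 1/2 * ((LBINT x. phi x * (X' n (x \<bullet> e) * g x)) + (LBINT x. - (phi (mirror e x) * (X' n (x \<bullet> e) * g x))))"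
    by (simp only: integral_mult_right_zero Lintegral_add[OF li[of n] b])
   finally show ?thesis unfolding a by simp
  qed
  have pt: "\<bar>phi x - phi (mirror e x)\<bar> \<le> 2 * K * \<bar>x \<bullet> e\<bar>" for x
  proof -
   have "\<bar>phi x - phi (mirror e x)\<bar> \<le> K * norm (x - mirror e x)" by (rule K(2))
   also have "norm (x - mirror e x) = 2 * \<bar>x \<bullet> e\<bar>" using e by (simp add: mirror_def)
   finally show ?thesis by (simp add: mult_ac)
  qed
  have bd: "\<bar>(phi x - phi (mirror e x)) * X' n (x \<bullet> e)\<bar> \<le> 2 * K" for x n
  proof -
   have "\<bar>(phi x - phi (mirror e x)) * X' n (x \<bullet> e)\<bar> \<le> 2 * K * \<bar>x \<bullet> e\<bar> * X' n (x \<bullet> e)"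
    unfolding abs_mult using pt[of x] X'n[of n "x \<bullet> e"] by (intro mult_mono) auto
   also have "\<dots> \<le> 2 * K * 1" unfolding mult.assoc using tX[of "x \<bullet> e" n] K(1) by (intro mult_left_mono) auto
   finally show ?thesis by simp
  qed
  have z: "phi x - phi (mirror e x) = 0" if "norm x > R" for x using CR(3) that mirror_norm[OF e] by simp
  have "(\<lambda>n. LBINT x. 1/2 * ((phi x - phi (mirror e x)) * X' n (x \<bullet> e) * g x)) ~~> (\<integral>x. 0 \<partial>(lborel :: (real^2) measure))"
  proof (rule integral_dominated_convergence[where w="\<lambda>x. K * (indicator (cball 0 R) x * \<bar>g x\<bar>)"])
   show "integ (\<lambda>x. K * (indicator (cball 0 R) x * \<bar>g x\<bar>))"
    by (intro integrable_mult_right loc_int_cutoff loc_int_abs wderivD(1)[OF wi])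
   show "AE x in lborel. (\<lambda>n. 1/2 * ((phi x - phi (mirror e x)) * X' n (x \<bullet> e) * g x)) ~~> 0" (is "AE x in _. ?Q1 x")
   proof (rule AE_I2)
    fix x
    show "?Q1 x"
    proof (cases "x \<bullet> e = 0")
     case True then show ?thesis by (simp add: mirror_def)
    next
     case False
     have "(\<lambda>n. 1/2 * ((phi x - phi (mirror e x)) * X' n (x \<bullet> e) * g x)) ~~> 1/2 * ((phi x - phi (mirror e x)) * 0 * g x)"
      by (intro tendsto_intros X'lim False)
     then show ?thesis by simp
    qed
   qed
   show "AE x in lborel. norm (1/2 * ((phi x - phi (mirror e x)) * X' n (x \<bullet> e) * g x)) \<le> K * (indicator (cball 0 R) x * \<bar>g x\<bar>)" (is "AE x in _. ?Q2 x") for n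
   proof (rule AE_I2)
    fix x
    show "?Q2 x"
    proof (cases "norm x > R")
     case False
     have "norm (1/2 * ((phi x - phi (mirror e x)) * X' n (x \<bullet> e) * g x)) = 1/2 * (\<bar>(phi x - phi (mirror e x)) * X' n (x \<bullet> e)\<bar> * \<bar>g x\<bar>)"
      by (simp add: abs_mult)
     also have "\<dots> \<le> 1/2 * (2 * K * \<bar>g x\<bar>)" by (intro mult_left_mono mult_right_mono bd) auto
     finally show ?thesis using False by simp
    qed (simp add: z)
   qed
  qed measurable
  then show ?thesis unfolding fold by simp
 qed
 have "(\<lambda>n. LBINT x. partial i phi x * (X n (x \<bullet> e) * g x)) ~~> - (LBINT x. phi x * (sgn (x \<bullet> e) * G x $ i)) - e $ i * 0"
  unfolding id by (intro tendsto_intros lim2 lim3)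
 from LIMSEQ_unique[OF lim1 this]
 show "(LBINT x. partial i phi x * (sgn (x \<bullet> e) * g x)) = - (LBINT x. phi x * (sgn (x \<bullet> e) *\<^sub>R G x) $ i)"
  by simp
qed

section \<open>The energy space\<close>

definition XR :: "(real^2 \<Rightarrow> real) \<Rightarrow> bool" where
 "XR u \<longleftrightarrow> (\<exists>G. wgrad u G \<and> integ (\<lambda>x. (norm (G x))^2))
   \<and> integ (\<lambda>x. (u x)^2)
   \<and> integ (\<lambda>x. ln (1 + norm x) * (u x)^2)"

definition TR :: "(real^2 \<Rightarrow> real) \<Rightarrow> real" where
 "TR u = (LBINT x. (norm ((SOME G. wgrad u G) x))^2)"

text \<open>Weak gradients are unique up to null sets, so the choice made in \<open>TR\<close> is
  harmless and any weak gradient computes it.\<close>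

lemma TR_eq_AE:
 assumes "wgrad u G" "AE x in lborel. u x = v x" "v \<in> Bor"
 shows "TR v = (LBINT x. (norm (G x))^2)"
proof -
 have v: "wgrad v G" by (rule wgrad_cong_AE[OF assms])
 then have s: "wgrad v (SOME G. wgrad v G)" by (rule someI[where P="wgrad v"])
 note [measurable] = wgrad_borel(2)[OF v] wgrad_borel(2)[OF s]
 have ae: "AE x in lborel. (SOME G. wgrad v G) x = G x"
  using wgrad_unique[OF s v] by simp
 show ?thesis unfolding TR_def
  by (intro integral_cong_AE) (measurable, measurable, use ae in \<open>eventually_elim, simp\<close>)
qed

lemma TR_eq: "wgrad u G \<Longrightarrow> TR u = (LBINT x. (norm (G x))^2)"
 using TR_eq_AE[of u G u] wgrad_borel(1) by blast

lemma TR_nonneg: "TR u \<ge> 0"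
 unfolding TR_def by simp

lemma XR_E:
 assumes "XR u"
 obtains G where "wgrad u G" "integ (\<lambda>x. (norm (G x))^2)" "TR u = (LBINT x. (norm (G x))^2)"
proof -
 from assms obtain G where "wgrad u G \<and> integ (\<lambda>x. (norm (G x))^2)"
  unfolding XR_def by (elim conjE exE) simp
 then show thesis using that[of G] TR_eq[of u G] by simp
qed

lemma XR_D:
 assumes "XR u"
 shows "integ (\<lambda>x. (u x)^2)" "integ (\<lambda>x. ln (1 + norm x) * (u x)^2)" "u \<in> Bor"
 using assms wgrad_borel unfolding XR_def by blast+

lemma square_add_le: "((a::real) + b)^2 \<le> 2 * a\<^sup>2 + 2 * b\<^sup>2"
 using sum_squares_bound[of a b] by (simp add: power2_sum)

lemma norm_square_add_le: "(norm ((a::'a::real_inner) + b))^2 \<le> 2 * (norm a)^2 + 2 * (norm b)^2"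
proof -
 have "(norm (a + b))^2 \<le> (norm a + norm b)^2" by (intro power_mono norm_triangle_ineq) simp
 then show ?thesis using square_add_le[of "norm a" "norm b"] by linarith
qed

lemma XR_I:
 assumes "wgrad u G" "integ wG" "\<And>x. (norm (G x))^2 \<le> wG x"
  "integ wu" "\<And>x. (u x)^2 \<le> wu x" "integ (\<lambda>x. ln (1 + norm x) * wu x)"
 shows "XR u" "integ (\<lambda>x. (norm (G x))^2)" (is ?t1)
proof -
 note [measurable] = wgrad_borel[OF assms(1)]
 show ?t1
  by (rule Lintegrable_bound[OF assms(2)]) (use assms(3) in \<open>auto intro: order.trans[OF _ abs_ge_self]\<close>)
 moreover have "integ (\<lambda>x. (u x)^2)"
  by (rule Lintegrable_bound[OF assms(4)]) (use assms(5) in \<open>auto intro: order.trans[OF _ abs_ge_self]\<close>)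
 moreover have "integ (\<lambda>x. ln (1 + norm x) * (u x)^2)"
  by (rule Lintegrable_bound[OF assms(6)])
    (use assms(5) in \<open>auto simp: abs_mult intro!: mult_left_mono order.trans[OF _ abs_ge_self]\<close>)
 ultimately show "XR u" unfolding XR_def using assms(1) by blast
qed

lemma XR_add:
 assumes "XR u" "XR v"
 shows "XR (\<lambda>x. u x + v x)"
proof -
 obtain G where G: "wgrad u G" "integ (\<lambda>x. (norm (G x))^2)" using XR_E[OF assms(1)] .
 obtain H where H: "wgrad v H" "integ (\<lambda>x. (norm (H x))^2)" using XR_E[OF assms(2)] .
 show ?thesis
 proof (rule XR_I[OF wgrad_add[OF G(1) H(1)]])
  show "(norm (G x + H x))^2 \<le> 2 * (norm (G x))^2 + 2 * (norm (H x))^2" for x by (rule norm_square_add_le)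
  show "(u x + v x)^2 \<le> 2 * (u x)^2 + 2 * (v x)^2" for x by (rule square_add_le)
  have "integ (\<lambda>x. 2 * (ln (1 + norm x) * (u x)^2) + 2 * (ln (1 + norm x) * (v x)^2))"
   using XR_D(2)[OF assms(1)] XR_D(2)[OF assms(2)] by (intro Lintegrable_add integrable_mult_right)
  then show "integ (\<lambda>x. ln (1 + norm x) * (2 * (u x)^2 + 2 * (v x)^2))"
   by (simp add: algebra_simps)
 qed (use G H XR_D[OF assms(1)] XR_D[OF assms(2)] in auto)
qed

lemma XR_cmult:
 assumes "XR u"
 shows "XR (\<lambda>x. c * u x)" "TR (\<lambda>x. c * u x) = c\<^sup>2 * TR u" (is ?t1)
proof -
 obtain G where G: "wgrad u G" "integ (\<lambda>x. (norm (G x))^2)" "TR u = (LBINT x. (norm (G x))^2)"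
  using XR_E[OF assms] .
 have n: "(\<lambda>x. (norm (c *\<^sub>R G x))^2) = (\<lambda>x. c\<^sup>2 * (norm (G x))^2)" by (simp add: power_mult_distrib)
 show "XR (\<lambda>x. c * u x)" unfolding XR_def
  using wgrad_cmult[OF G(1), of c] G(2) XR_D[OF assms]
  by (auto simp: n power_mult_distrib mult.left_commute[of _ "c\<^sup>2"] intro!: exI[of _ "\<lambda>x. c *\<^sub>R G x"])
 show ?t1
  unfolding TR_eq[OF wgrad_cmult[OF G(1), of c]] G(3) n by simp
qed

lemma XR_abs:
 assumes "XR u"
 shows "XR (\<lambda>x. \<bar>u x\<bar>)" (is ?t1) "TR (\<lambda>x. \<bar>u x\<bar>) \<le> TR u" (is ?t2)
proof -
 obtain G where G: "wgrad u G" "integ (\<lambda>x. (norm (G x))^2)" "TR u = (LBINT x. (norm (G x))^2)"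
  using XR_E[OF assms] .
 have le: "(norm (sgn (u x) *\<^sub>R G x))^2 \<le> (norm (G x))^2" for x by (simp add: sgn_real_def)
 note * = XR_I[OF wgrad_abs[OF G(1)] G(2) le XR_D(1)[OF assms] _ XR_D(2)[OF assms]]
 show ?t1 using * by simp
 have i: "integ (\<lambda>x. (norm (sgn (u x) *\<^sub>R G x))^2)" using *(2) by simp
 show ?t2 unfolding TR_eq[OF wgrad_abs[OF G(1)]] G(3)
  by (rule integral_mono[OF i G(2) le])
qed

lemma TR_parallelogram:
 assumes "XR u" "XR v"
 shows "TR (\<lambda>x. u x + v x) + TR (\<lambda>x. u x - v x) = 2 * TR u + 2 * TR v"
proof -
 obtain G where G: "wgrad u G" "integ (\<lambda>x. (norm (G x))^2)" "TR u = (LBINT x. (norm (G x))^2)" using XR_E[OF assms(1)] .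
 obtain H where H: "wgrad v H" "integ (\<lambda>x. (norm (H x))^2)" "TR v = (LBINT x. (norm (H x))^2)" using XR_E[OF assms(2)] .
 note [measurable] = wgrad_borel[OF G(1)] wgrad_borel[OF H(1)]
 have w: "integ (\<lambda>x. 2 * (norm (G x))^2 + 2 * (norm (H x))^2)" using G(2) H(2) by auto
 have i1: "integ (\<lambda>x. (norm (G x + H x))^2)"
  by (rule Lintegrable_bound[OF w]) (auto intro!: norm_square_add_le)
 have i2: "integ (\<lambda>x. (norm (G x - H x))^2)"
  by (rule Lintegrable_bound[OF w]) (auto intro!: norm_square_add_le[of _ "- _", simplified])
 have "(norm (G x + H x))^2 + (norm (G x - H x))^2 = 2 * (norm (G x))^2 + 2 * (norm (H x))^2" for x
  by (simp add: power2_norm_eq_inner inner_simps)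
 then have "(LBINT x. (norm (G x + H x))^2) + (LBINT x. (norm (G x - H x))^2) = (LBINT x. 2 * (norm (G x))^2 + 2 * (norm (H x))^2)"
  using Lintegral_add[OF i1 i2] by simp
 then show ?thesis
  unfolding TR_eq[OF wgrad_add[OF G(1) H(1)]] TR_eq[OF wgrad_diff[OF G(1) H(1)]] G(3) H(3) using G(2) H(2) by simp
qed

subsection \<open>Radial integration\<close>

text \<open>The minus sign makes the preimages of the upper half-lines, on which measures are
  compared, into balls; for the area itself they would be complements of balls, of infinite
  measure.\<close>

lemma distr_neg_area:
 "distr lborel borel (\<lambda>x::real^2. - (area x)) = density lborel (\<lambda>a. indicator {..0} a)"
proof (rule measure_eqI_lessThan)
 have ball: "emeasure (distr lborel borel (\<lambda>x::real^2. - (area x))) {a<..} = ennreal (if a < 0 then - a else 0)" for a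
 proof -
  have "(\<lambda>x::real^2. - (area x)) -` {a<..} = (if a < 0 then ball 0 (sqrt (- a / pi)) else {})"
  proof (cases "a < 0")
   case True
   have "a < - (area x) \<longleftrightarrow> norm x < sqrt (- a / pi)" for x :: "real^2"
   proof -
    have "a < - (area x) \<longleftrightarrow> (norm x)\<^sup>2 < - a / pi" by (simp add: field_simps) linarith
    also have "\<dots> \<longleftrightarrow> norm x < sqrt (- a / pi)"
     by (metis norm_ge_zero real_sqrt_less_iff real_sqrt_unique)
    finally show ?thesis .
   qed
   then show ?thesis using True by (auto simp: set_eq_iff)
  next
   case False
   have "\<not> a < - (area x)" for x :: "real^2"
   proof -
    have "0 \<le> pi * (norm x)^2" by simp
    then show ?thesis using False by linarith
   qed
   then show ?thesis using False by auto
  qed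
  moreover have "emeasure lborel (ball (0::real^2) (sqrt (- a / pi))) = ennreal (- a)" if "a < 0"
   using that by (subst emeasure_ball) (auto simp: eval_unit_ball_vol divide_nonpos_pos)
  ultimately show ?thesis
   by (subst emeasure_distr) auto
 qed
 show "emeasure (distr lborel borel (\<lambda>x::real^2. - (area x))) {a<..} < \<infinity>" for a
  unfolding ball by simp
 show "emeasure (distr lborel borel (\<lambda>x::real^2. - (area x))) {a<..} = emeasure (density lborel (\<lambda>a. indicator {..0} a)) {a<..}" for a
 proof -
  have "{..0} \<inter> {a<..} = {a<..0::real}" by auto
  then show ?thesis unfolding ball
   by (subst emeasure_density) (auto simp: indicator_inter_arith[symmetric])
 qed
qed auto

text \<open>In the area variable the polar Jacobian disappears: the plane is carried to the
  half-line with its own Lebesgue measure.\<close>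

lemma
 fixes F :: "real \<Rightarrow> real"
 assumes [measurable]: "F \<in> Bor"
 shows integral_radial: "(LBINT x. F (area (x::real^2))) = (LBINT a. indicator {0..} a * F a)" (is ?t1)
  and integrable_radial: "integ (\<lambda>x::real^2. F (area x)) \<longleftrightarrow> integ (\<lambda>a. indicator {0..} a * F a)" (is ?t2)
proof -
 have eq: "density lborel (\<lambda>a::real. indicator {..0} a) = density lborel (\<lambda>a. ennreal (indicator {..0} a))"
  by (simp add: ennreal_indicator)
 have fl: "(\<lambda>a. indicator {..0} (- a) * F (- (- a))) = (\<lambda>a. indicator {0..} a * F a)" by (auto simp: indicator_def)
 have "(LBINT x. F (area (x::real^2))) = (\<integral>a. F (- a) \<partial>distr lborel borel (\<lambda>x::real^2. - (area x)))"
  by (subst integral_distr) auto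
 also have "\<dots> = (LBINT a. indicator {..0} a * F (- a))"
  unfolding distr_neg_area eq by (subst integral_density) auto
 also have "\<dots> = (LBINT a. indicator {..0} (- a) * F (- (- a)))"
  using lborel_integral_real_affine[of "-1" "\<lambda>a. indicator {..0} a * F (- a)" 0] by simp
 finally show ?t1
  unfolding fl .
 have "integ (\<lambda>x::real^2. F (area x)) \<longleftrightarrow> integrable (distr lborel borel (\<lambda>x::real^2. - (area x))) (\<lambda>a. F (- a))"
  by (subst integrable_distr_eq) auto
 also have "\<dots> \<longleftrightarrow> integ (\<lambda>a. indicator {..0} a * F (- a))"
  unfolding distr_neg_area eq by (subst integrable_density) auto
 also have "\<dots> \<longleftrightarrow> integ (\<lambda>a. indicator {..0} (- a) * F (- (- a)))"
  using lborel_integrable_real_affine_iff[of "-1" "\<lambda>a. indicator {..0} a * F (- a)" 0] by simp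
 finally show ?t2
  unfolding fl .
qed

lemma gaussian_integral:
 assumes "t > 0"
 shows "integ (\<lambda>x::real^2. exp (- t * (norm x)^2))" (is ?t1) "(LBINT x. exp (- t * (norm (x::real^2))^2)) = pi / t" (is ?t2)
proof -
 have D: "((\<lambda>a. - (pi / t) * exp (- (t / pi) * a)) has_real_derivative exp (- (t / pi) * a)) (at a)" for a
  using assms by (auto intro!: derivative_eq_intros simp: field_simps)
 have lim: "((\<lambda>a. - (pi / t) * exp (- (t / pi) * a)) \<longlongrightarrow> 0) at_top"
  using assms by real_asymp
 have "(\<integral>\<^sup>+a. ennreal (exp (- (t / pi) * a)) * indicator {0..} a \<partial>lborel) = ennreal (0 - - (pi / t) * exp (- (t / pi) * 0))"
  by (rule nn_integral_FTC_atLeast[OF _ D _ lim]) auto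
 then have "has_bochner_integral lborel (\<lambda>a. exp (- (t / pi) * a) * indicator {0..} a) (pi / t)"
  using assms by (intro has_bochner_integral_nn_integral) (auto simp: ennreal_mult' ennreal_indicator)
 then have h: "has_bochner_integral lborel (\<lambda>a. indicator {0..} a * exp (- (t / pi) * a)) (pi / t)"
  by (simp add: mult.commute)
 have eq: "(\<lambda>x::real^2. exp (- t * (norm x)^2)) = (\<lambda>x. exp (- (t / pi) * (area x)))" by simp
 show ?t1
  unfolding eq using integrable_radial[of "\<lambda>a. exp (- (t / pi) * a)"] h by (auto simp: has_bochner_integral_iff)
 show ?t2
  unfolding eq using integral_radial[of "\<lambda>a. exp (- (t / pi) * a)"] h by (auto simp: has_bochner_integral_iff)
qed

subsection \<open>A Hardy inequality\<close>

text \<open>The factor \<open>5/4\<close> compensates \<open>smooth_step 2 = 4/5\<close>, so that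
  the cutoffs tend to 1 at every point.\<close>

definition cutoff :: "nat \<Rightarrow> real^2 \<Rightarrow> real" where
 "cutoff n x = 5/4 * smooth_step (2 - (x \<bullet> x) / (real (Suc n))^2)"

lemma cutoff_c1: "c1 (cutoff n) (\<lambda>x. (- (5/2) * smooth_step' (2 - (x \<bullet> x) / (real (Suc n))^2) / (real (Suc n))^2) *\<^sub>R x)"
proof -
 have 1: "c1 (\<lambda>x. 2 - (x \<bullet> x) / (real (Suc n))^2) (\<lambda>x. (-1 / (real (Suc n))^2) *\<^sub>R (2 *\<^sub>R x))"
  using c1_add[OF c1_const[of 2] c1_cmult[OF c1_norm_square, of "-1 / (real (Suc n))^2"]] by simp
 show ?thesis
  using c1_cmult[OF c1_compose[OF 1 smooth_step_DERIV smooth_step'_continuous], of "5/4"]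
  unfolding cutoff_def by simp
qed

lemma cutoff_bound: "0 \<le> cutoff n x" "cutoff n x \<le> 5/4"
 unfolding cutoff_def using smooth_step_nonneg smooth_step_le_1 by auto

lemma cutoff_support: "norm x > 2 * real (Suc n) \<Longrightarrow> cutoff n x = 0"
proof -
 assume a: "norm x > 2 * real (Suc n)"
 have "(2 * real (Suc n))^2 < (norm x)\<^sup>2" using a by (intro power_strict_mono) auto
 then have "4 * (real (Suc n))^2 < x \<bullet> x" by (simp add: power2_norm_eq_inner power_mult_distrib del: of_nat_Suc)
 then have "2 * (real (Suc n))^2 < x \<bullet> x" using zero_le_power2[of "real (Suc n)"] by linarith
 then have "2 - (x \<bullet> x) / (real (Suc n))^2 \<le> 0" by (simp add: field_simps)
 then show ?thesis by (simp add: cutoff_def smooth_step_def)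
qed

lemma inner_div_Suc_lim: "(\<lambda>n. c / (real (Suc n))^2) ~~> 0"
 by real_asymp

lemma cutoff_lim: "(\<lambda>n. cutoff n x) ~~> 1"
proof -
 have "isCont smooth_step 2" using smooth_step_DERIV DERIV_isCont by blast
 moreover have "(\<lambda>n. 2 - (x \<bullet> x) / (real (Suc n))^2) ~~> 2 - 0" by (intro tendsto_intros inner_div_Suc_lim)
 ultimately have "(\<lambda>n. smooth_step (2 - (x \<bullet> x) / (real (Suc n))^2)) ~~> smooth_step 2"
  using isCont_tendsto_compose[of 2 smooth_step] by (metis diff_zero)
 then have "(\<lambda>n. 5/4 * smooth_step (2 - (x \<bullet> x) / (real (Suc n))^2)) ~~> 5/4 * smooth_step 2" by (intro tendsto_intros)
 then show ?thesis by (simp add: cutoff_def smooth_step_def)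
qed

lemma smooth_step'_bound: "0 \<le> smooth_step' t" "smooth_step' t \<le> 1"
proof -
 show "0 \<le> smooth_step' t" by (simp add: smooth_step'_def)
 have "2 * t \<le> 1 + t\<^sup>2" using sum_squares_bound[of 1 t] by simp
 also have "1 + t\<^sup>2 \<le> (1 + t\<^sup>2)^2" by (rule self_le_power) auto
 finally show "smooth_step' t \<le> 1" using one_plus_square_pos[of t] by (simp add: smooth_step'_def divide_le_eq)
qed

lemma cutoff_partial_bound:
 "\<bar>partial i (cutoff n) x\<bar> \<le> 5 / real (Suc n)"
proof (cases "norm x > 2 * real (Suc n)")
 case True
 have "(2 * real (Suc n))^2 < (norm x)\<^sup>2" using True by (intro power_strict_mono) auto
 then have "4 * (real (Suc n))^2 < x \<bullet> x" by (simp add: power2_norm_eq_inner power_mult_distrib del: of_nat_Suc)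
 then have "2 * (real (Suc n))^2 < x \<bullet> x" using zero_le_power2[of "real (Suc n)"] by linarith
 then have "smooth_step' (2 - (x \<bullet> x) / (real (Suc n))^2) = 0" by (simp add: smooth_step'_def field_simps)
 then show ?thesis using c1_partial[OF cutoff_c1, of i n x] by simp
next
 case False
 have "\<bar>x $ i\<bar> \<le> 2 * real (Suc n)" using component_le_norm_cart[of x i] False by linarith
 then have "smooth_step' (2 - (x \<bullet> x) / (real (Suc n))^2) * \<bar>x $ i\<bar> \<le> 1 * (2 * real (Suc n))"
  using smooth_step'_bound[of "2 - (x \<bullet> x) / (real (Suc n))^2"] by (intro mult_mono) auto
 then have "5/2 * (smooth_step' (2 - (x \<bullet> x) / (real (Suc n))^2) * \<bar>x $ i\<bar>) / (real (Suc n))^2 \<le> 5/2 * (1 * (2 * real (Suc n))) / (real (Suc n))^2"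
  by (intro divide_right_mono mult_left_mono) auto
 also have "\<dots> = 5 / real (Suc n)" by (simp add: power2_eq_square del: of_nat_Suc)
 finally show ?thesis
  using c1_partial[OF cutoff_c1, of i n x] smooth_step'_bound(1)[of "2 - (x \<bullet> x) / (real (Suc n))^2"]
  by (simp add: abs_mult)
qed

lemma cutoff_test_fn: "test_fn (cutoff n)"
proof (rule c1_imp_test_fn[OF cutoff_c1])
 show "bounded {x. cutoff n x \<noteq> 0}"
  by (rule bounded_subset[OF bounded_cball[of 0 "2 * real (Suc n)"]])
    (use cutoff_support in \<open>force simp: not_less[symmetric]\<close>)
qed

text \<open>Integrability of \<open>h\<close> and \<open>k\<close> takes the place of the bounded
  support of a test function: the partial derivatives of the cutoffs are at most
  \<open>5 / (n + 1)\<close> and drop out in the limit.\<close>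

lemma wderiv_bounded_test:
 fixes p :: "real^2 \<Rightarrow> real^2"
 assumes w: "wderiv i h k" and ih: "integ h" "integ k"
  and f: "c1 f p" "\<And>x. \<bar>f x\<bar> \<le> C" "\<And>x. \<bar>p x $ i\<bar> \<le> C"
 shows "(LBINT x. p x $ i * h x) = - (LBINT x. f x * k x)"
proof -
 note [measurable] = wderiv_borel[OF w] c1_borel[OF f(1)] test_fn_borel[OF cutoff_test_fn] partial_borel[OF cutoff_test_fn]
 have [measurable]: "(\<lambda>x. p x $ i) \<in> Bor"
  by (intro borel_measurable_continuous_onI continuous_on_component c1_continuous_gradient[OF f(1)])
 have C: "C \<ge> 0" using f(2)[of 0] by linarith
 have id: "(LBINT x. (cutoff n x * p x $ i + f x * partial i (cutoff n) x) * h x) = - (LBINT x. cutoff n x * f x * k x)" for n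
  using wderivD(3)[OF w test_fn_mult_c1(1)[OF cutoff_test_fn f(1)]]
  unfolding test_fn_mult_c1(2)[OF cutoff_test_fn f(1)] .
 have p0: "(\<lambda>n. partial i (cutoff n) x) ~~> 0" for x
 proof (rule Lim_null_comparison[OF always_eventually])
  show "\<forall>n. norm (partial i (cutoff n) x) \<le> 5 / real (Suc n)" using cutoff_partial_bound by simp
  show "(\<lambda>n. 5 / real (Suc n)) ~~> 0" by real_asymp
 qed
 have pb: "\<bar>partial i (cutoff n) x\<bar> \<le> 5" for n x
  using cutoff_partial_bound[of i n x] by (rule order.trans) (simp add: divide_le_eq)
 have 1: "(\<lambda>n. LBINT x. (cutoff n x * p x $ i + f x * partial i (cutoff n) x) * h x) ~~> (LBINT x. p x $ i * h x)"
 proof (rule integral_dominated_convergence[where w="\<lambda>x. 10 * C * \<bar>h x\<bar>"])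
  show "AE x in lborel. (\<lambda>n. (cutoff n x * p x $ i + f x * partial i (cutoff n) x) * h x) ~~> p x $ i * h x" (is "AE x in _. ?Q1 x")
  proof (rule AE_I2)
   fix x
   have "(\<lambda>n. (cutoff n x * p x $ i + f x * partial i (cutoff n) x) * h x) ~~> (1 * p x $ i + f x * 0) * h x"
    by (intro tendsto_intros cutoff_lim p0)
   then show "?Q1 x" by simp
  qed
  show "AE x in lborel. norm ((cutoff n x * p x $ i + f x * partial i (cutoff n) x) * h x) \<le> 10 * C * \<bar>h x\<bar>" (is "AE x in _. ?Q2 x") for n
  proof (rule AE_I2)
   fix x
   have "\<bar>cutoff n x * p x $ i\<bar> \<le> 5/4 * C" unfolding abs_mult
    using cutoff_bound[of n x] f(3)[of x] C by (intro mult_mono) auto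
   moreover have "\<bar>f x * partial i (cutoff n) x\<bar> \<le> C * 5" unfolding abs_mult
    using f(2)[of x] pb[of n x] C by (intro mult_mono) auto
   ultimately have "\<bar>cutoff n x * p x $ i + f x * partial i (cutoff n) x\<bar> \<le> 10 * C" using C by linarith
   then show "?Q2 x"
    by (simp add: abs_mult mult_right_mono)
  qed
 qed (use ih in auto)
 have 2: "(\<lambda>n. LBINT x. cutoff n x * f x * k x) ~~> (LBINT x. f x * k x)"
 proof (rule integral_dominated_convergence[where w="\<lambda>x. 2 * C * \<bar>k x\<bar>"])
  show "AE x in lborel. (\<lambda>n. cutoff n x * f x * k x) ~~> f x * k x" (is "AE x in _. ?Q3 x")
  proof (rule AE_I2)
   fix x
   have "(\<lambda>n. cutoff n x * f x * k x) ~~> 1 * f x * k x" by (intro tendsto_intros cutoff_lim)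
   then show "?Q3 x" by simp
  qed
  show "AE x in lborel. norm (cutoff n x * f x * k x) \<le> 2 * C * \<bar>k x\<bar>" (is "AE x in _. ?Q4 x") for n
  proof (rule AE_I2)
   fix x
   have "\<bar>cutoff n x * f x\<bar> \<le> 5/4 * C" unfolding abs_mult
    using cutoff_bound[of n x] f(2)[of x] C by (intro mult_mono) auto
   then have "\<bar>cutoff n x * f x\<bar> \<le> 2 * C" using C by linarith
   then show "?Q4 x" by (simp add: abs_mult mult_right_mono)
  qed
 qed (use ih in auto)
 have "(\<lambda>n. LBINT x. (cutoff n x * p x $ i + f x * partial i (cutoff n) x) * h x) ~~> - (LBINT x. f x * k x)"
  unfolding id by (intro tendsto_intros 2)
 from LIMSEQ_unique[OF 1 this] show ?thesis .
qed

lemma young_ineq: "(s::real) > 0 \<Longrightarrow> 2 * (a * b) \<le> s * a\<^sup>2 + b\<^sup>2 / s"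
proof -
 assume s: "s > 0"
 have "0 \<le> (s * a - b)^2 / s" using s by simp
 also have "\<dots> = s * a\<^sup>2 + b\<^sup>2 / s - 2 * (a * b)" using s by (simp add: power2_eq_square field_simps)
 finally show ?thesis by simp
qed

lemma integrable_product_square:
 fixes u g :: "'a::euclidean_space \<Rightarrow> real"
 assumes [measurable]: "u \<in> Bor" "g \<in> Bor"
  and "integ (\<lambda>x. (u x)^2)" "integ (\<lambda>x. (g x)^2)"
 shows "integ (\<lambda>x. u x * g x)"
proof (rule Lintegrable_bound)
 show "integ (\<lambda>x. (u x)^2 + (g x)^2)" using assms by auto
 show "AE x in lborel. norm (u x * g x) \<le> norm ((u x)^2 + (g x)^2)" (is "AE x in _. ?Q1 x")
 proof (rule AE_I2)
  fix x
  have "2 * (\<bar>u x\<bar> * \<bar>g x\<bar>) \<le> (u x)^2 + (g x)^2" using young_ineq[of 1 "\<bar>u x\<bar>" "\<bar>g x\<bar>"] by simp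
  moreover have "0 \<le> \<bar>u x\<bar> * \<bar>g x\<bar>" by simp
  ultimately have "\<bar>u x\<bar> * \<bar>g x\<bar> \<le> (u x)^2 + (g x)^2" by linarith
  then show "?Q1 x" by (simp add: abs_mult)
 qed
qed simp

lemma component_square_integrable:
 fixes G :: "real^2 \<Rightarrow> real^2"
 assumes "wgrad u G" "integ (\<lambda>x. (norm (G x))^2)"
 shows "integ (\<lambda>x. (G x $ i)^2)"
proof (rule Lintegrable_bound[OF assms(2)])
 note [measurable] = wderiv_borel(2)[OF wgradD[OF assms(1), of i]]
 show "(\<lambda>x. (G x $ i)^2) \<in> borel_measurable lborel" by measurable
 show "AE x in lborel. norm ((G x $ i)^2) \<le> norm ((norm (G x))^2)"
  using component_le_norm_cart[of "G _" i] by (intro AE_I2) (simp add: abs_le_square_iff[symmetric])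
qed

text \<open>In the plane the unit field \<open>x / \<bar>x\<bar>\<close> has divergence
  \<open>1 / \<bar>x\<bar>\<close>. Integrating \<open>u^2\<close> against it by parts leaves at
  most twice the integral of \<open>\<bar>u\<bar>\<close> times the length of its gradient, which
  Young's inequality splits with the free weight \<open>s\<close>.\<close>

lemma hardy_origin:
 assumes X: "XR u" and s: "s > 0"
 shows "integ (\<lambda>x. (u x)^2 / norm x)" (is ?t1)
  and "(LBINT x. (u x)^2 / norm x) \<le> s * (LBINT x. (u x)^2) + TR u / s" (is ?t2)
proof -
 obtain G where G: "wgrad u G" "integ (\<lambda>x. (norm (G x))^2)" "TR u = (LBINT x. (norm (G x))^2)" using XR_E[OF X] .
 note [measurable] = wgrad_borel[OF G(1)]
 have Gm[measurable]: "(\<lambda>x. G x $ i) \<in> Bor" for i by (rule wderiv_borel(2)[OF wgradD[OF G(1)]])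
 have iuG: "integ (\<lambda>x. u x * G x $ i)" for i
  by (rule integrable_product_square[OF _ _ XR_D(1)[OF X] component_square_integrable[OF G(1,2)]]) auto
 have wsq: "wderiv i (\<lambda>x. (u x)^2) (\<lambda>x. 2 * (u x * G x $ i))" for i
  by (rule wderiv_square[OF wgradD[OF G(1)] integrable_imp_loc_int[OF XR_D(1)[OF X]] integrable_imp_loc_int[OF iuG]])
 define B where "B = s * (LBINT x. (u x)^2) + TR u / s"
 define eps where "eps n = 1 / real (Suc n)" for n
 have ep: "eps n > 0" for n by (auto simp: eps_def)
 have e0: "eps ~~> 0" unfolding eps_def by (rule LIMSEQ_Suc[OF lim_1_over_n])
 \<comment> \<open>The regularised distance makes the field \<open>x / r\<close> continuously
   differentiable at the origin.\<close>
 define r where "r n x = sqrt (x \<bullet> x + eps n)" for n and x :: "real^2"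
 have rp: "r n x > 0" and r2: "(r n x)^2 = x \<bullet> x + eps n" for n x
  unfolding r_def using ep[of n] by (auto simp: add_nonneg_pos add_nonneg_nonneg less_imp_le)
 have rx: "norm x \<le> r n x" for n x
  unfolding r_def using ep[of n] by (intro real_le_rsqrt) (simp add: power2_norm_eq_inner)
 have rm[measurable]: "r n \<in> Bor" for n unfolding r_def by measurable
 have c_inv: "c1 (\<lambda>x. 1 / r n x) (\<lambda>x. (- 1 / (r n x)^3) *\<^sub>R x)" for n
  unfolding c1_def
 proof (intro conjI allI)
  fix x
  have D: "((\<lambda>t. 1 / sqrt t) has_real_derivative - 1 / (2 * (r n x)^3)) (at (x \<bullet> x + eps n))"
  proof -
   have "x \<bullet> x + eps n > 0" using ep[of n] by (simp add: add_nonneg_pos)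
   moreover have "sqrt (x \<bullet> x + eps n) = r n x" by (simp add: r_def)
   ultimately show ?thesis using rp[of n x]
    by (auto intro!: derivative_eq_intros simp: field_simps power3_eq_cube)
  qed
  have "((\<lambda>x. x \<bullet> x + eps n) has_derivative (\<lambda>h. (2 *\<^sub>R x) \<bullet> h)) (at x)"
   using c1_derivative[OF c1_add[OF c1_norm_square c1_const[of "eps n"]]] by simp
  from has_derivative_compose[OF this D[unfolded has_field_derivative_def]]
  have "((\<lambda>x. 1 / sqrt (x \<bullet> x + eps n)) has_derivative (\<lambda>h. - 1 / (2 * (r n x)^3) * ((2 *\<^sub>R x) \<bullet> h))) (at x)" .
  moreover have "(\<lambda>h. - 1 / (2 * (r n x)^3) * ((2 *\<^sub>R x) \<bullet> h)) = (\<lambda>h. ((- 1 / (r n x)^3) *\<^sub>R x) \<bullet> h)" by auto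
  ultimately show "((\<lambda>x. 1 / r n x) has_derivative (\<lambda>h. ((- 1 / (r n x)^3) *\<^sub>R x) \<bullet> h)) (at x)"
   unfolding r_def by simp
 next
  show "continuous_on UNIV (\<lambda>x. (- 1 / (r n x)^3) *\<^sub>R x)"
   using rp[of n] unfolding r_def by (intro continuous_intros) (auto simp: less_le)
 qed
 have cF: "c1 (\<lambda>x. x $ i * (1 / r n x)) (\<lambda>x. (x $ i) *\<^sub>R ((- 1 / (r n x)^3) *\<^sub>R x) + (1 / r n x) *\<^sub>R axis i 1)" for i n
  by (rule c1_mult[OF c1_component c_inv])
 have xr: "\<bar>x $ i\<bar> \<le> r n x" for x i n
  using component_le_norm_cart[of x i] rx[of x n] by linarith
 define q where "q i n x = (1 / r n x) * (1 - (x $ i)\<^sup>2 / (r n x)^2)" for i :: 2 and n x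
 have qeq: "((x $ i) *\<^sub>R ((- 1 / (r n x)^3) *\<^sub>R x) + (1 / r n x) *\<^sub>R axis i 1) $ i = q i n x" for x i n
  using rp[of n x] by (simp add: q_def field_simps power2_eq_square power3_eq_cube axis_def)
 have q01: "0 \<le> 1 - (x $ i)\<^sup>2 / (r n x)^2" "1 - (x $ i)\<^sup>2 / (r n x)^2 \<le> 1" for x i n
  using xr[of x i n] rp[of n x] by (auto simp: divide_le_eq abs_le_square_iff[symmetric])
 have rmin: "1 / r n x \<le> 1 / sqrt (eps n)" for n x
  unfolding r_def using ep[of n] by (intro divide_left_mono) (auto intro!: mult_pos_pos add_nonneg_pos)
 have rmin0: "0 \<le> 1 / r n x" for n x using rp[of n x] by simp
 have qb: "0 \<le> q i n x" "q i n x \<le> 1 / sqrt (eps n)" (is ?t3) for i n x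
 proof -
  show "0 \<le> q i n x" unfolding q_def using rp[of n x] q01[where x=x and i=i and n=n] by simp
  have "q i n x \<le> 1 / r n x * 1" unfolding q_def using q01[where x=x and i=i and n=n] rmin0[of n x] by (intro mult_left_mono) auto
  then show ?t3 using rmin[of n x] by linarith
 qed
 have qm[measurable]: "q i n \<in> Bor" for i n unfolding q_def by measurable
 have bnd: "\<bar>x $ i * (1 / r n x)\<bar> \<le> 1" for x i n
  using xr[of x i n] rp[of n x] by (simp add: abs_mult divide_le_eq)
 have key: "(LBINT x. q i n x * (u x)^2) = - (LBINT x. (x $ i * (1 / r n x)) * (2 * (u x * G x $ i)))" for i n
 proof -
  have "(LBINT x. ((x $ i) *\<^sub>R ((- 1 / (r n x)^3) *\<^sub>R x) + (1 / r n x) *\<^sub>R axis i 1) $ i * (u x)^2)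
    = - (LBINT x. (x $ i * (1 / r n x)) * (2 * (u x * G x $ i)))"
  proof (rule wderiv_bounded_test[OF wsq XR_D(1)[OF X] integrable_mult_right[OF iuG] cF, where C="1 + 1 / sqrt (eps n)"])
   have sp: "0 < sqrt (eps n)" using ep by simp
   show "\<bar>x $ i * (1 / r n x)\<bar> \<le> 1 + 1 / sqrt (eps n)" for x
    using bnd[where x=x and i=i and n=n] sp by (smt (verit) zero_less_divide_1_iff)
   show "\<bar>((x $ i) *\<^sub>R ((- 1 / (r n x)^3) *\<^sub>R x) + (1 / r n x) *\<^sub>R axis i 1) $ i\<bar> \<le> 1 + 1 / sqrt (eps n)" for x
    unfolding qeq using qb[where x=x and i=i and n=n] by simp
  qed
  then show ?thesis unfolding qeq .
 qed
 have iq: "integ (\<lambda>x. q i n x * (u x)^2)" for i n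
 proof (rule Lintegrable_bound[OF integrable_mult_right[OF XR_D(1)[OF X], of "1 / sqrt (eps n)"]])
  show "AE x in lborel. norm (q i n x * (u x)^2) \<le> norm (1 / sqrt (eps n) * (u x)^2)" (is "AE x in _. ?Q1 x")
  proof (rule AE_I2)
   fix x
   have "\<bar>q i n x\<bar> \<le> \<bar>1 / sqrt (eps n)\<bar>" using qb[of i n x] by linarith
   then show "?Q1 x"
    unfolding real_norm_def abs_mult by (rule mult_right_mono) simp
  qed
 qed measurable
 have ii: "integ (\<lambda>x. (x $ i * (1 / r n x)) * (2 * (u x * G x $ i)))" for i n
 proof (rule Lintegrable_bound[OF integrable_mult_right[OF iuG[of i], of 2]])
  show "AE x in lborel. norm ((x $ i * (1 / r n x)) * (2 * (u x * G x $ i))) \<le> norm (2 * (u x * G x $ i))"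
   unfolding norm_mult[of "_ $ i * (1 / r n _)"] using bnd by (intro AE_I2 mult_left_le_one_le) (auto simp: abs_mult)
 qed measurable
 have sq: "(\<Sum>i\<in>UNIV. (x $ i)^2) = x \<bullet> x" for x :: "real^2" by (simp add: inner_vec_def power2_eq_square)
 have main: "(LBINT x. (u x)^2 / r n x) \<le> B \<and> integ (\<lambda>x. (u x)^2 / r n x)" for n
 proof
  have lower: "(u x)^2 / r n x \<le> (\<Sum>i\<in>UNIV. q i n x * (u x)^2)" for x
  proof -
   have "(\<Sum>i\<in>UNIV. q i n x) = (1 / r n x) * (2 - (x \<bullet> x) / (r n x)^2)"
    unfolding q_def sum_distrib_left[symmetric] sum_subtractf sum_divide_distrib[symmetric] sq by simp
   moreover have "(x \<bullet> x) / (r n x)^2 \<le> 1" using r2[of n x] ep[of n] rp[of n x] by (subst divide_le_eq_1_pos) (auto simp: add_nonneg_pos)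
   then have "(1 / r n x) * 1 \<le> (1 / r n x) * (2 - (x \<bullet> x) / (r n x)^2)"
    using rmin0[of n x] by (intro mult_left_mono) auto
   ultimately have "(1 / r n x) * (u x)^2 \<le> (\<Sum>i\<in>UNIV. q i n x) * (u x)^2" by (intro mult_right_mono) auto
   then show ?thesis by (simp add: sum_distrib_right)
  qed
  show iL: "integ (\<lambda>x. (u x)^2 / r n x)"
  proof (rule Lintegrable_bound[OF Lintegrable_sum[OF iq]])
   show "AE x in lborel. norm ((u x)^2 / r n x) \<le> norm (\<Sum>i\<in>UNIV. q i n x * (u x)^2)"
    using lower rp[of n] by (intro AE_I2) (auto simp: less_imp_le intro: order.trans[OF _ abs_ge_self])
  qed measurable
  have "(LBINT x. (u x)^2 / r n x) \<le> (LBINT x. (\<Sum>i\<in>UNIV. q i n x * (u x)^2))"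
   by (rule integral_mono[OF iL Lintegrable_sum[OF iq] lower])
  also have "\<dots> = (\<Sum>i\<in>UNIV. (LBINT x. q i n x * (u x)^2))"
   by (rule Lintegral_sum[OF iq])
  also have "\<dots> = - (LBINT x. (\<Sum>i\<in>UNIV. (x $ i * (1 / r n x)) * (2 * (u x * G x $ i))))"
   unfolding key sum_negf Lintegral_sum[OF ii] ..
  also have "\<dots> = (LBINT x. - (\<Sum>i\<in>UNIV. (x $ i * (1 / r n x)) * (2 * (u x * G x $ i))))" by simp
  also have "\<dots> \<le> (LBINT x. s * (u x)^2 + (norm (G x))^2 / s)"
  proof (rule integral_mono)
   show "integ (\<lambda>x. - (\<Sum>i\<in>UNIV. (x $ i * (1 / r n x)) * (2 * (u x * G x $ i))))"
    by (rule integrable_minus[OF Lintegrable_sum[OF ii]])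
   show "integ (\<lambda>x. s * (u x)^2 + (norm (G x))^2 / s)" using G(2) XR_D(1)[OF X] by auto
   fix x
   have "- (\<Sum>i\<in>UNIV. (x $ i * (1 / r n x)) * (2 * (u x * G x $ i))) = 2 * (- u x * ((x \<bullet> G x) / r n x))"
    by (simp add: inner_vec_def sum_distrib_left sum_divide_distrib sum_negf[symmetric] mult_ac)
   also have "\<dots> \<le> 2 * (\<bar>u x\<bar> * norm (G x))"
   proof -
    have "\<bar>x \<bullet> G x\<bar> \<le> norm x * norm (G x)" by (rule Cauchy_Schwarz_ineq2)
    also have "\<dots> \<le> r n x * norm (G x)" by (intro mult_right_mono rx) simp
    finally have "\<bar>(x \<bullet> G x) / r n x\<bar> \<le> norm (G x)" using rp[of n x] by (simp add: divide_le_eq mult.commute)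
    then have "\<bar>u x\<bar> * \<bar>(x \<bullet> G x) / r n x\<bar> \<le> \<bar>u x\<bar> * norm (G x)" by (intro mult_left_mono) auto
    then have "\<bar>u x * ((x \<bullet> G x) / r n x)\<bar> \<le> \<bar>u x\<bar> * norm (G x)" by (simp only: abs_mult)
    then have "- (u x * ((x \<bullet> G x) / r n x)) \<le> \<bar>u x\<bar> * norm (G x)" unfolding abs_le_iff by blast
    then show ?thesis unfolding mult_minus_left by linarith
   qed
   also have "\<dots> \<le> s * \<bar>u x\<bar>\<^sup>2 + (norm (G x))^2 / s" by (rule young_ineq[OF s])
   finally show "- (\<Sum>i\<in>UNIV. (x $ i * (1 / r n x)) * (2 * (u x * G x $ i))) \<le> s * (u x)^2 + (norm (G x))^2 / s" by simp
  qed
  also have "\<dots> = B" unfolding B_def G(3) using G(2) XR_D(1)[OF X] by simp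
  finally show "(LBINT x. (u x)^2 / r n x) \<le> B" .
 qed
 have B0: "0 \<le> B" unfolding B_def using s TR_nonneg[of u] by simp
 \<comment> \<open>The bound \<open>B\<close> does not depend on \<open>n\<close>, so Fatou's lemma
   removes the regularisation and yields integrability as well.\<close>
 have le_B: "(\<integral>\<^sup>+x. ennreal ((u x)^2 / norm x) \<partial>lborel) \<le> ennreal B"
 proof -
  have "(\<integral>\<^sup>+x. ennreal ((u x)^2 / norm x) \<partial>lborel) = (\<integral>\<^sup>+x. liminf (\<lambda>n. ennreal ((u x)^2 / r n x)) \<partial>lborel)"
  proof (rule nn_integral_cong_AE)
   show "AE x in lborel. ennreal ((u x)^2 / norm x) = liminf (\<lambda>n. ennreal ((u x)^2 / r n x))"
    using AE_lborel_singleton[of 0]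
   proof eventually_elim
    case (elim x)
    have "(\<lambda>n. (u x)^2 / r n x) ~~> (u x)\<^sup>2 / sqrt (x \<bullet> x + 0)"
     unfolding r_def using elim by (intro tendsto_intros e0) auto
    then have "(\<lambda>n. ennreal ((u x)^2 / r n x)) ~~> ennreal ((u x)^2 / norm x)"
     by (intro tendsto_ennrealI) (simp add: norm_eq_sqrt_inner)
    then show ?case by (simp add: lim_imp_Liminf)
   qed
  qed
  also have "\<dots> \<le> liminf (\<lambda>n. \<integral>\<^sup>+x. ennreal ((u x)^2 / r n x) \<partial>lborel)"
   by (rule nn_integral_liminf) measurable
  also have "\<dots> \<le> liminf (\<lambda>n. ennreal B)"
  proof (rule Liminf_mono, rule always_eventually, rule allI)
   fix n
   have "(\<integral>\<^sup>+x. ennreal ((u x)^2 / r n x) \<partial>lborel) = ennreal (LBINT x. (u x)^2 / r n x)"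
    using main[of n] rp[of n] by (intro nn_integral_eq_integral) (auto simp: less_imp_le)
   also have "\<dots> \<le> ennreal B" using main[of n] by (intro ennreal_leI) simp
   finally show "(\<integral>\<^sup>+x. ennreal ((u x)^2 / r n x) \<partial>lborel) \<le> ennreal B" .
  qed
  finally show ?thesis by (simp add: Liminf_const)
 qed
 then have "(\<integral>\<^sup>+x. ennreal ((u x)^2 / norm x) \<partial>lborel) < \<infinity>"
  using le_less_trans[OF _ ennreal_less_top] by simp
 then show i: ?t1
  by (intro integrableI_nonneg) auto
 have "ennreal (LBINT x. (u x)^2 / norm x) = (\<integral>\<^sup>+x. ennreal ((u x)^2 / norm x) \<partial>lborel)"
  by (rule nn_integral_eq_integral[symmetric, OF i]) auto
 also note le_B
 finally show ?t2
  using B0 by (simp add: B_def)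
qed

section \<open>The logarithmic interaction\<close>

lemma ln_add_norm:
 fixes x y :: "'a::real_normed_vector"
 shows "ln (1 + norm (x - y)) \<le> ln (1 + norm x) + ln (1 + norm y)"
proof -
 have "ln (1 + norm (x - y)) \<le> ln ((1 + norm x) * (1 + norm y))"
 proof (subst ln_le_cancel_iff)
  show "1 + norm (x - y) \<le> (1 + norm x) * (1 + norm y)"
  proof -
   have "(1 + norm x) * (1 + norm y) = 1 + norm x + norm y + norm x * norm y" by (simp add: algebra_simps)
   then show ?thesis
    using norm_triangle_ineq4[of x y] mult_nonneg_nonneg[OF norm_ge_zero[of x] norm_ge_zero[of y]] by linarith
  qed
 qed (auto intro!: mult_pos_pos add_pos_nonneg)
 also have "\<dots> = ln (1 + norm x) + ln (1 + norm y)"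
  using add_pos_nonneg[OF zero_less_one norm_ge_zero[of x]] add_pos_nonneg[OF zero_less_one norm_ge_zero[of y]]
  by (simp add: ln_mult)
 finally show ?thesis .
qed

text \<open>Separates the two defects of the kernel: \<open>1 / r\<close> near 0, logarithmic growth
  far away. The case \<open>r = 0\<close> is covered because \<open>ln 0\<close> and
  \<open>1 / 0\<close> are both 0.\<close>

lemma abs_ln_le:
 fixes r :: real
 assumes "r \<ge> 0"
 shows "\<bar>ln r\<bar> \<le> 1 / r + ln (1 + r)"
proof (cases "r \<ge> 1")
 case True
 then have "\<bar>ln r\<bar> = ln r" by (intro abs_of_nonneg ln_ge_zero)
 also have "\<dots> \<le> ln (1 + r)" using True by simp
 finally show ?thesis using True by (simp add: add_increasing)
next
 case False
 show ?thesis
 proof (cases "r = 0")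
  case False
  have r: "0 < r" "r < 1" using assms False \<open>\<not> r \<ge> 1\<close> by auto
  have "\<bar>ln r\<bar> = ln (1 / r)" using r by (simp add: ln_div)
  also have "\<dots> \<le> 1 / r - 1" using r by (intro ln_le_minus_one) simp
  finally show ?thesis using r ln_ge_zero[of "1 + r"] by linarith
 qed simp
qed

lemma abs_ln_norm_le:
 fixes x y :: "'a::real_normed_vector"
 shows "\<bar>ln (norm (x - y))\<bar> \<le> 1 / norm (x - y) + ln (1 + norm x) + ln (1 + norm y)"
 using abs_ln_le[of "norm (x - y)"] ln_add_norm[of x y] by simp

lemma XR_translate:
 assumes "XR u"
 shows "XR (\<lambda>x. u (x + b))" "TR (\<lambda>x. u (x + b)) = TR u" (is ?t1)
proof -
 obtain G where G: "wgrad u G" "integ (\<lambda>x. (norm (G x))^2)" "TR u = (LBINT x. (norm (G x))^2)" using XR_E[OF assms] .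
 note [measurable] = wgrad_borel[OF G(1)]
 have l: "integ (\<lambda>x. ln (1 + norm x) * (u (x + b))^2)"
 proof (rule Lintegrable_bound)
  show "integ (\<lambda>x. ln (1 + norm (x + b)) * (u (x + b))^2 + ln (1 + norm b) * (u (x + b))^2)"
   by (intro Lintegrable_add integrable_mult_right integrable_translate[OF XR_D(2)[OF assms]] integrable_translate[OF XR_D(1)[OF assms]])
  show "AE x in lborel. norm (ln (1 + norm x) * (u (x + b))^2) \<le> norm (ln (1 + norm (x + b)) * (u (x + b))^2 + ln (1 + norm b) * (u (x + b))^2)" (is "AE x in _. ?Q1 x")
  proof (rule AE_I2)
   fix x
   have "ln (1 + norm x) * (u (x + b))^2 \<le> (ln (1 + norm (x + b)) + ln (1 + norm b)) * (u (x + b))^2"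
    using ln_add_norm[of "x + b" b] by (intro mult_right_mono) auto
   then show "?Q1 x"
    by (simp add: distrib_right abs_mult)
  qed
 qed measurable
 show "XR (\<lambda>x. u (x + b))" unfolding XR_def
  by (intro conjI exI[of _ "\<lambda>x. G (x + b)"] wgrad_translate[OF G(1)] integrable_translate[OF G(2)] integrable_translate[OF XR_D(1)[OF assms]] l)
 show ?t1
  unfolding TR_eq[OF wgrad_translate[OF G(1)]] G(3) by (rule integral_translate) measurable
qed

text \<open>Mass and Dirichlet integral are translation invariant, so the bound at the origin holds
  about every centre with the same constant; this uniformity is what \<open>adm\<close>
  records.\<close>

lemma hardy:
 assumes X: "XR u" and s: "s > 0"
 shows "integ (\<lambda>x. (u x)^2 / norm (x - y))" (is ?t1)
  and "(LBINT x. (u x)^2 / norm (x - y)) \<le> s * (LBINT x. (u x)^2) + TR u / s" (is ?t2)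
proof -
 note [measurable] = XR_D(3)[OF X]
 note h = hardy_origin[OF XR_translate(1)[OF X, of y] s]
 show ?t1
  using integrable_translate[OF h(1), of "- y"] by simp
 have "(LBINT x. (u (x + y))^2 / norm x) = (LBINT x. (u x)^2 / norm (x - y))"
  using integral_translate[of "\<lambda>x. (u x)^2 / norm (x - y)" y] by simp
 moreover have "(LBINT x. (u (x + y))^2) = (LBINT x. (u x)^2)"
  by (rule integral_translate) measurable
 ultimately show ?t2
  using h(2) XR_translate(2)[OF X, of y] by simp
qed

text \<open>Densities, of either sign, for which every logarithmic double integral converges
  absolutely. Integrability is demanded next to the uniform bound because a divergent integral would
  count as 0.\<close>

definition adm :: "(real^2 \<Rightarrow> real) \<Rightarrow> bool" where
 "adm rho \<longleftrightarrow> integ rho \<and> integ (\<lambda>x. ln (1 + norm x) * rho x) \<and>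
   (\<exists>C. \<forall>y. integ (\<lambda>x. rho x / norm (x - y)) \<and> (LBINT x. \<bar>rho x\<bar> / norm (x - y)) \<le> C)"

lemma admD:
 assumes "adm rho"
 shows "integ rho" "integ (\<lambda>x. ln (1 + norm x) * rho x)" "integ (\<lambda>x. rho x / norm (x - y))"
  "rho \<in> Bor"
 using assms unfolding adm_def by (auto dest: borel_measurable_integrable)

lemma adm_E:
 assumes "adm rho"
 obtains C where "C \<ge> 0" "\<And>y. (LBINT x. \<bar>rho x\<bar> / norm (x - y)) \<le> C"
proof -
 obtain C where C: "\<And>y. (LBINT x. \<bar>rho x\<bar> / norm (x - y)) \<le> C" using assms unfolding adm_def by auto
 have "0 \<le> (LBINT x. \<bar>rho x\<bar> / norm (x - 0))" by (intro Lintegral_nonneg) auto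
 then show thesis using C[of 0] by (intro that[OF _ C]) linarith
qed

lemma adm_XR:
 assumes "XR u"
 shows "adm (\<lambda>x. (u x)^2)"
 unfolding adm_def
 using XR_D[OF assms] hardy[OF assms, of 1] by (intro conjI exI[of _ "(LBINT x. (u x)^2) + TR u"] allI) auto

lemma adm_add:
 assumes "adm rho" "adm sg"
 shows "adm (\<lambda>x. rho x + sg x)"
proof -
 note [measurable] = admD(4)[OF assms(1)] admD(4)[OF assms(2)]
 obtain C where C: "\<And>y. (LBINT x. \<bar>rho x\<bar> / norm (x - y)) \<le> C" using adm_E[OF assms(1)] by metis
 obtain D where D: "\<And>y. (LBINT x. \<bar>sg x\<bar> / norm (x - y)) \<le> D" using adm_E[OF assms(2)] by metis
 have i: "integ (\<lambda>x. (rho x + sg x) / norm (x - y))" for y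
  unfolding add_divide_distrib by (intro Lintegrable_add admD(3)[OF assms(1)] admD(3)[OF assms(2)])
 have ia: "integ (\<lambda>x. \<bar>f x\<bar> / norm (x - y))" if "integ (\<lambda>x. f x / norm (x - y))" for f and y :: "real^2"
  using integrable_abs[OF that] by simp
 have "(LBINT x. \<bar>rho x + sg x\<bar> / norm (x - y)) \<le> C + D" for y
 proof -
  have "(LBINT x. \<bar>rho x + sg x\<bar> / norm (x - y)) \<le> (LBINT x. \<bar>rho x\<bar> / norm (x - y) + \<bar>sg x\<bar> / norm (x - y))"
   by (rule integral_mono[OF ia[OF i] Lintegrable_add[OF ia[OF admD(3)[OF assms(1)]] ia[OF admD(3)[OF assms(2)]]]])
     (simp add: add_divide_distrib[symmetric] divide_right_mono)
  also have "\<dots> = (LBINT x. \<bar>rho x\<bar> / norm (x - y)) + (LBINT x. \<bar>sg x\<bar> / norm (x - y))"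
   by (rule Lintegral_add[OF ia[OF admD(3)[OF assms(1)]] ia[OF admD(3)[OF assms(2)]]])
  finally show ?thesis using C[of y] D[of y] by linarith
 qed
 moreover have "integ (\<lambda>x. ln (1 + norm x) * (rho x + sg x))"
  unfolding distrib_left by (intro Lintegrable_add admD(2)[OF assms(1)] admD(2)[OF assms(2)])
 ultimately show ?thesis unfolding adm_def using i admD(1)[OF assms(1)] admD(1)[OF assms(2)]
  by (intro conjI exI[of _ "C + D"] allI Lintegrable_add) auto
qed

lemma adm_bound:
 assumes "adm rho" "sg \<in> Bor" "\<And>x. \<bar>sg x\<bar> \<le> \<bar>rho x\<bar>"
 shows "adm sg"
proof -
 note [measurable] = admD(4)[OF assms(1)] assms(2)
 obtain C where C: "\<And>y. (LBINT x. \<bar>rho x\<bar> / norm (x - y)) \<le> C" using adm_E[OF assms(1)] by metis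
 have i: "integ (\<lambda>x. sg x / norm (x - y))" for y
  by (rule Lintegrable_bound[OF admD(3)[OF assms(1), of y]]) (auto intro!: divide_right_mono assms(3))
 have "(LBINT x. \<bar>sg x\<bar> / norm (x - y)) \<le> C" for y
 proof -
  have "(LBINT x. \<bar>sg x\<bar> / norm (x - y)) \<le> (LBINT x. \<bar>rho x\<bar> / norm (x - y))"
   using integrable_abs[OF i[of y]] integrable_abs[OF admD(3)[OF assms(1), of y]]
   by (intro integral_mono) (auto intro!: divide_right_mono assms(3))
  then show ?thesis using C[of y] by linarith
 qed
 moreover have "integ sg"
  by (rule Lintegrable_bound[OF admD(1)[OF assms(1)]]) (auto intro!: assms(3))
 moreover have "integ (\<lambda>x. ln (1 + norm x) * sg x)"
  by (rule Lintegrable_bound[OF admD(2)[OF assms(1)]]) (auto simp: abs_mult intro!: mult_left_mono assms(3))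
 ultimately show ?thesis unfolding adm_def using i by (intro conjI exI[of _ C] allI) auto
qed

lemma adm_cmult:
 assumes "adm rho"
 shows "adm (\<lambda>x. c * rho x)"
proof -
 obtain C where C: "\<And>y. (LBINT x. \<bar>rho x\<bar> / norm (x - y)) \<le> C" using adm_E[OF assms] by metis
 have i: "integ (\<lambda>x. c * rho x / norm (x - y))" for y
  using integrable_mult_right[OF admD(3)[OF assms, of y], of c] by simp
 have "(LBINT x. \<bar>c * rho x\<bar> / norm (x - y)) = \<bar>c\<bar> * (LBINT x. \<bar>rho x\<bar> / norm (x - y))" for y
  by (subst integral_mult_right_zero[symmetric]) (simp add: abs_mult)
 then have "(LBINT x. \<bar>c * rho x\<bar> / norm (x - y)) \<le> \<bar>c\<bar> * C" for y
  using mult_left_mono[OF C[of y] abs_ge_zero[of c]] by simp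
 moreover have "integ (\<lambda>x. ln (1 + norm x) * (c * rho x))"
  using integrable_mult_right[OF admD(2)[OF assms], of c] by (simp add: mult.left_commute)
 ultimately show ?thesis unfolding adm_def using i admD(1)[OF assms]
  by (intro conjI exI[of _ "\<bar>c\<bar> * C"] allI) auto
qed

lemma adm_diff: "adm rho \<Longrightarrow> adm sg \<Longrightarrow> adm (\<lambda>x. rho x - sg x)"
 using adm_add[OF _ adm_cmult[of sg "-1"], of rho] by simp

lemma adm_abs: "adm rho \<Longrightarrow> adm (\<lambda>x. \<bar>rho x\<bar>)"
 by (rule adm_bound) (auto dest: admD(4))

lemma integrable_prod_mult:
 fixes f :: "'a::euclidean_space \<Rightarrow> real" and g :: "'b::euclidean_space \<Rightarrow> real"
 assumes "integ f" "integ g"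
 shows "integrable (lborel \<Otimes>\<^sub>M lborel) (\<lambda>(x, y). f x * g y)"
proof (rule lborel_pair.Fubini_integrable)
 have [measurable]: "f \<in> Bor" "g \<in> Bor" using assms by auto
 show "(\<lambda>(x, y). f x * g y) \<in> borel_measurable (lborel \<Otimes>\<^sub>M lborel)" by measurable
 show "integ (\<lambda>x. LBINT y. norm (case (x, y) of (x, y) \<Rightarrow> f x * g y))"
  using assms by (simp add: abs_mult)
 show "AE x in lborel. integ (\<lambda>y. case (x, y) of (x, y) \<Rightarrow> f x * g y)"
  using assms by simp
qed

text \<open>Integrating first in \<open>y\<close> leaves a bounded potential times an integrable
  density.\<close>

lemma adm_kernel_integrable:
 assumes "adm rho" "adm sg"
 shows "integrable (lborel \<Otimes>\<^sub>M lborel) (\<lambda>(x, y). \<bar>rho x\<bar> * \<bar>sg y\<bar> / norm (x - y))"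
proof (rule lborel_pair.Fubini_integrable)
 note [measurable] = admD(4)[OF assms(1)] admD(4)[OF assms(2)]
 show "(\<lambda>(x, y). \<bar>rho x\<bar> * \<bar>sg y\<bar> / norm (x - y)) \<in> borel_measurable (lborel \<Otimes>\<^sub>M lborel)" by measurable
 obtain C where C: "C \<ge> 0" "\<And>y. (LBINT x. \<bar>sg x\<bar> / norm (x - y)) \<le> C" using adm_E[OF assms(2)] by metis
 have ia: "integ (\<lambda>y. \<bar>sg y\<bar> / norm (y - x))" for x
  using integrable_abs[OF admD(3)[OF assms(2), of x]] by simp
 have sw: "\<bar>rho x\<bar> * \<bar>sg y\<bar> / norm (x - y) = \<bar>rho x\<bar> * (\<bar>sg y\<bar> / norm (y - x))" for x y by (simp add: norm_minus_commute)
 show "AE x in lborel. integ (\<lambda>y. case (x, y) of (x, y) \<Rightarrow> \<bar>rho x\<bar> * \<bar>sg y\<bar> / norm (x - y))"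
  by (simp only: prod.case sw) (intro AE_I2 integrable_mult_right ia)
 show "integ (\<lambda>x. LBINT y. norm (case (x, y) of (x, y) \<Rightarrow> \<bar>rho x\<bar> * \<bar>sg y\<bar> / norm (x - y)))"
 proof (rule Lintegrable_bound[OF integrable_mult_right[OF admD(1)[OF assms(1)], of C]])
  show "AE x in lborel. norm (LBINT y. norm (case (x, y) of (x, y) \<Rightarrow> \<bar>rho x\<bar> * \<bar>sg y\<bar> / norm (x - y))) \<le> norm (C * rho x)" (is "AE x in _. ?Q1 x")
  proof (rule AE_I2)
   fix x
   have "(LBINT y. norm (case (x, y) of (x, y) \<Rightarrow> \<bar>rho x\<bar> * \<bar>sg y\<bar> / norm (x - y))) = \<bar>rho x\<bar> * (LBINT y. \<bar>sg y\<bar> / norm (y - x))"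
    by (subst integral_mult_right_zero[symmetric]) (simp add: norm_minus_commute)
   moreover have "0 \<le> (LBINT y. \<bar>sg y\<bar> / norm (y - x))" by (intro Lintegral_nonneg) auto
   ultimately show "?Q1 x"
    using mult_left_mono[OF C(2)[of x] abs_ge_zero[of "rho x"]] C(1) by (simp add: abs_mult mult.commute)
  qed
 qed measurable
qed

lemma adm_log_integrable:
 assumes "adm rho" "adm sg"
 shows "integrable (lborel \<Otimes>\<^sub>M lborel) (\<lambda>(x, y). ln (norm (x - y)) * rho x * sg y)"
proof (rule Lintegrable_bound)
 note [measurable] = admD(4)[OF assms(1)] admD(4)[OF assms(2)]
 show "(\<lambda>(x, y). ln (norm (x - y)) * rho x * sg y) \<in> borel_measurable (lborel \<Otimes>\<^sub>M lborel)" by measurable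
 let ?w = "\<lambda>z. (case z of (x, y) \<Rightarrow> \<bar>rho x\<bar> * \<bar>sg y\<bar> / norm (x - y))
   + (case z of (x, y) \<Rightarrow> (ln (1 + norm x) * \<bar>rho x\<bar>) * \<bar>sg y\<bar>) + (case z of (x, y) \<Rightarrow> \<bar>rho x\<bar> * (ln (1 + norm y) * \<bar>sg y\<bar>))"
 have a: "integ (\<lambda>x. \<bar>rho x\<bar>)" "integ (\<lambda>x. \<bar>sg x\<bar>)"
  "integ (\<lambda>x. ln (1 + norm x) * \<bar>rho x\<bar>)" "integ (\<lambda>x. ln (1 + norm x) * \<bar>sg x\<bar>)"
  using admD(1,2)[OF adm_abs[OF assms(1)]] admD(1,2)[OF adm_abs[OF assms(2)]] by auto
 show "integrable (lborel \<Otimes>\<^sub>M lborel) ?w"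
  by (intro Lintegrable_add adm_kernel_integrable assms integrable_prod_mult a)
 show "AE z in lborel \<Otimes>\<^sub>M lborel. norm (case z of (x, y) \<Rightarrow> ln (norm (x - y)) * rho x * sg y) \<le> norm (?w z)" (is "AE z in _. ?Q1 z")
 proof (rule AE_I2)
  fix z :: "(real^2) \<times> (real^2)"
  obtain x y where z: "z = (x, y)" by force
  have "\<bar>ln (norm (x - y))\<bar> * (\<bar>rho x\<bar> * \<bar>sg y\<bar>) \<le> (1 / norm (x - y) + ln (1 + norm x) + ln (1 + norm y)) * (\<bar>rho x\<bar> * \<bar>sg y\<bar>)"
   by (rule mult_right_mono[OF abs_ln_norm_le]) simp
  also have "\<dots> = ?w z" by (simp add: z algebra_simps)
  finally show "?Q1 z"
   by (simp add: z abs_mult mult_ac)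
 qed
qed

section \<open>The logarithmic potential and its bilinear form\<close>

definition pot :: "(real^2 \<Rightarrow> real) \<Rightarrow> real^2 \<Rightarrow> real" where
 "pot sg x = (LBINT y. ln (norm (x - y)) * sg y)"

definition DD :: "(real^2 \<Rightarrow> real) \<Rightarrow> (real^2 \<Rightarrow> real) \<Rightarrow> real" where
 "DD rho sg = (LBINT x. (LBINT y. ln (norm (x - y)) * rho x * sg y))"

lemma pot_integrable:
 assumes "adm sg"
 shows "integ (\<lambda>y. ln (norm (x - y)) * sg y)"
proof (rule Lintegrable_bound)
 note [measurable] = admD(4)[OF assms]
 show "(\<lambda>y. ln (norm (x - y)) * sg y) \<in> borel_measurable lborel" by measurable
 show "integ (\<lambda>y. \<bar>sg y / norm (y - x)\<bar> + ln (1 + norm x) * \<bar>sg y\<bar> + \<bar>ln (1 + norm y) * sg y\<bar>)"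
  by (intro Lintegrable_add integrable_mult_right integrable_abs admD[OF assms])
 show "AE y in lborel. norm (ln (norm (x - y)) * sg y) \<le> norm (\<bar>sg y / norm (y - x)\<bar> + ln (1 + norm x) * \<bar>sg y\<bar> + \<bar>ln (1 + norm y) * sg y\<bar>)" (is "AE y in _. ?Q1 y")
 proof (rule AE_I2)
  fix y
  have "\<bar>ln (norm (x - y))\<bar> * \<bar>sg y\<bar> \<le> (1 / norm (x - y) + ln (1 + norm x) + ln (1 + norm y)) * \<bar>sg y\<bar>"
   by (rule mult_right_mono[OF abs_ln_norm_le]) simp
  also have "\<dots> = \<bar>sg y / norm (y - x)\<bar> + ln (1 + norm x) * \<bar>sg y\<bar> + \<bar>ln (1 + norm y) * sg y\<bar>"
   by (simp add: algebra_simps abs_mult norm_minus_commute)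
  finally show "?Q1 y"
   by (simp add: abs_mult)
 qed
qed

lemma DD_pot: "DD rho sg = (LBINT x. rho x * pot sg x)"
 unfolding DD_def pot_def
 by (subst integral_mult_right_zero[symmetric]) (simp add: mult_ac)

lemma DD_pot_integrable:
 assumes "adm rho" "adm sg"
 shows "integ (\<lambda>x. rho x * pot sg x)"
proof -
 have "(LBINT y. ln (norm (x - y)) * rho x * sg y) = rho x * pot sg x" for x
  unfolding pot_def by (subst integral_mult_right_zero[symmetric]) (simp add: mult_ac)
 then show ?thesis using lborel_pair.integrable_fst[OF adm_log_integrable[OF assms]] by simp
qed

lemma pot_borel: "adm sg \<Longrightarrow> pot sg \<in> Bor"
proof -
 assume a: "adm sg"
 note [measurable] = admD(4)[OF a]
 have "(\<lambda>x. LBINT y. ln (norm (x - y)) * sg y) \<in> borel_measurable lborel" by measurable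
 then show ?thesis unfolding pot_def by simp
qed

lemma DD_commute:
 assumes "adm rho" "adm sg"
 shows "DD rho sg = DD sg rho"
proof -
 have "DD rho sg = (LBINT y. (LBINT x. ln (norm (x - y)) * rho x * sg y))"
  unfolding DD_def using lborel_pair.Fubini_integral[OF adm_log_integrable[OF assms]] by simp
 then show ?thesis unfolding DD_def by (simp add: norm_minus_commute mult_ac)
qed

lemma DD_lincomb:
 assumes "adm rho" "adm sg" "adm tau"
 shows "DD (\<lambda>x. a * rho x + b * sg x) tau = a * DD rho tau + b * DD sg tau" (is ?t1)
  "DD tau (\<lambda>x. a * rho x + b * sg x) = a * DD tau rho + b * DD tau sg" (is ?t2)
proof -
 have "(LBINT x. (a * rho x + b * sg x) * pot tau x) = (LBINT x. a * (rho x * pot tau x) + b * (sg x * pot tau x))"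
  by (simp add: algebra_simps)
 then show 1: ?t1
  unfolding DD_pot using DD_pot_integrable[OF assms(1,3)] DD_pot_integrable[OF assms(2,3)] by simp
 have "adm (\<lambda>x. a * rho x + b * sg x)" by (intro adm_add adm_cmult assms)
 then show ?t2
  using 1 DD_commute assms by metis
qed

lemma DD_quadratic:
 assumes "adm rho" "adm sg"
 shows "DD (\<lambda>x. a * rho x + b * sg x) (\<lambda>x. a * rho x + b * sg x) = a\<^sup>2 * DD rho rho + 2 * a * b * DD rho sg + b\<^sup>2 * DD sg sg"
proof -
 have "adm (\<lambda>x. a * rho x + b * sg x)" by (intro adm_add adm_cmult assms)
 then show ?thesis
  using DD_lincomb[OF assms] assms DD_commute[OF assms] by (simp add: power2_eq_square algebra_simps)
qed

lemma DD_cong_AE: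
 assumes "adm rho" "adm rho'" "adm sg" "adm sg'" "AE x in lborel. rho x = rho' x" "AE x in lborel. sg x = sg' x"
 shows "DD rho sg = DD rho' sg'"
proof -
 note [measurable] = admD(4)[OF assms(1)] admD(4)[OF assms(2)] admD(4)[OF assms(3)] admD(4)[OF assms(4)]
  pot_borel[OF assms(3)] pot_borel[OF assms(4)]
 have "pot sg x = pot sg' x" for x unfolding pot_def
  by (intro integral_cong_AE) (measurable, measurable, use assms(6) in \<open>eventually_elim, simp\<close>)
 then show ?thesis unfolding DD_pot
  by (intro integral_cong_AE) (measurable, measurable, use assms(5) in \<open>eventually_elim, simp\<close>)
qed

text \<open>Since \<open>ln r \<ge> - (1 / r)\<close>, the Hardy estimate bounds the potential of
  \<open>u^2\<close> below by one constant, uniformly in the point.\<close>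

lemma DD_lower_bound:
 assumes X: "XR u" and s: "s > 0" and ad: "adm sg" "\<And>x. sg x \<ge> 0"
 shows "DD sg (\<lambda>x. (u x)^2) \<ge> - ((LBINT x. sg x) * (s * (LBINT x. (u x)^2) + TR u / s))"
proof -
 define B where "B = s * (LBINT x. (u x)^2) + TR u / s"
 note au = adm_XR[OF X]
 have "pot (\<lambda>x. (u x)^2) x \<ge> - B" for x
 proof -
  have i: "integ (\<lambda>y. (u y)^2 / norm (y - x))" by (rule hardy(1)[OF X s])
  have lb: "- (1 / r) \<le> ln r" if "r \<ge> 0" for r :: real
  proof (cases "r = 0")
   case False
   then have "- ln r = ln (1 / r)" using that by (simp add: ln_div)
   also have "\<dots> \<le> 1 / r - 1" using that False by (intro ln_le_minus_one) simp
   finally show ?thesis by linarith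
  qed simp
  have "- B \<le> - (LBINT y. (u y)^2 / norm (y - x))" using hardy(2)[OF X s, of x] by (simp add: B_def)
  also have "\<dots> = (LBINT y. - ((u y)^2 / norm (y - x)))" by simp
  also have "\<dots> \<le> pot (\<lambda>x. (u x)^2) x" unfolding pot_def
  proof (rule integral_mono[OF integrable_minus[OF i] pot_integrable[OF au]])
   fix y
   show "- ((u y)^2 / norm (y - x)) \<le> ln (norm (x - y)) * (u y)^2"
    using mult_right_mono[OF lb[of "norm (x - y)"], of "(u y)^2"] by (simp add: norm_minus_commute)
  qed
  finally show ?thesis .
 qed
 then have "sg x * (- B) \<le> sg x * pot (\<lambda>x. (u x)^2) x" for x using ad(2)[of x] by (intro mult_left_mono) auto
 then have "(LBINT x. sg x * (- B)) \<le> (LBINT x. sg x * pot (\<lambda>x. (u x)^2) x)"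
  by (intro integral_mono integrable_mult_left admD(1)[OF ad(1)] DD_pot_integrable[OF ad(1) au])
 then show ?thesis unfolding DD_pot B_def[symmetric] by simp
qed

subsection \<open>Conditional negative definiteness\<close>

text \<open>The quotient is the integral of \<open>exp (- s * t)\<close> over \<open>s\<close> from
  \<open>a\<close> to \<open>b\<close>; exchanging the order leaves \<open>1 / s\<close>. It will
  present \<open>- 2 * ln r\<close> as a superposition of Gaussians in \<open>r\<close>.\<close>

lemma frullani:
 fixes a b :: real
 assumes "0 < a" "a \<le> b"
 shows "has_bochner_integral lborel (\<lambda>t. indicator {0<..} t * ((exp (- a * t) - exp (- b * t)) / t)) (ln b - ln a)"
proof (rule has_bochner_integral_nn_integral)
 show "(\<lambda>t. indicator {0<..} t * ((exp (- a * t) - exp (- b * t)) / t)) \<in> borel_measurable lborel" by measurable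
 have nn: "0 \<le> indicator {0<..} t * ((exp (- a * t) - exp (- b * t)) / t)" for t :: real
  using assms by (auto simp: indicator_def intro!: divide_nonneg_pos)
 then show "AE t in lborel. 0 \<le> indicator {0<..} t * ((exp (- a * t) - exp (- b * t)) / t)" by simp
 show "0 \<le> ln b - ln a" using assms by simp
 have inner: "(\<integral>\<^sup>+s. ennreal (exp (- s * t)) * indicator {a..b} s \<partial>lborel) = ennreal ((exp (- a * t) - exp (- b * t)) / t)" if "t > 0" for t :: real
 proof -
  have "(\<integral>\<^sup>+s. ennreal (exp (- s * t)) * indicator {a..b} s \<partial>lborel) = ennreal (- exp (- b * t) / t - - exp (- a * t) / t)"
   by (rule nn_integral_FTC_Icc[where F="\<lambda>s. - exp (- s * t) / t"])
     (use assms that in \<open>auto intro!: derivative_eq_intros simp: field_simps\<close>)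
  then show ?thesis by (simp add: diff_divide_distrib)
 qed
 have outer: "(\<integral>\<^sup>+t. ennreal (exp (- s * t)) * indicator {0<..} t \<partial>lborel) = ennreal (1 / s)" if "s > 0" for s :: real
 proof -
  have "(\<integral>\<^sup>+t. ennreal (exp (- s * t)) * indicator {0..} t \<partial>lborel) = ennreal (0 - - exp (- s * 0) / s)"
  proof (rule nn_integral_FTC_atLeast[where F="\<lambda>t. - exp (- s * t) / s"])
   show "((\<lambda>t. - exp (- s * t) / s) \<longlongrightarrow> 0) at_top" using that by real_asymp
   show "((\<lambda>t. - exp (- s * t) / s) has_real_derivative exp (- s * t)) (at t)" for t
    using that by (auto intro!: derivative_eq_intros simp: field_simps)
  qed auto
  moreover have "(\<integral>\<^sup>+t. ennreal (exp (- s * t)) * indicator {0<..} t \<partial>lborel) = (\<integral>\<^sup>+t. ennreal (exp (- s * t)) * indicator {0..} t \<partial>lborel)"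
   by (rule nn_integral_cong_AE) (use AE_lborel_singleton[of "0::real"] in \<open>eventually_elim, auto simp: indicator_def\<close>)
  ultimately show ?thesis by simp
 qed
 have "(\<integral>\<^sup>+t. ennreal (indicator {0<..} t * ((exp (- a * t) - exp (- b * t)) / t)) \<partial>lborel)
   = (\<integral>\<^sup>+t. (\<integral>\<^sup>+s. ennreal (exp (- s * t)) * indicator {a..b} s * indicator {0<..} t \<partial>lborel) \<partial>lborel)"
 proof (rule nn_integral_cong)
  fix t :: real
  show "ennreal (indicator {0<..} t * ((exp (- a * t) - exp (- b * t)) / t)) = (\<integral>\<^sup>+s. ennreal (exp (- s * t)) * indicator {a..b} s * indicator {0<..} t \<partial>lborel)"
   using inner[of t] by (cases "t > 0") (auto simp: nn_integral_multc)
 qed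
 also have "\<dots> = (\<integral>\<^sup>+s. (\<integral>\<^sup>+t. ennreal (exp (- s * t)) * indicator {a..b} s * indicator {0<..} t \<partial>lborel) \<partial>lborel)"
  by (rule lborel_pair.Fubini') measurable
 also have "\<dots> = (\<integral>\<^sup>+s. ennreal (1 / s) * indicator {a..b} s \<partial>lborel)"
 proof (rule nn_integral_cong)
  fix s :: real
  have "(\<integral>\<^sup>+t. ennreal (exp (- s * t)) * indicator {a..b} s * indicator {0<..} t \<partial>lborel) = (\<integral>\<^sup>+t. ennreal (exp (- s * t)) * indicator {0<..} t \<partial>lborel) * indicator {a..b} s"
   by (subst nn_integral_multc[symmetric]) (auto simp: mult_ac)
  then show "(\<integral>\<^sup>+t. ennreal (exp (- s * t)) * indicator {a..b} s * indicator {0<..} t \<partial>lborel) = ennreal (1 / s) * indicator {a..b} s"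
   using outer[of s] assms by (cases "s \<in> {a..b}") auto
 qed
 also have "\<dots> = ennreal (ln b - ln a)"
  by (rule nn_integral_FTC_Icc) (use assms in \<open>auto intro!: derivative_eq_intros\<close>)
 finally show "(\<integral>\<^sup>+t. ennreal (indicator {0<..} t * ((exp (- a * t) - exp (- b * t)) / t)) \<partial>lborel) = ennreal (ln b - ln a)" .
qed

text \<open>Frullani's integrand for the pair \<open>r^2\<close> and 1. The subtracted
  \<open>exp (- t)\<close> tames the singularity at \<open>t = 0\<close> and does not depend on
  \<open>r\<close>, so it is invisible to neutral densities.\<close>

definition logker :: "real \<Rightarrow> real \<Rightarrow> real" where
 "logker r t = indicator {0<..} t * ((exp (- r\<^sup>2 * t) - exp (- t)) / t)"

lemma logker_integral:
 assumes "r > 0"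
 shows "has_bochner_integral lborel (logker r) (- 2 * ln r)" (is ?t1) "has_bochner_integral lborel (\<lambda>t. \<bar>logker r t\<bar>) (2 * \<bar>ln r\<bar>)" (is ?t2)
proof -
 have l2: "ln (r\<^sup>2) = 2 * ln r" using assms by (simp add: ln_realpow)
 have "has_bochner_integral lborel (logker r) (- 2 * ln r) \<and> has_bochner_integral lborel (\<lambda>t. \<bar>logker r t\<bar>) (2 * \<bar>ln r\<bar>)"
 proof (cases "r \<le> 1")
  case True
  then have r1: "r\<^sup>2 \<le> 1" using assms by (simp add: power_le_one)
  have h: ?t1
   using frullani[of "r\<^sup>2" 1] r1 assms l2 unfolding logker_def by simp
  have "\<bar>logker r t\<bar> = logker r t" for t
   using r1 by (auto simp: logker_def indicator_def intro!: divide_nonneg_pos mult_right_mono)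
  moreover have "\<bar>ln r\<bar> = - ln r" using True assms by simp
  ultimately show ?thesis using h by simp
 next
  case False
  then have r1: "1 \<le> r\<^sup>2" using one_le_power[of r 2] by simp
  have h0: "has_bochner_integral lborel (\<lambda>t. indicator {0<..} t * ((exp (- 1 * t) - exp (- r\<^sup>2 * t)) / t)) (2 * ln r)"
   using frullani[of 1 "r\<^sup>2"] r1 l2 by simp
  have eq: "indicator {0<..} t * ((exp (- 1 * t) - exp (- r\<^sup>2 * t)) / t) = - logker r t" for t
   by (simp add: logker_def indicator_def diff_divide_distrib)
  have h: "has_bochner_integral lborel (\<lambda>t. - logker r t) (2 * ln r)" using h0 unfolding eq .
  have "\<bar>logker r t\<bar> = - logker r t" for t
  proof (cases "t > 0")
   case True
   have "exp (- r\<^sup>2 * t) \<le> exp (- t)" using r1 True by simp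
   then show ?thesis using True by (simp add: logker_def divide_nonpos_pos minus_divide_left)
  qed (simp add: logker_def)
  moreover have "\<bar>ln r\<bar> = ln r" using False by simp
  ultimately show ?thesis using h has_bochner_integral_minus[OF h] by simp
 qed
 then show ?t1 ?t2 by auto
qed

lemma gauss_product:
 fixes x y w :: "real^2"
 shows "exp (- 2 * t * (norm (x - w))^2) * exp (- 2 * t * (norm (y - w))^2)
   = exp (- t * (norm (x - y))^2) * exp (- (4 * t) * (norm (w - (1/2) *\<^sub>R (x + y)))^2)"
proof -
 have "- 2 * t * (norm (x - w))^2 + (- 2 * t * (norm (y - w))^2) = - t * (norm (x - y))^2 + (- (4 * t) * (norm (w - (1/2) *\<^sub>R (x + y)))^2)"
  unfolding power2_norm_eq_inner by (simp add: inner_simps inner_commute algebra_simps)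
 then show ?thesis unfolding exp_add[symmetric] by simp
qed

text \<open>Completing the square exhibits a Gaussian in \<open>x - y\<close> as the overlap of two
  Gaussians centred at \<open>x\<close> and \<open>y\<close>; this is what makes it a positive
  definite kernel.\<close>

lemma gauss_convolution:
 fixes x y :: "real^2"
 assumes "t > 0"
 shows "has_bochner_integral lborel (\<lambda>w. exp (- 2 * t * (norm (x - w))^2) * exp (- 2 * t * (norm (y - w))^2)) (pi / (4 * t) * exp (- t * (norm (x - y))^2))"
proof -
 let ?c = "(1/2) *\<^sub>R (x + y)"
 have i: "integ (\<lambda>w::real^2. exp (- (4 * t) * (norm (w + - ?c))^2))"
  using integrable_translate[OF gaussian_integral(1)[of "4 * t"], of "- ?c"] assms by simp
 have e: "(LBINT w. exp (- (4 * t) * (norm (w + - ?c))^2)) = pi / (4 * t)"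
  using integral_translate[of "\<lambda>w::real^2. exp (- (4 * t) * (norm w)^2)" "- ?c"] gaussian_integral(2)[of "4 * t"] assms by simp
 show ?thesis unfolding gauss_product has_bochner_integral_iff
  using i e by simp
qed

text \<open>For a neutral density \<open>- 2 * DD dl dl\<close> is the integral of
  \<open>A t / t\<close>, where \<open>A t\<close> is the energy for the Gaussian kernel and equals
  \<open>4 * t / pi\<close> times the squared norm of the smoothed density \<open>P t\<close>.
  Equality makes \<open>P t\<close> vanish for arbitrarily large \<open>t\<close>, and suitably
  normalised these smoothings approximate \<open>dl\<close>.\<close>

lemma DD_negative:
 assumes ad: "adm dl" and n0: "(LBINT x. dl x) = 0"
 shows "DD dl dl \<le> 0" (is ?t1) "DD dl dl = 0 \<Longrightarrow> AE x in lborel. dl x = 0"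
proof -
 note [measurable] = admD(4)[OF ad]
 define A where "A t = (\<integral>z. exp (- t * (norm (fst z - snd z))^2) * (dl (fst z) * dl (snd z)) \<partial>(lborel \<Otimes>\<^sub>M lborel))" for t
 define P where "P t w = (LBINT x. exp (- 2 * t * (norm (x - w))^2) * dl x)" for t w
 have id2: "integrable (lborel \<Otimes>\<^sub>M lborel) (\<lambda>z. dl (fst z) * dl (snd z))"
  using integrable_prod_mult[OF admD(1)[OF ad] admD(1)[OF ad]] by (simp add: case_prod_beta')
 have d20: "(\<integral>z. dl (fst z) * dl (snd z) \<partial>(lborel \<Otimes>\<^sub>M lborel)) = 0"
  using lborel_pair.integral_fst[OF integrable_prod_mult[OF admD(1)[OF ad] admD(1)[OF ad]]] n0 by (simp add: case_prod_beta')
 have iexp: "integrable (lborel \<Otimes>\<^sub>M lborel) (\<lambda>z. exp (- t * (norm (fst z - snd z))^2) * (dl (fst z) * dl (snd z)))" if "t > 0" for t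
 proof (rule Lintegrable_bound[OF id2])
  show "AE z in lborel \<Otimes>\<^sub>M lborel. norm (exp (- t * (norm (fst z - snd z))^2) * (dl (fst z) * dl (snd z))) \<le> norm (dl (fst z) * dl (snd z))"
   using that by (intro AE_I2) (auto simp: abs_mult intro!: mult_left_le_one_le)
 qed measurable
 have AP: "integ (\<lambda>w. (P t w)^2) \<and> A t = 4 * t / pi * (LBINT w. (P t w)^2)" if t: "t > 0" for t
 proof -
  let ?f = "\<lambda>z w. (exp (- 2 * t * (norm (fst z - w))^2) * exp (- 2 * t * (norm (snd z - w))^2)) * (dl (fst z) * dl (snd z))"
  have iw: "integ (\<lambda>w. ?f z w)" "(LBINT w. ?f z w) = pi / (4 * t) * exp (- t * (norm (fst z - snd z))^2) * (dl (fst z) * dl (snd z))"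
   "(LBINT w. norm (?f z w)) = pi / (4 * t) * exp (- t * (norm (fst z - snd z))^2) * \<bar>dl (fst z) * dl (snd z)\<bar>" for z
   using gauss_convolution[OF t, of "fst z" "snd z"] by (auto simp: has_bochner_integral_iff abs_mult)
  interpret Q: pair_sigma_finite "lborel \<Otimes>\<^sub>M lborel :: ((real^2) \<times> (real^2)) measure" "lborel :: (real^2) measure"
   unfolding lborel_prod by (rule lborel_pair.pair_sigma_finite_axioms)
  have I: "integrable ((lborel \<Otimes>\<^sub>M lborel) \<Otimes>\<^sub>M lborel) (\<lambda>(z, w). ?f z w)"
  proof (rule Q.Fubini_integrable)
   show "(\<lambda>(z, w). ?f z w) \<in> borel_measurable ((lborel \<Otimes>\<^sub>M lborel) \<Otimes>\<^sub>M lborel)" by measurable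
   show "AE z in lborel \<Otimes>\<^sub>M lborel. integ (\<lambda>w. case (z, w) of (z, w) \<Rightarrow> ?f z w)" using iw(1) by simp
   have "integrable (lborel \<Otimes>\<^sub>M lborel) (\<lambda>z. pi / (4 * t) * \<bar>exp (- t * (norm (fst z - snd z))^2) * (dl (fst z) * dl (snd z))\<bar>)"
    by (intro integrable_mult_right integrable_abs iexp t)
   then show "integrable (lborel \<Otimes>\<^sub>M lborel) (\<lambda>z. LBINT w. norm (case (z, w) of (z, w) \<Rightarrow> ?f z w))"
    unfolding prod.case iw(3) by (simp add: abs_mult mult.assoc)
  qed
  have fz: "(\<integral>z. ?f z w \<partial>(lborel \<Otimes>\<^sub>M lborel)) = (P t w)^2" for w
  proof -
   let ?g = "\<lambda>x. exp (- 2 * t * (norm (x - w))^2) * dl x"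
   have ig: "integ ?g"
    by (rule Lintegrable_bound[OF admD(1)[OF ad]]) (use t in \<open>auto simp: abs_mult intro!: mult_left_le_one_le\<close>)
   have "(\<integral>z. ?f z w \<partial>(lborel \<Otimes>\<^sub>M lborel)) = (\<integral>(x, y). ?g x * ?g y \<partial>(lborel \<Otimes>\<^sub>M lborel))"
    by (intro Lintegral_cong) (auto simp: mult_ac)
   also have "\<dots> = (LBINT x. (LBINT y. ?g x * ?g y))"
    by (rule lborel_pair.integral_fst[symmetric, OF integrable_prod_mult[OF ig ig]])
   finally show ?thesis by (simp add: P_def power2_eq_square)
  qed
  have "integ (\<lambda>w. (P t w)^2)"
   using Q.integrable_snd[OF I] unfolding fz .
  moreover have "(LBINT w. (P t w)^2) = (\<integral>z. (LBINT w. ?f z w) \<partial>(lborel \<Otimes>\<^sub>M lborel))"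
   using Q.Fubini_integral[OF I] unfolding fz .
  moreover have "(\<integral>z. (LBINT w. ?f z w) \<partial>(lborel \<Otimes>\<^sub>M lborel)) = pi / (4 * t) * A t"
   unfolding iw(2) A_def by (simp add: mult.assoc)
  ultimately show ?thesis using t by simp
 qed
 have A0: "A t \<ge> 0" if "t > 0" for t using AP[OF that] that by simp
 let ?k = "\<lambda>z t. logker (norm (fst z - snd z)) t * (dl (fst z) * dl (snd z))"
 have ne: "AE z in (lborel \<Otimes>\<^sub>M lborel :: ((real^2) \<times> (real^2)) measure). fst z \<noteq> snd z"
 proof (rule lborel_pair.AE_pair_measure)
  show "{z \<in> space (lborel \<Otimes>\<^sub>M lborel :: ((real^2) \<times> (real^2)) measure). fst z \<noteq> snd z} \<in> sets (lborel \<Otimes>\<^sub>M lborel)" by measurable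
  show "AE x in lborel. AE y in lborel. fst (x, y) \<noteq> snd (x, y :: real^2)"
  proof (rule AE_I2)
   fix x :: "real^2"
   show "AE y in lborel. fst (x, y) \<noteq> snd (x, y)" using AE_lborel_singleton[of x] by eventually_elim auto
  qed
 qed
 interpret R: pair_sigma_finite "lborel \<Otimes>\<^sub>M lborel :: ((real^2) \<times> (real^2)) measure" "lborel :: real measure"
  unfolding lborel_prod by (rule lborel_pair.pair_sigma_finite_axioms)
 have K: "integrable ((lborel \<Otimes>\<^sub>M lborel) \<Otimes>\<^sub>M lborel) (\<lambda>(z, t). ?k z t)"
 proof (rule R.Fubini_integrable)
  show "(\<lambda>(z, t). ?k z t) \<in> borel_measurable ((lborel \<Otimes>\<^sub>M lborel) \<Otimes>\<^sub>M lborel)"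
   unfolding logker_def by measurable
  show "AE z in lborel \<Otimes>\<^sub>M lborel. integ (\<lambda>t. case (z, t) of (z, t) \<Rightarrow> ?k z t)"
   using ne by eventually_elim (use logker_integral(1) in \<open>auto simp: has_bochner_integral_iff\<close>)
  have b: "integrable (lborel \<Otimes>\<^sub>M lborel) (\<lambda>z. 2 * \<bar>case z of (x, y) \<Rightarrow> ln (norm (x - y)) * dl x * dl y\<bar>)"
   by (intro integrable_mult_right integrable_abs adm_log_integrable ad)
  have mk: "(\<lambda>z. LBINT t. norm (?k z t)) \<in> borel_measurable (lborel \<Otimes>\<^sub>M lborel)"
   unfolding logker_def by measurable
  have "integrable (lborel \<Otimes>\<^sub>M lborel) (\<lambda>z. LBINT t. norm (?k z t))"
  proof (rule integrable_cong_AE_imp[OF b mk])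
   show "AE z in lborel \<Otimes>\<^sub>M lborel. 2 * \<bar>case z of (x, y) \<Rightarrow> ln (norm (x - y)) * dl x * dl y\<bar> = (LBINT t. norm (?k z t))"
    using ne
   proof eventually_elim
    case (elim z)
    have "(LBINT t. \<bar>logker (norm (fst z - snd z)) t\<bar>) = 2 * \<bar>ln (norm (fst z - snd z))\<bar>"
     using logker_integral(2)[of "norm (fst z - snd z)"] elim by (simp add: has_bochner_integral_iff)
    then show ?case by (simp add: abs_mult case_prod_beta' mult_ac)
   qed
  qed
  then show "integrable (lborel \<Otimes>\<^sub>M lborel) (\<lambda>z. LBINT t. norm (case (z, t) of (z, t) \<Rightarrow> ?k z t))"
   by simp
 qed
 \<comment> \<open>Here neutrality enters: the part with \<open>exp (- t)\<close> is a multiple of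
   the squared total mass of \<open>dl\<close>.\<close>
 have kt: "(\<integral>z. ?k z t \<partial>(lborel \<Otimes>\<^sub>M lborel)) = indicator {0<..} t * (A t / t)" for t
 proof (cases "t > 0")
  case True
  have "(\<integral>z. ?k z t \<partial>(lborel \<Otimes>\<^sub>M lborel)) = (\<integral>z. (exp (- t * (norm (fst z - snd z))^2) * (dl (fst z) * dl (snd z)) - exp (- t) * (dl (fst z) * dl (snd z))) / t \<partial>(lborel \<Otimes>\<^sub>M lborel))"
   using True by (intro Lintegral_cong) (auto simp: logker_def algebra_simps diff_divide_distrib)
  also have "\<dots> = (A t - exp (- t) * 0) / t"
   unfolding A_def using iexp[OF True] id2 d20 by simp
  finally show ?thesis using True by simp
 qed (simp add: logker_def)
 have iA: "integ (\<lambda>t. indicator {0<..} t * (A t / t))"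
  using R.integrable_snd[OF K] unfolding kt .
 have DA: "- 2 * DD dl dl = (LBINT t. indicator {0<..} t * (A t / t))"
 proof -
  have "(LBINT t. indicator {0<..} t * (A t / t)) = (\<integral>z. (LBINT t. ?k z t) \<partial>(lborel \<Otimes>\<^sub>M lborel))"
   using R.Fubini_integral[OF K] unfolding kt .
  also have "\<dots> = (\<integral>z. - 2 * (case z of (x, y) \<Rightarrow> ln (norm (x - y)) * dl x * dl y) \<partial>(lborel \<Otimes>\<^sub>M lborel))"
  proof (rule integral_cong_AE)
   show "(\<lambda>z. LBINT t. ?k z t) \<in> borel_measurable (lborel \<Otimes>\<^sub>M lborel)"
    unfolding logker_def by measurable
   show "AE z in lborel \<Otimes>\<^sub>M lborel. (LBINT t. ?k z t) = - 2 * (case z of (x, y) \<Rightarrow> ln (norm (x - y)) * dl x * dl y)"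
    using ne
   proof eventually_elim
    case (elim z)
    have "(LBINT t. logker (norm (fst z - snd z)) t) = - 2 * ln (norm (fst z - snd z))"
     using logker_integral(1)[of "norm (fst z - snd z)"] elim by (simp add: has_bochner_integral_iff)
    then show ?case by (simp add: case_prod_beta' mult_ac)
   qed
  qed measurable
  also have "\<dots> = - 2 * (\<integral>z. (case z of (x, y) \<Rightarrow> ln (norm (x - y)) * dl x * dl y) \<partial>(lborel \<Otimes>\<^sub>M lborel))" by simp
  also have "(\<integral>z. (case z of (x, y) \<Rightarrow> ln (norm (x - y)) * dl x * dl y) \<partial>(lborel \<Otimes>\<^sub>M lborel)) = DD dl dl"
   unfolding DD_def by (rule lborel_pair.integral_fst[symmetric, OF adm_log_integrable[OF ad ad]])
  finally show ?thesis by simp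
 qed
 have nnA: "0 \<le> indicator {0<..} t * (A t / t)" for t :: real using A0[of t] by (auto simp: indicator_def)
 have "0 \<le> (LBINT t. indicator {0<..} t * (A t / t))" using nnA by (intro Lintegral_nonneg)
 then show ?t1 using DA by linarith
 assume z: "DD dl dl = 0"
 have "AE t in lborel. indicator {0<..} t * (A t / t) = 0"
  using integral_nonneg_eq_0_iff_AE[OF iA] nnA DA z by simp
 then have AEA: "AE t in lborel. t > 0 \<longrightarrow> A t = 0" by eventually_elim auto
 \<comment> \<open>\<open>A\<close> vanishes only almost everywhere, which still yields a suitable
   \<open>t\<close> beyond every bound.\<close>
 have "\<exists>t. t > real n \<and> t > 0 \<and> A t = 0" for n
 proof (rule ccontr)
  assume c: "\<nexists>t. t > real n \<and> t > 0 \<and> A t = 0"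
  have "AE t in lborel. t \<notin> {real n <..< real n + 1}" using AEA by eventually_elim (use c in force)
  then have "{real n <..< real n + 1} \<in> null_sets lborel"
   by (subst AE_iff_null_sets) auto
  then have "emeasure lborel {real n <..< real n + 1} = 0" by (rule null_setsD1)
  then show False by simp
 qed
 then obtain T where T: "\<And>n. T n > real n" "\<And>n. T n > 0" "\<And>n. A (T n) = 0" by metis
 have P0: "AE w in lborel. P (T n) w = 0" for n
 proof -
  have "(LBINT w. (P (T n) w)^2) = 0" using AP[OF T(2)[of n]] T(2)[of n] T(3)[of n] by simp
  then have "AE w in lborel. (P (T n) w)^2 = 0" using AP[OF T(2)[of n]] integral_nonneg_eq_0_iff_AE[of lborel "\<lambda>w. (P (T n) w)^2"] by auto
  then show ?thesis by eventually_elim simp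
 qed
 \<comment> \<open>The translation modulus of \<open>dl\<close> in the mean; it measures the error
   of the approximation by Gaussian averages.\<close>
 define M where "M h = (LBINT w. \<bar>dl (w + h) - dl w\<bar>)" for h
 have Mm[measurable]: "M \<in> Bor"
 proof -
  have "(\<lambda>h. LBINT w. \<bar>dl (w + h) - dl w\<bar>) \<in> borel_measurable lborel" by measurable
  then show ?thesis unfolding M_def[abs_def] by simp
 qed
 define N where "N = (LBINT w. \<bar>dl w\<bar>)"
 have N0: "N \<ge> 0" unfolding N_def by simp
 have iabs: "integ (\<lambda>w. \<bar>dl w\<bar>)" "integ (\<lambda>w. \<bar>dl (w + h) - dl w\<bar>)" for h
  using admD(1)[OF ad] integrable_translate[OF admD(1)[OF ad]] by auto
 have M2: "0 \<le> M h" "M h \<le> 2 * N" for h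
 proof -
  show "0 \<le> M h" unfolding M_def by simp
  have "M h \<le> (LBINT w. \<bar>dl (w + h)\<bar> + \<bar>dl w\<bar>)" unfolding M_def
   by (intro integral_mono iabs Lintegrable_add integrable_translate[OF iabs(1)]) auto
  also have "\<dots> = 2 * N" unfolding N_def
   using integrable_translate[OF iabs(1), of h] iabs(1) integral_translate[of "\<lambda>w. \<bar>dl w\<bar>" h] by simp
  finally show "M h \<le> 2 * N" .
 qed
 have bound: "pi * N \<le> (LBINT k. exp (- 1 * (norm k)^2) * M ((1 / sqrt (2 * T n)) *\<^sub>R k))" for n
 proof -
  \<comment> \<open>This scale turns \<open>exp (- 2 * T * \<bar>x\<bar>^2)\<close> into the fixed
    Gaussian \<open>exp (- \<bar>k\<bar>^2)\<close> of total mass \<open>pi\<close>.\<close>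
  define c where "c = 1 / sqrt (2 * T n)"
  have c: "c > 0" "2 * T n * c\<^sup>2 = 1" using T(2)[of n] by (simp_all add: c_def power_divide)
  have J: "integrable (lborel \<Otimes>\<^sub>M lborel) (\<lambda>(w, k). exp (- 1 * (norm k)^2) * \<bar>dl (w + c *\<^sub>R k) - dl w\<bar>)"
  proof -
   have "integrable (lborel \<Otimes>\<^sub>M lborel) (\<lambda>(k, w). exp (- 1 * (norm k)^2) * \<bar>dl (w + c *\<^sub>R k) - dl w\<bar>)"
   proof (rule lborel_pair.Fubini_integrable)
    show "(\<lambda>(k, w). exp (- 1 * (norm k)^2) * \<bar>dl (w + c *\<^sub>R k) - dl w\<bar>) \<in> borel_measurable (lborel \<Otimes>\<^sub>M lborel)" by measurable
    show "AE k in lborel. integ (\<lambda>w. case (k, w) of (k, w) \<Rightarrow> exp (- 1 * (norm k)^2) * \<bar>dl (w + c *\<^sub>R k) - dl w\<bar>)"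
     unfolding prod.case by (intro AE_I2 integrable_mult_right iabs)
    have "integ (\<lambda>k. exp (- 1 * (norm k)^2) * M (c *\<^sub>R k))"
    proof (rule Lintegrable_bound[OF integrable_mult_left[OF gaussian_integral(1)[of 1], of "2 * N"]])
     show "AE k in lborel. norm (exp (- 1 * (norm (k::real^2))^2) * M (c *\<^sub>R k)) \<le> norm (exp (- 1 * (norm k)^2) * (2 * N))"
      using M2 N0 by (intro AE_I2) (auto simp: abs_mult)
    qed auto
    then show "integ (\<lambda>k. LBINT w. norm (case (k, w) of (k, w) \<Rightarrow> exp (- 1 * (norm k)^2) * \<bar>dl (w + c *\<^sub>R k) - dl w\<bar>))"
     by (simp add: M_def abs_mult)
   qed
   from lborel_pair.integrable_product_swap[OF this] show ?thesis by (simp add: case_prod_beta')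
  qed
  have conv: "pi * dl w - 2 * T n * P (T n) w = (LBINT k. exp (- 1 * (norm k)^2) * (dl w - dl (w + c *\<^sub>R k)))" for w
  proof -
   have ie: "integ (\<lambda>x. exp (- 2 * T n * (norm (x - w))^2) * dl x)"
    by (rule Lintegrable_bound[OF admD(1)[OF ad]]) (use T(2)[of n] in \<open>auto simp: abs_mult intro!: mult_left_le_one_le\<close>)
   have it: "integ (\<lambda>x. exp (- 2 * T n * (norm x)^2) * dl (w + x))"
    using integrable_translate[OF ie, of w] by (simp add: add.commute)
   have P1: "P (T n) w = (LBINT x. exp (- 2 * T n * (norm x)^2) * dl (w + x))"
    unfolding P_def using integral_translate[of "\<lambda>x. exp (- 2 * T n * (norm (x - w))^2) * dl x" w] by (simp add: add.commute)
   have ex: "exp (- 2 * T n * (norm (c *\<^sub>R k))^2) = exp (- 1 * (norm k)^2)" for k :: "real^2"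
   proof -
    have "- 2 * T n * (norm (c *\<^sub>R k))^2 = - (2 * T n * c\<^sup>2) * (norm k)^2" by (simp add: power_mult_distrib)
    then show ?thesis using c by simp
   qed
   have ik: "integ (\<lambda>k. exp (- 1 * (norm k)^2) * dl (w + c *\<^sub>R k))"
    using integrable_scale[OF c(1) it] unfolding ex .
   have "(LBINT k. exp (- 1 * (norm k)^2) * dl (w + c *\<^sub>R k)) = P (T n) w / c\<^sup>2"
    using integral_scale[OF c(1), of "\<lambda>x. exp (- 2 * T n * (norm x)^2) * dl (w + x)"] unfolding ex P1 by simp
   also have "\<dots> = 2 * T n * P (T n) w" using c by (simp add: field_simps)
   finally have e: "(LBINT k. exp (- 1 * (norm k)^2) * dl (w + c *\<^sub>R k)) = 2 * T n * P (T n) w" .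
   have "(LBINT k. exp (- 1 * (norm k)^2) * dl w - exp (- 1 * (norm k)^2) * dl (w + c *\<^sub>R k))
     = (\<integral>k. exp (- 1 * (norm k)^2) * dl w \<partial>(lborel :: (real^2) measure)) - (LBINT k. exp (- 1 * (norm k)^2) * dl (w + c *\<^sub>R k))"
    using integrable_mult_left[OF gaussian_integral(1)[of 1], of "dl w"] ik by (intro Lintegral_diff) auto
   then show ?thesis unfolding e using gaussian_integral[of 1] by (simp add: right_diff_distrib)
  qed
  have "pi * N = (LBINT w. \<bar>pi * dl w - 2 * T n * P (T n) w\<bar>)"
  proof -
   have [measurable]: "P (T n) \<in> Bor"
   proof -
    have "(\<lambda>w. LBINT x. exp (- 2 * T n * (norm (x - w))^2) * dl x) \<in> borel_measurable lborel" by measurable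
    then show ?thesis unfolding P_def[abs_def] by simp
   qed
   have "(LBINT w. \<bar>pi * dl w - 2 * T n * P (T n) w\<bar>) = (LBINT w. pi * \<bar>dl w\<bar>)"
    by (rule integral_cong_AE) (measurable, measurable, use P0[of n] in \<open>eventually_elim, simp add: abs_mult\<close>)
   then show ?thesis by (simp add: N_def)
  qed
  also have "\<dots> \<le> (LBINT w. (LBINT k. exp (- 1 * (norm k)^2) * \<bar>dl (w + c *\<^sub>R k) - dl w\<bar>))"
  proof (rule integral_mono')
   show "integ (\<lambda>w. LBINT k. exp (- 1 * (norm k)^2) * \<bar>dl (w + c *\<^sub>R k) - dl w\<bar>)"
    by (rule lborel_pair.integrable_fst[OF J])
   fix w
   have "\<bar>pi * dl w - 2 * T n * P (T n) w\<bar> \<le> (LBINT k. \<bar>exp (- 1 * (norm k)^2) * (dl w - dl (w + c *\<^sub>R k))\<bar>)"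
    unfolding conv by (rule integral_abs_bound)
   then show "\<bar>pi * dl w - 2 * T n * P (T n) w\<bar> \<le> (LBINT k. exp (- 1 * (norm k)^2) * \<bar>dl (w + c *\<^sub>R k) - dl w\<bar>)"
    by (simp add: abs_mult abs_minus_commute)
  qed auto
  also have "\<dots> = (LBINT k. (LBINT w. exp (- 1 * (norm k)^2) * \<bar>dl (w + c *\<^sub>R k) - dl w\<bar>))"
   using lborel_pair.Fubini_integral[OF J] by simp
  also have "\<dots> = (LBINT k. exp (- 1 * (norm k)^2) * M (c *\<^sub>R k))" by (simp add: M_def)
  finally show ?thesis by (simp add: c_def)
 qed
 have "(\<lambda>n. LBINT k. exp (- 1 * (norm k)^2) * M ((1 / sqrt (2 * T n)) *\<^sub>R k)) ~~> (\<integral>k. 0 \<partial>(lborel :: (real^2) measure))"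
 proof (rule integral_dominated_convergence[where w="\<lambda>k. exp (- 1 * (norm k)^2) * (2 * N)"])
  show "integ (\<lambda>k::real^2. exp (- 1 * (norm k)^2) * (2 * N))"
   by (rule integrable_mult_left[OF gaussian_integral(1)]) simp
  show "AE k in lborel. norm (exp (- 1 * (norm (k::real^2))^2) * M ((1 / sqrt (2 * T n)) *\<^sub>R k)) \<le> exp (- 1 * (norm k)^2) * (2 * N)" for n
   using M2 by (intro AE_I2) (auto simp: abs_mult)
  show "AE k in lborel. (\<lambda>n. exp (- 1 * (norm k)^2) * M ((1 / sqrt (2 * T n)) *\<^sub>R k)) ~~> 0"
  proof (intro AE_I2 tendsto_mult_right_zero)
   fix k :: "real^2"
   have Tt: "filterlim T at_top sequentially"
    by (rule filterlim_at_top_mono[OF filterlim_real_sequentially]) (use T(1) in \<open>auto simp: less_imp_le\<close>)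
   have "((\<lambda>t. 1 / sqrt (2 * t)) \<longlongrightarrow> 0) at_top" by real_asymp
   from filterlim_compose[OF this Tt] have "(\<lambda>n. 1 / sqrt (2 * T n)) ~~> 0" .
   then have "(\<lambda>n. (1 / sqrt (2 * T n)) *\<^sub>R k) ~~> 0 *\<^sub>R k" by (rule tendsto_scaleR[OF _ tendsto_const])
   then show "(\<lambda>n. M ((1 / sqrt (2 * T n)) *\<^sub>R k)) ~~> 0"
    unfolding M_def using L1_translation_continuous[OF admD(1)[OF ad]] by simp
  qed
 qed measurable
 then have "pi * N \<le> 0" using bound by (intro LIMSEQ_le_const) auto
 then have "N \<le> 0" using pi_gt_zero by (simp add: mult_le_0_iff)
 with N0 have "N = 0" by linarith
 then have "(LBINT w. \<bar>dl w\<bar>) = 0" unfolding N_def .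
 then have "AE w in lborel. \<bar>dl w\<bar> = 0" using integral_nonneg_eq_0_iff_AE[OF iabs(1)] by simp
 then show "AE x in lborel. dl x = 0" by eventually_elim simp
qed

section \<open>The variational problem\<close>

lemma XR_wgrad_integrable:
 assumes "XR u" "wgrad u H"
 shows "integ (\<lambda>x. (norm (H x))^2)"
proof -
 obtain G where G: "wgrad u G" "integ (\<lambda>x. (norm (G x))^2)" using XR_E[OF assms(1)] .
 note [measurable] = wgrad_borel[OF assms(2)]
 have ae: "AE x in lborel. G x = H x" using wgrad_unique[OF G(1) assms(2)] by simp
 show ?thesis
  by (intro integrable_cong_AE_imp[OF G(2)]) (measurable, use ae in \<open>eventually_elim, simp\<close>)
qed

section \<open>Reduction of complex states to pairs of real functions\<close>

lemma complex_integrable_parts_iff: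
 fixes f :: "'a \<Rightarrow> complex"
 shows "integrable M f \<longleftrightarrow> integrable M (\<lambda>x. Re (f x)) \<and> integrable M (\<lambda>x. Im (f x))"
proof
 assume a: "integrable M (\<lambda>x. Re (f x)) \<and> integrable M (\<lambda>x. Im (f x))"
 then have "integrable M (\<lambda>x. complex_of_real (Re (f x)) + \<i> * complex_of_real (Im (f x)))"
  by (intro Lintegrable_add integrable_mult_right integrable_of_real) auto
 then show "integrable M f" by (simp add: complex_eq[symmetric])
qed auto

lemma set_integrable_complex_iff:
 fixes u :: "'a \<Rightarrow> complex"
 shows "set_integrable M K u \<longleftrightarrow> set_integrable M K (\<lambda>x. Re (u x)) \<and> set_integrable M K (\<lambda>x. Im (u x))"
proof -
 have "complex_integrable M (\<lambda>x. indicator K x *\<^sub>R u x) \<longleftrightarrow> integrable M (\<lambda>x. Re (indicator K x *\<^sub>R u x)) \<and> integrable M (\<lambda>x. Im (indicator K x *\<^sub>R u x))"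
  by (rule complex_integrable_parts_iff)
 then show ?thesis by (simp add: set_integrable_def)
qed

lemma complex_integral_of_real_mult:
 fixes u :: "'a \<Rightarrow> complex" and p :: "'a \<Rightarrow> real"
 assumes "integrable M (\<lambda>x. p x * Re (u x))" "integrable M (\<lambda>x. p x * Im (u x))"
 shows "(\<integral>x. complex_of_real (p x) * u x \<partial>M) = Complex (\<integral>x. p x * Re (u x) \<partial>M) (\<integral>x. p x * Im (u x) \<partial>M)"
proof -
 have i: "complex_integrable M (\<lambda>x. complex_of_real (p x) * u x)"
  unfolding complex_integrable_parts_iff using assms by simp
 show ?thesis
  by (rule complex_eqI) (use integral_Re[OF i] integral_Im[OF i] in auto)
qed

text \<open>Test functions are real, so the complex test identity decouples into its real and
  imaginary parts.\<close>

lemma weak_gradient_iff: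
 "weak_gradient u G \<longleftrightarrow> wgrad (\<lambda>x. Re (u x)) (\<lambda>x. \<chi> i. Re (G x $ i)) \<and> wgrad (\<lambda>x. Im (u x)) (\<lambda>x. \<chi> i. Im (G x $ i))"
proof -
 let ?L = "loc_int (\<lambda>x. Re (u x)) \<and> loc_int (\<lambda>x. Im (u x)) \<and> (\<forall>i. loc_int (\<lambda>x. Re (G x $ i)) \<and> loc_int (\<lambda>x. Im (G x $ i)))"
 have L: "(\<forall>K. compact K \<longrightarrow> set_integrable lborel K u \<and> (\<forall>i. set_integrable lborel K (\<lambda>x. G x $ i))) \<longleftrightarrow> ?L"
  unfolding loc_int_def set_integrable_complex_iff by blast
 have R: "wgrad (\<lambda>x. Re (u x)) (\<lambda>x. \<chi> i. Re (G x $ i)) \<and> wgrad (\<lambda>x. Im (u x)) (\<lambda>x. \<chi> i. Im (G x $ i)) \<longleftrightarrow>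
  ?L \<and> (\<forall>phi i. test_fn phi \<longrightarrow> (LBINT x. partial i phi x * Re (u x)) = - (LBINT x. phi x * Re (G x $ i))
    \<and> (LBINT x. partial i phi x * Im (u x)) = - (LBINT x. phi x * Im (G x $ i)))"
  unfolding wgrad_def wderiv_def by auto
 have "(LBINT x. complex_of_real (partial i phi x) * u x) = - (LBINT x. complex_of_real (phi x) * (G x $ i)) \<longleftrightarrow>
   (LBINT x. partial i phi x * Re (u x)) = - (LBINT x. phi x * Re (G x $ i))
    \<and> (LBINT x. partial i phi x * Im (u x)) = - (LBINT x. phi x * Im (G x $ i))"
  if "?L" "test_fn phi" for phi i
 proof -
  have i: "integ (\<lambda>x. partial i phi x * Re (u x))" "integ (\<lambda>x. partial i phi x * Im (u x))"
   "integ (\<lambda>x. phi x * Re (G x $ i))" "integ (\<lambda>x. phi x * Im (G x $ i))"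
   using that(1) by (auto intro!: test_fn_mult_integrable[OF that(2)])
  show ?thesis
   unfolding complex_integral_of_real_mult[OF i(1,2)] complex_integral_of_real_mult[OF i(3,4)]
   by (simp add: complex_eq_iff)
 qed
 then show ?thesis unfolding R weak_gradient_def L by blast
qed

lemma sum_cmod_square:
 fixes G :: "complex^2"
 shows "(\<Sum>i\<in>UNIV. (cmod (G $ i))^2) = (norm (\<chi> i. Re (G $ i)))^2 + (norm (\<chi> i. Im (G $ i)))^2"
 unfolding cmod_power2 power2_norm_eq_inner inner_vec_def by (simp add: sum.distrib power2_eq_square)

lemma integrable_add_nonneg_iff:
 fixes f g :: "'a \<Rightarrow> real"
 assumes [measurable]: "f \<in> borel_measurable M" "g \<in> borel_measurable M" and nn: "\<And>x. f x \<ge> 0" "\<And>x. g x \<ge> 0"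
 shows "integrable M (\<lambda>x. f x + g x) \<longleftrightarrow> integrable M f \<and> integrable M g"
proof
 assume i: "integrable M (\<lambda>x. f x + g x)"
 have "integrable M f" by (rule Lintegrable_bound[OF i]) (use nn in auto)
 moreover have "integrable M g" by (rule Lintegrable_bound[OF i]) (use nn in auto)
 ultimately show "integrable M f \<and> integrable M g" ..
qed simp

lemma Xspace_parts:
 assumes "u \<in> Xspace"
 shows "XR (\<lambda>x. Re (u x))" "XR (\<lambda>x. Im (u x))"
proof -
 have m[measurable]: "u \<in> Bor" using assms by (simp add: Xspace_def)
 obtain G :: "real^2 \<Rightarrow> complex^2" where G: "weak_gradient u G" "integ (\<lambda>x. \<Sum>i\<in>UNIV. (cmod (G x $ i))^2)"
  using assms unfolding Xspace_def by auto
 note g = G(1)[unfolded weak_gradient_iff]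
 have gm: "(\<lambda>x. \<chi> i. Re (G x $ i)) \<in> Bor" "(\<lambda>x. \<chi> i. Im (G x $ i)) \<in> Bor"
  using wgrad_borel(2) g by blast+
 have ig: "integ (\<lambda>x. (norm (\<chi> i. Re (G x $ i)))^2)" "integ (\<lambda>x. (norm (\<chi> i. Im (G x $ i)))^2)"
  using G(2)[unfolded sum_cmod_square] gm by (subst (asm) integrable_add_nonneg_iff; simp)+
 have "integ (\<lambda>x. (Re (u x))^2 + (Im (u x))^2)"
  using assms by (simp add: Xspace_def cmod_power2)
 then have iu: "integ (\<lambda>x. (Re (u x))^2)" "integ (\<lambda>x. (Im (u x))^2)"
  by (subst (asm) integrable_add_nonneg_iff; simp)+
 have "integ (\<lambda>x. ln (1 + norm x) * (Re (u x))^2 + ln (1 + norm x) * (Im (u x))^2)"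
  using assms by (simp add: Xspace_def cmod_power2 distrib_left)
 then have il: "integ (\<lambda>x. ln (1 + norm x) * (Re (u x))^2)" "integ (\<lambda>x. ln (1 + norm x) * (Im (u x))^2)"
  by (subst (asm) integrable_add_nonneg_iff; simp)+
 show "XR (\<lambda>x. Re (u x))" unfolding XR_def
  by (intro conjI exI[of _ "\<lambda>x. \<chi> i. Re (G x $ i)"] conjunct1[OF g] ig(1) iu(1) il(1))
 show "XR (\<lambda>x. Im (u x))" unfolding XR_def
  by (intro conjI exI[of _ "\<lambda>x. \<chi> i. Im (G x $ i)"] conjunct2[OF g] ig(2) iu(2) il(2))
qed

lemma wgrad_zero: "wgrad (\<lambda>x. 0) (\<lambda>x. 0)"
 unfolding wgrad_def using c1_wderiv[OF c1_const[of 0]] by simp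

lemma XR_zero: "XR (\<lambda>x. 0)" "TR (\<lambda>x. 0) = 0"
 unfolding XR_def using wgrad_zero TR_eq[OF wgrad_zero] by auto

lemma XR_Xspace:
 assumes "XR w"
 shows "(\<lambda>x. complex_of_real (w x)) \<in> Xspace"
proof -
 obtain G where G: "wgrad w G" "integ (\<lambda>x. (norm (G x))^2)" using XR_E[OF assms] .
 note [measurable] = XR_D(3)[OF assms]
 have "weak_gradient (\<lambda>x. complex_of_real (w x)) (\<lambda>x. \<chi> i. complex_of_real (G x $ i))"
  unfolding weak_gradient_iff using G(1) wgrad_zero by (simp add: zero_vec_def)
 moreover have "(\<Sum>i\<in>UNIV. (cmod ((\<chi> i. complex_of_real (G x $ i)) $ i))^2) = (norm (G x))^2" for x
  unfolding sum_cmod_square by (simp add: zero_vec_def[symmetric])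
 ultimately show ?thesis unfolding Xspace_def using XR_D[OF assms] G(2) by auto
qed

lemma Energy_parts:
 assumes "u \<in> Xspace"
 shows "Energy \<gamma> u = TR (\<lambda>x. Re (u x)) + TR (\<lambda>x. Im (u x)) + \<gamma> / (4 * pi) * DD (\<lambda>x. (cmod (u x))^2) (\<lambda>x. (cmod (u x))^2)"
proof -
 obtain G where G: "weak_gradient u G" using assms unfolding Xspace_def by auto
 then have g: "weak_gradient u (grad u)" unfolding grad_def by (rule someI[where P="weak_gradient u"])
 note p = g[unfolded weak_gradient_iff]
 have "(LBINT x. (\<Sum>i\<in>UNIV. (cmod (grad u x $ i))^2)) = TR (\<lambda>x. Re (u x)) + TR (\<lambda>x. Im (u x))"
  unfolding sum_cmod_square TR_eq[OF conjunct1[OF p]] TR_eq[OF conjunct2[OF p]]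
  by (rule Lintegral_add[OF XR_wgrad_integrable[OF Xspace_parts(1)[OF assms] conjunct1[OF p]]
     XR_wgrad_integrable[OF Xspace_parts(2)[OF assms] conjunct2[OF p]]])
 then show ?thesis unfolding Energy_def DD_def by simp
qed

definition ER :: "real \<Rightarrow> (real^2 \<Rightarrow> real) \<Rightarrow> real" where
 "ER c u = TR u + c * DD (\<lambda>x. (u x)^2) (\<lambda>x. (u x)^2)"

lemma Energy_of_real:
 assumes "XR w"
 shows "Energy \<gamma> (\<lambda>x. complex_of_real (w x)) = ER (\<gamma> / (4 * pi)) w"
 unfolding Energy_parts[OF XR_Xspace[OF assms]] ER_def using XR_zero by simp

lemma adm_Xspace:
 assumes "u \<in> Xspace"
 shows "adm (\<lambda>x. (cmod (u x))^2)"
 unfolding cmod_power2 using Xspace_parts[OF assms] by (intro adm_add adm_XR)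

text \<open>Gives \<open>e0\<close> its meaning: \<open>Inf\<close> is a lower bound only for sets
  that are bounded below.\<close>

lemma Energy_lower_bound:
 assumes u: "u \<in> Xspace" and g: "\<gamma> > 0" and lam: "lam > 0" "Nmass u = lam"
 shows "Energy \<gamma> u \<ge> - ((\<gamma> / (4 * pi))^2 * lam^3)"
proof -
 define c where "c = \<gamma> / (4 * pi)"
 have c: "c > 0" using g by (simp add: c_def)
 \<comment> \<open>The Hardy weight is chosen so that the kinetic terms cancel exactly; what remains
   is \<open>- (c^2 * lam^3)\<close>.\<close>
 define s where "s = c * lam"
 have s: "s > 0" using c lam by (simp add: s_def)
 let ?rho = "\<lambda>x. (cmod (u x))^2"
 let ?a = "\<lambda>x. (Re (u x))^2" and ?b = "\<lambda>x. (Im (u x))^2"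
 note X = Xspace_parts[OF u]
 have N: "(LBINT x. ?a x) + (LBINT x. ?b x) = lam"
  using lam(2) XR_D(1)[OF X(1)] XR_D(1)[OF X(2)] by (simp add: Nmass_def cmod_power2)
 have ad: "adm ?rho" by (rule adm_Xspace[OF u])
 have "DD ?rho (\<lambda>x. 1 * ?a x + 1 * ?b x) = 1 * DD ?rho ?a + 1 * DD ?rho ?b"
  by (rule DD_lincomb(2)[OF adm_XR[OF X(1)] adm_XR[OF X(2)] ad])
 then have D: "DD ?rho ?rho = DD ?rho ?a + DD ?rho ?b" by (simp add: cmod_power2[symmetric])
 have "DD ?rho ?a \<ge> - ((LBINT x. ?rho x) * (s * (LBINT x. ?a x) + TR (\<lambda>x. Re (u x)) / s))"
  by (rule DD_lower_bound[OF X(1) s ad]) simp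
 moreover have "DD ?rho ?b \<ge> - ((LBINT x. ?rho x) * (s * (LBINT x. ?b x) + TR (\<lambda>x. Im (u x)) / s))"
  by (rule DD_lower_bound[OF X(2) s ad]) simp
 moreover have "(LBINT x. ?rho x) = lam" using lam by (simp add: Nmass_def)
 ultimately have "DD ?rho ?rho \<ge> - (lam * (s * (LBINT x. ?a x) + TR (\<lambda>x. Re (u x)) / s)) - (lam * (s * (LBINT x. ?b x) + TR (\<lambda>x. Im (u x)) / s))"
  unfolding D by simp
 also have "- (lam * (s * (LBINT x. ?a x) + TR (\<lambda>x. Re (u x)) / s)) - (lam * (s * (LBINT x. ?b x) + TR (\<lambda>x. Im (u x)) / s))
   = - (lam * (s * ((LBINT x. ?a x) + (LBINT x. ?b x)) + (TR (\<lambda>x. Re (u x)) + TR (\<lambda>x. Im (u x))) / s))"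
  by (simp add: distrib_left add_divide_distrib)
 also have "\<dots> = - (c * lam^3) - (TR (\<lambda>x. Re (u x)) + TR (\<lambda>x. Im (u x))) / c"
  unfolding N s_def using c lam by (simp add: field_simps power3_eq_cube)
 finally have "c * (- (c * lam^3) - (TR (\<lambda>x. Re (u x)) + TR (\<lambda>x. Im (u x))) / c) \<le> c * DD ?rho ?rho"
  using c by (intro mult_left_mono) auto
 then show ?thesis unfolding Energy_parts[OF u] c_def[symmetric] using c
  by (simp add: right_diff_distrib power2_eq_square mult.assoc)
qed

lemma e0_le:
 assumes "u \<in> Xspace" "\<gamma> > 0" "lam > 0" "Nmass u = lam"
 shows "e0 \<gamma> lam \<le> Energy \<gamma> u"
 unfolding e0_def
proof (rule cInf_lower)
 show "bdd_below {Energy \<gamma> u |u. u \<in> Xspace \<and> Nmass u = lam}"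
  using Energy_lower_bound assms by (intro bdd_belowI[of _ "- ((\<gamma> / (4 * pi))^2 * lam^3)"]) blast
qed (use assms in blast)

subsection \<open>The linearised quadratic form\<close>

text \<open>The form of the Schroedinger operator with potential \<open>2 * c * pot sg\<close> and
  Lagrange multiplier \<open>kp\<close>; the factor 2 comes from differentiating the interaction,
  which is quadratic in the density.\<close>

definition Qf :: "real \<Rightarrow> (real^2 \<Rightarrow> real) \<Rightarrow> real \<Rightarrow> (real^2 \<Rightarrow> real) \<Rightarrow> real" where
 "Qf c sg kp u = TR u + 2 * c * DD (\<lambda>x. (u x)^2) sg - kp * (LBINT x. (u x)^2)"

lemma Qf_cmult:
 assumes "XR u" "adm sg"
 shows "Qf c sg kp (\<lambda>x. t * u x) = t\<^sup>2 * Qf c sg kp u"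
proof -
 have "DD (\<lambda>x. (t * u x)^2) sg = t\<^sup>2 * DD (\<lambda>x. (u x)^2) sg"
  using DD_lincomb(1)[OF adm_XR[OF assms(1)] adm_XR[OF assms(1)] assms(2), of "t\<^sup>2" 0] by (simp add: power_mult_distrib)
 then show ?thesis unfolding Qf_def using XR_cmult(2)[OF assms(1), of t] by (simp add: power_mult_distrib algebra_simps)
qed

lemma Qf_parallelogram:
 assumes "XR u" "XR v" "adm sg"
 shows "Qf c sg kp (\<lambda>x. u x + v x) + Qf c sg kp (\<lambda>x. u x - v x) = 2 * Qf c sg kp u + 2 * Qf c sg kp v"
proof -
 have m: "XR (\<lambda>x. u x - v x)" using XR_add[OF assms(1) XR_cmult(1)[OF assms(2), of "-1"]] by simp
 note p = XR_add[OF assms(1,2)]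
 have eq: "(\<lambda>x. 1 * (u x + v x)^2 + 1 * (u x - v x)^2) = (\<lambda>x. 2 * (u x)^2 + 2 * (v x)^2)"
  by (auto simp: power2_eq_square algebra_simps)
 have "DD (\<lambda>x. (u x + v x)^2) sg + DD (\<lambda>x. (u x - v x)^2) sg = 2 * DD (\<lambda>x. (u x)^2) sg + 2 * DD (\<lambda>x. (v x)^2) sg"
  using DD_lincomb(1)[OF adm_XR[OF p] adm_XR[OF m] assms(3), of 1 1] DD_lincomb(1)[OF adm_XR[OF assms(1)] adm_XR[OF assms(2)] assms(3), of 2 2]
  unfolding eq by simp
 moreover have "(LBINT x. (u x + v x)^2) + (LBINT x. (u x - v x)^2) = 2 * (LBINT x. (u x)^2) + 2 * (LBINT x. (v x)^2)"
 proof -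
  have "(LBINT x. (u x + v x)^2) + (LBINT x. (u x - v x)^2) = (LBINT x. 1 * (u x + v x)^2 + 1 * (u x - v x)^2)"
   using XR_D(1)[OF p] XR_D(1)[OF m] by simp
  also have "\<dots> = 2 * (LBINT x. (u x)^2) + 2 * (LBINT x. (v x)^2)"
   unfolding eq using XR_D(1)[OF assms(1)] XR_D(1)[OF assms(2)] by simp
  finally show ?thesis .
 qed
 moreover note TR_parallelogram[OF assms(1,2)]
 moreover have "Qf c sg kp (\<lambda>x. u x + v x) + Qf c sg kp (\<lambda>x. u x - v x) = (TR (\<lambda>x. u x + v x) + TR (\<lambda>x. u x - v x))
  + 2 * c * (DD (\<lambda>x. (u x + v x)^2) sg + DD (\<lambda>x. (u x - v x)^2) sg) - kp * ((LBINT x. (u x + v x)^2) + (LBINT x. (u x - v x)^2))"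
  unfolding Qf_def by (simp add: algebra_simps)
 ultimately show ?thesis unfolding Qf_def by (simp add: algebra_simps)
qed

text \<open>The interaction is concave along densities of equal mass, so the energy lies below its
 linearisation at \<open>sg\<close>; hence a minimiser is a ground state of its own linearised operator, and
 strictness pins down the modulus of every ground state.\<close>

lemma Qf_nonneg:
 assumes X: "XR u" and ad: "adm sg" and s: "(LBINT x. sg x) = lam" "lam > 0" and c: "c > 0"
  and e: "\<And>u. XR u \<Longrightarrow> (LBINT x. (u x)^2) = lam \<Longrightarrow> e \<le> ER c u"
  and k: "kp * lam = e + c * DD sg sg"
 shows "0 \<le> Qf c sg kp u" (is ?t1)
  "Qf c sg kp u = 0 \<Longrightarrow> AE x in lborel. lam * (u x)^2 = (LBINT x. (u x)^2) * sg x"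
proof -
 define n where "n = (LBINT x. (u x)^2)"
 have n0: "n \<ge> 0" unfolding n_def by simp
 have "0 \<le> Qf c sg kp u \<and> (Qf c sg kp u = 0 \<longrightarrow> (AE x in lborel. lam * (u x)^2 = n * sg x))"
 proof (cases "n = 0")
  case True
  then have z: "AE x in lborel. (u x)^2 = 0"
   using integral_nonneg_eq_0_iff_AE[OF XR_D(1)[OF X]] unfolding n_def by simp
  have a0: "adm (\<lambda>x. 0)" using adm_XR[OF XR_zero(1)] by simp
  have "DD (\<lambda>x. (u x)^2) sg = DD (\<lambda>x. 0) sg" by (rule DD_cong_AE[OF adm_XR[OF X] a0 ad ad z]) simp
  also have "\<dots> = 0" by (simp add: DD_pot)
  finally have "Qf c sg kp u = TR u" unfolding Qf_def n_def[symmetric] using True by simp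
  moreover have "AE x in lborel. lam * (u x)^2 = n * sg x" using z by eventually_elim (simp add: True)
  ultimately show ?thesis using TR_nonneg[of u] by simp
 next
  case False
  then have n: "n > 0" using n0 by simp
  \<comment> \<open>Rescaled to mass \<open>lam\<close>, the density of \<open>w\<close> differs
    from \<open>sg\<close> by a neutral density, to which negativity applies.\<close>
  define t where "t = sqrt (lam / n)"
  have t2: "t\<^sup>2 = lam / n" "t\<^sup>2 > 0" using n s by (simp_all add: t_def)
  define w where "w x = t * u x" for x
  have Xw: "XR w" unfolding w_def by (rule XR_cmult[OF X])
  have w2: "(w x)^2 = t\<^sup>2 * (u x)^2" for x by (simp add: w_def power_mult_distrib)
  have nw: "(LBINT x. (w x)^2) = lam" unfolding w2 using n t2 by (simp add: n_def)
  note aw = adm_XR[OF Xw]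
  let ?d = "\<lambda>x. 1 * (w x)^2 + (-1) * sg x"
  have ad_d: "adm ?d" by (intro adm_add adm_cmult aw ad)
  have d0: "(LBINT x. ?d x) = 0" using nw s XR_D(1)[OF Xw] admD(1)[OF ad] by simp
  note neg = DD_negative[OF ad_d d0]
  have Dd: "DD ?d ?d = DD (\<lambda>x. (w x)^2) (\<lambda>x. (w x)^2) - 2 * DD (\<lambda>x. (w x)^2) sg + DD sg sg"
   using DD_quadratic[OF aw ad, of 1 "-1"] by simp
  have "Qf c sg kp w = TR w + 2 * c * DD (\<lambda>x. (w x)^2) sg - (e + c * DD sg sg)"
   unfolding Qf_def nw k ..
  also have "\<dots> = (ER c w - e) - c * DD ?d ?d" unfolding Dd ER_def by (simp add: algebra_simps)
  \<comment> \<open>Both contributions are nonnegative, so a zero of the form forces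
    \<open>DD ?d ?d = 0\<close> and then \<open>w^2 = sg\<close> almost everywhere.\<close>
  finally have Qw: "Qf c sg kp w = (ER c w - e) - c * DD ?d ?d" .
  have Qu: "Qf c sg kp w = t\<^sup>2 * Qf c sg kp u" unfolding w_def by (rule Qf_cmult[OF X ad])
  have e0: "e \<le> ER c w" by (rule e[OF Xw nw])
  have cD: "c * DD ?d ?d \<le> 0" using neg(1) c by (simp add: mult_nonneg_nonpos)
  have "0 \<le> Qf c sg kp w" using Qw e0 cD by linarith
  then have 1: ?t1 unfolding Qu using t2(2) by (simp add: zero_le_mult_iff)
  have 2: "AE x in lborel. lam * (u x)^2 = n * sg x" if "Qf c sg kp u = 0"
  proof -
   have "Qf c sg kp w = 0" using Qu that by simp
   then have "c * DD ?d ?d = 0" using Qw e0 cD by linarith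
   then have "DD ?d ?d = 0" using c by simp
   from neg(2)[OF this] show ?thesis
   proof eventually_elim
    case (elim x)
    then have "sg x = lam / n * (u x)^2" unfolding w2 t2 by simp
    then show ?case using n by simp
   qed
  qed
  show ?thesis using 1 2 by blast
 qed
 then show ?t1 "Qf c sg kp u = 0 \<Longrightarrow> AE x in lborel. lam * (u x)^2 = (LBINT x. (u x)^2) * sg x"
  unfolding n_def by blast+
qed

definition rmin :: "real \<Rightarrow> real \<Rightarrow> (real^2 \<Rightarrow> real) \<Rightarrow> bool" where
 "rmin c lam w \<longleftrightarrow> XR w \<and> (\<forall>x. w x \<ge> 0) \<and> (LBINT x. (w x)^2) = lam \<and>
   (\<forall>u. XR u \<longrightarrow> (LBINT x. (u x)^2) = lam \<longrightarrow> ER c w \<le> ER c u)"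

lemma ER_ge_e0:
 assumes "\<gamma> > 0" "lam > 0" "XR u" "(LBINT x. (u x)^2) = lam"
 shows "e0 \<gamma> lam \<le> ER (\<gamma> / (4 * pi)) u"
 using e0_le[OF XR_Xspace[OF assms(3)] assms(1,2)] assms(4) Energy_of_real[OF assms(3)] by (simp add: Nmass_def)

lemma real_of_square_nonneg:
 fixes z :: complex
 assumes "z\<^sup>2 = complex_of_real s" "s \<ge> 0"
 shows "Im z = 0"
proof -
 have "Re (z\<^sup>2) = s" "Im (z\<^sup>2) = 0" using assms by simp_all
 then have 1: "(Re z)^2 - (Im z)\<^sup>2 = s" "2 * (Re z * Im z) = 0" by (auto simp: power2_eq_square)
 then consider "Re z = 0" | "Im z = 0" unfolding mult_eq_0_iff by auto
 then show ?thesis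
 proof cases
  case 1
  then have "- (Im z)\<^sup>2 = s" using \<open>(Re z)\<^sup>2 - (Im z)\<^sup>2 = s\<close> by simp
  then have "(Im z)^2 = 0" using assms(2) zero_le_power2[of "Im z"] by linarith
  then show ?thesis by simp
 qed
qed

text \<open>The zeros of a nonnegative quadratic form are a linear space. The real and imaginary
  parts of \<open>v\<close> are zeros, and so are their combinations, each of which has its square
  proportional to \<open>sg\<close>. Hence \<open>v^2\<close> is a constant multiple of
  \<open>\<bar>v\<bar>^2\<close>, and half the argument of that constant is the phase, up to a
  sign.\<close>

lemma minimiser_phase:
 fixes v :: "real^2 \<Rightarrow> complex"
 assumes g: "\<gamma> > 0" and lam: "lam > 0" and v: "v \<in> Xspace" "Nmass v = lam" "Energy \<gamma> v = e0 \<gamma> lam"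
 obtains th :: real and w where "rmin (\<gamma> / (4 * pi)) lam w"
  "AE x in lborel. v x = exp (\<i> * complex_of_real th) * complex_of_real (w x)"
proof -
 define c where "c = \<gamma> / (4 * pi)"
 have c: "c > 0" using g by (simp add: c_def)
 define sg where "sg x = (cmod (v x))^2" for x
 have ad: "adm sg" unfolding sg_def by (rule adm_Xspace[OF v(1)])
 have s: "(LBINT x. sg x) = lam" using v(2) by (simp add: Nmass_def sg_def)
 define kp where "kp = (e0 \<gamma> lam + c * DD sg sg) / lam"
 have k: "kp * lam = e0 \<gamma> lam + c * DD sg sg" using lam by (simp add: kp_def)
 have ge: "e0 \<gamma> lam \<le> ER c u" if "XR u" "(LBINT x. (u x)^2) = lam" for u
  unfolding c_def by (rule ER_ge_e0[OF g lam that])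
 note Q0 = Qf_nonneg[OF _ ad s lam c ge k]
 define Z where "Z u \<longleftrightarrow> XR u \<and> Qf c sg kp u = 0" for u
 \<comment> \<open>By the parallelogram law the two nonnegative values of the form at
   \<open>p + q\<close> and \<open>p - q\<close> add up to 0.\<close>
 have Zadd: "Z (\<lambda>x. p x + q x)" if "Z p" "Z q" for p q
 proof -
  have X: "XR p" "XR q" and q: "Qf c sg kp p = 0" "Qf c sg kp q = 0" using that by (auto simp: Z_def)
  have "XR (\<lambda>x. p x - q x)" using XR_add[OF X(1) XR_cmult(1)[OF X(2), of "-1"]] by simp
  then have "0 \<le> Qf c sg kp (\<lambda>x. p x - q x)" by (rule Q0(1))
  moreover have "0 \<le> Qf c sg kp (\<lambda>x. p x + q x)" by (rule Q0(1)[OF XR_add[OF X]])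
  ultimately have "Qf c sg kp (\<lambda>x. p x + q x) = 0" using Qf_parallelogram[OF X ad, of c kp] q by linarith
  then show ?thesis using XR_add[OF X] by (simp add: Z_def)
 qed
 have Zc: "Z (\<lambda>x. t * p x)" if "Z p" for t p
  using that XR_cmult(1)[of p t] Qf_cmult[OF _ ad, of p c kp t] by (simp add: Z_def)
 define a where "a x = Re (v x)" for x
 define b where "b x = Im (v x)" for x
 have Xa: "XR a" and Xb: "XR b" unfolding a_def b_def by (rule Xspace_parts[OF v(1)])+
 have sgab: "sg x = 1 * (a x)^2 + 1 * (b x)^2" for x by (simp add: sg_def a_def b_def cmod_power2)
 have "DD (\<lambda>x. (a x)^2) sg + DD (\<lambda>x. (b x)^2) sg = DD sg sg"
  using DD_lincomb(1)[OF adm_XR[OF Xa] adm_XR[OF Xb] ad, of 1 1] unfolding sgab[symmetric] by simp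
 moreover have "(LBINT x. (a x)^2) + (LBINT x. (b x)^2) = lam"
  unfolding s[symmetric] sgab using XR_D(1)[OF Xa] XR_D(1)[OF Xb] by simp
 moreover have "TR a + TR b + c * DD sg sg = e0 \<gamma> lam"
  using Energy_parts[OF v(1), of \<gamma>] v(3) unfolding a_def b_def sg_def c_def by simp
 moreover have "Qf c sg kp a + Qf c sg kp b = TR a + TR b + 2 * c * (DD (\<lambda>x. (a x)^2) sg + DD (\<lambda>x. (b x)^2) sg)
   - kp * ((LBINT x. (a x)^2) + (LBINT x. (b x)^2))" unfolding Qf_def by (simp add: algebra_simps)
 ultimately have "Qf c sg kp a + Qf c sg kp b = 0" using k by simp
 then have Za: "Z a" and Zb: "Z b" using Q0(1)[OF Xa] Q0(1)[OF Xb] Xa Xb by (auto simp: Z_def)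
 note Zab = Zadd[OF Za Zb]
 \<comment> \<open>With \<open>a^2 = al * sg\<close>, \<open>(a + b)^2 = bt * sg\<close> and
   \<open>a^2 + b^2 = sg\<close>, the square of \<open>a + i b\<close> is
   \<open>((2 al - 1) + i (bt - 1)) * sg\<close>.\<close>
 define al where "al = (LBINT x. (a x)^2) / lam"
 define bt where "bt = (LBINT x. (a x + b x)^2) / lam"
 define zt where "zt = Complex (2 * al - 1) (bt - 1)"
 have Z2: "AE x in lborel. lam * (p x)^2 = (LBINT x. (p x)^2) * sg x" if "Z p" for p
  by (rule Q0(2)) (use that in \<open>auto simp: Z_def\<close>)
 have sq: "AE x in lborel. (v x)^2 = zt * complex_of_real (sg x)"
  using Z2[OF Za] Z2[OF Zab]
 proof eventually_elim
  case (elim x)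
  have 1: "(a x)^2 = al * sg x" using elim(1) lam by (simp add: al_def field_simps)
  have 2: "(a x + b x)^2 = bt * sg x" using elim(2) lam by (simp add: bt_def field_simps)
  have "(a x)^2 - (b x)\<^sup>2 = (2 * al - 1) * sg x" using 1 sgab[of x] by (simp add: algebra_simps)
  moreover have "2 * a x * b x = (bt - 1) * sg x" using 2 sgab[of x] by (simp add: power2_eq_square algebra_simps)
  ultimately show ?case
   by (simp add: complex_eq_iff zt_def a_def b_def power2_eq_square mult.commute mult.left_commute)
 qed
 have "cmod zt = 1"
 proof (rule ccontr)
  assume n: "cmod zt \<noteq> 1"
  have "AE x in lborel. sg x = 0"
   using sq
  proof eventually_elim
   case (elim x)
   have "cmod ((v x)^2) = cmod zt * sg x" unfolding elim by (simp add: norm_mult sg_def norm_power)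
   then have "sg x = cmod zt * sg x" by (simp add: norm_power sg_def)
   then show ?case using n by simp
  qed
  then have "(LBINT x. sg x) = (\<integral>x. 0 \<partial>(lborel :: (real^2) measure))"
   by (intro integral_cong_AE) (use admD(4)[OF ad] in auto)
  then show False using s lam by simp
 qed
 then obtain et where et: "zt = exp (\<i> * complex_of_real et)"
  by (metis complex_norm_eq_1_exp)
 define th where "th = et / 2"
 define w0 where "w0 x = cos th * a x + sin th * b x" for x
 have Zw: "Z w0" unfolding w0_def by (intro Zadd Zc Za Zb)
 have phase: "AE x in lborel. v x = exp (\<i> * complex_of_real th) * complex_of_real (w0 x) \<and> (w0 x)\<^sup>2 = sg x"
  using sq
 proof eventually_elim
  case (elim x)
  define z where "z = exp (- (\<i> * complex_of_real th)) * v x"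
  have "z\<^sup>2 = exp (- (\<i> * complex_of_real th)) ^ 2 * (v x)^2" by (simp add: z_def power_mult_distrib)
  also have "exp (- (\<i> * complex_of_real th)) ^ 2 = exp (- (\<i> * complex_of_real et))"
   by (simp add: exp_double[symmetric] th_def)
  also have "exp (- (\<i> * complex_of_real et)) * (v x)^2 = complex_of_real (sg x)"
   unfolding elim et by (simp add: exp_minus)
  finally have z2: "z\<^sup>2 = complex_of_real (sg x)" .
  then have "Im z = 0" by (rule real_of_square_nonneg) (simp add: sg_def)
  moreover have "Re z = w0 x"
   by (simp add: z_def w0_def a_def b_def exp_minus[symmetric] Re_exp Im_exp)
  ultimately have zw: "z = complex_of_real (w0 x)" by (simp add: complex_eq_iff)
  have "v x = exp (\<i> * complex_of_real th) * z" by (simp add: z_def exp_minus)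
  moreover have "(w0 x)^2 = sg x" using z2 unfolding zw by (metis of_real_eq_iff of_real_power)
  ultimately show ?case using zw by simp
 qed
 have Xw: "XR w0" using Zw by (simp add: Z_def)
 note [measurable] = XR_D(3)[OF Xw]
 define w where "w x = \<bar>w0 x\<bar>" for x
 have XW: "XR w" unfolding w_def by (rule XR_abs[OF Xw])
 have "Qf c sg kp w \<le> Qf c sg kp w0" unfolding Qf_def w_def using XR_abs(2)[OF Xw] by simp
 then have ZW: "Z w" using Zw Q0(1)[OF XW] XW by (simp add: Z_def)
 have w2: "AE x in lborel. (w x)^2 = sg x" using phase by eventually_elim (simp add: w_def)
 have nw: "(LBINT x. (w x)^2) = lam" unfolding s[symmetric]
  by (rule integral_cong_AE) (use w2 XR_D(3)[OF XW] admD(4)[OF ad] in auto)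
 have DW: "DD (\<lambda>x. (w x)^2) (\<lambda>x. (w x)^2) = DD sg sg" "DD (\<lambda>x. (w x)^2) sg = DD sg sg"
  using DD_cong_AE[OF adm_XR[OF XW] ad adm_XR[OF XW] ad w2 w2] DD_cong_AE[OF adm_XR[OF XW] ad ad ad w2] by auto
 have "ER c w = e0 \<gamma> lam"
  using ZW k nw unfolding Z_def Qf_def ER_def DW by simp
 then have rm: "rmin c lam w" unfolding rmin_def using XW nw ge by (auto simp: w_def)
 \<comment> \<open>\<open>w0 + w\<close> is again a zero of the form, so its square is a multiple of
   \<open>sg\<close>: either it vanishes almost everywhere, and \<open>w0 = - w\<close>, or it is
   nonzero wherever \<open>sg\<close> is, and \<open>w0\<close> is nonnegative almost
   everywhere.\<close>
 note ZS = Z2[OF Zadd[OF Zw ZW]]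
 show thesis
 proof (cases "(LBINT x. (w0 x + w x)^2) = 0")
  case True
  \<comment> \<open>The sign is absorbed by shifting the phase by \<open>pi\<close>.\<close>
  have "AE x in lborel. v x = exp (\<i> * complex_of_real (th + pi)) * complex_of_real (w x)"
   using ZS phase
  proof eventually_elim
   case (elim x)
   then have "w0 x + w x = 0" using True lam by simp
   then have "w0 x = - w x" by linarith
   then show ?case using elim by (simp add: distrib_left exp_add)
  qed
  then show thesis using that rm unfolding c_def by blast
 next
  case False
  have "AE x in lborel. v x = exp (\<i> * complex_of_real th) * complex_of_real (w x)"
   using ZS phase
  proof eventually_elim
   case (elim x)
   have "w0 x \<ge> 0"
   proof (rule ccontr)
    assume n: "\<not> w0 x \<ge> 0"
    then have "w0 x + w x = 0" by (simp add: w_def)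
    then have "sg x = 0" using elim(1) False by simp
    then show False using elim(2) n by simp
   qed
   then show ?case using elim(2) by (simp add: w_def)
  qed
  then show thesis using that rm unfolding c_def by blast
 qed
qed

section \<open>Symmetry of minimisers by polarisation\<close>

lemma AE_inner_neq:
 fixes e :: "real^2"
 assumes "norm e = 1"
 shows "AE x in lborel. x \<bullet> e \<noteq> t"
proof -
 have "negligible {x. e \<bullet> x = t}" using assms by (intro negligible_hyperplane) auto
 then have "{x. e \<bullet> x = t} \<in> null_sets lebesgue" by (simp add: negligible_iff_null_sets)
 moreover have "{x. e \<bullet> x = t} \<in> sets lborel" using closed_hyperplane[of e t] by simp
 ultimately have "{x. e \<bullet> x = t} \<in> null_sets lborel" by (simp add: null_sets_completion_iff)
 then have "AE x in lborel. x \<notin> {x. e \<bullet> x = t}" by (rule AE_not_in)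
 then show ?thesis by eventually_elim (simp add: inner_commute)
qed

lemma pot_mirror:
 assumes "adm sg" and e: "norm e = 1"
 shows "pot (\<lambda>x. sg (mirror e x)) x = pot sg (mirror e x)" (is ?t1)
  "(LBINT y. ln (norm (x - mirror e y)) * sg y) = pot sg (mirror e x)" (is ?t2)
  "integ (\<lambda>y. ln (norm (x - mirror e y)) * sg y)" (is ?t3)
proof -
 note o = mirror_orthogonal[OF e]
 note [measurable] = admD(4)[OF assms(1)] orthogonal_borel[OF o]
 have n: "norm (x - mirror e y) = norm (mirror e x - y)" for y
 proof -
  have "mirror e (mirror e x - y) = x - mirror e y"
   using linear_diff[OF mirror_linear] mirror_mirror[OF e] by metis
  then show ?thesis using mirror_norm[OF e, of "mirror e x - y"] by simp
 qed
 have "(LBINT y. ln (norm (x - y)) * sg (mirror e y)) = (LBINT y. ln (norm (x - mirror e y)) * sg y)"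
  using integral_orthogonal[OF o, of "\<lambda>y. ln (norm (x - mirror e y)) * sg y"] by (simp add: mirror_mirror[OF e])
 then show ?t1 unfolding pot_def by (simp add: n)
 show ?t2 unfolding pot_def by (simp add: n)
 show ?t3 unfolding n by (rule pot_integrable[OF assms(1)])
qed

lemma DD_mirror:
 assumes "adm rho" "adm sg" and e: "norm e = 1"
 shows "DD (\<lambda>x. rho (mirror e x)) (\<lambda>x. sg (mirror e x)) = DD rho sg"
proof -
 note [measurable] = admD(4)[OF assms(1)] pot_borel[OF assms(2)]
 show ?thesis unfolding DD_pot pot_mirror[OF assms(2) e]
  by (rule integral_orthogonal[OF mirror_orthogonal[OF e], of "\<lambda>x. rho x * pot sg x"]) measurable
qed

lemma XR_mirror:
 assumes "XR u" and e: "norm e = 1"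
 shows "XR (\<lambda>x. u (mirror e x))"
proof -
 obtain G where G: "wgrad u G" "integ (\<lambda>x. (norm (G x))^2)" using XR_E[OF assms(1)] .
 note o = mirror_orthogonal[OF e]
 show ?thesis unfolding XR_def
  using wgrad_mirror[OF G(1) e] integrable_orthogonal[OF o G(2)] integrable_orthogonal[OF o XR_D(1)[OF assms(1)]]
   integrable_orthogonal[OF o XR_D(2)[OF assms(1)]]
  by (intro conjI exI[of _ "\<lambda>x. mirror e (G (mirror e x))"]) (auto simp: mirror_norm[OF e])
qed

lemma integral_odd:
 assumes e: "norm e = 1" and "F \<in> Bor" "\<And>x. F (mirror e x) = - F x"
 shows "(LBINT x. F x) = (0::real)"
 using integral_orthogonal[OF mirror_orthogonal[OF e] assms(2)] assms(3) by simp

lemma mirror_dist: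
 assumes e: "norm e = 1"
 shows "(norm (x - mirror e y))^2 = (norm (x - y))^2 + 4 * (x \<bullet> e) * (y \<bullet> e)"
proof -
 have ee: "e \<bullet> e = 1" using e by (simp add: norm_eq_1)
 show ?thesis unfolding power2_norm_eq_inner mirror_def
  by (simp add: inner_simps ee algebra_simps inner_commute)
qed

text \<open>Two points on the same side of a line are closer to each other than one is to the mirror
  image of the other; on opposite sides it is the reverse. Points at which a logarithm would be
  evaluated at 0 are excluded.\<close>

lemma mirror_kernel_sign:
 assumes e: "norm e = 1" and nz: "x \<bullet> e \<noteq> 0" "y \<bullet> e \<noteq> 0" "x \<noteq> y" "x \<noteq> mirror e y"
 defines "k \<equiv> ln (norm (x - y)) - ln (norm (x - mirror e y))"
 shows "k * (sgn (x \<bullet> e) * sgn (y \<bullet> e)) < 0"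
proof (cases "(x \<bullet> e) * (y \<bullet> e) > 0")
 case True
 then have s: "sgn (x \<bullet> e) * sgn (y \<bullet> e) = 1" by (simp add: sgn_mult[symmetric])
 have "(norm (x - y))^2 < (norm (x - mirror e y))\<^sup>2" unfolding mirror_dist[OF e] using True by simp
 then have "norm (x - y) < norm (x - mirror e y)" by (rule power_less_imp_less_base) simp
 then have "k < 0" unfolding k_def using nz by simp
 then show ?thesis using s by simp
next
 case False
 then have l: "(x \<bullet> e) * (y \<bullet> e) < 0" using nz by (simp add: mult_less_0_iff zero_less_mult_iff) linarith
 then have s: "sgn (x \<bullet> e) * sgn (y \<bullet> e) = -1" by (simp add: sgn_mult[symmetric])
 have "(norm (x - mirror e y))^2 < (norm (x - y))\<^sup>2" unfolding mirror_dist[OF e] using l by simp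
 then have "norm (x - mirror e y) < norm (x - y)" by (rule power_less_imp_less_base) simp
 then have "k > 0" unfolding k_def using nz by simp
 then show ?thesis using s by simp
qed

text \<open>For odd densities the kernel may be antisymmetrised, and its sign is then known. This
  makes \<open>h\<close> nonnegative, so the assumed inequality forces \<open>h = 0\<close>: at
  almost all pairs of points the values of \<open>s * d\<close> have a nonnegative product. A
  density of one sign with balance 0 must vanish.\<close>

lemma odd_polarisation:
 assumes ad: "adm d" and odd: "\<And>x. d (mirror e x) = - d x" and e: "norm e = 1"
  and le: "DD d d \<le> DD (\<lambda>x. sgn (x \<bullet> e) * \<bar>d x\<bar>) (\<lambda>x. sgn (x \<bullet> e) * \<bar>d x\<bar>)"
  and bal: "(LBINT x. sgn (x \<bullet> e) * d x) = 0"
 shows "AE x in lborel. d x = 0"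
proof -
 note o = mirror_orthogonal[OF e]
 note [measurable] = admD(4)[OF ad] orthogonal_borel[OF o]
 define s where "s x = sgn (x \<bullet> e)" for x :: "real^2"
 have [measurable]: "s \<in> Bor" unfolding s_def by measurable
 have s_odd: "s (mirror e x) = - s x" for x by (simp add: s_def mirror_inner[OF e] sgn_minus)
 have s1: "\<bar>s x\<bar> \<le> 1" for x by (simp add: s_def sgn_real_def)
 define D where "D x = s x * \<bar>d x\<bar>" for x
 have aD: "adm D" unfolding D_def
  by (rule adm_bound[OF ad]) (use s1 in \<open>auto simp: abs_mult mult_left_le_one_le\<close>)
 have D_odd: "D (mirror e x) = - D x" for x by (simp add: D_def s_odd odd)
 define k where "k x y = ln (norm (x - y)) - ln (norm (x - mirror e y))" for x y
 \<comment> \<open>The potential of an odd density is odd as well, so it is half of the integral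
   against the difference kernel \<open>k\<close>.\<close>
 have pk: "pot f x = 1/2 * (LBINT y. k x y * f y)" (is ?t1) "integ (\<lambda>y. k x y * f y)" (is ?t2)
  if af: "adm f" and fo: "\<And>x. f (mirror e x) = - f x" for f x
 proof -
  have "pot (\<lambda>x. f (mirror e x)) x = - pot f x"
   unfolding fo pot_def by simp
  then have m: "pot f (mirror e x) = - pot f x" using pot_mirror(1)[OF af e] by simp
  have "(LBINT y. k x y * f y) = pot f x - pot f (mirror e x)"
   unfolding k_def left_diff_distrib pot_mirror(2)[OF af e, symmetric]
   using pot_integrable[OF af, of x] pot_mirror(3)[OF af e, of x] by (simp add: pot_def)
  then show ?t1 using m by simp
  show ?t2
   unfolding k_def left_diff_distrib by (intro Lintegrable_diff pot_integrable[OF af] pot_mirror(3)[OF af e])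
 qed
 note pd = pk[OF ad odd] and pD = pk[OF aD D_odd]
 define h where "h x y = k x y * (d x * d y) - k x y * (D x * D y)" for x y
 have ih: "integ (\<lambda>y. h x y)" for x
  using integrable_mult_right[OF pd(2)[of x], of "d x"] integrable_mult_right[OF pD(2)[of x], of "D x"]
  unfolding h_def by (intro Lintegrable_diff) (simp_all add: mult_ac)
 have H: "(LBINT y. h x y) = 2 * (d x * pot d x - D x * pot D x)" for x
 proof -
  have "(LBINT y. h x y) = (LBINT y. d x * (k x y * d y) - D x * (k x y * D y))"
   unfolding h_def by (simp add: mult_ac)
  also have "\<dots> = d x * (LBINT y. k x y * d y) - D x * (LBINT y. k x y * D y)"
   using pd(2)[of x] pD(2)[of x] by simp
  finally show ?thesis unfolding pd(1)[of x] pD(1)[of x] by (simp add: algebra_simps)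
 qed
 have AEy: "AE y in lborel. k x y * (s x * s y) < 0" if "x \<bullet> e \<noteq> 0" for x
  using AE_inner_neq[OF e, of 0] AE_lborel_singleton[of x] AE_orthogonal[OF o AE_lborel_singleton[of x]]
 proof eventually_elim
  case (elim y)
  show ?case unfolding k_def s_def by (rule mirror_kernel_sign[OF e that]) (use elim in auto)
 qed
 have hsign: "h x y \<ge> 0 \<and> (h x y = 0 \<longrightarrow> (s x * d x) * (s y * d y) = \<bar>d x\<bar> * \<bar>d y\<bar>)" if ks: "k x y * (s x * s y) < 0" for x y
 proof -
  have "s x \<noteq> 0" "s y \<noteq> 0" using ks by auto
  then have ss: "s x * s y = 1 \<or> s x * s y = -1" unfolding s_def by (auto simp: sgn_real_def split: if_splits)
  have a: "D x * D y = (s x * s y) * (\<bar>d x\<bar> * \<bar>d y\<bar>)" by (simp add: D_def mult_ac)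
  have b: "(s x * d x) * (s y * d y) = (s x * s y) * (d x * d y)" by (simp add: mult_ac)
  have eq: "h x y = (- (k x y * (s x * s y))) * (\<bar>d x\<bar> * \<bar>d y\<bar> - (s x * d x) * (s y * d y))"
   unfolding h_def a b using ss by (elim disjE) (simp_all add: algebra_simps)
  have "(s x * d x) * (s y * d y) \<le> \<bar>d x * d y\<bar>"
   unfolding b using ss abs_ge_self[of "d x * d y"] abs_ge_minus_self[of "d x * d y"] by (elim disjE) simp_all
  then have B: "0 \<le> \<bar>d x\<bar> * \<bar>d y\<bar> - (s x * d x) * (s y * d y)" by (simp add: abs_mult)
  have A: "- (k x y * (s x * s y)) > 0" using ks by simp
  show ?thesis
  proof
   show "0 \<le> h x y" unfolding eq using A B by (intro mult_nonneg_nonneg) auto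
   show "h x y = 0 \<longrightarrow> (s x * d x) * (s y * d y) = \<bar>d x\<bar> * \<bar>d y\<bar>"
    unfolding eq mult_eq_0_iff[of "- (k x y * (s x * s y))"] using A by linarith
  qed
 qed
 have AEx: "AE x in lborel. x \<bullet> e \<noteq> 0" by (rule AE_inner_neq[OF e])
 have Hnn: "AE x in lborel. 0 \<le> (LBINT y. h x y)"
  using AEx
 proof eventually_elim
  case (elim x)
  have "AE y in lborel. 0 \<le> h x y" using AEy[OF elim] by eventually_elim (use hsign in blast)
  then show ?case by (rule integral_nonneg_AE)
 qed
 have iH: "integ (\<lambda>x. LBINT y. h x y)"
  unfolding H by (intro integrable_mult_right Lintegrable_diff DD_pot_integrable ad aD)
 have "(LBINT x. (LBINT y. h x y)) = 2 * (DD d d - DD D D)"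
  unfolding H DD_pot using DD_pot_integrable[OF ad ad] DD_pot_integrable[OF aD aD] by simp
 also have "\<dots> \<le> 0" using le unfolding D_def s_def by simp
 finally have "(LBINT x. (LBINT y. h x y)) \<le> 0" .
 moreover have "0 \<le> (LBINT x. (LBINT y. h x y))" by (rule integral_nonneg_AE[OF Hnn])
 ultimately have "(LBINT x. (LBINT y. h x y)) = 0" by linarith
 then have H0: "AE x in lborel. (LBINT y. h x y) = 0"
  using integral_nonneg_eq_0_iff_AE[OF iH Hnn] by simp
 define I where "I = (LBINT y. \<bar>d y\<bar>)"
 have "AE x in lborel. \<bar>d x\<bar> * I = 0"
  using H0 AEx
 proof eventually_elim
  case (elim x)
  have nn: "AE y in lborel. 0 \<le> h x y" using AEy[OF elim(2)] by eventually_elim (use hsign in blast)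
  have "AE y in lborel. h x y = 0" using integral_nonneg_eq_0_iff_AE[OF ih nn] elim(1) by simp
  then have ae: "AE y in lborel. (s x * d x) * (s y * d y) = \<bar>d x\<bar> * \<bar>d y\<bar>"
   using AEy[OF elim(2)] by eventually_elim (use hsign in blast)
  \<comment> \<open>After integration in \<open>y\<close> the left side is \<open>s x * d x\<close>
    times the balance integral, that is 0.\<close>
  have "(LBINT y. (s x * d x) * (s y * d y)) = (LBINT y. \<bar>d x\<bar> * \<bar>d y\<bar>)"
   by (rule integral_cong_AE) (measurable, measurable, rule ae)
  then show ?case using bal unfolding s_def[symmetric] I_def by simp
 qed
 then have "(LBINT x. \<bar>d x\<bar> * I) = (\<integral>x. 0 \<partial>(lborel :: (real^2) measure))"
  by (intro integral_cong_AE) auto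
 then have "I = 0" by (simp add: I_def)
 then have "AE y in lborel. \<bar>d y\<bar> = 0"
  unfolding I_def using integral_nonneg_eq_0_iff_AE[of lborel "\<lambda>y. \<bar>d y\<bar>"] admD(1)[OF ad] by simp
 then show ?thesis by eventually_elim simp
qed

text \<open>\<open>P\<close> is the larger of \<open>w\<close> and its reflection on the side
  \<open>x \<bullet> e > 0\<close> and the smaller on the other. Off the coincidence set its
  gradient is that of \<open>w\<close> or of the reflected function, with the roles matched at the
  mirror point, so the Dirichlet integral does not grow.\<close>

lemma TR_polarisation_le:
 assumes X: "XR w" and e: "norm e = 1"
 defines "g \<equiv> \<lambda>x. w x - w (mirror e x)"
 defines "P \<equiv> \<lambda>x. 1/2 * ((w x + w (mirror e x)) + sgn (x \<bullet> e) * \<bar>g x\<bar>)"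
 shows "XR P" "TR P \<le> TR w"
proof -
 note o = mirror_orthogonal[OF e]
 obtain G where G: "wgrad w G" "integ (\<lambda>x. (norm (G x))^2)" "TR w = (LBINT x. (norm (G x))^2)" using XR_E[OF X] .
 note [measurable] = wgrad_borel[OF G(1)] orthogonal_borel[OF o]
 define s where "s x = sgn (x \<bullet> e)" for x :: "real^2"
 have [measurable]: "s \<in> Bor" unfolding s_def by measurable
 have s_odd: "s (mirror e x) = - s x" for x by (simp add: s_def mirror_inner[OF e] sgn_minus)
 have s3: "s x = 1 \<or> s x = -1 \<or> s x = 0" for x by (auto simp: s_def sgn_real_def)
 define GR where "GR x = mirror e (G (mirror e x))" for x
 have GR: "wgrad (\<lambda>x. w (mirror e x)) GR" unfolding GR_def by (rule wgrad_mirror[OF G(1) e])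
 define H where "H x = G x - GR x" for x
 have wg: "wgrad g H" unfolding g_def H_def by (rule wgrad_diff[OF G(1) GR])
 have g_odd: "g (mirror e x) = - g x" for x by (simp add: g_def mirror_mirror[OF e])
 have wsg: "wgrad (\<lambda>x. s x * g x) (\<lambda>x. s x *\<^sub>R H x)" unfolding s_def by (rule wgrad_odd_sgn[OF wg g_odd e])
 \<comment> \<open>The rule for a product with the sign covers odd functions, and
   \<open>\<bar>g\<bar>\<close> is even; so \<open>s * \<bar>g\<bar>\<close> is written as
   \<open>\<bar>g + s * g\<bar> - \<bar>g\<bar>\<close>, in which the sign multiplies the odd
   \<open>g\<close>.\<close>
 define GP where "GP x = (1/2) *\<^sub>R ((G x + GR x) + (sgn (g x + s x * g x) *\<^sub>R (H x + s x *\<^sub>R H x) - sgn (g x) *\<^sub>R H x))" for x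
 have "wgrad (\<lambda>x. 1/2 * ((w x + w (mirror e x)) + (\<bar>g x + s x * g x\<bar> - \<bar>g x\<bar>))) GP" unfolding GP_def
  by (intro wgrad_cmult wgrad_add wgrad_diff wgrad_abs G(1) GR wg wsg)
 moreover have "\<bar>g x + s x * g x\<bar> - \<bar>g x\<bar> = s x * \<bar>g x\<bar>" for x using s3[of x] by auto
 ultimately have wP: "wgrad P GP" unfolding P_def s_def by simp
 \<comment> \<open>\<open>eps\<close> is 1 where \<open>P\<close> follows \<open>w\<close>, -1 where
   it follows the reflection, and 0 on the line or where \<open>g\<close> vanishes; there the mean
   of both gradients appears.\<close>
 define eps where "eps x = s x * sgn (g x)" for x
 have GPe: "GP x = (1/2) *\<^sub>R ((G x + GR x) + eps x *\<^sub>R H x)" for x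
 proof -
  have "sgn (g x + s x * g x) *\<^sub>R (H x + s x *\<^sub>R H x) - sgn (g x) *\<^sub>R H x = eps x *\<^sub>R H x"
   using s3[of x] by (auto simp: eps_def sgn_real_def scaleR_2[symmetric] algebra_simps split: if_splits)
  then show ?thesis unfolding GP_def by simp
 qed
 define K where "K x = (norm (G x))^2" for x
 have KR: "(norm (GR x))^2 = K (mirror e x)" for x by (simp add: GR_def K_def mirror_norm[OF e])
 have [measurable]: "K \<in> Bor" unfolding K_def by measurable
 have [measurable]: "g \<in> Bor" unfolding g_def by measurable
 have [measurable]: "eps \<in> Bor" unfolding eps_def by measurable
 have e3: "eps x = 1 \<or> eps x = -1 \<or> eps x = 0" for x using s3[of x] by (auto simp: eps_def sgn_real_def)
 have e_even: "eps (mirror e x) = eps x" for x by (simp add: eps_def s_odd g_odd sgn_minus)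
 have iK: "integ K" "integ (\<lambda>x. K (mirror e x))"
  using G(2) integrable_orthogonal[OF o, of K] by (auto simp: K_def[abs_def])
 have bnd: "(norm (GP x))^2 \<le> 1/2 * (K x + K (mirror e x)) + 1/2 * (eps x * (K x - K (mirror e x)))" for x
 proof -
  have par: "(norm ((1/2) *\<^sub>R (G x + GR x)))^2 \<le> 1/2 * (K x + K (mirror e x))"
   using norm_square_add_le[of "G x" "GR x"] by (simp add: power_divide K_def[symmetric] KR)
  have h1: "(1/2) *\<^sub>R ((G x + GR x) + H x) = G x" "(1/2) *\<^sub>R ((G x + GR x) + (-1) *\<^sub>R H x) = GR x"
   by (simp_all add: H_def scaleR_2[symmetric] algebra_simps)
  show ?thesis using e3[of x]
  proof (elim disjE)
   assume "eps x = 1" then show ?thesis unfolding GPe using h1 by (simp add: K_def[symmetric] field_simps)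
  next
   assume "eps x = -1" then show ?thesis unfolding GPe using h1 by (simp add: KR field_simps)
  next
   assume "eps x = 0" then show ?thesis unfolding GPe using par by simp
  qed
 qed
 have ie: "integ (\<lambda>x. eps x * (K x - K (mirror e x)))"
 proof (rule Lintegrable_bound[OF Lintegrable_diff[OF iK]])
  show "AE x in lborel. norm (eps x * (K x - K (mirror e x))) \<le> norm (K x - K (mirror e x))" (is "AE x in _. ?Q1 x")
  proof (rule AE_I2)
   fix x show "?Q1 x" using e3[of x] by auto
  qed
 qed measurable
 have iB: "integ (\<lambda>x. 1/2 * (K x + K (mirror e x)) + 1/2 * (eps x * (K x - K (mirror e x))))"
  by (intro Lintegrable_add integrable_mult_right iK ie)
 have XwR: "XR (\<lambda>x. w (mirror e x))" by (rule XR_mirror[OF X e])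
 have Xg: "XR g" unfolding g_def using XR_add[OF X XR_cmult(1)[OF XwR, of "-1"]] by simp
 have Xsg: "XR (\<lambda>x. s x * g x)"
 proof (rule XR_I(1)[OF wsg XR_wgrad_integrable[OF Xg wg] _ XR_D(1)[OF Xg] _ XR_D(2)[OF Xg]])
  show "(norm (s x *\<^sub>R H x))^2 \<le> (norm (H x))^2" for x using s3[of x] by auto
  show "(s x * g x)^2 \<le> (g x)^2" for x using s3[of x] by auto
 qed
 have "XR (\<lambda>x. 1/2 * ((w x + w (mirror e x)) + (\<bar>g x + s x * g x\<bar> + (-1) * \<bar>g x\<bar>)))"
  by (intro XR_cmult(1) XR_add XR_abs(1) X XwR Xg Xsg)
 moreover have "\<bar>g x + s x * g x\<bar> + (-1) * \<bar>g x\<bar> = s x * \<bar>g x\<bar>" for x using s3[of x] by auto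
 ultimately show XP: "XR P" unfolding P_def s_def by simp
 have "TR P = (LBINT x. (norm (GP x))^2)" by (rule TR_eq[OF wP])
 also have "\<dots> \<le> (LBINT x. 1/2 * (K x + K (mirror e x)) + 1/2 * (eps x * (K x - K (mirror e x))))"
  by (rule integral_mono[OF XR_wgrad_integrable[OF XP wP] iB bnd])
 also have "\<dots> = 1/2 * ((LBINT x. K x) + (LBINT x. K (mirror e x))) + 1/2 * (LBINT x. eps x * (K x - K (mirror e x)))"
  using iK ie by simp
 also have "(LBINT x. K (mirror e x)) = (LBINT x. K x)" by (rule integral_orthogonal[OF o]) measurable
 \<comment> \<open>An even factor times an odd one.\<close>
 also have "(LBINT x. eps x * (K x - K (mirror e x))) = 0"
  by (rule integral_odd[OF e]) (measurable, simp add: e_even mirror_mirror[OF e] algebra_simps)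
 finally show "TR P \<le> TR w" unfolding G(3) K_def by simp
qed

text \<open>Squares split into an even and an odd part: \<open>w^2 = m + d\<close>, while the
  polarised function has \<open>m + D\<close>. Odd parts carry no mass and do not interact with even
  ones, so the comparison of energies reduces to \<open>DD d d \<le> DD D D\<close>.\<close>

lemma rmin_mirror_symmetric:
 assumes rm: "rmin c lam w" and c: "c > 0" and e: "norm e = 1"
  and bal: "(LBINT x. sgn (x \<bullet> e) * (w x)^2) = 0"
 shows "AE x in lborel. w (mirror e x) = w x"
proof -
 have X: "XR w" and pos: "\<And>x. w x \<ge> 0" and N: "(LBINT x. (w x)^2) = lam"
  and mn: "\<And>u. XR u \<Longrightarrow> (LBINT x. (u x)^2) = lam \<Longrightarrow> ER c w \<le> ER c u"
  using rm by (auto simp: rmin_def)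
 note o = mirror_orthogonal[OF e]
 note [measurable] = XR_D(3)[OF X] orthogonal_borel[OF o]
 define s where "s x = sgn (x \<bullet> e)" for x :: "real^2"
 have [measurable]: "s \<in> Bor" unfolding s_def by measurable
 have s_odd: "s (mirror e x) = - s x" for x by (simp add: s_def mirror_inner[OF e] sgn_minus)
 have s3: "s x = 1 \<or> s x = -1 \<or> s x = 0" for x by (auto simp: s_def sgn_real_def)
 define P where "P x = 1/2 * ((w x + w (mirror e x)) + s x * \<bar>w x - w (mirror e x)\<bar>)" for x
 have XP: "XR P" and TP: "TR P \<le> TR w" unfolding P_def s_def by (rule TR_polarisation_le[OF X e])+
 define m where "m x = 1/2 * ((w x)^2 + (w (mirror e x))^2)" for x
 define d where "d x = 1/2 * ((w x)^2 - (w (mirror e x))\<^sup>2)" for x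
 define D where "D x = s x * \<bar>d x\<bar>" for x
 note aw = adm_XR[OF X] and aR = adm_XR[OF XR_mirror[OF X e]]
 have am: "adm m" unfolding m_def by (intro adm_cmult adm_add aw aR)
 have add': "adm d" unfolding d_def by (intro adm_cmult adm_diff aw aR)
 note [measurable] = admD(4)[OF am] admD(4)[OF add']
 have aD: "adm D" unfolding D_def
 proof (rule adm_bound[OF add'])
  show "\<bar>s x * \<bar>d x\<bar>\<bar> \<le> \<bar>d x\<bar>" for x using s3[of x] by auto
 qed measurable
 have d_odd: "d (mirror e x) = - d x" for x by (simp add: d_def mirror_mirror[OF e] algebra_simps)
 have m_even: "m (mirror e x) = m x" for x by (simp add: m_def mirror_mirror[OF e])
 have D_odd: "D (mirror e x) = - D x" for x by (simp add: D_def d_odd s_odd)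
 have w2: "(w x)^2 = 1 * m x + 1 * d x" for x by (simp add: m_def d_def algebra_simps)
 have P2: "(P x)^2 = 1 * m x + 1 * D x" if nz: "x \<bullet> e \<noteq> 0" for x
 proof -
  have ab: "\<bar>d x\<bar> = 1/2 * (\<bar>w x - w (mirror e x)\<bar> * (w x + w (mirror e x)))"
   using pos[of x] pos[of "mirror e x"] by (simp add: d_def power2_eq_square square_diff_square_factored abs_mult)
  have s: "s x = 1 \<or> s x = -1" using nz by (auto simp: s_def sgn_real_def)
  define p q where "p = w x" and "q = w (mirror e x)"
  have "\<bar>p - q\<bar> * \<bar>p - q\<bar> = (p - q) * (p - q)" by (rule abs_mult_self_eq)
  then show ?thesis using s unfolding P_def m_def D_def ab p_def[symmetric] q_def[symmetric]
   by (auto simp: power2_eq_square algebra_simps) (simp_all add: field_simps)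
 qed
 have aeP: "AE x in lborel. (P x)^2 = 1 * m x + 1 * D x" using AE_inner_neq[OF e, of 0] by eventually_elim (rule P2)
 have amD: "adm (\<lambda>x. 1 * m x + 1 * D x)" by (intro adm_add adm_cmult am aD)
 have "(LBINT x. (P x)^2) = (LBINT x. 1 * m x + 1 * D x)"
  by (rule integral_cong_AE) (use XR_D(3)[OF XP] admD(4)[OF amD] aeP in auto)
 also have "\<dots> = (LBINT x. m x) + (LBINT x. D x)" using admD(1)[OF am] admD(1)[OF aD] by simp
 also have "(LBINT x. D x) = 0" by (rule integral_odd[OF e admD(4)[OF aD] D_odd])
 also have "0 = (LBINT x. d x)" by (rule integral_odd[OF e admD(4)[OF add'] d_odd, symmetric])
 also have "(LBINT x. m x) + (LBINT x. d x) = lam"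
  unfolding N[symmetric] w2 using admD(1)[OF am] admD(1)[OF add'] by simp
 finally have NP: "(LBINT x. (P x)^2) = lam" .
 have md: "DD m f = 0" if "adm f" "\<And>x. f (mirror e x) = - f x" for f
 proof -
  have "DD m f = DD (\<lambda>x. m (mirror e x)) (\<lambda>x. f (mirror e x))" by (rule DD_mirror[OF am that(1) e, symmetric])
  also have "\<dots> = DD m (\<lambda>x. - f x)" unfolding m_even that(2) ..
  also have "\<dots> = - DD m f" using DD_lincomb(2)[OF that(1) that(1) am, of "-1" 0] by simp
  finally show ?thesis by simp
 qed
 have "ER c w \<le> ER c P" by (rule mn[OF XP NP])
 then have "c * DD (\<lambda>x. (w x)^2) (\<lambda>x. (w x)^2) \<le> c * DD (\<lambda>x. (P x)^2) (\<lambda>x. (P x)^2)" unfolding ER_def using TP by linarith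
 then have "DD (\<lambda>x. (w x)^2) (\<lambda>x. (w x)^2) \<le> DD (\<lambda>x. (P x)^2) (\<lambda>x. (P x)^2)" using c by simp
 also have "\<dots> = DD (\<lambda>x. 1 * m x + 1 * D x) (\<lambda>x. 1 * m x + 1 * D x)"
  by (rule DD_cong_AE[OF adm_XR[OF XP] amD adm_XR[OF XP] amD aeP aeP])
 also have "\<dots> = DD m m + DD D D" using DD_quadratic[OF am aD, of 1 1] md[OF aD D_odd] by simp
 finally have "DD d d \<le> DD D D" unfolding w2 using DD_quadratic[OF am add', of 1 1] md[OF add' d_odd] by simp
 then have le: "DD d d \<le> DD (\<lambda>x. sgn (x \<bullet> e) * \<bar>d x\<bar>) (\<lambda>x. sgn (x \<bullet> e) * \<bar>d x\<bar>)" unfolding D_def s_def .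
 \<comment> \<open>The balance condition on \<open>w^2\<close> passes to \<open>d\<close>, because
   \<open>s * m\<close> is odd.\<close>
 have "(LBINT x. s x * m x) = 0" by (rule integral_odd[OF e]) (measurable, simp add: s_odd m_even)
 moreover have "integ (\<lambda>x. s x * f x)" if "adm f" for f
 proof (rule Lintegrable_bound[OF admD(1)[OF that]])
  note [measurable] = admD(4)[OF that]
  show "(\<lambda>x. s x * f x) \<in> borel_measurable lborel" by measurable
  have "\<bar>s x\<bar> * \<bar>f x\<bar> \<le> \<bar>f x\<bar>" for x using s3[of x] by auto
  then show "AE x in lborel. norm (s x * f x) \<le> norm (f x)" by (simp add: abs_mult)
 qed
 ultimately have "(LBINT x. s x * d x) = (LBINT x. s x * (w x)^2)"
  unfolding w2 distrib_left using am add' by simp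
 then have "(LBINT x. sgn (x \<bullet> e) * d x) = 0" using bal unfolding s_def by simp
 from odd_polarisation[OF add' d_odd e le this] show ?thesis
 proof eventually_elim
  case (elim x)
  then have "(w x)^2 = (w (mirror e x))^2" by (simp add: d_def)
  then show ?case using pos[of x] pos[of "mirror e x"] by (simp add: power2_eq_iff_nonneg)
 qed
qed

lemma ER_translate:
 assumes "XR u"
 shows "ER c (\<lambda>x. u (x + b)) = ER c u"
proof -
 note a = adm_XR[OF assms]
 note [measurable] = XR_D(3)[OF assms] pot_borel[OF a]
 have p: "pot (\<lambda>x. (u (x + b))^2) x = pot (\<lambda>x. (u x)^2) (x + b)" for x
  unfolding pot_def using integral_translate[of "\<lambda>y. ln (norm (x + b - y)) * (u y)^2" b] by simp
 have "DD (\<lambda>x. (u (x + b))^2) (\<lambda>x. (u (x + b))^2) = DD (\<lambda>x. (u x)^2) (\<lambda>x. (u x)^2)"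
  unfolding DD_pot p using integral_translate[of "\<lambda>x. (u x)^2 * pot (\<lambda>x. (u x)^2) x" b] by simp
 then show ?thesis unfolding ER_def XR_translate(2)[OF assms] by simp
qed

lemma rmin_translate:
 assumes "rmin c lam w"
 shows "rmin c lam (\<lambda>x. w (x + b))"
proof -
 have X: "XR w" using assms by (simp add: rmin_def)
 note [measurable] = XR_D(3)[OF X]
 have "(LBINT x. (w (x + b))^2) = (LBINT x. (w x)^2)" by (rule integral_translate) measurable
 then show ?thesis using assms XR_translate(1)[OF X] ER_translate[OF X] by (auto simp: rmin_def)
qed

text \<open>Intermediate value theorem for the mass on one side minus the mass on the other; it is
  continuous in \<open>t\<close> because lines are null sets, and it has opposite signs far out at
  the two ends.\<close>

lemma bisecting_line:
 fixes rho :: "real^2 \<Rightarrow> real" and e :: "real^2"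
 assumes [measurable]: "rho \<in> Bor" and i: "integ rho" and p: "(LBINT x. rho x) > 0"
  and e: "norm e = 1"
 obtains t where "(LBINT x. sgn (x \<bullet> e - t) * rho x) = (0::real)"
proof -
 define F where "F t = (LBINT x. sgn (x \<bullet> e - t) * rho x)" for t
 have dom: "norm (sgn (x \<bullet> e - t) * rho x) \<le> \<bar>rho x\<bar>" for x t by (simp add: abs_mult sgn_real_def)
 have cont: "isCont F t" for t
 proof (rule continuous_at_sequentiallyI)
  fix T assume T: "T ~~> t"
  show "(\<lambda>n. F (T n)) ~~> F t" unfolding F_def
  proof (rule integral_dominated_convergence[where w="\<lambda>x. \<bar>rho x\<bar>"])
   show "AE x in lborel. (\<lambda>n. sgn (x \<bullet> e - T n) * rho x) ~~> sgn (x \<bullet> e - t) * rho x"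
    using AE_inner_neq[OF e, of t] by eventually_elim (intro tendsto_intros T, simp)
  qed (use i dom in auto)
 qed
 have "(\<lambda>n. F (- real n)) ~~> (LBINT x. rho x)" unfolding F_def
 proof (rule integral_dominated_convergence[where w="\<lambda>x. \<bar>rho x\<bar>"])
  show "AE x in lborel. (\<lambda>n. sgn (x \<bullet> e - - real n) * rho x) ~~> rho x"
  proof (rule AE_I2, rule tendsto_eventually)
   fix x
   obtain N where "- (x \<bullet> e) < real N" using reals_Archimedean2 by blast
   then show "\<forall>\<^sub>F n in sequentially. sgn (x \<bullet> e - - real n) * rho x = rho x"
    by (auto simp: eventually_sequentially sgn_real_def intro!: exI[of _ N])
  qed
  show "AE x in lborel. norm (sgn (x \<bullet> e - - real n) * rho x) \<le> \<bar>rho x\<bar>" for n by (rule AE_I2) (rule dom)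
 qed (use i in auto)
 from LIMSEQ_D[OF this, of "(LBINT x. rho x)"] p obtain n where "norm (F (- real n) - (LBINT x. rho x)) < (LBINT x. rho x)" by blast
 then have n: "F (- real n) > 0" by (simp add: abs_less_iff)
 have "(\<lambda>n. F (real n)) ~~> (LBINT x. - rho x)" unfolding F_def
 proof (rule integral_dominated_convergence[where w="\<lambda>x. \<bar>rho x\<bar>"])
  show "AE x in lborel. (\<lambda>n. sgn (x \<bullet> e - real n) * rho x) ~~> - rho x"
  proof (rule AE_I2, rule tendsto_eventually)
   fix x
   obtain N where "x \<bullet> e < real N" using reals_Archimedean2 by blast
   then show "\<forall>\<^sub>F n in sequentially. sgn (x \<bullet> e - real n) * rho x = - rho x"
    by (auto simp: eventually_sequentially sgn_real_def intro!: exI[of _ N])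
  qed
 qed (use i dom in auto)
 from LIMSEQ_D[OF this, of "(LBINT x. rho x)"] p obtain m where "norm (F (real m) - (LBINT x. - rho x)) < (LBINT x. rho x)" by blast
 then have m: "F (real m) < 0" by (simp add: abs_less_iff)
 have "\<exists>t\<ge>- real n. t \<le> real m \<and> F t = 0"
  by (rule IVT2) (use n m cont in auto)
 then show thesis using that unfolding F_def by blast
qed

lemma axis_inner: "axis i (1::real) \<bullet> (axis j 1 :: real^2) = (if i = j then 1 else 0)"
 unfolding inner_axis by (simp add: axis_def)

lemma mirror_axes: "mirror (axis 1 1) (mirror (axis 2 1) x) = - x"
proof -
 have "mirror (axis 1 1) (mirror (axis 2 1) x) $ i = - x $ i" for i
  using exhaust_2[of i] unfolding mirror_def inner_axis by (auto simp: axis_def)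
 then show ?thesis by (simp add: vec_eq_iff)
qed

lemma rmin_symmetric:
 assumes rm: "rmin c lam w" and c: "c > 0" and lam: "lam > 0"
 obtains b where "\<And>e. norm e = 1 \<Longrightarrow> AE x in lborel. w (mirror e x + b) = w (x + b)"
proof -
 have X: "XR w" and N: "(LBINT x. (w x)^2) = lam" using rm by (auto simp: rmin_def)
 define e1 where "e1 = (axis 1 1 :: real^2)"
 define e2 where "e2 = (axis 2 1 :: real^2)"
 have n: "norm e1 = 1" "norm e2 = 1" by (simp_all add: e1_def e2_def)
 have ip: "e1 \<bullet> e1 = 1" "e2 \<bullet> e2 = 1" "e1 \<bullet> e2 = 0" "e2 \<bullet> e1 = 0" by (simp_all add: e1_def e2_def axis_inner)
 note [measurable] = XR_D(3)[OF X]
 have i: "integ (\<lambda>x. (w x)^2)" by (rule XR_D(1)[OF X])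
 obtain t1 where t1: "(LBINT x. sgn (x \<bullet> e1 - t1) * (w x)^2) = 0"
  by (rule bisecting_line[OF _ i _ n(1)]) (use N lam in auto)
 obtain t2 where t2: "(LBINT x. sgn (x \<bullet> e2 - t2) * (w x)^2) = 0"
  by (rule bisecting_line[OF _ i _ n(2)]) (use N lam in auto)
 define b where "b = t1 *\<^sub>R e1 + t2 *\<^sub>R e2"
 define v where "v x = w (x + b)" for x
 have rv: "rmin c lam v" unfolding v_def by (rule rmin_translate[OF rm])
 have [measurable]: "v \<in> Bor" using rv XR_D(3) by (simp add: rmin_def)
 have b1: "(LBINT x. sgn (x \<bullet> e1) * (v x)^2) = 0"
  using integral_translate[of "\<lambda>x. sgn (x \<bullet> e1 - t1) * (w x)^2" b] t1 by (simp add: v_def b_def inner_add_left ip)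
 have b2: "(LBINT x. sgn (x \<bullet> e2) * (v x)^2) = 0"
  using integral_translate[of "\<lambda>x. sgn (x \<bullet> e2 - t2) * (w x)^2" b] t2 by (simp add: v_def b_def inner_add_left ip)
 note s1 = rmin_mirror_symmetric[OF rv c n(1) b1] and s2 = rmin_mirror_symmetric[OF rv c n(2) b2]
 have "AE x in lborel. v (mirror e1 (mirror e2 x)) = v (mirror e2 x)"
  by (rule AE_orthogonal[OF mirror_orthogonal[OF n(2)] s1])
 then have ev: "AE x in lborel. v (- x) = v x"
  using s2 by eventually_elim (simp add: e1_def e2_def mirror_axes)
 have om: "orthogonal_transformation (\<lambda>x::real^2. - x)"
  by (simp add: orthogonal_transformation_def linear_uminus)
 show thesis
 proof (rule that[of b])
  fix e :: "real^2" assume e: "norm e = 1"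
  \<comment> \<open>Evenness of \<open>v\<close> turns the integral into its own negative.\<close>
  have "(LBINT x. sgn (x \<bullet> e) * (v x)^2) = (LBINT x. sgn (- x \<bullet> e) * (v (- x))^2)"
   by (rule integral_orthogonal[OF om, symmetric]) measurable
  also have "\<dots> = (LBINT x. - (sgn (x \<bullet> e) * (v x)^2))"
   by (rule integral_cong_AE) (measurable, measurable, use ev in \<open>eventually_elim, simp add: sgn_minus\<close>)
  finally have "(LBINT x. sgn (x \<bullet> e) * (v x)^2) = 0" by simp
  from rmin_mirror_symmetric[OF rv c e this] show "AE x in lborel. w (mirror e x + b) = w (x + b)"
   by (simp add: v_def)
 qed
qed

section \<open>Radial functions\<close>

definition rot :: "real \<Rightarrow> real^2 \<Rightarrow> real^2" where
 "rot th x = vector [cos th * x $ 1 - sin th * x $ 2, sin th * x $ 1 + cos th * x $ 2]"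

lemma rot_nth: "rot th x $ 1 = cos th * x $ 1 - sin th * x $ 2" "rot th x $ 2 = sin th * x $ 1 + cos th * x $ 2"
 by (simp_all add: rot_def)

lemma vec2_eq_iff: "(x::real^2) = y \<longleftrightarrow> x $ 1 = y $ 1 \<and> x $ 2 = y $ 2"
 by (simp add: vec_eq_iff forall_2)

lemma inner_vec2: "(x::real^2) \<bullet> y = x $ 1 * y $ 1 + x $ 2 * y $ 2"
 by (simp add: inner_vec_def sum_2)

lemma rot_add: "rot al (rot bt x) = rot (al + bt) x"
 by (simp add: vec2_eq_iff rot_nth cos_add sin_add algebra_simps)

lemma rot_zero: "rot 0 x = x"
 by (simp add: vec2_eq_iff rot_nth)

lemma rot_orthogonal: "orthogonal_transformation (rot th)"
 unfolding orthogonal_transformation_def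
proof (intro conjI allI)
 show "linear (rot th)" by (rule linearI) (auto simp: vec2_eq_iff rot_nth algebra_simps)
 fix x y
 have "(cos th)^2 + (sin th)^2 = 1" by simp
 moreover have "rot th x \<bullet> rot th y = ((cos th)^2 + (sin th)^2) * (x $ 1 * y $ 1 + x $ 2 * y $ 2)"
  unfolding inner_vec2 rot_nth by algebra
 ultimately show "rot th x \<bullet> rot th y = x \<bullet> y" by (simp add: inner_vec2)
qed

lemma rot_norm: "norm (rot th x) = norm x"
 by (rule orthogonal_transformation_norm[OF rot_orthogonal])

text \<open>A rotation is a product of two reflections whose normals enclose half its angle; this
  passes from invariance under reflections to invariance under rotations.\<close>

lemma rot_mirror: "mirror (rot (th / 2) (axis 1 1)) (mirror (axis 1 1) x) = rot th x"
proof -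
 have c: "cos th = (cos (th/2))^2 - (sin (th/2))\<^sup>2" "sin th = 2 * sin (th/2) * cos (th/2)"
  using cos_double[of "th/2"] sin_double[of "th/2"] by simp_all
 have p: "sin (th/2) * sin (th/2) = 1 - cos (th/2) * cos (th/2)"
  using sin_squared_eq[of "th/2"] by (simp add: power2_eq_square)
 show ?thesis
  unfolding vec2_eq_iff mirror_def rot_nth inner_vec2 c
  by (simp add: rot_nth axis_def inner_vec2 power2_eq_square algebra_simps p)
qed

lemma rot_polar:
 obtains th where "x = rot th (norm x *\<^sub>R axis 1 1)"
proof (cases "x = 0")
 case True then show thesis using that[of 0] by (simp add: rot_zero)
next
 case False
 have nn: "(norm x)^2 = (x $ 1)^2 + (x $ 2)^2" unfolding power2_norm_eq_inner inner_vec2 by (simp add: power2_eq_square)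
 have "(x $ 1 / norm x)^2 + (x $ 2 / norm x)^2 = 1"
  by (simp only: power_divide add_divide_distrib[symmetric] nn[symmetric]) (use False in simp)
 then obtain th where "x $ 1 / norm x = cos th" "x $ 2 / norm x = sin th" using sincos_total_2pi by metis
 then have c: "norm x * cos th = x $ 1" "norm x * sin th = x $ 2" using False by (auto simp: field_simps)
 have "rot th (norm x *\<^sub>R axis 1 1) $ 1 = norm x * cos th" "rot th (norm x *\<^sub>R axis 1 1) $ 2 = norm x * sin th"
  by (simp_all add: rot_nth axis_def)
 then have "x = rot th (norm x *\<^sub>R axis 1 1)" unfolding vec2_eq_iff c by simp
 then show thesis by (rule that)
qed

lemma mirror_invariant_imp_rot_invariant:
 fixes v :: "real^2 \<Rightarrow> real"
 assumes "\<And>e. norm e = 1 \<Longrightarrow> AE x in lborel. v (mirror e x) = v x"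
 shows "AE x in lborel. v (rot th x) = v x"
proof -
 have n: "norm (axis 1 1 :: real^2) = 1" "norm (rot (th / 2) (axis 1 1)) = 1" by (simp_all add: rot_norm)
 have "AE x in lborel. v (mirror (rot (th / 2) (axis 1 1)) (mirror (axis 1 1) x)) = v (mirror (axis 1 1) x)"
  by (rule AE_orthogonal[OF mirror_orthogonal[OF n(1)] assms[OF n(2)]])
 then show ?thesis using assms[OF n(1)] by eventually_elim (simp add: rot_mirror)
qed

lemma rot_borel[measurable]: "(\<lambda>(th, x). rot th x) \<in> borel_measurable (borel \<Otimes>\<^sub>M borel)"
proof -
 have "continuous_on UNIV (\<lambda>z::real \<times> (real^2). \<chi> i. rot (fst z) (snd z) $ i)"
 proof (rule continuous_on_vec_lambda)
  fix i :: 2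
  show "continuous_on UNIV (\<lambda>z::real \<times> (real^2). rot (fst z) (snd z) $ i)"
   using exhaust_2[of i]
  proof (elim disjE)
   assume "i = 1" then show ?thesis by (simp only: rot_nth) (intro continuous_intros)
  next
   assume "i = 2" then show ?thesis by (simp only: rot_nth) (intro continuous_intros)
  qed
 qed
 then have "(\<lambda>z::real \<times> (real^2). rot (fst z) (snd z)) \<in> Bor"
  by (intro borel_measurable_continuous_onI) simp
 then show ?thesis by (simp add: borel_prod case_prod_beta')
qed

text \<open>The exceptional null set depends on the angle. Fubini exchanges the quantifiers, and
  averaging over angles then produces one measurable function of the radius.\<close>

lemma rot_invariant_imp_radial:
 fixes v :: "real^2 \<Rightarrow> real"
 assumes [measurable]: "v \<in> Bor" and inv: "\<And>th. AE x in lborel. v (rot th x) = v x"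
 obtains f :: "real \<Rightarrow> real" where "f \<in> Bor" "AE x in lborel. v x = f (area x)"
proof -
 \<comment> \<open>An interval of angles of length 1 serves as well as the full circle: for almost
   every \<open>x\<close> the averaged function equals \<open>v x\<close> up to a null set of
   angles.\<close>
 define g where "g r = (LBINT th. indicator {0..1} th * v (rot th (r *\<^sub>R axis 1 1)))" for r :: real
 have vr[measurable]: "(\<lambda>(th, x). v (rot th x)) \<in> borel_measurable (borel \<Otimes>\<^sub>M borel)"
  using measurable_compose[OF rot_borel assms(1)] by (simp add: case_prod_beta')
 have gm[measurable]: "g \<in> Bor"
 proof -
  have m1: "(\<lambda>z::real \<times> real. (snd z, fst z *\<^sub>R axis 1 1 :: real^2)) \<in> borel \<Otimes>\<^sub>M borel \<rightarrow>\<^sub>M borel \<Otimes>\<^sub>M borel" by measurable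
  have [measurable]: "(\<lambda>z::real \<times> real. v (rot (snd z) (fst z *\<^sub>R axis 1 1))) \<in> borel_measurable (borel \<Otimes>\<^sub>M borel)"
   using measurable_compose[OF m1 vr] by simp
  have "(\<lambda>r. LBINT th. indicator {0..1} th * v (rot th (r *\<^sub>R axis 1 1))) \<in> borel_measurable lborel"
  proof (rule lborel.borel_measurable_lebesgue_integral)
   have "(\<lambda>z::real \<times> real. indicat_real {0..1} (snd z) * v (rot (snd z) (fst z *\<^sub>R axis 1 1))) \<in> borel_measurable (borel \<Otimes>\<^sub>M borel)"
    by measurable
   then show "(\<lambda>(r, th). indicat_real {0..1} th * v (rot th (r *\<^sub>R axis 1 1))) \<in> borel_measurable (lborel \<Otimes>\<^sub>M lborel)"
    by (simp add: case_prod_beta' cong: measurable_cong_sets)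
  qed
  then show ?thesis unfolding g_def[abs_def] by simp
 qed
 have "AE th in lborel. AE x in lborel. v (rot th x) = v x" by (rule AE_I2) (rule inv)
 then have "AE x in lborel. AE th in lborel. v (rot th x) = v x"
 proof (subst (asm) lborel_pair.AE_commute)
  have "{z \<in> space (borel \<Otimes>\<^sub>M borel). v (rot (fst z) (snd z)) = v (snd z)} \<in> sets (borel \<Otimes>\<^sub>M borel)"
   using vr by (simp add: case_prod_beta')
  then show "{z \<in> space (lborel \<Otimes>\<^sub>M lborel). v (rot (fst z) (snd z)) = v (snd z)} \<in> sets (lborel \<Otimes>\<^sub>M lborel)"
   by (simp add: space_pair_measure cong: sets_pair_measure_cong)
 qed
 then have *: "AE x in lborel. v x = g (norm x)"
 proof eventually_elim
  case (elim x)
  obtain al where al: "x = rot al (norm x *\<^sub>R axis 1 1)" by (rule rot_polar)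
  have "AE th in lborel. v (rot (th + - al) x) = v x" by (rule AE_translate[OF elim])
  moreover have "rot (th + - al) x = rot th (norm x *\<^sub>R axis 1 1)" for th
   by (subst al) (simp add: rot_add)
  ultimately have ae: "AE th in lborel. v (rot th (norm x *\<^sub>R axis 1 1)) = v x" by simp
  have [measurable]: "(\<lambda>th. v (rot th (norm x *\<^sub>R axis 1 1))) \<in> Bor"
   using measurable_compose[OF measurable_Pair2'[of "norm x *\<^sub>R axis 1 1 :: real^2" borel borel] vr] by simp
  have "g (norm x) = (\<integral>th. indicator {0..1} th * v x \<partial>(lborel :: real measure))" unfolding g_def
   by (rule integral_cong_AE) (measurable, measurable, use ae in \<open>eventually_elim, simp\<close>)
  then show ?case by simp
 qed
 show thesis
 proof (rule that[of "\<lambda>a. g (sqrt (a / pi))"])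
  show "(\<lambda>a. g (sqrt (a / pi))) \<in> Bor" by measurable
  show "AE x in lborel. v x = g (sqrt (pi * (norm x)^2 / pi))" using * by eventually_elim simp
 qed
qed

subsection \<open>Newton's theorem\<close>

text \<open>\<open>Ln (1 - q * z)\<close> is holomorphic on the closed unit disc, because
  \<open>Re (1 - q * z) > 0\<close> there, and it vanishes at 0; its mean over the circle is
  Cauchy's formula at the centre.\<close>

lemma circle_mean_log:
 fixes q :: complex
 assumes q: "cmod q < 1"
 shows "((\<lambda>t. ln (cmod (1 - q * exp (2 * of_real pi * \<i> * of_real t)))) has_integral 0) {0..1}"
proof -
 define F where "F z = Ln (1 - q * z)" for z
 have re: "Re (1 - q * z) > 0" if "z \<in> cball 0 1" for z
 proof -
  have "cmod (q * z) \<le> cmod q * 1" using that by (simp add: norm_mult mult_left_le)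
  then have "Re (q * z) < 1" using q complex_Re_le_cmod[of "q * z"] by linarith
  then show ?thesis by simp
 qed
 have "F holomorphic_on cball 0 1"
  unfolding F_def
 proof (intro holomorphic_on_Ln' holomorphic_intros)
  show "1 - q * z \<notin> \<real>\<^sub>\<le>\<^sub>0" if "z \<in> cball 0 1" for z using re[OF that] by (auto simp: complex_nonpos_Reals_iff)
 qed
 then have "((\<lambda>u. F u / (u - 0)) has_contour_integral 2 * of_real pi * \<i> * F 0) (circlepath 0 1)"
  by (intro Cauchy_integral_circlepath_simple) auto
 then have "((\<lambda>t. F (circlepath 0 1 t) / (circlepath 0 1 t - 0) * vector_derivative (circlepath 0 1) (at t within {0..1})) has_integral 0) {0..1}"
  unfolding has_contour_integral_def by (simp add: F_def)
 then have "((\<lambda>t. 2 * of_real pi * \<i> * F (exp (2 * of_real pi * \<i> * of_real t))) has_integral 0) {0..1}"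
 proof (rule has_integral_eq[rotated])
  fix t :: real assume t: "t \<in> {0..1}"
  have "vector_derivative (circlepath 0 1) (at t within {0..1}) = 2 * of_real pi * \<i> * exp (2 * of_real pi * \<i> * of_real t)"
   using t by (simp add: vector_derivative_circlepath01)
  then show "F (circlepath 0 1 t) / (circlepath 0 1 t - 0) * vector_derivative (circlepath 0 1) (at t within {0..1})
    = 2 * of_real pi * \<i> * F (exp (2 * of_real pi * \<i> * of_real t))"
   by (simp add: circlepath)
 qed
 from has_integral_mult_right[OF this, of "1 / (2 * of_real pi * \<i>)"]
 have "((\<lambda>t. F (exp (2 * of_real pi * \<i> * of_real t))) has_integral 0) {0..1}" by simp
 from has_integral_Re[OF this]
 have "((\<lambda>t. Re (F (exp (2 * of_real pi * \<i> * of_real t)))) has_integral 0) {0..1}" by simp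
 then show ?thesis
 proof (rule has_integral_eq[rotated])
  fix t :: real
  have "Re (1 - q * exp (2 * of_real pi * \<i> * of_real t)) > 0"
   by (rule re) (simp add: norm_exp_eq_Re)
  then have "1 - q * exp (2 * of_real pi * \<i> * of_real t) \<noteq> 0"
   by (metis less_irrefl zero_complex.simps(1))
  then show "Re (F (exp (2 * of_real pi * \<i> * of_real t))) = ln (cmod (1 - q * exp (2 * of_real pi * \<i> * of_real t)))"
   by (simp add: F_def)
 qed
qed

definition cplx :: "real^2 \<Rightarrow> complex" where
 "cplx x = Complex (x $ 1) (x $ 2)"

lemma cplx_norm: "cmod (cplx x) = norm x"
 by (simp add: cplx_def cmod_def norm_vec_def L2_set_def sum_2)

lemma cplx_diff: "cplx (x - y) = cplx x - cplx y"
 by (simp add: cplx_def complex_eq_iff)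

lemma cplx_rot: "cplx (rot (2 * pi * t) y) = exp (2 * of_real pi * \<i> * of_real t) * cplx y"
proof -
 have "exp (2 * of_real pi * \<i> * of_real t) = cis (2 * pi * t)" by (simp add: cis_conv_exp mult_ac)
 then show ?thesis by (simp add: cplx_def complex_eq_iff rot_nth)
qed

text \<open>The longer of the two vectors is factored out, which leaves \<open>1 - q * E\<close>
  with \<open>\<bar>q\<bar> < 1\<close> and \<open>E\<close> on the unit circle.\<close>

lemma circle_mean_newton:
 assumes "x \<noteq> 0" "y \<noteq> 0" "norm x \<noteq> norm y"
 shows "((\<lambda>t. ln (norm (x - rot (2 * pi * t) y))) has_integral max (ln (norm x)) (ln (norm y))) {0..1}"
proof -
 let ?E = "\<lambda>t. exp (2 * of_real pi * \<i> * of_real t)"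
 have nE: "cmod (?E t) = 1" for t by (simp add: norm_exp_eq_Re)
 have n: "norm (x - rot (2 * pi * t) y) = cmod (cplx x - ?E t * cplx y)" for t
  by (simp add: cplx_norm[symmetric] cplx_diff cplx_rot)
 have nz: "cplx x \<noteq> 0" "cplx y \<noteq> 0" using assms cplx_norm by (metis norm_eq_zero)+
 show ?thesis
 proof (cases "norm y < norm x")
  case True
  define q where "q = cplx y / cplx x"
  have q: "cmod q < 1" using True assms by (simp add: q_def norm_divide cplx_norm)
  have "cmod (cplx x - ?E t * cplx y) = norm x * cmod (1 - q * ?E t)" for t
  proof -
   have "cplx x - ?E t * cplx y = cplx x * (1 - q * ?E t)" using nz by (simp add: q_def field_simps)
   then show ?thesis by (simp add: norm_mult cplx_norm)
  qed
  moreover have "cmod (1 - q * ?E t) > 0" for t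
  proof -
   have "cmod (q * ?E t) < 1" using q nE[of t] by (simp add: norm_mult)
   then show ?thesis by (metis diff_eq_diff_eq norm_one order_less_irrefl right_minus_eq zero_less_norm_iff)
  qed
  ultimately have eq: "ln (norm (x - rot (2 * pi * t) y)) = ln (norm x) + ln (cmod (1 - q * ?E t))" for t
   unfolding n using assms by (simp add: ln_mult_pos)
  have "((\<lambda>t. ln (norm x) + ln (cmod (1 - q * ?E t))) has_integral (1 - 0) *\<^sub>R ln (norm x) + 0) {0..1}"
   using has_integral_const_real[of "ln (norm x)" 0 1] by (intro has_integral_add circle_mean_log q) simp
  moreover have "max (ln (norm x)) (ln (norm y)) = ln (norm x)" using True assms by simp
  ultimately show ?thesis unfolding eq by simp
 next
  case False
  then have lt: "norm x < norm y" using assms by simp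
  \<comment> \<open>The conjugate keeps the form \<open>1 - q * E\<close>: since
    \<open>\<bar>E\<bar> = 1\<close>, dividing by \<open>E\<close> amounts to passing to the
    conjugate, which leaves the modulus unchanged.\<close>
  define q where "q = cnj (cplx x / cplx y)"
  have q: "cmod q < 1" using lt assms by (simp add: q_def norm_divide cplx_norm)
  have "cmod (cplx x - ?E t * cplx y) = norm y * cmod (1 - q * ?E t)" for t
  proof -
   have cE: "cnj (?E t) * ?E t = 1" using complex_norm_square[of "?E t"] nE[of t] by (simp add: mult.commute)
   have "cnj (1 - q * ?E t) * ?E t = ?E t - (cplx x / cplx y) * (cnj (?E t) * ?E t)" by (simp add: q_def algebra_simps)
   then have "(- cplx y) * (cnj (1 - q * ?E t) * ?E t) = cplx x - ?E t * cplx y" using cE nz by (simp add: field_simps)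
   then have "cmod (cplx x - ?E t * cplx y) = cmod (- cplx y) * (cmod (cnj (1 - q * ?E t)) * cmod (?E t))" by (metis norm_mult)
   then show ?thesis unfolding complex_mod_cnj nE by (simp add: cplx_norm)
  qed
  moreover have "cmod (1 - q * ?E t) > 0" for t
  proof -
   have "cmod (q * ?E t) < 1" using q nE[of t] by (simp add: norm_mult)
   then show ?thesis by (metis diff_eq_diff_eq norm_one order_less_irrefl right_minus_eq zero_less_norm_iff)
  qed
  ultimately have eq: "ln (norm (x - rot (2 * pi * t) y)) = ln (norm y) + ln (cmod (1 - q * ?E t))" for t
   unfolding n using assms by (simp add: ln_mult_pos)
  have "((\<lambda>t. ln (norm y) + ln (cmod (1 - q * ?E t))) has_integral (1 - 0) *\<^sub>R ln (norm y) + 0) {0..1}"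
   using has_integral_const_real[of "ln (norm y)" 0 1] by (intro has_integral_add circle_mean_log q) simp
  moreover have "max (ln (norm x)) (ln (norm y)) = ln (norm y)" using lt assms by simp
  ultimately show ?thesis unfolding eq by simp
 qed
qed

lemma circle_mean_lebesgue:
 assumes "x \<noteq> 0" "y \<noteq> 0" "norm x \<noteq> norm y"
 shows "(LBINT t. indicator {0..1} t * ln (norm (x - rot (2 * pi * t) y))) = max (ln (norm x)) (ln (norm y))"
proof -
 have ne: "norm (x - rot (2 * pi * t) y) \<noteq> 0" for t using assms(3) rot_norm[of "2 * pi * t" y] by (metis norm_eq_zero right_minus_eq)
 have cr: "continuous_on UNIV (\<lambda>t. rot (2 * pi * t) y)"
 proof -
  have "continuous_on UNIV (\<lambda>t. \<chi> i. rot (2 * pi * t) y $ i)"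
  proof (rule continuous_on_vec_lambda)
   fix i :: 2
   show "continuous_on UNIV (\<lambda>t. rot (2 * pi * t) y $ i)" using exhaust_2[of i]
   proof (elim disjE)
    assume "i = 1" then show ?thesis by (simp only: rot_nth) (intro continuous_intros)
   next
    assume "i = 2" then show ?thesis by (simp only: rot_nth) (intro continuous_intros)
   qed
  qed
  then show ?thesis by simp
 qed
 have c: "continuous_on {0..1} (\<lambda>t. ln (norm (x - rot (2 * pi * t) y)))"
  using ne by (intro continuous_intros continuous_on_subset[OF cr]) auto
 have s: "set_integrable lborel {0..1} (\<lambda>t. ln (norm (x - rot (2 * pi * t) y)))"
  by (rule borel_integrable_atLeastAtMost'[OF c])
 have "(LINT t:{0..1}|lborel. ln (norm (x - rot (2 * pi * t) y))) = integral {0..1} (\<lambda>t. ln (norm (x - rot (2 * pi * t) y)))"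
  by (rule set_borel_integral_eq_integral(2)[OF s])
 also have "\<dots> = max (ln (norm x)) (ln (norm y))" using circle_mean_newton[OF assms] by (rule integral_unique)
 finally show ?thesis by (simp add: set_lebesgue_integral_def)
qed

lemma AE_norm_neq:
 fixes r :: real
 shows "AE y in (lborel :: (real^2) measure). norm y \<noteq> r"
proof -
 have "negligible (sphere (0::real^2) r)" by (rule negligible_sphere)
 then have "sphere (0::real^2) r \<in> null_sets lebesgue" by (simp add: negligible_iff_null_sets)
 moreover have "sphere (0::real^2) r \<in> sets lborel" by (simp add: closed_sphere borel_closed)
 ultimately have "sphere (0::real^2) r \<in> null_sets lborel" by (simp add: null_sets_completion_iff)
 then have "AE y in lborel. y \<notin> sphere (0::real^2) r" by (rule AE_not_in)
 then show ?thesis by eventually_elim simp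
qed

text \<open>Rotating \<open>y\<close> does not change the integral, so the kernel may be replaced by
  its mean over circles, known off the null set where \<open>\<bar>y\<bar> = \<bar>x\<bar>\<close>
  or \<open>y = 0\<close>.\<close>

lemma newton:
 assumes ad: "adm sg" and inv: "\<And>th. AE x in lborel. sg (rot th x) = sg x" and x: "x \<noteq> 0"
 shows "pot sg x = (LBINT y. max (ln (norm x)) (ln (norm y)) * sg y)" (is ?t1)
  and "integ (\<lambda>y. max (ln (norm x)) (ln (norm y)) * sg y)" (is ?t2)
proof -
 note [measurable] = admD(4)[OF ad]
 have m: "(\<lambda>z. rot (2 * pi * fst z) (snd z)) \<in> borel_measurable (lborel \<Otimes>\<^sub>M (lborel :: (real^2) measure))"
 proof -
  have "(\<lambda>z::real \<times> (real^2). (2 * pi * fst z, snd z)) \<in> borel \<Otimes>\<^sub>M borel \<rightarrow>\<^sub>M borel \<Otimes>\<^sub>M borel" by measurable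
  from measurable_compose[OF this rot_borel] show ?thesis by (simp cong: measurable_cong_sets)
 qed
 have shift: "(LBINT y. h (rot th y) * sg y) = (LBINT y. h y * sg y)" (is ?t3)
  "integ (\<lambda>y. h y * sg y) \<Longrightarrow> integ (\<lambda>y. h (rot th y) * sg y)"
  if [measurable]: "h \<in> Bor" for h :: "real^2 \<Rightarrow> real" and th
 proof -
  note o = rot_orthogonal[of th]
  note [measurable] = orthogonal_borel[OF o]
  have "(LBINT y. h (rot th y) * sg y) = (LBINT y. h (rot th y) * sg (rot th y))"
   by (rule integral_cong_AE) (measurable, measurable, use inv[of th] in \<open>eventually_elim, simp\<close>)
  also have "\<dots> = (LBINT y. h y * sg y)" by (rule integral_orthogonal[OF o, of "\<lambda>y. h y * sg y"]) measurable
  finally show ?t3 .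
  assume "integ (\<lambda>y. h y * sg y)"
  from integrable_orthogonal[OF o this] have i: "integ (\<lambda>y. h (rot th y) * sg (rot th y))" .
  show "integ (\<lambda>y. h (rot th y) * sg y)"
   by (rule integrable_cong_AE_imp[OF i]) (measurable, use inv[of th] in \<open>eventually_elim, simp\<close>)
 qed
 let ?f = "\<lambda>t y. indicator {0..1} t * (ln (norm (x - rot (2 * pi * t) y)) * sg y)"
 have pi': "integ (\<lambda>y. \<bar>ln (norm (x - y)) * sg y\<bar>)" by (rule integrable_abs[OF pot_integrable[OF ad]])
 have I: "integrable (lborel \<Otimes>\<^sub>M lborel) (\<lambda>(t, y). ?f t y)"
 proof (rule lborel_pair.Fubini_integrable)
  show "(\<lambda>(t, y). ?f t y) \<in> borel_measurable (lborel \<Otimes>\<^sub>M lborel)"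
   unfolding case_prod_beta' using m by measurable
  show "AE t in lborel. integ (\<lambda>y. case (t, y) of (t, y) \<Rightarrow> ?f t y)"
   unfolding prod.case by (intro AE_I2 integrable_mult_right shift(2)[OF _ pot_integrable[OF ad]]) measurable
  define C where "C = (LBINT y. \<bar>ln (norm (x - y)) * sg y\<bar>)"
  have "(LBINT y. norm (case (t, y) of (t, y) \<Rightarrow> ?f t y)) = indicator {0..1} t * C" for t
  proof -
   have "(LBINT y. norm (case (t, y) of (t, y) \<Rightarrow> ?f t y)) = indicator {0..1} t * (LBINT y. \<bar>ln (norm (x - rot (2 * pi * t) y)) * sg y\<bar>)"
    by (subst integral_mult_right_zero[symmetric]) (simp add: abs_mult)
   also have "(LBINT y. \<bar>ln (norm (x - rot (2 * pi * t) y)) * sg y\<bar>) = C"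
   proof -
    note o = rot_orthogonal[of "2 * pi * t"]
    note [measurable] = orthogonal_borel[OF o]
    have "(LBINT y. \<bar>ln (norm (x - rot (2 * pi * t) y)) * sg y\<bar>) = (LBINT y. \<bar>ln (norm (x - rot (2 * pi * t) y)) * sg (rot (2 * pi * t) y)\<bar>)"
     by (rule integral_cong_AE) (measurable, measurable, use inv[of "2 * pi * t"] in \<open>eventually_elim, simp\<close>)
    also have "\<dots> = C" unfolding C_def by (rule integral_orthogonal[OF o, of "\<lambda>y. \<bar>ln (norm (x - y)) * sg y\<bar>"]) measurable
    finally show ?thesis .
   qed
   finally show ?thesis .
  qed
  then show "integ (\<lambda>t. LBINT y. norm (case (t, y) of (t, y) \<Rightarrow> ?f t y))" by simp
 qed
 have inner: "AE y in lborel. (LBINT t. ?f t y) = max (ln (norm x)) (ln (norm y)) * sg y"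
  using AE_norm_neq[of "norm x"] AE_lborel_singleton[of 0]
 proof eventually_elim
  case (elim y)
  have "(LBINT t. ?f t y) = (LBINT t. indicator {0..1} t * ln (norm (x - rot (2 * pi * t) y))) * sg y"
   by (subst integral_mult_left_zero[symmetric]) (simp add: mult.assoc)
  then show ?case using circle_mean_lebesgue[OF x, of y] elim by simp
 qed
 have iI: "integ (\<lambda>y. LBINT t. ?f t y)" by (rule lborel_pair.integrable_snd[OF I])
 show ?t2
  by (rule integrable_cong_AE_imp[OF iI _ inner]) measurable
 have "pot sg x = (\<integral>t. indicator {0..1} t * pot sg x \<partial>(lborel :: real measure))" by simp
 also have "\<dots> = (LBINT t. (LBINT y. ?f t y))"
 proof -
  have "(LBINT y. ln (norm (x - rot th y)) * sg y) = pot sg x" for th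
   unfolding pot_def by (rule shift(1)[of "\<lambda>y. ln (norm (x - y))"]) measurable
  then show ?thesis by simp
 qed
 also have "\<dots> = (LBINT y. (LBINT t. ?f t y))" using lborel_pair.Fubini_integral[OF I] by simp
 also have "\<dots> = (LBINT y. max (ln (norm x)) (ln (norm y)) * sg y)"
  by (rule integral_cong_AE) (use iI inner in auto)
 finally show ?t1 .
qed

section \<open>The Euler--Lagrange equation\<close>

lemma test_fn_XR:
 assumes t: "test_fn phi"
 shows "XR phi" "wgrad phi (\<lambda>x. \<chi> i. partial i phi x)" (is ?t1)
proof -
 show w: ?t1
  unfolding wgrad_def using c1_wderiv[OF test_fn_imp_c1[OF t]] by simp
 obtain C R where CR: "C \<ge> 0" "R > 0" "\<And>x. \<bar>phi x\<bar> \<le> C" "\<And>i x. \<bar>partial i phi x\<bar> \<le> C"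
  "\<And>x. norm x > R \<Longrightarrow> phi x = 0" "\<And>i x. norm x > R \<Longrightarrow> partial i phi x = 0"
  using test_fn_bounds[OF t] by metis
 have fin: "integ (\<lambda>x::real^2. indicator (cball 0 R) x * B)" for B :: real
  by (intro integrable_mult_left integrable_real_indicator) (auto simp: emeasure_lborel_cball_finite[unfolded infinity_ennreal_def])
 show "XR phi"
 proof (rule XR_I(1)[OF w fin[of "(2 * C)^2"] _ fin[of "C\<^sup>2"]])
  show "(norm (\<chi> i. partial i phi x))^2 \<le> indicator (cball 0 R) x * (2 * C)^2" for x
  proof (cases "norm x > R")
   case True
   then have "(\<chi> i. partial i phi x) = 0" using CR(6) by (simp add: vec_eq_iff)
   then show ?thesis by (simp add: indicator_def)
  next
   case False
   have "norm (\<chi> i. partial i phi x) \<le> (\<Sum>i\<in>UNIV. \<bar>(\<chi> i. partial i phi x) $ i\<bar>)" by (rule norm_le_l1_cart)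
   also have "\<dots> \<le> (\<Sum>i\<in>(UNIV::2 set). C)" using CR(4) by (intro sum_mono) simp
   finally have "(norm (\<chi> i. partial i phi x))^2 \<le> (2 * C)^2" by (intro power_mono) auto
   then show ?thesis using False by simp
  qed
  show "(phi x)^2 \<le> indicator (cball 0 R) x * C\<^sup>2" for x
   using CR(3)[of x] CR(5)[of x] CR(1) by (cases "norm x > R") (auto simp: abs_le_square_iff[symmetric])
  show "integ (\<lambda>x::real^2. ln (1 + norm x) * (indicator (cball 0 R) x * C\<^sup>2))"
  proof (rule Lintegrable_bound[OF fin[of "ln (1 + R) * C\<^sup>2"]])
   show "AE x in lborel. norm (ln (1 + norm x) * (indicator (cball 0 R) (x::real^2) * C\<^sup>2)) \<le> norm (indicator (cball 0 R) x * (ln (1 + R) * C\<^sup>2))"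
   proof (rule AE_I2)
    fix x :: "real^2"
    have "ln (1 + norm x) \<le> ln (1 + R)" if "norm x \<le> R"
     using that CR(2) by (subst ln_le_cancel_iff) (auto intro: add_pos_nonneg)
    then show "norm (ln (1 + norm x) * (indicator (cball 0 R) x * C\<^sup>2)) \<le> norm (indicator (cball 0 R) x * (ln (1 + R) * C\<^sup>2))"
     using CR(2) by (auto simp: indicator_def abs_mult intro!: mult_right_mono)
   qed
   show "(\<lambda>x::real^2. ln (1 + norm x) * (indicator (cball 0 R) x * C\<^sup>2)) \<in> borel_measurable lborel"
    using borel_closed[OF closed_cball, of "0::real^2" R] by (intro borel_measurable_times borel_measurable_indicator borel_measurable_const) (auto intro: borel_measurable_continuous_onI)
  qed
 qed
qed

text \<open>\<open>kp\<close> is fixed by requiring the form to vanish at the minimiser; it is the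
  Lagrange multiplier of the mass constraint.\<close>

lemma rmin_form:
 assumes rm: "rmin c lam w" and c: "c > 0" and lam: "lam > 0"
 obtains kp where "\<And>u. XR u \<Longrightarrow> 0 \<le> Qf c (\<lambda>x. (w x)^2) kp u" "Qf c (\<lambda>x. (w x)^2) kp w = 0"
proof -
 have X: "XR w" and N: "(LBINT x. (w x)^2) = lam"
  and mn: "\<And>u. XR u \<Longrightarrow> (LBINT x. (u x)^2) = lam \<Longrightarrow> ER c w \<le> ER c u"
  using rm by (auto simp: rmin_def)
 define kp where "kp = (ER c w + c * DD (\<lambda>x. (w x)^2) (\<lambda>x. (w x)^2)) / lam"
 have k: "kp * lam = ER c w + c * DD (\<lambda>x. (w x)^2) (\<lambda>x. (w x)^2)" using lam by (simp add: kp_def)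
 show thesis
 proof (rule that[of kp])
  show "0 \<le> Qf c (\<lambda>x. (w x)^2) kp u" if "XR u" for u
   by (rule Qf_nonneg(1)[OF that adm_XR[OF X] N lam c mn k])
  show "Qf c (\<lambda>x. (w x)^2) kp w = 0" unfolding Qf_def N k ER_def by simp
 qed
qed

lemma quadratic_nonneg_imp_linear_zero:
 fixes B q :: real
 assumes "\<And>t. 0 \<le> 2 * t * B + t\<^sup>2 * q"
 shows "B = 0"
proof (rule ccontr)
 assume B: "B \<noteq> 0"
 define Q where "Q = \<bar>q\<bar> + 1"
 have Q: "Q > 0" "q \<le> Q" by (auto simp: Q_def)
 have "0 \<le> 2 * (- B / Q) * B + (- B / Q)^2 * q" by (rule assms)
 also have "\<dots> \<le> 2 * (- B / Q) * B + (- B / Q)^2 * Q" using Q by (intro add_left_mono mult_left_mono) auto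
 also have "\<dots> = - (B\<^sup>2 / Q)" using Q by (simp add: field_simps power2_eq_square)
 finally show False using B Q by (simp add: divide_le_0_iff)
qed

text \<open>Along \<open>w + t * phi\<close> the form is a quadratic polynomial in \<open>t\<close>
  that is nonnegative and vanishes at \<open>t = 0\<close>, so its linear coefficient is 0.\<close>

lemma euler_lagrange:
 assumes X: "XR w" and ad: "adm sg" and Q: "\<And>u. XR u \<Longrightarrow> 0 \<le> Qf c sg kp u" "Qf c sg kp w = 0"
  and G: "wgrad w G" and Xf: "XR phi" and H: "wgrad phi H"
 shows "integ (\<lambda>x. (2 * c * pot sg x - kp) * (w x * phi x))" (is ?t1)
  "(LBINT x. G x \<bullet> H x) + (LBINT x. (2 * c * pot sg x - kp) * (w x * phi x)) = 0" (is ?t2)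
proof -
 note [measurable] = wgrad_borel[OF G] wgrad_borel[OF H] pot_borel[OF ad]
 note iG = XR_wgrad_integrable[OF X G] and iH = XR_wgrad_integrable[OF Xf H]
 have iGH: "integ (\<lambda>x. G x \<bullet> H x)"
 proof (rule Lintegrable_bound[OF Lintegrable_add[OF iG iH]])
  show "AE x in lborel. norm (G x \<bullet> H x) \<le> norm ((norm (G x))^2 + (norm (H x))^2)" (is "AE x in _. ?Q1 x")
  proof (rule AE_I2)
   fix x
   have "\<bar>G x \<bullet> H x\<bar> \<le> norm (G x) * norm (H x)" by (rule Cauchy_Schwarz_ineq2)
   moreover have "2 * (norm (G x) * norm (H x)) \<le> 1 * (norm (G x))^2 + (norm (H x))^2 / 1" by (rule young_ineq) simp
   moreover have "0 \<le> norm (G x) * norm (H x)" by simp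
   ultimately have "\<bar>G x \<bullet> H x\<bar> \<le> (norm (G x))^2 + (norm (H x))^2" by linarith
   then show "?Q1 x" by simp
  qed
 qed measurable
 note p1 = DD_pot_integrable[OF adm_XR[OF X] ad] and p2 = DD_pot_integrable[OF adm_XR[OF Xf] ad]
 have prod_le: "\<bar>w x * phi x\<bar> \<le> (w x)^2 + (phi x)^2" for x
 proof -
  have "2 * (\<bar>w x\<bar> * \<bar>phi x\<bar>) \<le> 1 * \<bar>w x\<bar>\<^sup>2 + \<bar>phi x\<bar>\<^sup>2 / 1" by (rule young_ineq) simp
  moreover have "0 \<le> \<bar>w x\<bar> * \<bar>phi x\<bar>" by simp
  ultimately have "\<bar>w x\<bar> * \<bar>phi x\<bar> \<le> \<bar>w x\<bar>\<^sup>2 + \<bar>phi x\<bar>\<^sup>2" by linarith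
  then show ?thesis by (simp add: abs_mult)
 qed
 have ip: "integ (\<lambda>x. (w x * phi x) * pot sg x)"
 proof (rule Lintegrable_bound[OF Lintegrable_add[OF integrable_abs[OF p1] integrable_abs[OF p2]]])
  show "AE x in lborel. norm ((w x * phi x) * pot sg x) \<le> norm (\<bar>(w x)^2 * pot sg x\<bar> + \<bar>(phi x)^2 * pot sg x\<bar>)" (is "AE x in _. ?Q2 x")
  proof (rule AE_I2)
   fix x
   have "\<bar>w x * phi x\<bar> * \<bar>pot sg x\<bar> \<le> ((w x)^2 + (phi x)^2) * \<bar>pot sg x\<bar>" by (rule mult_right_mono[OF prod_le]) simp
   then show "?Q2 x"
    by (simp add: abs_mult distrib_right)
  qed
 qed measurable
 have iw: "integ (\<lambda>x. w x * phi x)"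
  by (rule integrable_product_square[OF _ _ XR_D(1)[OF X] XR_D(1)[OF Xf]]) measurable
 have eqV: "(2 * c * pot sg x - kp) * (w x * phi x) = 2 * c * ((w x * phi x) * pot sg x) - kp * (w x * phi x)" for x by (simp add: algebra_simps)
 show ?t1 unfolding eqV
  by (intro Lintegrable_diff integrable_mult_right ip iw)
 define B where "B = (LBINT x. G x \<bullet> H x) + (2 * c * (LBINT x. (w x * phi x) * pot sg x) - kp * (LBINT x. w x * phi x))"
 have ex: "Qf c sg kp (\<lambda>x. w x + t * phi x) = Qf c sg kp w + (2 * t * B + t\<^sup>2 * Qf c sg kp phi)" for t
 proof -
  have "TR (\<lambda>x. w x + t * phi x) = (LBINT x. (norm (G x + t *\<^sub>R H x))^2)"
   by (rule TR_eq[OF wgrad_add[OF G wgrad_cmult[OF H]]])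
  also have "\<dots> = (LBINT x. (norm (G x))^2 + (2 * t * (G x \<bullet> H x) + t\<^sup>2 * (norm (H x))^2))"
  proof (rule Lintegral_cong[OF HOL.refl])
   fix x
   show "(norm (G x + t *\<^sub>R H x))^2 = (norm (G x))^2 + (2 * t * (G x \<bullet> H x) + t\<^sup>2 * (norm (H x))^2)"
    unfolding power2_norm_eq_inner by (simp add: inner_simps inner_commute power2_eq_square algebra_simps)
  qed
  also have "\<dots> = TR w + 2 * t * (LBINT x. G x \<bullet> H x) + t\<^sup>2 * TR phi"
   unfolding TR_eq[OF G] TR_eq[OF H] using iG iH iGH by simp
  finally have T: "TR (\<lambda>x. w x + t * phi x) = TR w + 2 * t * (LBINT x. G x \<bullet> H x) + t\<^sup>2 * TR phi" .
  have sq: "(w x + t * phi x)^2 = (w x)^2 + (2 * t * (w x * phi x) + t\<^sup>2 * (phi x)^2)" for x by (simp add: power2_eq_square algebra_simps)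
  have "DD (\<lambda>x. (w x + t * phi x)^2) sg = (LBINT x. (w x)^2 * pot sg x + (2 * t * ((w x * phi x) * pot sg x) + t\<^sup>2 * ((phi x)^2 * pot sg x)))"
   unfolding DD_pot sq by (simp add: algebra_simps)
  also have "\<dots> = DD (\<lambda>x. (w x)^2) sg + 2 * t * (LBINT x. (w x * phi x) * pot sg x) + t\<^sup>2 * DD (\<lambda>x. (phi x)^2) sg"
   unfolding DD_pot using p1 p2 ip by simp
  finally have D: "DD (\<lambda>x. (w x + t * phi x)^2) sg = DD (\<lambda>x. (w x)^2) sg + 2 * t * (LBINT x. (w x * phi x) * pot sg x) + t\<^sup>2 * DD (\<lambda>x. (phi x)^2) sg" .
  have M: "(LBINT x. (w x + t * phi x)^2) = (LBINT x. (w x)^2) + 2 * t * (LBINT x. w x * phi x) + t\<^sup>2 * (LBINT x. (phi x)^2)"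
   unfolding sq using XR_D(1)[OF X] XR_D(1)[OF Xf] iw by simp
  show ?thesis unfolding Qf_def T D M B_def by (simp add: algebra_simps)
 qed
 have "B = 0"
 proof (rule quadratic_nonneg_imp_linear_zero)
  fix t
  have "0 \<le> Qf c sg kp (\<lambda>x. w x + t * phi x)" by (intro Q(1) XR_add X XR_cmult(1) Xf)
  then show "0 \<le> 2 * t * B + t\<^sup>2 * Qf c sg kp phi" unfolding ex Q(2) by simp
 qed
 then show ?t2
  unfolding eqV B_def using ip iw by simp
qed

text \<open>The gradient of \<open>phi\<close> is \<open>2 pi x K\<close>, and its components are to
  be test functions in turn: then the weak derivative of \<open>w\<close> can be moved onto them,
  which leaves the divergence of \<open>x K\<close>, namely \<open>2 (K + a K')\<close>.\<close>

lemma radial_test_fn: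
 assumes Psi: "\<And>t. (Psi has_real_derivative K t) (at t)" and K: "\<And>t. (K has_real_derivative K' t) (at t)" "continuous_on UNIV K'"
  and q: "q > 0" "\<And>t. t \<ge> q \<Longrightarrow> Psi t = 0" "\<And>t. t \<ge> q \<Longrightarrow> K t = 0"
 defines "phi \<equiv> \<lambda>x::real^2. Psi (area x)"
 shows "test_fn phi" "partial i phi x = 2 * pi * (x $ i * K (area x))" (is ?t1)
  "test_fn (\<lambda>x. x $ i * K (area x))" (is ?t2)
  "(\<Sum>i\<in>UNIV. partial i (\<lambda>x. x $ i * K (area x)) x) = 2 * (K (area x) + pi * (norm x)^2 * K' (area x))" (is ?t3)
proof -
 have Kc: "continuous_on UNIV K" using K(1) by (meson DERIV_isCont continuous_at_imp_continuous_on)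
 have a: "c1 (\<lambda>x::real^2. pi * (norm x)^2) (\<lambda>x. pi *\<^sub>R (2 *\<^sub>R x))"
  using c1_cmult[OF c1_norm_square, of pi] by (simp add: power2_norm_eq_inner)
 have bd: "bounded {x::real^2. F (area x) \<noteq> 0}" if "\<And>t. t \<ge> q \<Longrightarrow> F t = (0::real)" for F
 proof (rule bounded_subset[OF bounded_cball[of 0 "sqrt (q / pi)"]])
  show "{x::real^2. F (area x) \<noteq> 0} \<subseteq> cball 0 (sqrt (q / pi))"
  proof
   fix x :: "real^2" assume "x \<in> {x. F (area x) \<noteq> 0}"
   then have "pi * (norm x)^2 < q" using that[of "pi * (norm x)^2"] by force
   then have "(norm x)^2 \<le> q / pi" by (simp add: field_simps)
   then have "norm x \<le> sqrt (q / pi)" by (rule real_le_rsqrt)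
   then show "x \<in> cball 0 (sqrt (q / pi))" by simp
  qed
 qed
 note cphi = c1_compose[OF a Psi Kc]
 show "test_fn phi" unfolding phi_def by (rule c1_imp_test_fn[OF cphi bd[OF q(2)]])
 show ?t1
  unfolding phi_def using c1_partial[OF cphi] by simp
 note cH = c1_mult[OF c1_component c1_compose[OF a K]]
 have "test_fn (\<lambda>x. x $ j * K (area x))" for j
  by (rule c1_imp_test_fn[OF cH bounded_subset[OF bd[OF q(3)]]]) auto
 then show ?t2 .
 have pi': "partial j (\<lambda>x. x $ j * K (area x)) x = 2 * pi * K' (area x) * (x $ j * x $ j) + K (area x)" for j x
  using c1_partial[OF cH] by (simp add: axis_def)
 have n: "(norm x)^2 = x $ 1 * x $ 1 + x $ 2 * x $ 2" unfolding power2_norm_eq_inner inner_vec2 ..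
 show ?t3
  unfolding pi' sum_2 by (simp add: n[symmetric] distrib_left[symmetric] mult_ac) (simp add: n algebra_simps)
qed

text \<open>Only the profile \<open>f\<close> survives, with no derivative on it;
  \<open>4 pi (K + a K')\<close> is the Laplacian of the radial test function.\<close>

lemma radial_euler_lagrange:
 assumes X: "XR w" and ad: "adm sg" and Q: "\<And>u. XR u \<Longrightarrow> 0 \<le> Qf c sg kp u" "Qf c sg kp w = 0"
  and f: "f \<in> Bor" "AE x in lborel. w x = f (area x)"
  and W: "W \<in> Bor" "AE x in lborel. 2 * c * pot sg x - kp = W (area x)"
  and Psi: "\<And>t. (Psi has_real_derivative K t) (at t)" and K: "\<And>t. (K has_real_derivative K' t) (at t)" "continuous_on UNIV K'"
  and q: "q > 0" "\<And>t. t \<ge> q \<Longrightarrow> Psi t = 0" "\<And>t. t \<ge> q \<Longrightarrow> K t = 0"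
 shows "4 * pi * (LBINT a. indicator {0..} a * (f a * (K a + a * K' a))) = (LBINT a. indicator {0..} a * (W a * f a * Psi a))"
proof -
 note rt = radial_test_fn[OF Psi K q]
 obtain G where G: "wgrad w G" "integ (\<lambda>x. (norm (G x))^2)" using XR_E[OF X] .
 have [measurable]: "Psi \<in> Bor" "K \<in> Bor" "K' \<in> Bor"
  using K(2) by (auto intro!: borel_measurable_continuous_onI continuous_at_imp_continuous_on DERIV_isCont[OF Psi] DERIV_isCont[OF K(1)])
 note [measurable] = f(1) W(1) XR_D(3)[OF X] pot_borel[OF ad]
 define phi where "phi x = Psi (area x)" for x :: "real^2"
 define H where "H x = (\<chi> i. partial i phi x)" for x
 define k where "k i x = x $ i * K (area x)" for i :: 2 and x :: "real^2"
 have t: "test_fn phi" unfolding phi_def by (rule rt(1))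
 have Hk: "H x $ i = 2 * pi * k i x" for i x unfolding H_def k_def phi_def using rt(2) by simp
 have tk: "test_fn (k i)" for i unfolding k_def by (rule rt(3))
 have EL: "(LBINT x. G x \<bullet> H x) + (LBINT x. (2 * c * pot sg x - kp) * (w x * phi x)) = 0"
  by (rule euler_lagrange(2)[OF X ad Q G(1) test_fn_XR(1)[OF t]]) (use test_fn_XR(2)[OF t] in \<open>simp_all add: H_def\<close>)
 have "(LBINT x. G x \<bullet> H x) = (LBINT x. (\<Sum>i\<in>UNIV. 2 * pi * (k i x * G x $ i)))"
  unfolding inner_vec_def Hk by (simp add: mult_ac)
 also have "\<dots> = (\<Sum>i\<in>UNIV. 2 * pi * (LBINT x. k i x * G x $ i))"
  using test_fn_mult_integrable(1)[OF tk wderivD(2)[OF wgradD[OF G(1)]]] by (subst Lintegral_sum) auto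
 also have "\<dots> = (\<Sum>i\<in>UNIV. - (LBINT x. 2 * pi * (partial i (k i) x * w x)))"
  using wderivD(3)[OF wgradD[OF G(1)] tk] by simp
 also have "\<dots> = - (LBINT x. (\<Sum>i\<in>UNIV. 2 * pi * (partial i (k i) x * w x)))"
  unfolding sum_negf using test_fn_mult_integrable(2)[OF tk wderivD(1)[OF wgradD[OF G(1)]]]
  by (subst Lintegral_sum) auto
 also have "(\<lambda>x. (\<Sum>i\<in>UNIV. 2 * pi * (partial i (k i) x * w x))) = (\<lambda>x. 4 * pi * (w x * (K (area x) + pi * (norm x)^2 * K' (area x))))"
 proof
  fix x
  have "(\<Sum>i\<in>UNIV. 2 * pi * (partial i (k i) x * w x)) = 2 * pi * w x * (\<Sum>i\<in>UNIV. partial i (k i) x)"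
   by (simp add: sum_distrib_left mult_ac)
  also have "(\<Sum>i\<in>UNIV. partial i (k i) x) = 2 * (K (area x) + pi * (norm x)^2 * K' (area x))"
   unfolding k_def by (rule rt(4))
  finally show "(\<Sum>i\<in>UNIV. 2 * pi * (partial i (k i) x * w x)) = 4 * pi * (w x * (K (area x) + pi * (norm x)^2 * K' (area x)))"
   by simp
 qed
 also have "(LBINT x. 4 * pi * (w x * (K (area x) + pi * (norm x)^2 * K' (area x))))
   = (LBINT x. 4 * pi * (f (area (x::real^2)) * (K (area x) + pi * (norm x)^2 * K' (area x))))"
  by (rule integral_cong_AE) (measurable, measurable, use f(2) in \<open>eventually_elim, simp\<close>)
 also have "\<dots> = (LBINT a. indicator {0..} a * (4 * pi * (f a * (K a + a * K' a))))"
  by (rule integral_radial[of "\<lambda>a. 4 * pi * (f a * (K a + a * K' a))"]) measurable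
 also have "\<dots> = 4 * pi * (LBINT a. indicator {0..} a * (f a * (K a + a * K' a)))"
  by (subst integral_mult_right_zero[symmetric]) (simp add: mult_ac)
 finally have 1: "(LBINT x. G x \<bullet> H x) = - (4 * pi * (LBINT a. indicator {0..} a * (f a * (K a + a * K' a))))" .
 have "(LBINT x. (2 * c * pot sg x - kp) * (w x * phi x)) = (LBINT x. W (area (x::real^2)) * f (area x) * Psi (area x))"
  unfolding phi_def
 proof (rule integral_cong_AE)
  show "AE x in lborel. (2 * c * pot sg x - kp) * (w x * Psi (area x)) = W (area x) * f (area x) * Psi (area x)"
   using W(2) f(2) by eventually_elim simp
 qed measurable
 also have "\<dots> = (LBINT a. indicator {0..} a * (W a * f a * Psi a))"
  by (rule integral_radial[of "\<lambda>a. W a * f a * Psi a"]) measurable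
 finally show ?thesis using EL 1 by simp
qed

section \<open>The radial profile\<close>

text \<open>The base point \<open>p - 1\<close> lies strictly to the left of the support, so the
  antiderivative has a two-sided derivative at every point, also at \<open>p\<close>.\<close>

lemma antiderivative_from_left:
 fixes k :: "real \<Rightarrow> real"
 assumes k: "continuous_on UNIV k" "\<And>t. t \<le> p \<Longrightarrow> k t = 0"
 defines "A \<equiv> \<lambda>t. integral {p - 1..t} k"
 shows "(A has_real_derivative k t) (at t)" (is ?t1) "t \<le> p \<Longrightarrow> A t = 0"
proof -
 have z: "A s = 0" if "s \<le> p" for s
 proof -
  have "integral {p - 1..s} k = integral {p - 1..s} (\<lambda>_. 0)" using that k(2) by (intro integral_cong) auto
  then show ?thesis by (simp add: A_def)
 qed
 then show "t \<le> p \<Longrightarrow> A t = 0" .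
 show ?t1
 proof (cases "t < p")
  case True
  have "((\<lambda>_. 0) has_real_derivative 0) (at t)" by simp
  then have "(A has_real_derivative 0) (at t)"
   by (rule has_field_derivative_transform_within[where d="p - t"]) (use True z in \<open>auto simp: dist_real_def\<close>)
  then show ?thesis using True k(2) by simp
 next
  case False
  have "(A has_real_derivative k t) (at t within {p - 1..t + 1})" unfolding A_def
   by (rule integral_has_real_derivative) (use k(1) False in \<open>auto intro: continuous_on_subset\<close>)
  moreover have "at t within {p - 1..t + 1} = at t" using False by (intro at_within_interior) (auto simp: interior_atLeastAtMost_real)
  ultimately show ?thesis by simp
 qed
qed

lemma antiderivative_const_right:
 fixes A :: "real \<Rightarrow> real"
 assumes "\<And>t. (A has_real_derivative k t) (at t)" "\<And>t. t \<ge> q \<Longrightarrow> k t = 0" "t \<ge> q"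
 shows "A t = A q"
proof (cases "t = q")
 case False
 have "(A has_real_derivative 0) (at x)" if "q < x" for x using assms(1)[of x] assms(2)[of x] that by simp
 moreover have "continuous_on {q..t} A" using assms(1) by (meson DERIV_isCont continuous_at_imp_continuous_on)
 ultimately show ?thesis using False assms(3) by (intro DERIV_isconst_end) auto
qed simp

lemma integrable_continuous_compact:
 fixes u :: "real \<Rightarrow> real"
 assumes "continuous_on UNIV u" "\<And>t. t \<notin> {p..q} \<Longrightarrow> u t = 0"
 shows "integ u"
proof -
 have "set_integrable lborel {p..q} u"
  by (rule borel_integrable_atLeastAtMost') (use assms in \<open>auto intro: continuous_on_subset\<close>)
 moreover have "(\<lambda>x. indicat_real {p..q} x *\<^sub>R u x) = u" using assms(2) by (force simp: indicator_def)
 ultimately show ?thesis by (simp add: set_integrable_def)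
qed

text \<open>Integration by parts performed as an exchange of integrals over \<open>b < a\<close>,
  since \<open>v\<close> has no more than integrability.\<close>

lemma fubini_by_parts:
 fixes u v A :: "real \<Rightarrow> real"
 assumes u: "continuous_on UNIV u" "\<And>t. t \<notin> {p..q} \<Longrightarrow> u t = 0"
  and A: "\<And>t. (A has_real_derivative u t) (at t)" "\<And>t. t \<ge> q \<Longrightarrow> A t = 0"
  and v: "v \<in> Bor" "integ (\<lambda>b. indicator {..q} b * v b)"
 shows "(LBINT a. u a * (LBINT b. indicator {..<a} b * v b)) = - (LBINT b. v b * A b)"
proof -
 note [measurable] = v(1)
 have [measurable]: "u \<in> Bor" using u(1) by (rule borel_measurable_continuous_onI)
 have iu: "integ u" by (rule integrable_continuous_compact[OF u])
 have I: "integrable (lborel \<Otimes>\<^sub>M lborel) (\<lambda>(a, b). u a * (indicator {..<a} b * v b))"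
 proof (rule Lintegrable_bound[OF integrable_prod_mult[OF iu v(2)]])
  have "Measurable.pred (borel \<Otimes>\<^sub>M borel) (\<lambda>z::real \<times> real. snd z < fst z)" by measurable
  then have [measurable]: "(\<lambda>z::real \<times> real. indicat_real {..<fst z} (snd z)) \<in> borel_measurable (borel \<Otimes>\<^sub>M borel)"
   unfolding indicator_def lessThan_iff by measurable
  show "(\<lambda>(a, b). u a * (indicator {..<a} b * v b)) \<in> borel_measurable (lborel \<Otimes>\<^sub>M lborel)"
   unfolding case_prod_beta' by measurable
  show "AE z in lborel \<Otimes>\<^sub>M lborel. norm (case z of (a, b) \<Rightarrow> u a * (indicator {..<a} b * v b)) \<le> norm (case z of (a, b) \<Rightarrow> u a * (indicator {..q} b * v b))" (is "AE z in _. ?Q1 z")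
  proof (rule AE_I2)
   fix z :: "real \<times> real"
   obtain a b where z: "z = (a, b)" by force
   show "?Q1 z"
    using u(2)[of a] by (cases "a \<in> {p..q}") (auto simp: z indicator_def)
  qed
 qed
 have inner: "(LBINT a. u a * (indicator {..<a} b * v b)) = - (v b * A b)" for b
 proof -
  have e: "(LBINT a. u a * indicator {..<a} b) = - A b"
  proof (cases "b \<ge> q")
   case True
   have "u a * indicator {..<a} b = 0" for a using u(2)[of a] True by (auto simp: indicator_def)
   then show ?thesis using A(2)[OF True] by (simp only: Lintegral_zero minus_zero)
  next
   case False
   have "(LBINT a. u a * indicator {..<a} b) = (LBINT a. u a * indicator {b..q} a)"
   proof (rule integral_cong_AE)
    show "(\<lambda>a. u a * indicator {..<a} b) \<in> borel_measurable lborel"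
    proof -
     have "(\<lambda>a. u a * indicator {..<a} b) = (\<lambda>a. u a * indicator {b<..} a)" by (auto simp: indicator_def)
     then show ?thesis by simp
    qed
    show "AE a in lborel. u a * indicator {..<a} b = u a * indicator {b..q} a"
     using AE_lborel_singleton[of b] by eventually_elim (use u(2) in \<open>force simp: indicator_def\<close>)
   qed measurable
   also have "\<dots> = A q - A b"
    by (rule integral_FTC_Icc_real) (use False A(1) u(1) in \<open>auto simp: continuous_on_eq_continuous_at\<close>)
   finally show ?thesis using A(2)[of q] by simp
  qed
  have "(LBINT a. u a * (indicator {..<a} b * v b)) = (LBINT a. u a * indicator {..<a} b) * v b"
   by (subst integral_mult_left_zero[symmetric]) (simp add: mult.assoc)
  then show ?thesis unfolding e by simp
 qed
 have "(LBINT a. u a * (LBINT b. indicator {..<a} b * v b)) = (LBINT a. (LBINT b. u a * (indicator {..<a} b * v b)))" by simp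
 also have "\<dots> = (LBINT b. (LBINT a. u a * (indicator {..<a} b * v b)))" using lborel_pair.Fubini_integral[OF I] by simp
 finally show ?thesis unfolding inner by simp
qed

text \<open>Subtracting a multiple of one fixed bump gives any bump mean zero, so \<open>k\<close>
  integrates against all bumps like a constant \<open>C\<close>, read off from the fixed one.
  Supports stay away from 0, where the radial equation is singular.\<close>

lemma du_bois_reymond:
 fixes k :: "real \<Rightarrow> real"
 assumes km[measurable]: "k \<in> Bor" and ki: "\<And>R. integ (\<lambda>a. indicator {0..R} a * k a)"
  and z: "\<And>et p q. 0 < p \<Longrightarrow> p < q \<Longrightarrow> continuous_on UNIV et \<Longrightarrow> (\<And>t. t \<notin> {p..q} \<Longrightarrow> et t = 0) \<Longrightarrow> (LBINT a. et a) = 0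
    \<Longrightarrow> (LBINT a. indicator {0..} a * (k a * et a)) = 0"
 obtains C where "AE a in lborel. a > 0 \<longrightarrow> k a = C"
proof -
 \<comment> \<open>Bumps that tend to the indicator of the open interval as \<open>n\<close> grows;
   \<open>b 1 2 1\<close> is the fixed reference bump.\<close>
 define b where "b p q n t = smooth_step (real n * (t - p)) * smooth_step (real n * (q - t))" for p q :: real and n t
 have sc: "continuous_on UNIV smooth_step"
  using smooth_step_DERIV by (meson DERIV_isCont continuous_at_imp_continuous_on)
 have bc: "continuous_on UNIV (b p q n)" for p q n
  unfolding b_def by (intro continuous_intros continuous_on_compose2[OF sc]) auto
 have [measurable]: "b p q n \<in> Bor" for p q n using bc by (rule borel_measurable_continuous_onI)
 have b0: "b p q n t = 0" if "t \<notin> {p..q}" for p q n t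
 proof -
  have "t \<le> p \<or> t \<ge> q" using that by auto
  then show ?thesis unfolding b_def by (auto simp: smooth_step_def mult_le_0_iff)
 qed
 have b01: "0 \<le> b p q n t" "b p q n t \<le> 1" for p q n t
  unfolding b_def using smooth_step_nonneg smooth_step_le_1 by (auto intro!: mult_le_one)
 have ib: "integ (b p q n)" for p q n by (rule integrable_continuous_compact[OF bc b0])
 have blim: "(\<lambda>n. b p q n t) ~~> indicator {p<..<q} t" for p q t
 proof -
  have "(\<lambda>n. b p q n t) ~~> (if t - p > 0 then 1 else 0) * (if q - t > 0 then 1 else 0)"
   unfolding b_def by (intro tendsto_mult smooth_step_tendsto)
  then show ?thesis by (auto simp: indicator_def split: if_splits)
 qed
 define bt where "bt = (LBINT a. b 1 2 1 a)"
 have bt: "bt \<noteq> 0"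
 proof
  assume "bt = 0"
  then have "AE a in lborel. b 1 2 1 a = 0"
   using integral_nonneg_eq_0_iff_AE[OF ib[of 1 2 1]] b01 unfolding bt_def by simp
  then have "AE a in lborel. a \<notin> {1<..<2::real}"
  proof eventually_elim
   case (elim a)
   show ?case
   proof
    assume "a \<in> {1<..<2}"
    then have "smooth_step (a - 1) > 0" "smooth_step (2 - a) > 0"
     by (auto simp: smooth_step_def one_plus_square_pos intro!: divide_pos_pos)
    then show False using elim by (simp add: b_def)
   qed
  qed
  then have "{1<..<2::real} \<in> null_sets lborel" by (subst AE_iff_null_sets) auto
  then have "emeasure lborel {1<..<2::real} = 0" by (rule null_setsD1)
  then show False by simp
 qed
 have ikb: "integ (\<lambda>a. indicator {0..} a * (k a * b p q n a))" if "0 < p" for p q n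
 proof (rule Lintegrable_bound[OF ki[of q]])
  show "AE a in lborel. norm (indicator {0..} a * (k a * b p q n a)) \<le> norm (indicator {0..q} a * k a)" (is "AE a in _. ?Q1 a")
  proof (rule AE_I2)
   fix a
   have "\<bar>k a\<bar> * \<bar>b p q n a\<bar> \<le> \<bar>k a\<bar> * 1" using b01[of p q n a] by (intro mult_left_mono) auto
   then show "?Q1 a"
    using b0[of a p q n] that by (cases "a \<in> {p..q}") (auto simp: indicator_def abs_mult)
  qed
 qed measurable
 define C where "C = (LBINT a. indicator {0..} a * (k a * b 1 2 1 a)) / bt"
 have eqb: "(LBINT a. indicator {0..} a * (k a * b p q n a)) = C * (LBINT a. b p q n a)" if pq: "0 < p" "p < q" for p q n
 proof -
  define I where "I = (LBINT a. b p q n a)"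
  define et where "et t = b p q n t - I / bt * b 1 2 1 t" for t
  have "(LBINT a. indicator {0..} a * (k a * et a)) = 0"
  proof (rule z[of "min p 1" "max q 2"])
   show "continuous_on UNIV et" unfolding et_def by (intro continuous_intros bc)
   show "et t = 0" if "t \<notin> {min p 1..max q 2}" for t
   proof -
    have "t \<notin> {p..q}" "t \<notin> {1..2}" using that by auto
    then have "b p q n t = 0" "b 1 2 1 t = 0" using b0 by blast+
    then show ?thesis unfolding et_def by simp
   qed
   show "(LBINT a. et a) = 0"
    unfolding et_def using ib[of p q n] ib[of 1 2 1] bt by (simp add: I_def bt_def)
  qed (use pq in auto)
  moreover have "(\<lambda>a. indicator {0..} a * (k a * et a)) = (\<lambda>a. indicator {0..} a * (k a * b p q n a) - I / bt * (indicator {0..} a * (k a * b 1 2 1 a)))"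
   by (auto simp: et_def algebra_simps)
  ultimately have "(LBINT a. indicator {0..} a * (k a * b p q n a)) - I / bt * (LBINT a. indicator {0..} a * (k a * b 1 2 1 a)) = 0"
   using ikb[OF pq(1), of q n] ikb[of 1 2 1] by simp
  then show ?thesis by (simp add: C_def I_def)
 qed
 have box0: "(LBINT a. indicator {p<..<q} a * (k a - C)) = 0" if pq: "0 < p" for p q
 proof (cases "p < q")
  case False then show ?thesis by simp
 next
  case True
  have "(\<lambda>n. LBINT a. indicator {0..} a * (k a * b p q n a) - C * b p q n a) ~~> (LBINT a. indicator {p<..<q} a * (k a - C))"
  proof (rule integral_dominated_convergence[where w="\<lambda>a. \<bar>indicator {0..q} a * k a\<bar> + \<bar>C\<bar> * indicator {p..q} a"])
   show "integ (\<lambda>a. \<bar>indicator {0..q} a * k a\<bar> + \<bar>C\<bar> * indicator {p..q} a)"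
    by (intro Lintegrable_add integrable_abs ki integrable_mult_right integrable_real_indicator) (auto simp: emeasure_lborel_Icc_eq)
   show "AE a in lborel. (\<lambda>n. indicator {0..} a * (k a * b p q n a) - C * b p q n a) ~~> indicator {p<..<q} a * (k a - C)" (is "AE a in _. ?Q2 a")
   proof (rule AE_I2)
    fix a
    have "(\<lambda>n. indicator {0..} a * (k a * b p q n a) - C * b p q n a) ~~> indicator {0..} a * (k a * indicator {p<..<q} a) - C * indicator {p<..<q} a"
     by (intro tendsto_intros blim)
    moreover have "indicator {0..} a * (k a * indicator {p<..<q} a) - C * indicator {p<..<q} a = indicator {p<..<q} a * (k a - C)"
     using pq by (auto simp: indicator_def algebra_simps)
    ultimately show "?Q2 a" by simp
   qed
   show "AE a in lborel. norm (indicator {0..} a * (k a * b p q n a) - C * b p q n a) \<le> \<bar>indicator {0..q} a * k a\<bar> + \<bar>C\<bar> * indicator {p..q} a" (is "AE a in _. ?Q3 a") for n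
   proof (rule AE_I2)
    fix a
    have "\<bar>k a\<bar> * b p q n a \<le> \<bar>k a\<bar> * 1" "\<bar>C\<bar> * b p q n a \<le> \<bar>C\<bar> * 1" using b01[of p q n a] by (intro mult_left_mono; simp)+
    moreover have "\<bar>k a * b p q n a - C * b p q n a\<bar> \<le> \<bar>k a\<bar> * b p q n a + \<bar>C\<bar> * b p q n a"
     using abs_triangle_ineq4[of "k a * b p q n a" "C * b p q n a"] b01(1)[of p q n a] by (simp add: abs_mult)
    ultimately show "?Q3 a"
     using b0[of a p q n] pq by (cases "a \<in> {p..q}") auto
   qed
  qed measurable
  moreover have "(LBINT a. indicator {0..} a * (k a * b p q n a) - C * b p q n a) = 0" for n
   using eqb[OF pq True, of n] ikb[OF pq, of q n] ib[of p q n] by simp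
  ultimately show ?thesis by (simp add: LIMSEQ_const_iff)
 qed
 have "AE a in lborel. indicator {r<..<s} a * (k a - C) = 0" if r: "0 < r" for r s
 proof (rule integral_box_zero_imp_AE_zero)
  show "integ (\<lambda>a. indicator {r<..<s} a * (k a - C))"
  proof (rule Lintegrable_bound)
   show "integ (\<lambda>a. \<bar>indicator {0..s} a * k a\<bar> + \<bar>C\<bar> * indicator {r..s} a)"
    by (intro Lintegrable_add integrable_abs ki integrable_mult_right integrable_real_indicator) (auto simp: emeasure_lborel_Icc_eq)
   show "AE a in lborel. norm (indicator {r<..<s} a * (k a - C)) \<le> norm (\<bar>indicator {0..s} a * k a\<bar> + \<bar>C\<bar> * indicator {r..s} a)"
    using r by (intro AE_I2) (auto simp: indicator_def)
  qed measurable
  fix x y :: real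
  have "indicator (box x y) a * (indicator {r<..<s} a * (k a - C)) = indicator {max x r<..<min y s} a * (k a - C)" for a
   by (auto simp: indicator_def box_real)
  then show "(LBINT a. indicator (box x y) a * (indicator {r<..<s} a * (k a - C))) = 0"
   using box0[of "max x r" "min y s"] r by (simp only: less_max_iff_disj simp_thms)
 qed
 then have "AE a in lborel. \<forall>n. indicator {1 / real (Suc n)<..<real (Suc n)} a * (k a - C) = 0"
  unfolding AE_all_countable by simp
 then have "AE a in lborel. a > 0 \<longrightarrow> k a = C"
 proof eventually_elim
  case (elim a)
  show ?case
  proof
   assume a: "a > 0"
   obtain N1 where N1: "1 / a < real N1" using reals_Archimedean2 by blast
   obtain N2 where N2: "a < real N2" using reals_Archimedean2 by blast
   define N where "N = max N1 N2"
   have "1 / a < real (Suc N)" "a < real (Suc N)" using N1 N2 by (auto simp: N_def)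
   then have "a \<in> {1 / real (Suc N)<..<real (Suc N)}" using a by (simp add: field_simps)
   then show "k a = C" using elim[rule_format, of N] by simp
  qed
 qed
 then show thesis by (rule that)
qed

subsection \<open>Indefinite integrals from the origin\<close>

text \<open>Zero for \<open>a \<le> 0\<close>, hence continuous on the whole line and not only on
  the half-line of areas.\<close>

definition indef :: "(real \<Rightarrow> real) \<Rightarrow> real \<Rightarrow> real" where
 "indef m a = (LBINT b. indicator {0<..<a} b * m b)"

lemma indef_continuous:
 assumes [measurable]: "m \<in> Bor" and i: "\<And>a. integ (\<lambda>b. indicator {0<..<a} b * m b)"
 shows "continuous_on UNIV (indef m)"
proof (rule continuous_at_imp_continuous_on, rule ballI, rule continuous_at_sequentiallyI)
 fix a :: real and T assume T: "T ~~> a"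
 then have "bounded (range T)" by (rule convergent_imp_bounded)
 then obtain R where R: "\<And>n. \<bar>T n\<bar> \<le> R" unfolding bounded_iff by auto
 show "(\<lambda>n. indef m (T n)) ~~> indef m a" unfolding indef_def
 proof (rule integral_dominated_convergence[where w="\<lambda>b. \<bar>indicator {0<..<R + 1} b * m b\<bar>"])
  show "integ (\<lambda>b. \<bar>indicator {0<..<R + 1} b * m b\<bar>)" by (intro integrable_abs i)
  show "AE b in lborel. norm (indicator {0<..<T n} b * m b) \<le> \<bar>indicator {0<..<R + 1} b * m b\<bar>" (is "AE b in _. ?Q1 b") for n
  proof (rule AE_I2)
   fix b show "?Q1 b"
    using R[of n] by (auto simp: indicator_def)
  qed
  show "AE b in lborel. (\<lambda>n. indicator {0<..<T n} b * m b) ~~> indicator {0<..<a} b * m b"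
   using AE_lborel_singleton[of a]
  proof eventually_elim
   case (elim b)
   have "\<forall>\<^sub>F n in sequentially. indicat_real {0<..<T n} b = indicator {0<..<a} b"
   proof (cases "b < a")
    case True
    have "\<forall>\<^sub>F n in sequentially. b < T n" by (rule order_tendstoD(1)[OF T True])
    then show ?thesis by eventually_elim (use True in \<open>auto simp: indicator_def\<close>)
   next
    case False
    then have "\<forall>\<^sub>F n in sequentially. T n < b" using elim by (intro order_tendstoD(2)[OF T]) auto
    then show ?thesis by eventually_elim (use False in \<open>auto simp: indicator_def\<close>)
   qed
   then have "(\<lambda>n. indicat_real {0<..<T n} b) ~~> indicator {0<..<a} b" by (rule tendsto_eventually)
   then show ?case by (intro tendsto_intros)
  qed
 qed measurable
qed

lemma indef_nonpos: "a \<le> 0 \<Longrightarrow> indef m a = 0"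
 by (simp add: indef_def)

lemma indef_DERIV:
 assumes [measurable]: "m \<in> Bor" and i: "\<And>a. integ (\<lambda>b. indicator {0<..<a} b * m b)"
  and c: "continuous_on {0<..} m" and a: "a > 0"
 shows "(indef m has_real_derivative m a) (at a)"
proof -
 \<comment> \<open>\<open>m\<close> may be singular at 0; splitting the integral at
   \<open>a / 2\<close> leaves a piece to which the classical theorem applies.\<close>
 define r where "r = a / 2"
 have r: "0 < r" "r < a" using a by (auto simp: r_def)
 have sp: "indef m t = indef m r + integral {r..t} m" if t: "t \<ge> r" for t
 proof -
  have s: "set_integrable lborel {r..t} m"
   by (rule borel_integrable_atLeastAtMost') (use c r in \<open>auto intro: continuous_on_subset\<close>)
  have ae: "AE b in lborel. indicator {0<..<t} b * m b = indicator {0<..<r} b * m b + indicator {r..t} b * m b"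
   using AE_lborel_singleton[of t] by eventually_elim (use t r in \<open>auto simp: indicator_def\<close>)
  have "indef m t = (LBINT b. indicator {0<..<r} b * m b + indicator {r..t} b * m b)"
   unfolding indef_def by (rule integral_cong_AE[OF _ _ ae]) measurable
  also have "\<dots> = indef m r + (LINT b:{r..t}|lborel. m b)"
   unfolding indef_def set_lebesgue_integral_def using i[of r] s by (simp add: set_integrable_def)
  also have "(LINT b:{r..t}|lborel. m b) = integral {r..t} m" by (rule set_borel_integral_eq_integral(2)[OF s])
  finally show ?thesis .
 qed
 have "((\<lambda>t. integral {r..t} m) has_real_derivative m a) (at a within {r..a + 1})"
  by (rule integral_has_real_derivative) (use c r in \<open>auto intro: continuous_on_subset\<close>)
 moreover have "at a within {r..a + 1} = at a" using r by (intro at_within_interior) (auto simp: interior_atLeastAtMost_real)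
 ultimately have "((\<lambda>t. indef m r + integral {r..t} m) has_real_derivative 0 + m a) (at a)"
  by (intro DERIV_add DERIV_const) simp
 then have "((\<lambda>t. indef m r + integral {r..t} m) has_real_derivative m a) (at a)" by simp
 then show ?thesis
 proof (rule has_field_derivative_transform_within[where d="a - r"])
  show "indef m r + integral {r..t} m = indef m t" if "dist t a < a - r" for t
   using sp[of t, symmetric] that by (simp add: dist_real_def)
 qed (use r in simp_all)
qed

text \<open>The majorant \<open>2 * b powr (-1/2) + a\<close> comes from
  \<open>ln y \<le> y - 1\<close>, taken at \<open>y = b\<close> and at
  \<open>y = b powr (-1/2)\<close>.\<close>

lemma ln_integrable_near_0:
 fixes a :: real
 shows "integ (\<lambda>b. indicator {0<..<a} b * ln b)"
proof (cases "a > 0")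
 case True
 have "(\<lambda>x. x powr (-1/2)) absolutely_integrable_on {0..a}"
  by (rule nonnegative_absolutely_integrable_1)
   (use has_integral_powr_from_0[of "-1/2" a] True in \<open>auto simp: integrable_on_def\<close>)
 then have 1: "integ (\<lambda>x. indicator {0..a} x * x powr (-1/2))"
  unfolding set_integrable_def by (simp add: integrable_completion)
 have 2: "integ (indicat_real {0..a})" by (intro integrable_real_indicator) (auto simp: emeasure_lborel_Icc_eq)
 show ?thesis
 proof (rule Lintegrable_bound)
  show "integ (\<lambda>x. 2 * (indicator {0..a} x * x powr (-1/2)) + a * indicator {0..a} x)"
   by (intro Lintegrable_add integrable_mult_right 1 2)
  show "AE b in lborel. norm (indicator {0<..<a} b * ln b) \<le> norm (2 * (indicator {0..a} b * b powr (-1/2)) + a * indicator {0..a} b)" (is "AE b in _. ?Q1 b")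
  proof (rule AE_I2)
   fix b :: real
   have "\<bar>ln b\<bar> \<le> 2 * b powr (-1/2) + a" if b: "0 < b" "b < a"
   proof -
    have "ln b \<le> b - 1" using b by (intro ln_le_minus_one) simp
    moreover have "ln (b powr (-1/2)) \<le> b powr (-1/2) - 1" using b by (intro ln_le_minus_one) simp
    then have "- ln b \<le> 2 * b powr (-1/2)" using b by (simp add: ln_powr)
    ultimately show ?thesis using b powr_ge_zero[of b "-1/2"] by linarith
   qed
   then show "?Q1 b"
    using True by (auto simp: indicator_def)
  qed
 qed measurable
qed simp

text \<open>Exchanging the order over \<open>0 < b < s < a\<close> turns \<open>ds / s\<close> into
  \<open>ln a - ln b\<close>, the logarithmic kernel that Newton's theorem produces. The hypothesis
  on \<open>ln b * m b\<close> makes the double integral absolutely convergent.\<close>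

lemma indef_iterated:
 fixes m :: "real \<Rightarrow> real"
 assumes m[measurable]: "m \<in> Bor"
  and i: "\<And>a. integ (\<lambda>b. indicator {0<..<a} b * m b)" "\<And>a. integ (\<lambda>b. indicator {0<..<a} b * (ln b * m b))"
 shows "integ (\<lambda>s. indicator {0<..<a} s * (indef m s / s))" (is ?t1)
  "indef (\<lambda>s. indef m s / s) a = (LBINT b. indicator {0<..<a} b * ((ln a - ln b) * m b))" (is ?t2)
  "integ (\<lambda>b. indicator {0<..<a} b * ((ln a - ln b) * m b))" (is ?t3)
proof -
 define Phi where "Phi b s = indicator {0<..<a} s * (indicator {0<..<s} b * m b) / s" for b s
 have "Measurable.pred (borel \<Otimes>\<^sub>M borel) (\<lambda>z::real \<times> real. 0 < fst z \<and> fst z < snd z)" by measurable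
 then have [measurable]: "(\<lambda>z::real \<times> real. indicat_real {0<..<snd z} (fst z)) \<in> borel_measurable (borel \<Otimes>\<^sub>M borel)"
  unfolding indicator_def greaterThanLessThan_iff by measurable
 have Phim[measurable]: "(\<lambda>(b, s). Phi b s) \<in> borel_measurable (lborel \<Otimes>\<^sub>M lborel)"
  unfolding Phi_def case_prod_beta' by measurable
 have eq: "Phi b s = (indicator {0<..<a} b * m b) * (indicator {b<..<a} s / s)" for b s
  unfolding Phi_def by (auto simp: indicator_def)
 have inv: "integ (\<lambda>s. indicator {b<..<a} s / s)" (is ?t4) "(LBINT s. indicator {b<..<a} s / s) = ln a - ln b" (is ?t5) if b: "0 < b" "b < a" for b
 proof -
  have ic: "set_integrable lborel {b..a} (\<lambda>s. 1 / s)"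
   by (rule borel_integrable_atLeastAtMost') (use b in \<open>auto intro!: continuous_intros\<close>)
  have ae: "AE s in lborel. indicator {b..a} s *\<^sub>R (1 / s) = indicator {b<..<a} s / s"
   using AE_lborel_singleton[of b] AE_lborel_singleton[of a] by eventually_elim (auto simp: indicator_def)
  show ?t4
   by (rule integrable_cong_AE_imp[OF ic[unfolded set_integrable_def] _ ae]) measurable
  have "(LBINT s. indicator {b<..<a} s / s) = (LBINT s. indicator {b..a} s *\<^sub>R (1 / s))"
   by (rule integral_cong_AE[symmetric, OF _ _ ae]) measurable
  also have "\<dots> = ln a - ln b"
   by (rule integral_FTC_Icc) (use b in \<open>auto intro!: derivative_eq_intros continuous_intros simp: has_real_derivative_iff_has_vector_derivative[symmetric]\<close>)
  finally show ?t5 .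
 qed
 have in1: "(LBINT s. Phi b s) = indicator {0<..<a} b * ((ln a - ln b) * m b)" for b
  unfolding eq integral_mult_right_zero using inv[of b] by (cases "0 < b \<and> b < a") (auto simp: indicator_def)
 have in2: "(LBINT s. norm (Phi b s)) = \<bar>indicator {0<..<a} b * ((ln a - ln b) * m b)\<bar>" for b
 proof (cases "0 < b \<and> b < a")
  case True
  then have l: "ln a - ln b \<ge> 0" by simp
  have "norm (Phi b s) = \<bar>m b\<bar> * (indicator {b<..<a} s / s)" for s
   unfolding eq using True by (auto simp: indicator_def abs_mult)
  then have "(LBINT s. norm (Phi b s)) = \<bar>m b\<bar> * (ln a - ln b)" using inv(2)[of b] True by (simp only: integral_mult_right_zero simp_thms)
  then show ?thesis using True l by (simp add: abs_mult)
 next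
  case False
  then have "Phi b s = 0" for s unfolding eq by (auto simp: indicator_def)
  then show ?thesis using False by (simp add: indicator_def)
 qed
 have "(\<lambda>b. indicator {0<..<a} b * ((ln a - ln b) * m b)) = (\<lambda>b. ln a * (indicator {0<..<a} b * m b) - indicator {0<..<a} b * (ln b * m b))"
  by (auto simp: algebra_simps)
 then show I1: ?t3
  using i by (simp only: Lintegrable_diff integrable_mult_right)
 have I: "integrable (lborel \<Otimes>\<^sub>M lborel) (\<lambda>(b, s). Phi b s)"
 proof (rule lborel_pair.Fubini_integrable[OF Phim])
  show "integ (\<lambda>b. LBINT s. norm (case (b, s) of (b, s) \<Rightarrow> Phi b s))" unfolding prod.case in2 by (rule integrable_abs[OF I1])
  show "AE b in lborel. integ (\<lambda>s. case (b, s) of (b, s) \<Rightarrow> Phi b s)"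
  proof (rule AE_I2, unfold prod.case eq)
   fix b show "integ (\<lambda>s. indicator {0<..<a} b * m b * (indicator {b<..<a} s / s))"
    using inv(1)[of b] by (cases "0 < b \<and> b < a") (intro integrable_mult_right, simp, auto simp: indicator_def)
  qed
 qed
 have in3: "(LBINT b. Phi b s) = indicator {0<..<a} s * (indef m s / s)" for s
  unfolding Phi_def indef_def by simp
 show ?t1
  using lborel_pair.integrable_snd[OF I] unfolding in3 .
 show ?t2
  unfolding indef_def[of "\<lambda>s. indef m s / s"] in3[symmetric] in1[symmetric] by (rule lborel_pair.Fubini_integral[OF I])
qed

text \<open>Null sets pass from the half-line to the plane through the vanishing of the radial
  integral of \<open>\<bar>f - F\<bar>\<close>.\<close>

lemma AE_radial:
 fixes f F :: "real \<Rightarrow> real"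
 assumes [measurable]: "f \<in> Bor" "F \<in> Bor" and e: "AE a in lborel. a > 0 \<longrightarrow> f a = F a"
 shows "AE x in lborel. f (area (x::real^2)) = F (area x)"
proof -
 have ae: "AE a in lborel. indicator {0..} a * \<bar>f a - F a\<bar> = 0"
  using e AE_lborel_singleton[of 0] by eventually_elim (auto simp: indicator_def)
 have i0: "integ (\<lambda>a. indicator {0..} a * \<bar>f a - F a\<bar>)"
  by (subst integrable_cong_AE[where g="\<lambda>_. 0"]) (use ae in auto)
 have z: "(LBINT a. indicator {0..} a * \<bar>f a - F a\<bar>) = 0"
  by (rule integral_eq_zero_AE[OF ae])
 have "integ (\<lambda>x::real^2. \<bar>f (area x) - F (area x)\<bar>)"
  using integrable_radial[of "\<lambda>a. \<bar>f a - F a\<bar>"] i0 by simp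
 moreover have "(LBINT x. \<bar>f (area (x::real^2)) - F (area x)\<bar>) = 0"
  using integral_radial[of "\<lambda>a. \<bar>f a - F a\<bar>"] z by simp
 ultimately have "AE x in lborel. \<bar>f (area (x::real^2)) - F (area x)\<bar> = 0"
  by (subst (asm) integral_nonneg_eq_0_iff_AE) auto
 then show ?thesis by eventually_elim simp
qed

lemma continuous_AE_nonneg:
 fixes u :: "'a::euclidean_space \<Rightarrow> real"
 assumes c: "continuous_on UNIV u" and ae: "AE x in lborel. u x \<ge> 0"
 shows "u x \<ge> 0"
proof -
 have o: "open {x. u x < 0}" using c by (intro open_Collect_less continuous_on_const)
 have "{x. u x < 0} \<in> null_sets lborel" using ae o by (subst AE_iff_null_sets) (auto simp: not_less)
 then have "negligible {x. u x < 0}" unfolding negligible_iff_null_sets by (rule null_sets_completionI)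
 then have "{x. u x < 0} = {}" using open_not_negligible[OF o] by blast
 then show ?thesis by (force simp: not_less)
qed

text \<open>\<open>max (ln a) (ln b)\<close> is \<open>ln b\<close> plus the positive part of
  \<open>ln a - ln b\<close>; the first gives the constant \<open>P\<close>, twice the potential at
  the origin, the second the iterated integral. The factor 2 absorbs
  \<open>ln \<bar>x\<bar> = (ln a - ln pi) / 2\<close>.\<close>

lemma radial_potential:
 assumes X: "XR w" and f[measurable]: "f \<in> Bor" and w: "AE x in lborel. w x = f (area x)"
 shows "integ (\<lambda>b. indicator {0..} b * (f b)^2)" (is ?t1)
  "integ (\<lambda>b. indicator {0..} b * (ln b * (f b)^2))" (is ?t2)
  "\<exists>P. AE x in lborel. 2 * pot (\<lambda>x. (w x)^2) x = P + indef (\<lambda>s. indef (\<lambda>b. (f b)^2) s / s) (area x)" (is ?t3)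
proof -
 note ad = adm_XR[OF X]
 note [measurable] = XR_D(3)[OF X]
 have w2: "AE x in lborel. (w x)^2 = (f (area x))^2" using w by eventually_elim simp
 have nz: "AE y::real^2 in lborel. norm y \<noteq> 0" by (rule AE_norm_neq)
 have lnn: "ln (norm y) = (ln (area y) - ln pi) / 2" if "norm y \<noteq> 0" for y :: "real^2"
  using that by (simp add: ln_mult ln_realpow)
 have "integ (\<lambda>x::real^2. (f (area x))^2)"
  by (rule integrable_cong_AE_imp[OF XR_D(1)[OF X] _ w2]) measurable
 then show im: ?t1 using integrable_radial[of "\<lambda>a. (f a)^2"] by simp
 have "integ (\<lambda>y::real^2. (ln (area y) - ln pi) / 2 * (f (area y))^2)"
  by (rule integrable_cong_AE_imp[OF pot_integrable[OF ad, of 0]]) (measurable, use w2 nz in \<open>eventually_elim, simp add: lnn\<close>)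
 then have "integ (\<lambda>b. indicator {0..} b * ((ln b - ln pi) / 2 * (f b)^2))" using integrable_radial[of "\<lambda>b. (ln b - ln pi) / 2 * (f b)^2"] by simp
 then have "integ (\<lambda>b. 2 * (indicator {0..} b * ((ln b - ln pi) / 2 * (f b)^2)) + ln pi * (indicator {0..} b * (f b)^2))"
  by (intro Lintegrable_add integrable_mult_right im)
 moreover have "(\<lambda>b. 2 * (indicator {0..} b * ((ln b - ln pi) / 2 * (f b)^2)) + ln pi * (indicator {0..} b * (f b)^2)) = (\<lambda>b. indicator {0..} b * (ln b * (f b)^2))"
  by (rule ext) (simp add: field_simps)
 ultimately show il: ?t2 by (simp only:)
 have i0: "integ (\<lambda>b. indicator {0<..<a} b * (f b)^2)" for a
  by (rule Lintegrable_bound[OF im]) (auto simp: indicator_def)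
 have i1: "integ (\<lambda>b. indicator {0<..<a} b * (ln b * (f b)^2))" for a
  by (rule Lintegrable_bound[OF il]) (auto simp: indicator_def)
 note it = indef_iterated[OF _ i0 i1]
 define P where "P = (LBINT b. indicator {0..} b * (ln b * (f b)^2)) - ln pi * (LBINT b. indicator {0..} b * (f b)^2)"
 have inv: "AE x in lborel. (w (rot th x))^2 = (w x)^2" for th
  using AE_orthogonal[OF rot_orthogonal w2, of th] w2 by eventually_elim (simp add: rot_norm)
 have "2 * pot (\<lambda>x. (w x)^2) x = P + indef (\<lambda>s. indef (\<lambda>b. (f b)^2) s / s) (area x)" if x: "x \<noteq> 0" for x
 proof -
  define a where "a = pi * (norm x)^2"
  have a: "a > 0" using x by (simp add: a_def)
  have "2 * pot (\<lambda>x. (w x)^2) x = (LBINT y. 2 * (max (ln (norm x)) (ln (norm y)) * (w y)^2))"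
   using newton(1)[OF ad inv x] by simp
  also have "\<dots> = (LBINT y. max (ln a - ln pi) (ln (area (y::real^2)) - ln pi) * (f (area y))^2)"
   by (rule integral_cong_AE) (measurable, measurable, use w2 nz in \<open>eventually_elim, use x in \<open>simp add: lnn a_def max_def\<close>\<close>)
  also have "\<dots> = (LBINT b. indicator {0..} b * (max (ln a - ln pi) (ln b - ln pi) * (f b)^2))"
   by (rule integral_radial[of "\<lambda>b. max (ln a - ln pi) (ln b - ln pi) * (f b)^2"]) measurable
  also have "\<dots> = (LBINT b. (indicator {0..} b * (ln b * (f b)^2) - ln pi * (indicator {0..} b * (f b)^2)) + indicator {0<..<a} b * ((ln a - ln b) * (f b)^2))"
  proof (rule integral_cong_AE)
   show "AE b in lborel. indicator {0..} b * (max (ln a - ln pi) (ln b - ln pi) * (f b)^2) =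
    (indicator {0..} b * (ln b * (f b)^2) - ln pi * (indicator {0..} b * (f b)^2)) + indicator {0<..<a} b * ((ln a - ln b) * (f b)^2)"
    using AE_lborel_singleton[of 0]
   proof eventually_elim
    case (elim b)
    consider "b < 0" | "0 < b" "b < a" | "a \<le> b" using elim by linarith
    then show ?case
    proof cases
     case 2
     then have "max (ln a - ln pi) (ln b - ln pi) = ln a - ln pi" by simp
     then show ?thesis using 2 by (simp add: algebra_simps)
    next
     case 3
     then have "max (ln a - ln pi) (ln b - ln pi) = ln b - ln pi" using a by (simp add: max_def)
     then show ?thesis using 3 a by (simp add: algebra_simps)
    qed (simp add: indicator_def)
   qed
  qed measurable
  also have "\<dots> = P + indef (\<lambda>s. indef (\<lambda>b. (f b)^2) s / s) a"
   unfolding P_def it(2)[OF borel_measurable_power[OF f]] using im il it(3)[OF borel_measurable_power[OF f], of a] by simp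
  finally show ?thesis unfolding a_def .
 qed
 then have "AE x in lborel. 2 * pot (\<lambda>x. (w x)^2) x = P + indef (\<lambda>s. indef (\<lambda>b. (f b)^2) s / s) (area x)"
  using nz by (auto elim: eventually_mono)
 then show ?t3 ..
qed

text \<open>The radial equations as a first-order system: \<open>H\<close> and \<open>N\<close> are
  the fluxes \<open>a F' / al\<close> and \<open>a V' / c\<close>. Continuity at 0 together with
  vanishing fluxes selects the solutions that are regular at the singular point.\<close>

definition sol :: "real \<Rightarrow> real \<Rightarrow> (real \<Rightarrow> real) \<Rightarrow> (real \<Rightarrow> real) \<Rightarrow> (real \<Rightarrow> real) \<Rightarrow> (real \<Rightarrow> real) \<Rightarrow> bool" where
 "sol al c F V H N \<longleftrightarrow> continuous_on {0..} F \<and> continuous_on {0..} V \<and> continuous_on {0..} H \<and> continuous_on {0..} N \<and> H 0 = 0 \<and> N 0 = 0 \<and>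
   (\<forall>a>0. (F has_real_derivative al * H a / a) (at a) \<and> (V has_real_derivative c * N a / a) (at a) \<and>
    (H has_real_derivative V a * F a) (at a) \<and> (N has_real_derivative (F a)\<^sup>2) (at a))"

text \<open>Collects what the comparison of profiles uses, in a form that survives dilation. The
  form is tested on all of \<open>XR\<close>; integrability is recorded since a divergent integral
  would count as 0.\<close>

definition ground_state :: "real \<Rightarrow> (real^2 \<Rightarrow> real) \<Rightarrow> (real \<Rightarrow> real) \<Rightarrow> (real \<Rightarrow> real) \<Rightarrow> bool" where
 "ground_state c w F V \<longleftrightarrow> XR w \<and> (\<exists>H N. sol (1 / (4 * pi)) c F V H N) \<and> (AE x in lborel. w x = F (area x)) \<and>
   (\<forall>a\<ge>0. F a \<ge> 0) \<and> TR w + (LBINT x. V (area x) * (w x)^2) = 0 \<and> V \<in> Bor \<and>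
   (\<forall>u. XR u \<longrightarrow> integ (\<lambda>x. V (area x) * (u x)^2) \<and> 0 \<le> TR u + (LBINT x. V (area x) * (u x)^2))"

text \<open>The test function is built backwards from \<open>et\<close>: \<open>K\<close> is chosen
  with \<open>(t K)' = et\<close>, and \<open>Psi\<close> is the antiderivative of \<open>K\<close>
  that vanishes to the right. Two integrations by parts then move both antiderivatives onto the
  potential term.\<close>

lemma radial_weak_equation:
 fixes f W :: "real \<Rightarrow> real"
 assumes f[measurable]: "f \<in> Bor" and W[measurable]: "W \<in> Bor"
  and i1: "\<And>a. integ (\<lambda>b. indicator {0<..<a} b * (W b * f b))" "\<And>a. integ (\<lambda>b. indicator {0<..<a} b * (ln b * (W b * f b)))"
  and EL: "\<And>Psi K K' q. (\<And>t. (Psi has_real_derivative K t) (at t)) \<Longrightarrow> (\<And>t. (K has_real_derivative K' t) (at t)) \<Longrightarrow> continuous_on UNIV K' \<Longrightarrow>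
   q > 0 \<Longrightarrow> (\<And>t. t \<ge> q \<Longrightarrow> Psi t = 0) \<Longrightarrow> (\<And>t. t \<ge> q \<Longrightarrow> K t = 0) \<Longrightarrow>
   4 * pi * (LBINT a. indicator {0..} a * (f a * (K a + a * K' a))) = (LBINT a. indicator {0..} a * (W a * f a * Psi a))"
  and pq: "0 < p" "p < q" and et: "continuous_on UNIV et" "\<And>t. t \<notin> {p..q} \<Longrightarrow> et t = 0" "(LBINT a. et a) = 0"
 shows "4 * pi * (LBINT a. indicator {0..} a * (f a * et a)) = (LBINT a. et a * indef (\<lambda>s. indef (\<lambda>b. W b * f b) s / s) a)"
proof -
 have etp: "et t = 0" if "t \<le> p" for t
 proof -
  have "closed {t. et t = 0}" using et(1) by (intro closed_Collect_eq continuous_on_const)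
  moreover have "{..<p} \<subseteq> {t. et t = 0}" using et(2) by auto
  ultimately have "closure {..<p} \<subseteq> {t. et t = 0}" by (rule closure_minimal[rotated])
  then show ?thesis using that by auto
 qed
 have etq: "et t = 0" if "t \<ge> q" for t
 proof -
  have "closed {t. et t = 0}" using et(1) by (intro closed_Collect_eq continuous_on_const)
  moreover have "{q<..} \<subseteq> {t. et t = 0}" using et(2) by auto
  ultimately have "closure {q<..} \<subseteq> {t. et t = 0}" by (rule closure_minimal[rotated])
  then show ?thesis using that by auto
 qed
 define X where "X t = integral {p - 1..t} et" for t
 have X: "(X has_real_derivative et t) (at t)" "t \<le> p \<Longrightarrow> X t = 0" for t
  using antiderivative_from_left[of et p t, OF et(1)] etp by (simp_all add: X_def[abs_def])
 \<comment> \<open>The vanishing mean of \<open>et\<close> is used here: its antiderivative returns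
   to 0 beyond \<open>q\<close>.\<close>
 have Xq: "X t = 0" if "t \<ge> q" for t
 proof -
  have "X t = (LINT b:{p - 1..t}|lborel. et b)" unfolding X_def
   by (rule set_borel_integral_eq_integral(2)[symmetric]) (intro borel_integrable_atLeastAtMost' continuous_on_subset[OF et(1)] subset_UNIV)
  also have "\<dots> = (LBINT b. et b)" unfolding set_lebesgue_integral_def
  proof (rule Lintegral_cong[OF HOL.refl])
   fix b show "indicator {p - 1..t} b *\<^sub>R et b = et b" using etp[of b] etq[of b] that pq by (cases "b \<le> p"; cases "b \<ge> q") (auto simp: indicator_def)
  qed
  finally show ?thesis using et(3) by simp
 qed
 define K where "K t = X t / t" for t
 define K' where "K' t = (et t - K t) / t" for t
 have Kp: "K t = 0" if "t \<le> p" for t using X(2)[OF that] by (simp add: K_def)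
 have Kq: "K t = 0" if "t \<ge> q" for t using Xq[OF that] by (simp add: K_def)
 have K'p: "K' t = 0" if "t \<le> p" for t using Kp[OF that] etp[OF that] by (simp add: K'_def)
 have Kd: "(K has_real_derivative K' t) (at t)" for t
 proof (cases "t < p")
  case True
  have "((\<lambda>_. 0) has_real_derivative 0) (at t)" by simp
  then have "(K has_real_derivative 0) (at t)"
   by (rule has_field_derivative_transform_within[where d="p - t"]) (use True Kp in \<open>auto simp: dist_real_def\<close>)
  then show ?thesis using True K'p by simp
 next
  case False
  then have t: "t > 0" using pq by simp
  have "((\<lambda>t. X t / t) has_real_derivative (et t * t - X t * 1) / (t * t)) (at t)"
   by (rule DERIV_divide[OF X(1) DERIV_ident]) (use t in simp)
  moreover have "(et t * t - X t * 1) / (t * t) = K' t" using t by (simp add: K'_def K_def field_simps)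
  ultimately show ?thesis unfolding K_def[abs_def] by simp
 qed
 have Kc: "continuous_on UNIV K" using Kd by (meson DERIV_isCont continuous_at_imp_continuous_on)
 have K'c: "continuous_on UNIV K'"
 proof (rule continuous_at_imp_continuous_on, rule ballI)
  fix t :: real
  show "isCont K' t"
  proof (cases "t < p")
   case True
   have "continuous_on {..<p} K'" using K'p by (subst continuous_on_cong[OF HOL.refl, of _ _ "\<lambda>_. 0"]) auto
   then show ?thesis using True by (subst (asm) continuous_on_eq_continuous_at) auto
  next
   case False
   then have t: "t > 0" using pq by simp
   have "isCont et t" "isCont K t" using et(1) Kc by (auto simp: continuous_on_eq_continuous_at)
   then show ?thesis unfolding K'_def[abs_def] using t by (intro continuous_intros) auto
  qed
 qed
 define A where "A t = integral {p - 1..t} K" for t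
 have A: "(A has_real_derivative K t) (at t)" for t
  using antiderivative_from_left(1)[of K p t, OF Kc] Kp by (simp add: A_def[abs_def])
 define Psi where "Psi t = A t - A q" for t
 have Psid: "(Psi has_real_derivative K t) (at t)" for t
  unfolding Psi_def[abs_def] using DERIV_diff[OF A DERIV_const] by simp
 have Psiq: "Psi t = 0" if "t \<ge> q" for t using antiderivative_const_right[of A K q t, OF A Kq that] by (simp add: Psi_def)
 have K0: "K t = 0" if "t \<notin> {p..q}" for t using Kp[of t] Kq[of t] that by auto
 have h: "(LBINT b. indicator {..<a} b * (indicator {0<..} b * (m b))) = indef m a" for a and m :: "real \<Rightarrow> real"
  unfolding indef_def by (intro Lintegral_cong) (auto simp: indicator_def)
 have hi: "integ (\<lambda>b. indicator {..q} b * (indicator {0<..} b * m b))"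
  if "integ (\<lambda>b. indicator {0<..<q + 1} b * m b)" and [measurable]: "m \<in> Bor" for m :: "real \<Rightarrow> real"
  by (rule Lintegrable_bound[OF that(1)]) (auto simp: indicator_def)
 have [measurable]: "indef (\<lambda>b. W b * f b) \<in> Bor"
  by (intro borel_measurable_continuous_onI indef_continuous i1 borel_measurable_times f W)
 note it = indef_iterated[OF _ i1]
 have "4 * pi * (LBINT a. indicator {0..} a * (f a * et a)) = 4 * pi * (LBINT a. indicator {0..} a * (f a * (K a + a * K' a)))"
 proof -
  have "K a + a * K' a = et a" for a using etp[of a] Kp[of a] K'p[of a] pq by (cases "a \<le> p") (auto simp: K'_def)
  then show ?thesis by simp
 qed
 also have "\<dots> = (LBINT a. indicator {0..} a * (W a * f a * Psi a))"
  by (rule EL[where q=q, OF Psid Kd K'c _ Psiq Kq]) (use pq in auto)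
 also have "\<dots> = (LBINT b. (indicator {0<..} b * (W b * f b)) * Psi b)"
 proof -
  have [measurable]: "Psi \<in> Bor"
   using Psid by (intro borel_measurable_continuous_onI) (meson DERIV_isCont continuous_at_imp_continuous_on)
  show ?thesis
   by (rule integral_cong_AE) (measurable, measurable, use AE_lborel_singleton[of 0] in \<open>eventually_elim, auto simp: indicator_def\<close>)
 qed
 also have "\<dots> = - (LBINT a. K a * indef (\<lambda>b. W b * f b) a)"
  using fubini_by_parts[of K p q Psi, OF Kc K0 Psid Psiq _ hi[OF i1(1)]] unfolding h by simp
 also have "\<dots> = - (LBINT a. (indicator {0<..} a * (indef (\<lambda>b. W b * f b) a / a)) * X a)"
 proof -
  have "K a * indef (\<lambda>b. W b * f b) a = (indicator {0<..} a * (indef (\<lambda>b. W b * f b) a / a)) * X a" for a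
   using X(2)[of a] pq by (cases "a > 0") (auto simp: K_def)
  then show ?thesis by (simp only:)
 qed
 also have "\<dots> = (LBINT a. et a * indef (\<lambda>s. indef (\<lambda>b. W b * f b) s / s) a)"
  using fubini_by_parts[of et p q X, OF et(1,2) X(1) Xq _ hi[OF it(1)]] unfolding h by simp
 finally show ?thesis .
qed

text \<open>\<open>f\<close> is only measurable. It differs by a constant, almost everywhere, from
  the double integral \<open>g\<close> of \<open>V f / (4 pi)\<close>, so \<open>F = C + g\<close>
  is a continuous representative, and the integrals of \<open>f\<close> may be rewritten with
  \<open>F\<close>.\<close>

lemma radial_minimiser_profile:
 assumes rm: "rmin c lam w" and c: "c > 0" and lam: "lam > 0"
  and f[measurable]: "f \<in> Bor" and w: "AE x in lborel. w x = f (area x)"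
 obtains F V where "ground_state c w F V"
proof -
 have X: "XR w" and wn: "\<And>x. w x \<ge> 0" using rm by (auto simp: rmin_def)
 note ad = adm_XR[OF X]
 obtain kp where Q: "\<And>u. XR u \<Longrightarrow> 0 \<le> Qf c (\<lambda>x. (w x)^2) kp u" "Qf c (\<lambda>x. (w x)^2) kp w = 0"
  by (rule rmin_form[OF rm c lam]) (rule that)
 note rp = radial_potential[OF X f w]
 obtain P where P: "AE x in lborel. 2 * pot (\<lambda>x. (w x)^2) x = P + indef (\<lambda>s. indef (\<lambda>b. (f b)^2) s / s) (area x)"
  using rp(3) by blast
 have i0: "integ (\<lambda>b. indicator {0<..<a} b * (f b)^2)" for a
  by (rule Lintegrable_bound[OF rp(1)]) (auto simp: indicator_def)
 have i1: "integ (\<lambda>b. indicator {0<..<a} b * (ln b * (f b)^2))" for a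
  by (rule Lintegrable_bound[OF rp(2)]) (auto simp: indicator_def)
 define M where "M = indef (\<lambda>b. (f b)^2)"
 have Mc: "continuous_on UNIV M" unfolding M_def by (rule indef_continuous[OF _ i0]) measurable
 then have [measurable]: "M \<in> Bor" by (rule borel_measurable_continuous_onI)
 have iM: "integ (\<lambda>s. indicator {0<..<a} s * (M s / s))" for a
  unfolding M_def by (rule indef_iterated(1)[OF _ i0 i1]) measurable
 \<comment> \<open>Defined for all \<open>a\<close> by the integral formula: this makes
   \<open>V\<close> continuous, although the potential is known to agree with it only almost
   everywhere.\<close>
 define V where "V a = c * P - kp + c * indef (\<lambda>s. M s / s) a" for a
 have Vc: "continuous_on UNIV V" unfolding V_def[abs_def] by (intro continuous_intros indef_continuous[OF _ iM]) measurable
 then have [measurable]: "V \<in> Bor" by (rule borel_measurable_continuous_onI)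
 have aeV: "AE x in lborel. 2 * c * pot (\<lambda>x. (w x)^2) x - kp = V (area x)"
  using P
 proof eventually_elim
  case (elim x)
  have "2 * c * pot (\<lambda>x. (w x)^2) x = c * (2 * pot (\<lambda>x. (w x)^2) x)" by simp
  then show ?case unfolding elim V_def M_def by (simp add: algebra_simps)
 qed
 \<comment> \<open>Applied below with the weights \<open>k = 1\<close> and \<open>k = ln\<close>; on
   bounded intervals \<open>V\<close> is bounded, and
   \<open>\<bar>f\<bar> \<le> 1 + f^2\<close>.\<close>
 have iVf: "integ (\<lambda>b. indicator {0<..<a} b * (k b * (V b * f b)))" if k[measurable]: "k \<in> Bor"
  and ik: "integ (\<lambda>b. indicator {0<..<a} b * k b)" "integ (\<lambda>b. indicator {0<..<a} b * (k b * (f b)^2))" for k :: "real \<Rightarrow> real" and a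
 proof -
  have "compact (V ` {0..a})" by (intro compact_continuous_image continuous_on_subset[OF Vc]) auto
  then have "bounded (V ` {0..a})" by (rule compact_imp_bounded)
  then obtain B where B: "B > 0" "\<And>b. b \<in> {0..a} \<Longrightarrow> \<bar>V b\<bar> \<le> B" unfolding bounded_pos by auto
  show ?thesis
  proof (rule Lintegrable_bound)
   show "integ (\<lambda>b. B * (\<bar>indicator {0<..<a} b * k b\<bar> + \<bar>indicator {0<..<a} b * (k b * (f b)^2)\<bar>))"
    by (intro integrable_mult_right Lintegrable_add integrable_abs ik)
   show "AE b in lborel. norm (indicator {0<..<a} b * (k b * (V b * f b))) \<le> norm (B * (\<bar>indicator {0<..<a} b * k b\<bar> + \<bar>indicator {0<..<a} b * (k b * (f b)^2)\<bar>))" (is "AE b in _. ?Q1 b")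
   proof (rule AE_I2)
    fix b
    have "0 \<le> (\<bar>f b\<bar> - 1)^2" by simp
    then have "2 * \<bar>f b\<bar> \<le> 1 + (f b)^2" unfolding power2_diff by simp
    then have "\<bar>f b\<bar> \<le> 1 + (f b)^2" by linarith
    then have "\<bar>V b\<bar> * \<bar>f b\<bar> \<le> B * (1 + (f b)^2)" if "b \<in> {0<..<a}" using B that by (intro mult_mono) auto
    then have "\<bar>k b\<bar> * (\<bar>V b\<bar> * \<bar>f b\<bar>) \<le> \<bar>k b\<bar> * (B * (1 + (f b)^2))" if "b \<in> {0<..<a}" using that by (intro mult_left_mono) auto
    moreover have "norm (B * (\<bar>k b\<bar> + \<bar>k b * (f b)^2\<bar>)) = \<bar>k b\<bar> * (B * (1 + (f b)^2))"
     using B(1) by (simp add: abs_mult algebra_simps)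
    ultimately show "?Q1 b"
     by (cases "b \<in> {0<..<a}") (simp_all add: abs_mult)
   qed
  qed measurable
 qed
 have i2: "integ (\<lambda>b. indicator {0<..<a} b * (V b * f b))" for a
 proof -
  have "integ (indicat_real {0<..<a})"
   using integrable_real_indicator[of "{0<..<a}" lborel] by (cases "0 \<le> a") simp_all
  then have "integ (\<lambda>b. indicator {0<..<a} b * (1::real))" by simp
  from iVf[OF _ this] show ?thesis using i0 by simp
 qed
 have i3: "integ (\<lambda>b. indicator {0<..<a} b * (ln b * (V b * f b)))" for a
  by (rule iVf[OF _ ln_integrable_near_0 i1]) measurable
 define h where "h = indef (\<lambda>b. V b * f b)"
 have hc: "continuous_on UNIV h" unfolding h_def by (rule indef_continuous[OF _ i2]) measurable
 then have [measurable]: "h \<in> Bor" by (rule borel_measurable_continuous_onI)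
 have ih: "integ (\<lambda>s. indicator {0<..<a} s * (h s / s))" for a
  unfolding h_def by (rule indef_iterated(1)[OF _ i2 i3]) measurable
 define g where "g a = indef (\<lambda>s. h s / s) a / (4 * pi)" for a
 have gc: "continuous_on UNIV g" unfolding g_def[abs_def] by (intro continuous_intros indef_continuous[OF _ ih]) auto
 then have [measurable]: "g \<in> Bor" by (rule borel_measurable_continuous_onI)
 have ifR: "integ (\<lambda>a. indicator {0..R} a * f a)" for R
 proof -
  have "integ (\<lambda>a. indicator {0..R} a * (indicator {0..} a * f a))"
  proof (rule integrable_product_square)
   have e: "(\<lambda>x. (indicator {0..R} x :: real)^2) = indicator {0..R}" "(\<lambda>x. (indicator {0..} x * f x)^2) = (\<lambda>b. indicator {0..} b * (f b)^2)"
    by (auto simp: indicator_def)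
   show "integ (\<lambda>x. (indicator {0..R} x :: real)^2)" unfolding e by (intro integrable_real_indicator) (auto simp: emeasure_lborel_Icc_eq)
   show "integ (\<lambda>x. (indicator {0..} x * f x)^2)" unfolding e by (rule rp(1))
  qed measurable
  moreover have "(\<lambda>a. indicator {0..R} a * (indicator {0..} a * f a)) = (\<lambda>a. indicator {0..R} a * f a)" by (auto simp: indicator_def)
  ultimately show ?thesis by simp
 qed
 have igR: "integ (\<lambda>a. indicator {0..R} a * g a)" for R
  using borel_integrable_atLeastAtMost'[of 0 R g] continuous_on_subset[OF gc] by (simp add: set_integrable_def)
 obtain C where C: "AE a in lborel. a > 0 \<longrightarrow> f a - g a = C"
 proof (rule du_bois_reymond[of "\<lambda>a. f a - g a"])
  show "integ (\<lambda>a. indicator {0..R} a * (f a - g a))" for R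
   using Lintegrable_diff[OF ifR[of R] igR[of R]] by (simp add: algebra_simps)
  fix et :: "real \<Rightarrow> real" and p q assume pq: "0 < p" "p < q" and e: "continuous_on UNIV et" "\<And>t. t \<notin> {p..q} \<Longrightarrow> et t = 0" "(LBINT a. et a) = 0"
  have [measurable]: "et \<in> Bor" using e(1) by (rule borel_measurable_continuous_onI)
  have eq: "4 * pi * (LBINT a. indicator {0..} a * (f a * et a)) = (LBINT a. et a * indef (\<lambda>s. indef (\<lambda>b. V b * f b) s / s) a)"
   by (rule radial_weak_equation[OF f _ i2 i3 radial_euler_lagrange[OF X ad Q f w _ aeV] pq e]) measurable
  have gg: "et a * indef (\<lambda>s. indef (\<lambda>b. V b * f b) s / s) a = 4 * pi * (indicator {0..} a * (g a * et a))" for a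
   using e(2)[of a] pq by (cases "a \<ge> 0") (auto simp: g_def h_def)
  have ig: "integ (\<lambda>a. indicator {0..} a * (g a * et a))"
  proof -
   have "integ (\<lambda>a. g a * et a)"
    by (rule integrable_continuous_compact[of _ p q]) (use e(2) in \<open>auto intro!: continuous_intros gc e(1)\<close>)
   moreover have "(\<lambda>a. g a * et a) = (\<lambda>a. indicator {0..} a * (g a * et a))" using e(2) pq by (force simp: indicator_def)
   ultimately show ?thesis by simp
  qed
  have if': "integ (\<lambda>a. indicator {0..} a * (f a * et a))"
  proof -
   have "bounded (et ` {p..q})" by (intro compact_imp_bounded compact_continuous_image continuous_on_subset[OF e(1)]) auto
   then obtain B where B: "B > 0" "\<And>b. b \<in> {p..q} \<Longrightarrow> \<bar>et b\<bar> \<le> B" unfolding bounded_pos by auto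
   show ?thesis
   proof (rule Lintegrable_bound[OF integrable_mult_right[OF ifR[of q], of B]])
    show "AE a in lborel. norm (indicator {0..} a * (f a * et a)) \<le> norm (B * (indicator {0..q} a * f a))" (is "AE a in _. ?Q2 a")
    proof (rule AE_I2)
     fix a
     have "\<bar>f a\<bar> * \<bar>et a\<bar> \<le> \<bar>f a\<bar> * B" if "a \<in> {p..q}" using B(2)[OF that] by (intro mult_left_mono) auto
     then show "?Q2 a"
      using B(1) e(2)[of a] pq by (cases "a \<in> {p..q}") (simp_all add: abs_mult mult.commute)
    qed
   qed measurable
  qed
  have "(LBINT a. indicator {0..} a * ((f a - g a) * et a)) = (LBINT a. indicator {0..} a * (f a * et a) - indicator {0..} a * (g a * et a))"
   by (simp add: algebra_simps)
  also have "\<dots> = (LBINT a. indicator {0..} a * (f a * et a)) - (LBINT a. indicator {0..} a * (g a * et a))"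
   by (rule Lintegral_diff[OF if' ig])
  also have "\<dots> = 0" using eq unfolding gg integral_mult_right_zero by simp
  finally show "(LBINT a. indicator {0..} a * ((f a - g a) * et a)) = 0" .
 qed measurable
 define F where "F a = C + g a" for a
 have Fc: "continuous_on UNIV F" unfolding F_def[abs_def] by (intro continuous_intros gc)
 then have [measurable]: "F \<in> Bor" by (rule borel_measurable_continuous_onI)
 have fF: "AE a in lborel. a > 0 \<longrightarrow> f a = F a" using C by eventually_elim (auto simp: F_def)
 have wF: "AE x in lborel. w x = F (area x)" using w AE_radial[OF f \<open>F \<in> Bor\<close> fF] by eventually_elim simp
  \<comment> \<open>Continuity upgrades nonnegativity almost everywhere in the plane to every value
    of \<open>a\<close>.\<close>
  have Fn: "F a \<ge> 0" if a: "a \<ge> 0" for a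
  proof -
   have 1: "continuous_on UNIV (\<lambda>x::real^2. F (area x))"
    by (rule continuous_on_compose2[OF Fc]) (auto intro!: continuous_intros)
   have "AE x::real^2 in lborel. F (area x) \<ge> 0" using wF by eventually_elim (use wn in metis)
   from continuous_AE_nonneg[OF 1 this, of "sqrt (a / pi) *\<^sub>R axis 1 1"] show ?thesis using a by (simp add: power_mult_distrib)
  qed
  have i: "integ (\<lambda>x. V (area x) * (u x)^2)" (is ?t1)
   "Qf c (\<lambda>x. (w x)^2) kp u = TR u + (LBINT x. V (area x) * (u x)^2)" (is ?t2) if u: "XR u" for u
  proof -
   note [measurable] = XR_D(3)[OF u] pot_borel[OF ad]
   note I1 = DD_pot_integrable[OF adm_XR[OF u] ad] and I2 = XR_D(1)[OF u]
   have ae: "AE x in lborel. 2 * c * ((u x)^2 * pot (\<lambda>x. (w x)^2) x) - kp * (u x)^2 = V (area x) * (u x)^2"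
    using aeV
   proof eventually_elim
    case (elim x)
    show ?case unfolding elim[symmetric] by (simp add: algebra_simps)
   qed
   have I: "integ (\<lambda>x. 2 * c * ((u x)^2 * pot (\<lambda>x. (w x)^2) x) - kp * (u x)^2)"
    by (intro Lintegrable_diff integrable_mult_right I1 I2)
   show ?t1
    by (rule integrable_cong_AE_imp[OF I _ ae]) measurable
   have "(LBINT x. V (area x) * (u x)^2) = (LBINT x. 2 * c * ((u x)^2 * pot (\<lambda>x. (w x)^2) x) - kp * (u x)^2)"
    by (rule integral_cong_AE[symmetric, OF _ _ ae]) measurable
   then show ?t2
    unfolding Qf_def DD_pot using I1 I2 by simp
  qed
  define H where "H = indef (\<lambda>b. V b * F b)"
  define N where "N = indef (\<lambda>b. (F b)^2)"
  have hH: "h a = H a" for a unfolding h_def H_def indef_def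
   by (rule integral_cong_AE) (measurable, measurable, use fF in \<open>eventually_elim, auto simp: indicator_def\<close>)
  have MN: "M a = N a" for a unfolding M_def N_def indef_def
   by (rule integral_cong_AE) (measurable, measurable, use fF in \<open>eventually_elim, auto simp: indicator_def\<close>)
  have iVF: "integ (\<lambda>b. indicator {0<..<a} b * (V b * F b))" for a
   by (rule integrable_cong_AE_imp[OF i2[of a]]) (measurable, use fF in \<open>eventually_elim, auto simp: indicator_def\<close>)
  have iFF: "integ (\<lambda>b. indicator {0<..<a} b * (F b)^2)" for a
   by (rule integrable_cong_AE_imp[OF i0[of a]]) (measurable, use fF in \<open>eventually_elim, auto simp: indicator_def\<close>)
  have dF: "(F has_real_derivative 1 / (4 * pi) * H a / a) (at a)" if a: "a > 0" for a
  proof -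
   have "(indef (\<lambda>s. h s / s) has_real_derivative h a / a) (at a)"
    by (rule indef_DERIV[OF _ ih]) (measurable, auto intro!: continuous_intros continuous_on_subset[OF hc] simp: a)
   then have "(F has_real_derivative 0 + h a / a / (4 * pi)) (at a)"
    unfolding F_def[abs_def] g_def[abs_def] by (intro DERIV_add DERIV_const DERIV_cdivide)
   then show ?thesis using hH[of a] by (simp add: mult.commute)
  qed
  have dV: "(V has_real_derivative c * N a / a) (at a)" if a: "a > 0" for a
  proof -
   have "(indef (\<lambda>s. M s / s) has_real_derivative M a / a) (at a)"
    by (rule indef_DERIV[OF _ iM]) (measurable, auto intro!: continuous_intros continuous_on_subset[OF Mc] simp: a)
   then have "(V has_real_derivative 0 + c * (M a / a)) (at a)"
    unfolding V_def[abs_def] by (intro DERIV_add DERIV_const DERIV_cmult)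
   then show ?thesis using MN[of a] by simp
  qed
  have dH: "(H has_real_derivative V a * F a) (at a)" "(N has_real_derivative (F a)\<^sup>2) (at a)" if "a > 0" for a
   unfolding H_def N_def
   by (intro indef_DERIV[OF _ iVF] indef_DERIV[OF _ iFF] that borel_measurable_times borel_measurable_power continuous_intros
     continuous_on_subset[OF Vc] continuous_on_subset[OF Fc]; simp)+
  have "continuous_on UNIV H" "continuous_on UNIV N" unfolding H_def N_def
   by (intro indef_continuous[OF _ iVF] indef_continuous[OF _ iFF]; simp)+
  then have HNc: "continuous_on {0..} H" "continuous_on {0..} N" by (auto intro: continuous_on_subset)
  have "sol (1 / (4 * pi)) c F V H N" unfolding sol_def
   using dF dV dH HNc continuous_on_subset[OF Fc] continuous_on_subset[OF Vc] by (auto simp: H_def N_def indef_nonpos)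
  moreover have "TR w + (LBINT x. V (area x) * (w x)^2) = 0" using i(2)[OF X] Q(2) by simp
  moreover have "0 \<le> TR u + (LBINT x. V (area x) * (u x)^2)" if "XR u" for u using i(2)[OF that] Q(1)[OF that] by simp
  ultimately have "ground_state c w F V" unfolding ground_state_def using X wF Fn i(1) by auto
  then show thesis by (rule that)
qed

section \<open>Uniqueness of the radial ground state\<close>

lemma solD:
 assumes "sol al c F V H N"
 shows "continuous_on {0..} F" "continuous_on {0..} V" "continuous_on {0..} H" "continuous_on {0..} N" "H 0 = 0" "N 0 = 0"
  "a > 0 \<Longrightarrow> (F has_real_derivative al * H a / a) (at a)" "a > 0 \<Longrightarrow> (V has_real_derivative c * N a / a) (at a)"
  "a > 0 \<Longrightarrow> (H has_real_derivative V a * F a) (at a)" "a > 0 \<Longrightarrow> (N has_real_derivative (F a)\<^sup>2) (at a)"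
 using assms unfolding sol_def by auto

lemma sol_scale:
 assumes so: "sol al c F V H N" and s: "s > 0"
 shows "sol al c (\<lambda>a. s * F (s * a)) (\<lambda>a. s * V (s * a)) (\<lambda>a. s * H (s * a)) (\<lambda>a. s * N (s * a))"
proof -
 have c: "continuous_on {0..} (\<lambda>a. s * G (s * a))" if "continuous_on {0..} G" for G :: "real \<Rightarrow> real"
  by (intro continuous_intros continuous_on_compose2[OF that]) (use s in auto)
 have d: "((\<lambda>a. s * G (s * a)) has_real_derivative s * (G' * s)) (at a)" if "(G has_real_derivative G') (at (s * a))" for G G' a
  by (intro DERIV_cmult DERIV_chain2[where g="\<lambda>a. s * a", OF that]) (auto intro!: derivative_eq_intros)
 show ?thesis unfolding sol_def
 proof (intro conjI allI impI)
  fix a :: real assume a: "a > 0"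
  then have p: "s * a > 0" using s by simp
  show "((\<lambda>a. s * F (s * a)) has_real_derivative al * (s * H (s * a)) / a) (at a)"
   using d[OF solD(7)[OF so p]] s a by (simp add: field_simps)
  show "((\<lambda>a. s * V (s * a)) has_real_derivative c * (s * N (s * a)) / a) (at a)"
   using d[OF solD(8)[OF so p]] s a by (simp add: field_simps)
  show "((\<lambda>a. s * H (s * a)) has_real_derivative (s * V (s * a)) * (s * F (s * a))) (at a)"
   using d[OF solD(9)[OF so p]] by (simp add: mult_ac)
  show "((\<lambda>a. s * N (s * a)) has_real_derivative (s * F (s * a))\<^sup>2) (at a)"
   using d[OF solD(10)[OF so p]] by (simp add: mult_ac power2_eq_square)
 qed (use c solD[OF so] in auto)
qed

lemma DERIV_abs_le_imp_abs_diff_le: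
 fixes g k :: "real \<Rightarrow> real"
 assumes "a \<le> b" "continuous_on {a..b} g" "continuous_on {a..b} k"
  and "\<And>t. a < t \<Longrightarrow> t < b \<Longrightarrow> (g has_real_derivative g' t) (at t)" "\<And>t. a < t \<Longrightarrow> t < b \<Longrightarrow> (k has_real_derivative k' t) (at t)"
  and "\<And>t. a < t \<Longrightarrow> t < b \<Longrightarrow> \<bar>g' t\<bar> \<le> k' t"
 shows "\<bar>g b - g a\<bar> \<le> k b - k a"
proof -
 have 1: "k a - g a \<le> k b - g b"
 proof (rule DERIV_nonneg_imp_increasing_open[where f="\<lambda>t. k t - g t", OF assms(1)])
  show "\<exists>y. ((\<lambda>t. k t - g t) has_real_derivative y) (at t) \<and> 0 \<le> y" if "a < t" "t < b" for t
   using DERIV_diff[OF assms(5,4)[OF that]] assms(6)[OF that] by (intro exI[of _ "k' t - g' t"]) auto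
 qed (intro continuous_intros assms)
 have 2: "k a + g a \<le> k b + g b"
 proof (rule DERIV_nonneg_imp_increasing_open[where f="\<lambda>t. k t + g t", OF assms(1)])
  show "\<exists>y. ((\<lambda>t. k t + g t) has_real_derivative y) (at t) \<and> 0 \<le> y" if "a < t" "t < b" for t
   using DERIV_add[OF assms(5,4)[OF that]] assms(6)[OF that] by (intro exI[of _ "k' t + g' t"]) auto
 qed (intro continuous_intros assms)
 show ?thesis using 1 2 by linarith
qed

text \<open>The factor \<open>1 / a\<close> makes the system singular at 0, but the differences of
  the fluxes vanish there linearly, which cancels it. In the norm weighted with
  \<open>exp (- kp * a)\<close> the differences then satisfy \<open>S \<le> S / 2\<close>, on the
  whole interval at once.\<close>

lemma sol_unique:
 assumes s1: "sol al c F1 V1 H1 N1" and s2: "sol al c F2 V2 H2 N2" and pos: "al > 0" "c > 0"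
  and z: "F1 0 = F2 0" "V1 0 = V2 0" and R: "R \<ge> 0"
 shows "F1 R = F2 R"
proof -
 have sub: "{0..r} \<subseteq> {0..}" for r :: real by auto
 note d1 = solD[OF s1] and d2 = solD[OF s2]
 define phi where "phi a = F1 a - F2 a" for a
 define psi where "psi a = V1 a - V2 a" for a
 have con: "continuous_on {0..r} F1" "continuous_on {0..r} F2" "continuous_on {0..r} V1" "continuous_on {0..r} V2"
  "continuous_on {0..r} H1" "continuous_on {0..r} H2" "continuous_on {0..r} N1" "continuous_on {0..r} N2" for r
  by (intro continuous_on_subset[OF _ sub] d1 d2)+
 have "bounded ((\<lambda>a. \<bar>F1 a\<bar> + \<bar>F2 a\<bar> + \<bar>V1 a\<bar> + \<bar>V2 a\<bar>) ` {0..R})"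
  by (intro compact_imp_bounded compact_continuous_image continuous_intros con compact_Icc)
 then obtain B where B: "B > 0" "\<And>a. a \<in> {0..R} \<Longrightarrow> \<bar>F1 a\<bar> + \<bar>F2 a\<bar> + \<bar>V1 a\<bar> + \<bar>V2 a\<bar> \<le> B" unfolding bounded_pos by fastforce
 \<comment> \<open>Chosen so that the Lipschitz constants \<open>al * B\<close> and
   \<open>2 * c * B\<close>, divided by \<open>kp\<close>, add up to \<open>1/2\<close>.\<close>
 define kp where "kp = 2 * (al + 2 * c) * B"
 have k: "kp > 0" using pos B by (simp add: kp_def)
 have Ec: "continuous_on {0..R} (\<lambda>a. exp (- kp * a) * (\<bar>phi a\<bar> + \<bar>psi a\<bar>))"
  unfolding phi_def psi_def by (intro continuous_intros con)
 obtain m where m: "m \<in> {0..R}" "\<And>a. a \<in> {0..R} \<Longrightarrow> exp (- kp * a) * (\<bar>phi a\<bar> + \<bar>psi a\<bar>) \<le> exp (- kp * m) * (\<bar>phi m\<bar> + \<bar>psi m\<bar>)"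
  using continuous_attains_sup[OF compact_Icc _ Ec] R by auto
 define S where "S = exp (- kp * m) * (\<bar>phi m\<bar> + \<bar>psi m\<bar>)"
 have S0: "S \<ge> 0" by (simp add: S_def)
 have Sb: "\<bar>phi a\<bar> + \<bar>psi a\<bar> \<le> S * exp (kp * a)" if "a \<in> {0..R}" for a
 proof -
  have "(\<bar>phi a\<bar> + \<bar>psi a\<bar>) = exp (kp * a) * (exp (- kp * a) * (\<bar>phi a\<bar> + \<bar>psi a\<bar>))" by (simp add: exp_minus field_simps)
  also have "\<dots> \<le> exp (kp * a) * S" unfolding S_def by (intro mult_left_mono m(2)[OF that]) simp
  finally show ?thesis by (simp add: mult.commute)
 qed
 \<comment> \<open>Integrating a derivative bounded by the weighted norm produces the factor
   \<open>a\<close> that pays for \<open>1 / a\<close>.\<close>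
 have lin: "\<bar>G a\<bar> \<le> D * S * exp (kp * a) * a" if a: "a \<in> {0..R}" and G: "G 0 = 0" "continuous_on {0..a} G" "\<And>t. 0 < t \<Longrightarrow> t < a \<Longrightarrow> (G has_real_derivative G' t) (at t)"
  "\<And>t. 0 < t \<Longrightarrow> t < a \<Longrightarrow> \<bar>G' t\<bar> \<le> D * (\<bar>phi t\<bar> + \<bar>psi t\<bar>)" and D: "D \<ge> 0" for G G' a D
 proof -
  have "\<bar>G a - G 0\<bar> \<le> D * S * exp (kp * a) * a - D * S * exp (kp * a) * 0"
  proof (rule DERIV_abs_le_imp_abs_diff_le[where g'=G' and k'="\<lambda>_. D * S * exp (kp * a)"])
   show "((*) (D * S * exp (kp * a)) has_real_derivative D * S * exp (kp * a)) (at t)" for t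
    using DERIV_cmult[OF DERIV_ident] by simp
   show "\<bar>G' t\<bar> \<le> D * S * exp (kp * a)" if t: "0 < t" "t < a" for t
   proof -
    have "\<bar>phi t\<bar> + \<bar>psi t\<bar> \<le> S * exp (kp * t)" using t a by (intro Sb) auto
    also have "\<dots> \<le> S * exp (kp * a)" using t k S0 by (intro mult_left_mono) auto
    finally have "D * (\<bar>phi t\<bar> + \<bar>psi t\<bar>) \<le> D * (S * exp (kp * a))" using D by (intro mult_left_mono)
    then show ?thesis using G(4)[OF t] by (simp add: mult.assoc)
   qed
  qed (use a G in \<open>auto intro!: continuous_intros\<close>)
  then show ?thesis using G(1) by simp
 qed
 have Hb: "\<bar>H1 a - H2 a\<bar> \<le> B * S * exp (kp * a) * a" if a: "a \<in> {0..R}" for a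
 proof (rule lin[OF a, where G'="\<lambda>t. V1 t * F1 t - V2 t * F2 t"])
  fix t assume t: "0 < t" "t < a"
  have "V1 t * F1 t - V2 t * F2 t = V1 t * phi t + F2 t * psi t" by (simp add: phi_def psi_def algebra_simps)
  then have "\<bar>V1 t * F1 t - V2 t * F2 t\<bar> \<le> \<bar>V1 t\<bar> * \<bar>phi t\<bar> + \<bar>F2 t\<bar> * \<bar>psi t\<bar>" using abs_triangle_ineq[of "V1 t * phi t" "F2 t * psi t"] by (simp add: abs_mult)
  also have "\<dots> \<le> B * \<bar>phi t\<bar> + B * \<bar>psi t\<bar>" using B(2)[of t] t a by (intro add_mono mult_right_mono) auto
  finally show "\<bar>V1 t * F1 t - V2 t * F2 t\<bar> \<le> B * (\<bar>phi t\<bar> + \<bar>psi t\<bar>)" by (simp add: algebra_simps)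
 qed (use d1 d2 B in \<open>auto intro!: continuous_intros con DERIV_diff\<close>)
 have Nb: "\<bar>N1 a - N2 a\<bar> \<le> (2 * B) * S * exp (kp * a) * a" if a: "a \<in> {0..R}" for a
 proof (rule lin[OF a, where G'="\<lambda>t. (F1 t)^2 - (F2 t)\<^sup>2"])
  fix t assume t: "0 < t" "t < a"
  have "(F1 t)^2 - (F2 t)\<^sup>2 = (F1 t + F2 t) * phi t" by (simp add: phi_def algebra_simps power2_eq_square)
  then have "\<bar>(F1 t)^2 - (F2 t)\<^sup>2\<bar> = \<bar>F1 t + F2 t\<bar> * \<bar>phi t\<bar>" by (simp add: abs_mult)
  also have "\<dots> \<le> (2 * B) * (\<bar>phi t\<bar> + \<bar>psi t\<bar>)" using B(2)[of t] t a by (intro mult_mono) auto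
  finally show "\<bar>(F1 t)^2 - (F2 t)\<^sup>2\<bar> \<le> (2 * B) * (\<bar>phi t\<bar> + \<bar>psi t\<bar>)" .
 qed (use d1 d2 B in \<open>auto intro!: continuous_intros con DERIV_diff\<close>)
 have ex: "\<bar>g a\<bar> \<le> D * S * (exp (kp * a) - 1) / kp" if a: "a \<in> {0..R}" and g: "g 0 = 0" "continuous_on {0..a} g" "\<And>t. 0 < t \<Longrightarrow> t < a \<Longrightarrow> (g has_real_derivative dl * G t / t) (at t)"
  "\<And>t. t \<in> {0..R} \<Longrightarrow> \<bar>dl * G t\<bar> \<le> D * S * exp (kp * t) * t" for g G dl D a
 proof -
  have "\<bar>g a - g 0\<bar> \<le> D * S * exp (kp * a) / kp - D * S * exp (kp * 0) / kp"
  proof (rule DERIV_abs_le_imp_abs_diff_le[where g'="\<lambda>t. dl * G t / t" and k'="\<lambda>t. D * S * exp (kp * t)"])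
   show "((\<lambda>a. D * S * exp (kp * a) / kp) has_real_derivative D * S * exp (kp * t)) (at t)" for t
    using k by (auto intro!: derivative_eq_intros)
   show "\<bar>dl * G t / t\<bar> \<le> D * S * exp (kp * t)" if "0 < t" "t < a" for t
    using g(4)[of t] that a by (simp add: field_simps)
  qed (use a g k in \<open>auto intro!: continuous_intros\<close>)
  then show ?thesis using g(1) by (simp add: diff_divide_distrib right_diff_distrib)
 qed
 have "\<bar>phi m\<bar> \<le> (al * B) * S * (exp (kp * m) - 1) / kp"
 proof (rule ex[OF m(1), where dl=al and G="\<lambda>t. H1 t - H2 t"])
  show "(phi has_real_derivative al * (H1 t - H2 t) / t) (at t)" if "0 < t" for t
   unfolding phi_def[abs_def] using DERIV_diff[OF d1(7)[OF that] d2(7)[OF that]] by (simp add: diff_divide_distrib right_diff_distrib)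
  show "\<bar>al * (H1 t - H2 t)\<bar> \<le> al * B * S * exp (kp * t) * t" if "t \<in> {0..R}" for t
   using mult_left_mono[OF Hb[OF that], of al] pos by (simp add: abs_mult mult.assoc)
 qed (use z in \<open>auto simp: phi_def[abs_def] intro!: continuous_intros con\<close>)
 moreover have "\<bar>psi m\<bar> \<le> (c * (2 * B)) * S * (exp (kp * m) - 1) / kp"
 proof (rule ex[OF m(1), where dl=c and G="\<lambda>t. N1 t - N2 t"])
  show "(psi has_real_derivative c * (N1 t - N2 t) / t) (at t)" if "0 < t" for t
   unfolding psi_def[abs_def] using DERIV_diff[OF d1(8)[OF that] d2(8)[OF that]] by (simp add: diff_divide_distrib right_diff_distrib)
  show "\<bar>c * (N1 t - N2 t)\<bar> \<le> c * (2 * B) * S * exp (kp * t) * t" if "t \<in> {0..R}" for t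
   using mult_left_mono[OF Nb[OF that], of c] pos by (simp add: abs_mult mult.assoc)
 qed (use z in \<open>auto simp: psi_def[abs_def] intro!: continuous_intros con\<close>)
 ultimately have "\<bar>phi m\<bar> + \<bar>psi m\<bar> \<le> (al * B) * S * (exp (kp * m) - 1) / kp + (c * (2 * B)) * S * (exp (kp * m) - 1) / kp" by linarith
 also have "\<dots> = S * (exp (kp * m) - 1) * ((al + 2 * c) * B / kp)"
  unfolding add_divide_distrib[symmetric] times_divide_eq_right by (simp add: algebra_simps)
 also have "(al + 2 * c) * B / kp = 1 / 2"
 proof -
  have "(al + 2 * c) * B = kp / 2" by (simp add: kp_def)
  then show ?thesis using k by simp
 qed
 finally have "\<bar>phi m\<bar> + \<bar>psi m\<bar> \<le> S * exp (kp * m) / 2" using S0 by (simp add: algebra_simps)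
 moreover have "\<bar>phi m\<bar> + \<bar>psi m\<bar> = S * exp (kp * m)" unfolding S_def by (simp add: exp_minus field_simps)
 ultimately have "S * exp (kp * m) \<le> 0" using mult_nonneg_nonneg[OF S0, of "exp (kp * m)"] by linarith
 then have "S = 0" using S0 by (simp add: mult_le_0_iff)
 then have "phi R = 0" using Sb[of R] R by simp
 then show ?thesis by (simp add: phi_def)
qed

text \<open>A zero of a nonnegative function at \<open>R > 0\<close> is a minimum, so the flux
  vanishes there too; backward uniqueness for the linear system satisfied by \<open>F\<close> and
  \<open>H\<close> then spreads the zero to the left.\<close>

lemma sol_interior_zero:
 assumes so: "sol al c F V H N" and pos: "al > 0" and nn: "\<And>a. a \<ge> 0 \<Longrightarrow> F a \<ge> 0" and R: "R > 0" "F R = 0"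
 shows "F (R / 2) = 0"
proof -
 note d = solD[OF so]
 have "al * H R / R = 0"
  by (rule DERIV_local_min[OF d(7)[OF R(1)] R(1)]) (use nn R in \<open>auto simp: abs_less_iff\<close>)
 then have HR: "H R = 0" using pos R by simp
 have "bounded (V ` {R / 2..R})"
  by (intro compact_imp_bounded compact_continuous_image continuous_on_subset[OF d(2)]) (use R in auto)
 then obtain B where B: "B > 0" "\<And>a. a \<in> {R / 2..R} \<Longrightarrow> \<bar>V a\<bar> \<le> B" unfolding bounded_pos by auto
 \<comment> \<open>\<open>L\<close> bounds \<open>\<bar>al / a + V a\<bar>\<close> on
   \<open>[R/2, R]\<close>, which makes \<open>(F^2 + H^2) * exp (L * a)\<close> nondecreasing
   there; its value at \<open>R\<close> is 0.\<close>
 define L where "L = al * 2 / R + B"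
 define E where "E a = ((F a)^2 + (H a)^2) * exp (L * a)" for a
 have "E (R / 2) \<le> E R"
 proof (rule DERIV_nonneg_imp_nondecreasing[where f=E])
  fix a assume a: "R / 2 \<le> a" "a \<le> R"
  then have a0: "a > 0" using R by simp
  define D where "D = 2 * F a * H a * (al / a + V a) + L * ((F a)^2 + (H a)^2)"
  have "(E has_real_derivative D * exp (L * a)) (at a)"
   unfolding E_def[abs_def] D_def using a0 by (auto intro!: derivative_eq_intros d(7)[OF a0] d(9)[OF a0] simp: field_simps power2_eq_square)
  moreover have "D \<ge> 0"
  proof -
   have "\<bar>al / a + V a\<bar> \<le> L"
   proof -
    have "al / a \<le> al * 2 / R" using a a0 R pos by (simp add: field_simps)
    moreover have "al / a \<ge> 0" using a0 pos by simp
    ultimately show ?thesis using B(2)[of a] a unfolding L_def by auto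
   qed
   moreover have "\<bar>2 * F a * H a\<bar> \<le> (F a)^2 + (H a)^2"
    using sum_squares_bound[of "\<bar>F a\<bar>" "\<bar>H a\<bar>"] by (simp add: abs_mult)
   ultimately have "\<bar>2 * F a * H a\<bar> * \<bar>al / a + V a\<bar> \<le> ((F a)^2 + (H a)^2) * L" by (intro mult_mono) auto
   then have "\<bar>2 * F a * H a * (al / a + V a)\<bar> \<le> L * ((F a)^2 + (H a)^2)" by (simp only: abs_mult mult.commute mult.left_commute)
   then show ?thesis unfolding D_def abs_le_iff by linarith
  qed
  ultimately show "\<exists>y. (E has_real_derivative y) (at a) \<and> 0 \<le> y" by (intro exI[of _ "D * exp (L * a)"]) simp
 qed (use R in simp)
 then have "((F (R / 2))^2 + (H (R / 2))^2) * exp (L * (R / 2)) \<le> 0" unfolding E_def HR R(2) by simp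
 then have "(F (R / 2))^2 + (H (R / 2))^2 \<le> 0" by (simp add: mult_le_0_iff)
 then show ?thesis using sum_power2_le_zero_iff by blast
qed

lemma sol_N_nonneg:
 assumes so: "sol al c F V H N" and a: "0 \<le> a"
 shows "0 \<le> N a"
proof -
 have "N 0 \<le> N a"
  by (rule DERIV_nonneg_imp_increasing_open[OF a])
   (use solD(10)[OF so] in \<open>force\<close>, intro continuous_on_subset[OF solD(4)[OF so]], auto)
 then show ?thesis using solD(6)[OF so] by simp
qed

lemma sol_V_ge:
 assumes so: "sol al c F V H N" and c: "c > 0" and a: "0 \<le> a"
 shows "V 0 \<le> V a"
proof (rule DERIV_nonneg_imp_increasing_open[OF a])
 show "\<exists>y. (V has_real_derivative y) (at t) \<and> 0 \<le> y" if "0 < t" "t < a" for t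
  using solD(8)[OF so that(1)] sol_N_nonneg[OF so, of t] c that by (intro exI[of _ "c * N t / t"]) auto
qed (intro continuous_on_subset[OF solD(2)[OF so]], auto)

text \<open>While \<open>F1 > F2\<close> the quotient \<open>F2 / F1\<close> decreases, because the derivative of the Wronskian
 \<open>H1 F2 - F1 H2\<close> is \<open>(V1 - V2) F1 F2\<close>; so the profiles can only meet at a common zero.\<close>

lemma sol_strict_order:
 assumes s1: "sol al c F1 V1 H1 N1" and s2: "sol al c F2 V2 H2 N2" and pos: "al > 0" "c > 0"
  and nn: "\<And>a. a \<ge> 0 \<Longrightarrow> F1 a \<ge> 0" "\<And>a. a \<ge> 0 \<Longrightarrow> F2 a \<ge> 0" and z: "F1 0 > F2 0" "V1 0 = V2 0"
 shows "a \<ge> 0 \<Longrightarrow> F1 a > F2 a" "a > 0 \<Longrightarrow> V1 a > V2 a"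
proof -
 note d1 = solD[OF s1] and d2 = solD[OF s2]
 have sub: "{0..r} \<subseteq> {0..}" for r :: real by auto
 note con = continuous_on_subset[OF d1(1) sub] continuous_on_subset[OF d2(1) sub] continuous_on_subset[OF d1(2) sub] continuous_on_subset[OF d2(2) sub]
  continuous_on_subset[OF d1(3) sub] continuous_on_subset[OF d2(3) sub] continuous_on_subset[OF d1(4) sub] continuous_on_subset[OF d2(4) sub]
 have Ngt: "N1 a > N2 a" if a: "a > 0" and gt: "\<And>t. 0 < t \<Longrightarrow> t < a \<Longrightarrow> F1 t > F2 t" for a
 proof -
  have "N1 0 - N2 0 < N1 a - N2 a"
  proof (rule DERIV_pos_imp_increasing_open[where f="\<lambda>t. N1 t - N2 t", OF a])
   show "\<exists>y. ((\<lambda>t. N1 t - N2 t) has_real_derivative y) (at t) \<and> 0 < y" if t: "0 < t" "t < a" for t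
   proof (intro exI conjI)
    show "((\<lambda>t. N1 t - N2 t) has_real_derivative (F1 t)\<^sup>2 - (F2 t)\<^sup>2) (at t)" by (intro DERIV_diff d1 d2 t)
    show "0 < (F1 t)\<^sup>2 - (F2 t)\<^sup>2" using power_strict_mono[OF gt[OF t], of 2] nn(2)[of t] t by simp
   qed
  qed (intro continuous_intros con)
  then show ?thesis using d1(6) d2(6) by simp
 qed
 have Vgt: "V1 a > V2 a" if a: "a > 0" and gt: "\<And>t. 0 < t \<Longrightarrow> t < a \<Longrightarrow> F1 t > F2 t" for a
 proof -
  have "V1 0 - V2 0 < V1 a - V2 a"
  proof (rule DERIV_pos_imp_increasing_open[where f="\<lambda>t. V1 t - V2 t", OF a])
   show "\<exists>y. ((\<lambda>t. V1 t - V2 t) has_real_derivative y) (at t) \<and> 0 < y" if t: "0 < t" "t < a" for t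
   proof (intro exI conjI)
    show "((\<lambda>t. V1 t - V2 t) has_real_derivative c * N1 t / t - c * N2 t / t) (at t)" by (intro DERIV_diff d1 d2 t)
    have "N2 t < N1 t" using gt t by (intro Ngt) auto
    then show "0 < c * N1 t / t - c * N2 t / t" using pos t by (simp add: divide_strict_right_mono)
   qed
  qed (intro continuous_intros con)
  then show ?thesis using z by simp
 qed
 have gt: "F1 a > F2 a" if a: "a \<ge> 0" for a
 proof (rule ccontr)
  assume "\<not> F1 a > F2 a"
  \<comment> \<open>The set of failures is closed, so it has a first point \<open>R\<close>, which
    is positive because of the strict order at 0.\<close>
  define S where "S = {t \<in> {0..a}. F1 t - F2 t \<le> 0}"
  have "closed S" unfolding S_def
   by (rule continuous_on_closed_Collect_le) (intro continuous_intros con, auto)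
  moreover have "bounded S" by (rule bounded_subset[of "{0..a}"]) (auto simp: S_def)
  ultimately have "compact S" by (simp add: compact_eq_bounded_closed)
  moreover have "S \<noteq> {}" using \<open>\<not> F1 a > F2 a\<close> a by (auto simp: S_def intro!: exI[of _ a])
  ultimately obtain R where R: "R \<in> S" "\<And>t. t \<in> S \<Longrightarrow> R \<le> t" using compact_attains_inf by metis
  have R0: "R > 0" using R(1) z by (cases "R = 0") (auto simp: S_def)
  have lt: "F1 t > F2 t" if "0 \<le> t" "t < R" for t using R(1) R(2)[of t] that by (force simp: S_def)
  have F1R: "F1 R \<le> F2 R" using R(1) by (auto simp: S_def)
  \<comment> \<open>The quotient never exceeds its initial value \<open>k < 1\<close>; at
    \<open>R\<close> the chain \<open>F1 \<le> F2 \<le> k * F1\<close> then leaves only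
    \<open>F1 R = 0\<close>.\<close>
  define k where "k = F2 0 / F1 0"
  have F10: "F1 0 > 0" using z nn(2)[of 0] by simp
  have k: "0 \<le> k" "k < 1" using z F10 nn(2)[of 0] by (auto simp: k_def)
  have Wr: "0 \<le> H1 t * F2 t - F1 t * H2 t" if t: "0 \<le> t" "t < R" for t
  proof -
   have "H1 0 * F2 0 - F1 0 * H2 0 \<le> H1 t * F2 t - F1 t * H2 t"
   proof (rule DERIV_nonneg_imp_increasing_open[where f="\<lambda>t. H1 t * F2 t - F1 t * H2 t", OF t(1)])
    fix r assume r: "0 < r" "r < t"
    have "((\<lambda>t. H1 t * F2 t - F1 t * H2 t) has_real_derivative (V1 r - V2 r) * (F1 r * F2 r)) (at r)"
     using r by (auto intro!: derivative_eq_intros d1 d2 simp: field_simps)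
    moreover have "0 \<le> (V1 r - V2 r) * (F1 r * F2 r)"
     using Vgt[of r] lt t r nn(1)[of r] nn(2)[of r] by (intro mult_nonneg_nonneg) (auto intro: less_imp_le)
    ultimately show "\<exists>y. ((\<lambda>t. H1 t * F2 t - F1 t * H2 t) has_real_derivative y) (at r) \<and> 0 \<le> y" by blast
   qed (intro continuous_intros con)
   then show ?thesis using d1(5) d2(5) by simp
  qed
  have q: "F2 t \<le> k * F1 t" if t: "0 \<le> t" "t < R" for t
  proof -
   have p: "F1 r > 0" if "0 \<le> r" "r \<le> t" for r using lt[of r] nn(2)[of r] that t by linarith
   have "F2 t / F1 t \<le> F2 0 / F1 0"
   proof (rule DERIV_nonpos_imp_decreasing_open[where f="\<lambda>t. F2 t / F1 t", OF t(1)])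
    fix r assume r: "0 < r" "r < t"
    have "((\<lambda>t. F2 t / F1 t) has_real_derivative - (al * (H1 r * F2 r - F1 r * H2 r) / (r * (F1 r)^2))) (at r)"
     using r p[of r] by (auto intro!: derivative_eq_intros d1 d2 simp: field_simps power2_eq_square)
    moreover have "0 \<le> al * (H1 r * F2 r - F1 r * H2 r) / (r * (F1 r)^2)"
     using Wr[of r] r t pos by (intro divide_nonneg_nonneg mult_nonneg_nonneg) auto
    ultimately show "\<exists>y. ((\<lambda>t. F2 t / F1 t) has_real_derivative y) (at r) \<and> y \<le> 0"
     by (intro exI[of _ "- (al * (H1 r * F2 r - F1 r * H2 r) / (r * (F1 r)^2))"]) simp
   next
    show "continuous_on {0..t} (\<lambda>t. F2 t / F1 t)" by (intro continuous_intros con) (use p in force)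
   qed
   then show ?thesis using p[OF t(1)] by (simp add: k_def[symmetric] pos_divide_le_eq)
  qed
  have "F2 R \<le> k * F1 R"
  proof -
   have cl: "closure {0..<R} = {0..R}" using R0 by simp
   have "F2 R - k * F1 R \<le> 0"
   proof (rule continuous_le_on_closure[where S="{0..<R}" and f="\<lambda>t. F2 t - k * F1 t" and x=R])
    show "continuous_on (closure {0..<R}) (\<lambda>t. F2 t - k * F1 t)" unfolding cl by (intro continuous_intros con)
    show "R \<in> closure {0..<R}" unfolding cl using R0 by simp
    show "F2 t - k * F1 t \<le> 0" if "t \<in> {0..<R}" for t using q[of t] that by simp
   qed
   then show ?thesis by simp
  qed
  then have "(1 - k) * F1 R \<le> 0" using F1R by (simp add: algebra_simps)
  then have "F1 R = 0" using k nn(1)[of R] R0 by (simp add: mult_le_0_iff)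
  \<comment> \<open>The zero at \<open>R\<close> spreads to \<open>R / 2\<close>, where
    \<open>F1 > F2 \<ge> 0\<close> still holds.\<close>
  then have "F1 (R / 2) = 0" using sol_interior_zero[OF s1 pos(1) nn(1) R0] by simp
  then show False using lt[of "R / 2"] nn(2)[of "R / 2"] R0 by simp
 qed
 show "a \<ge> 0 \<Longrightarrow> F1 a > F2 a" by (rule gt)
 show "a > 0 \<Longrightarrow> V1 a > V2 a" by (rule Vgt) (auto intro: gt)
qed

section \<open>Dilations and the comparison of ground states\<close>

lemma AE_scale:
 fixes P :: "real^2 \<Rightarrow> bool"
 assumes c: "c > 0" and ae: "AE x in lborel. P x"
 shows "AE x in lborel. P (c *\<^sub>R x)"
proof (rule AE_distrD[of "\<lambda>x. c *\<^sub>R x" lborel borel P])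
 show "AE x in distr lborel borel (\<lambda>x. c *\<^sub>R x). P x" unfolding lborel_scale[OF c]
  using ae by (subst AE_density) (auto elim: eventually_mono)
qed simp

text \<open>In two dimensions the factor \<open>t^2\<close> from the gradient cancels the Jacobian,
  so the Dirichlet integral is invariant under dilation.\<close>

lemma XR_scale:
 assumes X: "XR u" and t: "t > 0"
 shows "XR (\<lambda>x. u (t *\<^sub>R x))" (is ?t1) "TR (\<lambda>x. u (t *\<^sub>R x)) = TR u" (is ?t2)
proof -
 obtain G where G: "wgrad u G" "integ (\<lambda>x. (norm (G x))^2)" "TR u = (LBINT x. (norm (G x))^2)" using XR_E[OF X] .
 note [measurable] = wgrad_borel[OF G(1)]
 note w = wgrad_scale[OF G(1) t]
 have n: "(norm (t *\<^sub>R G (t *\<^sub>R x)))^2 = t\<^sup>2 * (norm (G (t *\<^sub>R x)))^2" for x using t by (simp add: power_mult_distrib)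
 have i: "integ (\<lambda>x. (norm (t *\<^sub>R G (t *\<^sub>R x)))^2)"
  unfolding n by (intro integrable_mult_right integrable_scale[OF t G(2)])
 note i0 = integrable_scale[OF t XR_D(1)[OF X]] and i1 = integrable_scale[OF t XR_D(2)[OF X]]
 have "integ (\<lambda>x. ln (1 + norm x) * (u (t *\<^sub>R x))^2)"
 proof (rule Lintegrable_bound)
  \<comment> \<open>From \<open>1 + \<bar>x\<bar> \<le> (1 + t \<bar>x\<bar>) (1 + 1/t)\<close>: the
    dilation costs the logarithmic weight at most an additive constant.\<close>
  show "integ (\<lambda>x. ln (1 + norm (t *\<^sub>R x)) * (u (t *\<^sub>R x))^2 + ln (1 + 1 / t) * (u (t *\<^sub>R x))^2)"
   by (intro Lintegrable_add integrable_mult_right i0 i1)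
  show "AE x in lborel. norm (ln (1 + norm x) * (u (t *\<^sub>R x))^2) \<le> norm (ln (1 + norm (t *\<^sub>R x)) * (u (t *\<^sub>R x))^2 + ln (1 + 1 / t) * (u (t *\<^sub>R x))^2)" (is "AE x in _. ?Q1 x")
  proof (rule AE_I2)
   fix x :: "real^2"
   have p: "1 + t * norm x > 0" "1 + 1 / t > 0" "1 + norm x > 0" using t by (auto intro: add_pos_nonneg add_pos_pos)
   have "1 + norm x \<le> (1 + t * norm x) * (1 + 1 / t)" using t by (simp add: algebra_simps add_increasing)
   then have "ln (1 + norm x) \<le> ln ((1 + t * norm x) * (1 + 1 / t))" using p by (subst ln_le_cancel_iff) auto
   also have "\<dots> = ln (1 + t * norm x) + ln (1 + 1 / t)" using p by (simp add: ln_mult)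
   finally have "ln (1 + norm x) * (u (t *\<^sub>R x))^2 \<le> (ln (1 + t * norm x) + ln (1 + 1 / t)) * (u (t *\<^sub>R x))^2" by (rule mult_right_mono) simp
   moreover have "0 \<le> ln (1 + norm x) * (u (t *\<^sub>R x))^2" by simp
   ultimately show "?Q1 x"
    using t by (simp add: distrib_right)
  qed
 qed measurable
 then show ?t1 unfolding XR_def using w i i0 by (intro conjI exI[of _ "\<lambda>x. t *\<^sub>R G (t *\<^sub>R x)"])
 have "TR (\<lambda>x. u (t *\<^sub>R x)) = t\<^sup>2 * (LBINT x. (norm (G (t *\<^sub>R x)))^2)" unfolding TR_eq[OF w] n by simp
 also have "\<dots> = TR u" unfolding G(3) by (subst integral_scale[OF t, of "\<lambda>x. (norm (G x))^2"]) (use t in auto)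
 finally show ?t2 .
qed

lemma integral_square_scale:
 assumes X: "XR w" and s: "s > 0"
 shows "(LBINT x. (s * w (sqrt s *\<^sub>R x))^2) = s * (LBINT x. (w x)^2)"
proof -
 note [measurable] = XR_D(3)[OF X]
 have r: "sqrt s > 0" using s by simp
 have "(LBINT x. (s * w (sqrt s *\<^sub>R x))^2) = s\<^sup>2 * (LBINT x. (w (sqrt s *\<^sub>R x))^2)" by (simp add: power_mult_distrib)
 also have "(LBINT x. (w (sqrt s *\<^sub>R x))^2) = (LBINT x. (w x)^2) / s"
  using integral_scale[OF r, of "\<lambda>x. (w x)^2"] s by simp
 finally show ?thesis using s by (simp add: power2_eq_square)
qed

text \<open>Scaling the area by \<open>s\<close> scales lengths by \<open>sqrt s\<close>. A trial
  function for the new form is a dilated trial function for the old one, and with the prefactor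
  \<open>s\<close> on \<open>V\<close> both parts of the form are preserved.\<close>

lemma ground_state_scale:
 assumes g: "ground_state c w F V" and s: "s > 0"
 shows "ground_state c (\<lambda>x. s * w (sqrt s *\<^sub>R x)) (\<lambda>a. s * F (s * a)) (\<lambda>a. s * V (s * a))"
proof -
 have r: "sqrt s > 0" using s by simp
 have X: "XR w" and so: "\<exists>H N. sol (1 / (4 * pi)) c F V H N" and ae: "AE x in lborel. w x = F (area x)"
  and Fn: "\<And>a. a \<ge> 0 \<Longrightarrow> F a \<ge> 0" and Q0: "TR w + (LBINT x. V (area x) * (w x)^2) = 0" and Vm[measurable]: "V \<in> Bor"
  and iV: "\<And>u. XR u \<Longrightarrow> integ (\<lambda>x. V (area x) * (u x)^2)"
  and Q: "\<And>u. XR u \<Longrightarrow> 0 \<le> TR u + (LBINT x. V (area x) * (u x)^2)"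
  using g unfolding ground_state_def by auto
 have nr: "pi * (norm (sqrt s *\<^sub>R x))^2 = s * (area x)" for x :: "real^2" using s by (simp add: power_mult_distrib)
 have sc: "integ (\<lambda>x. s * V (s * (area x)) * (u (sqrt s *\<^sub>R x))^2)" (is ?t1)
  "(LBINT x. s * V (s * (area x)) * (u (sqrt s *\<^sub>R x))^2) = (LBINT x. V (area x) * (u x)^2)" (is ?t2) if u: "XR u" for u
 proof -
  note [measurable] = XR_D(3)[OF u]
  have "integ (\<lambda>x. s * (V (pi * (norm (sqrt s *\<^sub>R x))^2) * (u (sqrt s *\<^sub>R x))^2))"
   by (intro integrable_mult_right integrable_scale[OF r iV[OF u]])
  then show ?t1 unfolding nr by (simp only: mult.assoc)
  have "(LBINT x. s * V (s * (area x)) * (u (sqrt s *\<^sub>R x))^2) = s * (LBINT x. V (pi * (norm (sqrt s *\<^sub>R x))^2) * (u (sqrt s *\<^sub>R x))^2)"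
   unfolding nr mult.assoc[of s] by (rule integral_mult_right_zero)
  also have "\<dots> = (LBINT x. V (area x) * (u x)^2)"
   by (subst integral_scale[OF r, of "\<lambda>x. V (area x) * (u x)^2"]) (measurable, use s in simp)
  finally show ?t2 .
 qed
 show ?thesis unfolding ground_state_def
 proof (intro conjI allI impI)
  show "XR (\<lambda>x. s * w (sqrt s *\<^sub>R x))" by (intro XR_cmult(1) XR_scale(1) X r)
  show "\<exists>H N. sol (1 / (4 * pi)) c (\<lambda>a. s * F (s * a)) (\<lambda>a. s * V (s * a)) H N" using so sol_scale[OF _ s] by blast
  show "AE x in lborel. s * w (sqrt s *\<^sub>R x) = s * F (s * (area x))"
   using AE_scale[OF r ae] by eventually_elim (simp only: nr)
  show "0 \<le> s * F (s * a)" if "0 \<le> a" for a using Fn[of "s * a"] s that by simp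
  have "(LBINT x. s * V (s * (area x)) * (s * w (sqrt s *\<^sub>R x))^2) = (LBINT x. s\<^sup>2 * (s * V (s * (area x)) * (w (sqrt s *\<^sub>R x))^2))"
   by (simp only: power_mult_distrib mult_ac)
  also have "\<dots> = s\<^sup>2 * (LBINT x. V (area x) * (w x)^2)" unfolding integral_mult_right_zero sc(2)[OF X] ..
  finally have "TR (\<lambda>x. s * w (sqrt s *\<^sub>R x)) + (LBINT x. s * V (s * (area x)) * (s * w (sqrt s *\<^sub>R x))^2) =
    s\<^sup>2 * (TR w + (LBINT x. V (area x) * (w x)^2))"
   using XR_cmult(2)[OF XR_scale(1)[OF X r], of s] XR_scale(2)[OF X r] by (simp add: algebra_simps)
  then show "TR (\<lambda>x. s * w (sqrt s *\<^sub>R x)) + (LBINT x. s * V (s * (area x)) * (s * w (sqrt s *\<^sub>R x))^2) = 0" unfolding Q0 by simp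
  show "(\<lambda>a. s * V (s * a)) \<in> Bor" by measurable
  fix u assume u: "XR u"
  have r': "1 / sqrt s > 0" using r by simp
  have inv_s: "(1 / sqrt s) *\<^sub>R (sqrt s *\<^sub>R x) = x" for x :: "real^2" using r by simp
  note u' = XR_scale[OF u r'] note sc' = sc[OF u'(1), unfolded inv_s]
  show "integ (\<lambda>x. s * V (s * (area x)) * (u x)^2)" by (rule sc'(1))
  show "0 \<le> TR u + (LBINT x. s * V (s * (area x)) * (u x)^2)" unfolding sc'(2) using Q[OF u'(1)] u'(2) by simp
 qed
qed

lemma mass_pos_not_AE_zero:
 assumes "XR w" "(LBINT x. (w x)^2) > 0"
 shows "\<not> (AE x in lborel. w x = 0)"
proof
 assume "AE x in lborel. w x = 0"
 then have "AE x in lborel. (w x)^2 = 0" by eventually_elim simp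
 then have "(LBINT x. (w x)^2) = 0" by (rule integral_eq_zero_AE)
 then show False using assms(2) by simp
qed

text \<open>If the Dirichlet integral were 0, the Hardy bound with arbitrarily small weight
  \<open>s\<close> would force the integral of \<open>w^2 / \<bar>x\<bar>\<close> to vanish.\<close>

lemma TR_pos:
 assumes X: "XR w" and m: "(LBINT x. (w x)^2) > 0"
 shows "TR w > 0"
proof (rule ccontr)
 assume "\<not> TR w > 0"
 then have T: "TR w = 0" using TR_nonneg[of w] by simp
 define I where "I = (LBINT x. (w x)^2 / norm (x - 0))"
 have le: "I \<le> s * (LBINT x. (w x)^2)" if "s > 0" for s unfolding I_def using hardy(2)[OF X that, of 0] T by simp
 have "I \<le> 0"
 proof (rule ccontr)
  assume "\<not> I \<le> 0"
  then show False using le[of "I / (2 * (LBINT x. (w x)^2))"] m by simp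
 qed
 moreover have "I \<ge> 0" unfolding I_def by (intro Lintegral_nonneg) simp
 ultimately have "(LBINT x. (w x)^2 / norm (x - 0)) = 0" unfolding I_def by linarith
 then have "AE x in lborel. (w x)^2 / norm (x - 0) = 0"
  using hardy(1)[OF X zero_less_one, of 0] by (subst (asm) integral_nonneg_eq_0_iff_AE) auto
 then have "AE x in lborel. w x = 0" using AE_norm_neq[of 0] by eventually_elim simp
 then show False using mass_pos_not_AE_zero[OF X m] by simp
qed

text \<open>\<open>V\<close> is smallest at the origin, so \<open>V 0 \<ge> 0\<close> would make the
  form positive at \<open>w\<close>. It follows that the quotient \<open>V1 0 / V2 0\<close> is a
  legitimate positive scale.\<close>

lemma ground_state_V0_neg:
 assumes g: "ground_state c w F V" and c: "c > 0" and m: "(LBINT x. (w x)^2) > 0"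
 shows "V 0 < 0"
proof (rule ccontr)
 assume "\<not> V 0 < 0"
 obtain H N where so: "sol (1 / (4 * pi)) c F V H N" using g unfolding ground_state_def by auto
 have X: "XR w" using g unfolding ground_state_def by auto
 have "0 \<le> (LBINT x. V (area x) * (w x)^2)"
 proof (rule Lintegral_nonneg)
  fix x :: "real^2"
  have "V 0 \<le> V (area x)" by (rule sol_V_ge[OF so c]) simp
  then show "0 \<le> V (area x) * (w x)^2" using \<open>\<not> V 0 < 0\<close> by simp
 qed
 then show False using TR_pos[OF X m] g unfolding ground_state_def by auto
qed

text \<open>If \<open>F1 0 > F2 0\<close>, the ordering gives \<open>V1 > V2\<close> off the origin;
  the first ground state, used as a trial function, would then make the second form
  negative.\<close>

lemma ground_state_compare:
 assumes g1: "ground_state c w1 F1 V1" and g2: "ground_state c w2 F2 V2" and c: "c > 0"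
  and m: "(LBINT x. (w1 x)^2) > 0" and z: "V1 0 = V2 0"
 shows "F1 0 \<le> F2 0"
proof (rule ccontr)
 assume "\<not> F1 0 \<le> F2 0"
 then have F0: "F1 0 > F2 0" by simp
 obtain H1 N1 where s1: "sol (1 / (4 * pi)) c F1 V1 H1 N1" using g1 unfolding ground_state_def by auto
 obtain H2 N2 where s2: "sol (1 / (4 * pi)) c F2 V2 H2 N2" using g2 unfolding ground_state_def by auto
 have nn: "\<And>a. a \<ge> 0 \<Longrightarrow> F1 a \<ge> 0" "\<And>a. a \<ge> 0 \<Longrightarrow> F2 a \<ge> 0" using g1 g2 unfolding ground_state_def by auto
 have Vgt: "V1 a > V2 a" if "a > 0" for a by (rule sol_strict_order(2)[OF s1 s2 _ c nn F0 z that]) simp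
 have X: "XR w1" and Q1: "TR w1 + (LBINT x. V1 (area x) * (w1 x)^2) = 0"
  and I1: "integ (\<lambda>x. V1 (area x) * (w1 x)^2)" using g1 unfolding ground_state_def by auto
 have I2: "integ (\<lambda>x. V2 (area x) * (w1 x)^2)" and Q2: "0 \<le> TR w1 + (LBINT x. V2 (area x) * (w1 x)^2)"
  using g2 X unfolding ground_state_def by auto
 define D where "D x = V1 (area x) * (w1 x)^2 - V2 (area x) * (w1 x)^2" for x
 have DI: "integ D" unfolding D_def[abs_def] by (rule Lintegrable_diff[OF I1 I2])
 have Dn: "D x \<ge> 0" for x
 proof (cases "x = 0")
  case False
  then have "V2 (area x) \<le> V1 (area x)" using Vgt[of "pi * (norm x)^2"] by simp
  then show ?thesis unfolding D_def by (simp add: mult_right_mono)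
 qed (simp add: D_def z)
 have "(LBINT x. D x) \<le> 0" unfolding D_def using Lintegral_diff[OF I1 I2] Q1 Q2 by simp
 then have "(LBINT x. D x) = 0" using Lintegral_nonneg[of lborel D, OF Dn] by linarith
 then have "AE x in lborel. D x = 0" using integral_nonneg_eq_0_iff_AE[OF DI] Dn by simp
 then have "AE x in lborel. w1 x = 0" using AE_norm_neq[of 0]
 proof eventually_elim
  case (elim x)
  then have "V2 (area x) < V1 (area x)" by (intro Vgt) simp
  moreover have "(V1 (area x) - V2 (area x)) * (w1 x)^2 = 0" using elim(1) by (simp add: D_def left_diff_distrib)
  ultimately show ?case by simp
 qed
 then show False using mass_pos_not_AE_zero[OF X m] by simp
qed

lemma ground_state_unique:
 assumes g1: "ground_state c w1 F1 V1" and g2: "ground_state c w2 F2 V2" and c: "c > 0" and lam: "lam > 0"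
  and m: "(LBINT x. (w1 x)^2) = lam" "(LBINT x. (w2 x)^2) = lam"
 shows "AE x in lborel. w1 x = w2 x"
proof -
 have V: "V1 0 < 0" "V2 0 < 0" using ground_state_V0_neg[OF g1 c] ground_state_V0_neg[OF g2 c] m lam by auto
 define s where "s = V1 0 / V2 0"
 have s: "s > 0" using V by (simp add: s_def divide_neg_neg)
 note gs = ground_state_scale[OF g2 s]
 have V0: "V1 0 = s * V2 (s * 0)" using V by (simp add: s_def)
 have X: "XR w1" "XR w2" using g1 g2 unfolding ground_state_def by auto
 have ms: "(LBINT x. (s * w2 (sqrt s *\<^sub>R x))^2) = s * lam" using integral_square_scale[OF X(2) s] m by simp
 \<comment> \<open>Applied in both directions, since each comparison excludes only one strict
   inequality.\<close>
 have "F1 0 \<le> s * F2 (s * 0)" by (rule ground_state_compare[OF g1 gs c _ V0]) (use m lam in simp)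
 moreover have "s * F2 (s * 0) \<le> F1 0" by (rule ground_state_compare[OF gs g1 c _ V0[symmetric]]) (use ms s lam in simp)
 ultimately have F0: "F1 0 = s * F2 (s * 0)" by simp
 obtain H1 N1 where s1: "sol (1 / (4 * pi)) c F1 V1 H1 N1" using g1 unfolding ground_state_def by auto
 obtain H2 N2 where s2: "sol (1 / (4 * pi)) c (\<lambda>a. s * F2 (s * a)) (\<lambda>a. s * V2 (s * a)) H2 N2" using gs unfolding ground_state_def by auto
 have F: "F1 a = s * F2 (s * a)" if "a \<ge> 0" for a
  using sol_unique[OF s1 s2 _ c F0 V0 that] by simp
 have ae1: "AE x in lborel. w1 x = F1 (area x)" and ae2: "AE x in lborel. w2 x = F2 (area x)"
  and ae3: "AE x in lborel. s * w2 (sqrt s *\<^sub>R x) = s * F2 (s * (area x))"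
  using g1 g2 gs unfolding ground_state_def by auto
 have e: "AE x in lborel. w1 x = s * w2 (sqrt s *\<^sub>R x)" using ae1 ae3 by eventually_elim (simp only: F zero_le_mult_iff pi_ge_zero zero_le_power2 simp_thms)
 note [measurable] = XR_D(3)[OF X(1)] XR_D(3)[OF X(2)]
 have "(LBINT x. (w1 x)^2) = (LBINT x. (s * w2 (sqrt s *\<^sub>R x))^2)"
  by (rule integral_cong_AE) (measurable, measurable, use e in \<open>eventually_elim, simp\<close>)
 then have "s = 1" using m ms lam by simp
 then show ?thesis using ae1 ae2 F by auto
qed

lemma rmin_radial_unique:
 assumes r: "rmin c lam w1" "rmin c lam w2" and c: "c > 0" and lam: "lam > 0"
  and inv: "\<And>th. AE x in lborel. w1 (rot th x) = w1 x" "\<And>th. AE x in lborel. w2 (rot th x) = w2 x"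
 shows "AE x in lborel. w1 x = w2 x"
proof -
 have X: "w1 \<in> Bor" "w2 \<in> Bor" using r XR_D(3) by (auto simp: rmin_def)
 obtain f1 where f1: "f1 \<in> Bor" "AE x in lborel. w1 x = f1 (area x)" by (rule rot_invariant_imp_radial[OF X(1) inv(1)])
 obtain f2 where f2: "f2 \<in> Bor" "AE x in lborel. w2 x = f2 (area x)" by (rule rot_invariant_imp_radial[OF X(2) inv(2)])
 obtain F1 V1 where g1: "ground_state c w1 F1 V1" by (rule radial_minimiser_profile[OF r(1) c lam f1])
 obtain F2 V2 where g2: "ground_state c w2 F2 V2" by (rule radial_minimiser_profile[OF r(2) c lam f2])
 show ?thesis by (rule ground_state_unique[OF g1 g2 c lam]) (use r in \<open>auto simp: rmin_def\<close>)
qed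

theorem theorem3p3:
  fixes \<gamma> lam :: real and ustar v :: "real^2 \<Rightarrow> complex"
  assumes "\<gamma> > 0" and "lam > 0"
    and "ustar \<in> Xspace" and "sym_decreasing ustar"
    and "Nmass ustar = lam" and "Energy \<gamma> ustar = e0 \<gamma> lam"
    and "v \<in> Xspace" and "Nmass v = lam" and "Energy \<gamma> v = e0 \<gamma> lam"
  shows "\<exists>\<theta>::real. \<exists>x0::real^2.
           AE x in lborel. v x = exp (\<i> * complex_of_real \<theta>) * ustar (x - x0)"
proof -
  define c where "c = \<gamma> / (4 * pi)"
  have c: "c > 0" using assms(1) by (simp add: c_def)
  obtain t1 w1 where w1: "rmin c lam w1" "AE x in lborel. ustar x = exp (\<i> * complex_of_real t1) * complex_of_real (w1 x)"
    using minimiser_phase[OF assms(1,2,3,5,6)] unfolding c_def .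
  obtain t2 w2 where w2: "rmin c lam w2" "AE x in lborel. v x = exp (\<i> * complex_of_real t2) * complex_of_real (w2 x)"
    using minimiser_phase[OF assms(1,2,7,8,9)] unfolding c_def .
  obtain f :: "real \<Rightarrow> real" where f: "\<And>x. ustar x = complex_of_real (f (norm x))" using assms(4) unfolding sym_decreasing_def by auto
  \<comment> \<open>Taking moduli removes the phase, so \<open>w1\<close> inherits rotation
    invariance from \<open>ustar\<close>.\<close>
  have "AE x in lborel. w1 x = \<bar>f (norm x)\<bar>" using w1(2)
  proof eventually_elim
    case (elim x)
    have "cmod (ustar x) = \<bar>w1 x\<bar>" unfolding elim by (simp add: norm_mult)
    then show ?case using f[of x] w1(1) by (simp add: rmin_def)
  qed
  note fa = this
  have inv1: "AE x in lborel. w1 (rot \<theta> x) = w1 x" for \<theta>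
    using AE_orthogonal[OF rot_orthogonal fa, of \<theta>] fa by eventually_elim (simp add: rot_norm)
  obtain b where b: "\<And>e. norm e = 1 \<Longrightarrow> AE x in lborel. w2 (mirror e x + b) = w2 (x + b)" by (rule rmin_symmetric[OF w2(1) c assms(2)]) (rule that)
  have inv2: "AE x in lborel. w2 (rot \<theta> x + b) = w2 (x + b)" for \<theta>
    by (rule mirror_invariant_imp_rot_invariant[of "\<lambda>x. w2 (x + b)", OF b])
  \<comment> \<open>\<open>w2\<close> is radial about its own centre \<open>b\<close>; translated to
    the origin it can be compared with \<open>w1\<close>.\<close>
  have "AE x in lborel. w1 x = w2 (x + b)"
    by (rule rmin_radial_unique[OF w1(1) rmin_translate[OF w2(1)] c assms(2) inv1 inv2])
  \<comment> \<open>Shifting back by \<open>b\<close> produces \<open>x - b\<close>, and the two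
    phases combine to \<open>t2 - t1\<close>.\<close>
  from AE_translate[OF this, of "- b"] AE_translate[OF w1(2), of "- b"] w2(2)
  have "AE x in lborel. v x = exp (\<i> * complex_of_real (t2 - t1)) * ustar (x - b)"
  proof eventually_elim
    case (elim x)
    have "exp (\<i> * complex_of_real (t2 - t1)) * exp (\<i> * complex_of_real t1) = exp (\<i> * complex_of_real t2)"
      by (simp add: exp_add[symmetric] algebra_simps)
    then show ?case using elim by (simp add: mult.assoc[symmetric])
  qed
  then show ?thesis by blast
qed

end
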